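(* Let $G$ be a finite group and $H$ a normal subgroup of $G$. Then the $C^*$-index of the conditional expectation $z_H:\mathcal{F}_H\to\mathcal{A}_{(H,G)}$ is $$\mathrm{Index}\ z_H=|G||H|\,I,$$ where $I$ is the unit of $\mathcal{F}_H$.
   Context: Let $e$ be the unit of $G$; $|G|$ and $|H|$ are the orders of $G$ and $H$. $\delta_{a,b}$ with two group-element indices and no argument is the Kronecker delta. The Hopf $*$-algebra $D(H;G)$: it is the crossed product of $C(H)$ (complex functions on $H$) with the group algebra $\mathbb{C}G$ under the adjoint action. It has linear basis $(h,g)$, $h\in H$, $g\in G$, with multiplication $(h_1,g_1)(h_2,g_2)=\delta_{h_1g_1,g_1h_2}(h_1,g_1g_2)$, unit $\sum_{h\in H}(h,e)$, $(h,g)^*=(g^{-1}hg,g^{-1})$, coproduct $\Delta(h,g)=\sum_{t\in H}(t,g)\otimes(t^{-1}h,g)$, counit $\varepsilon(h,g)=\delta_{h,e}$, antipode $S(h,g)=(g^{-1}h^{-1}g,g^{-1})$. Put $z_H=\frac1{|G|}\sum_{g\in G}(e,g)\in D(H;G)$. The algebra $\mathcal{F}_{H,loc}$: it is the unital associative complex $*$-algebra with unit $I$ generated by $\delta_g(x)$, $\rho_h(l)$ ($g\in G$, $h\in H$, $x\in\mathbb{Z}$, $l\in\mathbb{Z}+\frac12$) subject to: $\sum_{g\in G}\delta_g(x)=I=\rho_e(l)$; $\delta_{g_1}(x)\delta_{g_2}(x)=\delta_{g_1,g_2}\delta_{g_1}(x)$; $\rho_{h_1}(l)\rho_{h_2}(l)=\rho_{h_1h_2}(l)$;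 $\delta_{g_1}(x)\delta_{g_2}(x')=\delta_{g_2}(x')\delta_{g_1}(x)$; $\rho_h(l)\delta_g(x)=\delta_{hg}(x)\rho_h(l)$ if $l<x$ and $\rho_h(l)\delta_g(x)=\delta_g(x)\rho_h(l)$ if $l>x$; $\rho_{h_1}(l)\rho_{h_2}(l')=\rho_{h_2}(l')\rho_{h_2^{-1}h_1h_2}(l)$ if $l>l'$. The involution is determined by $\delta_g(x)^*=\delta_g(x)$, $\rho_h(l)^*=\rho_{h^{-1}}(l)$. For a finite subset $\Lambda\subseteq\frac12\mathbb{Z}$, $\mathcal{F}_H(\Lambda)$ is the unital subalgebra of $\mathcal{F}_{H,loc}$ generated by $\delta_g(x)$, $\rho_h(l)$ with $g\in G$, $h\in H$, $x\in\Lambda\cap\mathbb{Z}$, $l\in\Lambda\cap(\mathbb{Z}+\frac12)$. The field algebra $\mathcal{F}_H$: consider the increasing intervals $\Lambda_{2n}=\{s\in\frac12\mathbb{Z}:-n+\frac12\le s\le n\}$, $\Lambda_{2n+1}=\{s\in\frac12\mathbb{Z}:-n-\frac12\le s\le n\}$. For $H=G$ the $*$-algebra $\mathcal{F}_G(\Lambda_n)$ is isomorphic to the full matrix algebra $M_{|G|^n}(\mathbb{C})$, and $\mathcal{F}_H(\Lambda_n)$ is a $*$-subalgebra of it, hence a finite-dimensional $C^*$-algebra. The inclusions $\mathcal{F}_H(\Lambda_n)\subseteq\mathcal{F}_H(\Lambda_{n+1})$ are norm preserving, and $\mathcal{F}_H=\overline{\bigcup_n\mathcal{F}_H(\Lambda_n)}$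 is the $C^*$-inductive limit (the $C^*$-completion of $\mathcal{F}_{H,loc}$). Action: $D(H;G)$ acts on $\mathcal{F}_H$; the action is the continuous extension of the one on $\mathcal{F}_{H,loc}$ determined by $(h,g)\delta_f(x)=\delta_{h,e}\,\delta_{gf}(x)$ for $f\in G$, $(h,g)\rho_t(l)=\delta_{h,gtg^{-1}}\,\rho_h(l)$ for $t\in H$, and the module algebra rules $(ab)(F)=a(b(F))$, $a(F_1F_2)=\sum_{(a)}a_{(1)}(F_1)a_{(2)}(F_2)$, $a(I)=\varepsilon(a)I$; it also satisfies $a(F^* )=(S(a^* )(F))^*$. The map $F\mapsto z_H(F)$ denotes the action of the element $z_H$. The observable algebra is $\mathcal{A}_{(H,G)}=\{F\in\mathcal{F}_H: z_H(F)=F\}$, a unital $C^*$-subalgebra of $\mathcal{F}_H$. A conditional expectation from a unital $C^*$-algebra $B$ onto a unital $C^*$-subalgebra $A$ is a positive linear unital $A$-bimodule map from $B$ onto $A$; it is known that $z_H:\mathcal{F}_H\to\mathcal{A}_{(H,G)}$, $F\mapsto z_H(F)$, is one. A quasi-basis for a conditional expectation $\Gamma:B\to A$ is a finite family $\{(u_1,u_1^* ),\dots,(u_n,u_n^* )\}\subseteq B\times B$ such that $\sum_{i=1}^n u_i\Gamma(u_i^*a)=a=\sum_{i=1}^n\Gamma(au_i)u_i^*$ for all $a\in B$. If a quasi-basis exists, $\Gamma$ is said to be of index-finite type and its ($C^*$-)index is $\mathrm{Index}\ \Gamma=\sum_{i=1}^n u_iu_i^*$, which does not depend on the choice of quasi-basis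 (Watatani). A statement that $\mathrm{Index}\ \Gamma$ equals a given element is understood to include that $\Gamma$ is of index-finite type. *)

theory Defs
  imports Complex_Main "HOL-Algebra.QuotRing" "HOL-Algebra.Module"
begin

section \<open>Complex star algebras as records\<close>

record 'b star_algebra = "(complex, 'b) module" +
  star :: "'b \<Rightarrow> 'b"

record 'b normed_star_algebra = "'b star_algebra" +
  alg_norm :: "'b \<Rightarrow> real"

inductive_set generated_subalgebra :: "('b, 'm) star_algebra_scheme \<Rightarrow> 'b set \<Rightarrow> 'b set"
  for A (structure) and S where
  gen: "x \<in> S \<Longrightarrow> x \<in> generated_subalgebra A S"
| one: "\<one> \<in> generated_subalgebra A S"
| add: "x \<in> generated_subalgebra A S \<Longrightarrow> y \<in> generated_subalgebra A S
        \<Longrightarrow> x \<oplus> y \<in> generated_subalgebra A S"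
| mult: "x \<in> generated_subalgebra A S \<Longrightarrow> y \<in> generated_subalgebra A S
        \<Longrightarrow> x \<otimes> y \<in> generated_subalgebra A S"
| smult: "x \<in> generated_subalgebra A S \<Longrightarrow> c \<odot> x \<in> generated_subalgebra A S"

text \<open>\<open>N\<close> is a C*-norm on the *-subalgebra \<open>B\<close> of \<open>A\<close>.  Completeness is not part of the
  definition; it is automatic for finite-dimensional \<open>B\<close>, the only case used below.\<close>

definition is_cstar_norm :: "('b, 'm) star_algebra_scheme \<Rightarrow> 'b set \<Rightarrow> ('b \<Rightarrow> real) \<Rightarrow> bool" where
  "is_cstar_norm A B N \<longleftrightarrow>
     (\<forall>x\<in>B. 0 \<le> N x \<and> (N x = 0 \<longleftrightarrow> x = \<zero>\<^bsub>A\<^esub>)) \<and>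
     (\<forall>x\<in>B. \<forall>c. N (c \<odot>\<^bsub>A\<^esub> x) = cmod c * N x) \<and>
     (\<forall>x\<in>B. \<forall>y\<in>B. N (x \<oplus>\<^bsub>A\<^esub> y) \<le> N x + N y) \<and>
     (\<forall>x\<in>B. \<forall>y\<in>B. N (x \<otimes>\<^bsub>A\<^esub> y) \<le> N x * N y) \<and>
     (\<forall>x\<in>B. N (star A x \<otimes>\<^bsub>A\<^esub> x) = (N x)\<^sup>2)"


subsection \<open>Free star algebras and quotients\<close>

text \<open>The free unital algebra on \<open>X\<close>: finitely supported functions on words, with concatenation
  extended bilinearly.  The map \<open>\<sigma>\<close> is meant to be an involution of \<open>X\<close>; it is extended
  to the antilinear antimultiplicative involution of the free algebra.\<close>

definition free_star_algebra :: "'x set \<Rightarrow> ('x \<Rightarrow> 'x) \<Rightarrow> ('x list \<Rightarrow> complex) star_algebra" where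
  "free_star_algebra X \<sigma> =
     \<lparr>carrier = {f. finite {w. f w \<noteq> 0} \<and> {w. f w \<noteq> 0} \<subseteq> lists X},
      mult = (\<lambda>f g w. \<Sum>k\<le>length w. f (take k w) * g (drop k w)),
      one = (\<lambda>w. if w = [] then 1 else 0),
      zero = (\<lambda>w. 0),
      add = (\<lambda>f g w. f w + g w),
      smult = (\<lambda>c f w. c * f w),
      star = (\<lambda>f w. if w \<in> lists X then cnj (f (rev (map \<sigma> w))) else 0)\<rparr>"

definition gen_elem :: "'x \<Rightarrow> 'x list \<Rightarrow> complex" where
  "gen_elem x = (\<lambda>w. if w = [x] then 1 else 0)"

text \<open>The quotient ring \<open>A Quot I\<close> for a star-closed ideal \<open>I\<close>, whose elements are cosets, with the
  induced scalar multiplication and involution.\<close>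

definition quotient_star_algebra ::
    "('b, 'm) star_algebra_scheme \<Rightarrow> 'b set \<Rightarrow> 'b set star_algebra" where
  "quotient_star_algebra A I =
     \<lparr>carrier = carrier (A Quot I),
      mult = mult (A Quot I),
      one = one (A Quot I),
      zero = zero (A Quot I),
      add = add (A Quot I),
      smult = (\<lambda>c X. \<Union>f\<in>X. I +>\<^bsub>A\<^esub> (c \<odot>\<^bsub>A\<^esub> f)),
      star = (\<lambda>X. star A ` X)\<rparr>"


subsection \<open>Completion with respect to a norm\<close>

definition cauchy_seqs :: "('b, 'm) star_algebra_scheme \<Rightarrow> ('b \<Rightarrow> real) \<Rightarrow> (nat \<Rightarrow> 'b) set" where
  "cauchy_seqs A N =
     {F. range F \<subseteq> carrier A \<and>
         (\<forall>\<epsilon>>0. \<exists>M. \<forall>m\<ge>M. \<forall>n\<ge>M. N (F m \<ominus>\<^bsub>A\<^esub> F n) < \<epsilon>)}"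

definition seq_class ::
    "('b, 'm) star_algebra_scheme \<Rightarrow> ('b \<Rightarrow> real) \<Rightarrow> (nat \<Rightarrow> 'b) \<Rightarrow> (nat \<Rightarrow> 'b) set" where
  "seq_class A N F = {F' \<in> cauchy_seqs A N. (\<lambda>n. N (F n \<ominus>\<^bsub>A\<^esub> F' n)) \<longlonglongrightarrow> 0}"

text \<open>In the operations below the union runs over representatives; all of them give the same class
  when the operation is continuous.\<close>

definition completion_lift ::
    "('b, 'm) star_algebra_scheme \<Rightarrow> ('b \<Rightarrow> real) \<Rightarrow> ('b \<Rightarrow> 'b) \<Rightarrow> (nat \<Rightarrow> 'b) set \<Rightarrow> (nat \<Rightarrow> 'b) set" where
  "completion_lift A N \<phi> X = (\<Union>F\<in>X. seq_class A N (\<lambda>n. \<phi> (F n)))"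

definition completion_lift2 ::
    "('b, 'm) star_algebra_scheme \<Rightarrow> ('b \<Rightarrow> real) \<Rightarrow> ('b \<Rightarrow> 'b \<Rightarrow> 'b) \<Rightarrow>
     (nat \<Rightarrow> 'b) set \<Rightarrow> (nat \<Rightarrow> 'b) set \<Rightarrow> (nat \<Rightarrow> 'b) set" where
  "completion_lift2 A N \<phi> X Y = (\<Union>F\<in>X. \<Union>F'\<in>Y. seq_class A N (\<lambda>n. \<phi> (F n) (F' n)))"

definition completion ::
    "('b, 'm) star_algebra_scheme \<Rightarrow> ('b \<Rightarrow> real) \<Rightarrow> (nat \<Rightarrow> 'b) set normed_star_algebra" where
  "completion A N =
     \<lparr>carrier = seq_class A N ` cauchy_seqs A N,
      mult = completion_lift2 A N (mult A),
      one = seq_class A N (\<lambda>n. \<one>\<^bsub>A\<^esub>),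
      zero = seq_class A N (\<lambda>n. \<zero>\<^bsub>A\<^esub>),
      add = completion_lift2 A N (add A),
      smult = (\<lambda>c. completion_lift A N (smult A c)),
      star = completion_lift A N (star A),
      alg_norm = (\<lambda>X. THE r. \<forall>F\<in>X. (\<lambda>n. N (F n)) \<longlonglongrightarrow> r)\<rparr>"


section \<open>Conditional expectations and index\<close>

text \<open>The positive cone: finite sums of elements \<open>y* y\<close>.  (In a C*-algebra every such sum is
  again of the form \<open>y* y\<close>.)\<close>

definition positive_cone :: "('b, 'm) star_algebra_scheme \<Rightarrow> 'b set" where
  "positive_cone B =
     {(\<Oplus>\<^bsub>B\<^esub>i\<in>{..<length ys}. star B (ys ! i) \<otimes>\<^bsub>B\<^esub> (ys ! i)) | ys. set ys \<subseteq> carrier B}"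

text \<open>That \<open>B\<close> is a unital C*-algebra and \<open>A\<close> a unital C*-subalgebra is presupposed, not stated.\<close>

definition conditional_expectation ::
    "('b, 'm) star_algebra_scheme \<Rightarrow> 'b set \<Rightarrow> ('b \<Rightarrow> 'b) \<Rightarrow> bool" where
  "conditional_expectation B A \<Gamma> \<longleftrightarrow>
     A \<subseteq> carrier B \<and> \<Gamma> ` carrier B = A \<and> \<Gamma> \<one>\<^bsub>B\<^esub> = \<one>\<^bsub>B\<^esub> \<and>
     (\<forall>x\<in>carrier B. \<forall>y\<in>carrier B. \<Gamma> (x \<oplus>\<^bsub>B\<^esub> y) = \<Gamma> x \<oplus>\<^bsub>B\<^esub> \<Gamma> y) \<and>
     (\<forall>c. \<forall>x\<in>carrier B. \<Gamma> (c \<odot>\<^bsub>B\<^esub> x) = c \<odot>\<^bsub>B\<^esub> \<Gamma> x) \<and>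
     (\<forall>a\<in>A. \<forall>x\<in>carrier B. \<Gamma> (a \<otimes>\<^bsub>B\<^esub> x) = a \<otimes>\<^bsub>B\<^esub> \<Gamma> x \<and> \<Gamma> (x \<otimes>\<^bsub>B\<^esub> a) = \<Gamma> x \<otimes>\<^bsub>B\<^esub> a) \<and>
     (\<forall>x\<in>positive_cone B. \<Gamma> x \<in> positive_cone B)"

text \<open>The list \<open>us\<close> stands for the family of pairs \<open>(u, u*)\<close>.\<close>

definition quasi_basis ::
    "('b, 'm) star_algebra_scheme \<Rightarrow> ('b \<Rightarrow> 'b) \<Rightarrow> 'b list \<Rightarrow> bool" where
  "quasi_basis B \<Gamma> us \<longleftrightarrow> set us \<subseteq> carrier B \<and>
     (\<forall>a\<in>carrier B.
        (\<Oplus>\<^bsub>B\<^esub>i\<in>{..<length us}. (us ! i) \<otimes>\<^bsub>B\<^esub> \<Gamma> (star B (us ! i) \<otimes>\<^bsub>B\<^esub> a)) = a \<and>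
        (\<Oplus>\<^bsub>B\<^esub>i\<in>{..<length us}. \<Gamma> (a \<otimes>\<^bsub>B\<^esub> (us ! i)) \<otimes>\<^bsub>B\<^esub> star B (us ! i)) = a)"

definition index_finite_type ::
    "('b, 'm) star_algebra_scheme \<Rightarrow> 'b set \<Rightarrow> ('b \<Rightarrow> 'b) \<Rightarrow> bool" where
  "index_finite_type B A \<Gamma> \<longleftrightarrow> conditional_expectation B A \<Gamma> \<and> (\<exists>us. quasi_basis B \<Gamma> us)"

definition cstar_index :: "('b, 'm) star_algebra_scheme \<Rightarrow> ('b \<Rightarrow> 'b) \<Rightarrow> 'b" where
  "cstar_index B \<Gamma> =
     (THE c. \<exists>us. quasi_basis B \<Gamma> us \<and>
        c = (\<Oplus>\<^bsub>B\<^esub>i\<in>{..<length us}. (us ! i) \<otimes>\<^bsub>B\<^esub> star B (us ! i)))"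


section \<open>The Hopf star algebra \<open>D(H;G)\<close>\<close>

context
  fixes G :: "('a, 'm) monoid_scheme" (structure) and H :: "'a set"
begin

text \<open>Elements are their coefficient functions with respect to the basis \<open>(h, g)\<close>.\<close>

definition D_basis :: "'a \<times> 'a \<Rightarrow> 'a \<times> 'a \<Rightarrow> complex" where
  "D_basis p = (\<lambda>q. if q = p then 1 else 0)"

definition D_algebra :: "('a \<times> 'a \<Rightarrow> complex) star_algebra" where
  "D_algebra =
     \<lparr>carrier = {a. \<forall>p. p \<notin> H \<times> carrier G \<longrightarrow> a p = 0},
      mult = (\<lambda>a b r. \<Sum>(h1, g1)\<in>H \<times> carrier G. \<Sum>(h2, g2)\<in>H \<times> carrier G.
                a (h1, g1) * b (h2, g2) *
                (if h1 \<otimes> g1 = g1 \<otimes> h2 then D_basis (h1, g1 \<otimes> g2) r else 0)),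
      one = (\<lambda>r. \<Sum>h\<in>H. D_basis (h, \<one>) r),
      zero = (\<lambda>r. 0),
      add = (\<lambda>a b r. a r + b r),
      smult = (\<lambda>c a r. c * a r),
      star = (\<lambda>a r. \<Sum>(h, g)\<in>H \<times> carrier G.
                cnj (a (h, g)) * D_basis (inv g \<otimes> h \<otimes> g, inv g) r)\<rparr>"

text \<open>Elements of the tensor square are coefficient functions with respect to the basis
  of pairs of basis elements.\<close>

definition D_coproduct ::
    "('a \<times> 'a \<Rightarrow> complex) \<Rightarrow> ('a \<times> 'a) \<times> ('a \<times> 'a) \<Rightarrow> complex" where
  "D_coproduct a = (\<lambda>(p, q). \<Sum>(h, g)\<in>H \<times> carrier G. \<Sum>t\<in>H.
     a (h, g) * (D_basis (t, g) p * D_basis (inv t \<otimes> h, g) q))"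

definition D_counit :: "('a \<times> 'a \<Rightarrow> complex) \<Rightarrow> complex" where
  "D_counit a = (\<Sum>(h, g)\<in>H \<times> carrier G. a (h, g) * (if h = \<one> then 1 else 0))"

definition D_antipode :: "('a \<times> 'a \<Rightarrow> complex) \<Rightarrow> 'a \<times> 'a \<Rightarrow> complex" where
  "D_antipode a = (\<lambda>r. \<Sum>(h, g)\<in>H \<times> carrier G.
     a (h, g) * D_basis (inv g \<otimes> inv h \<otimes> g, inv g) r)"

definition z_elem :: "'a \<times> 'a \<Rightarrow> complex" where
  "z_elem = (\<lambda>r. (1 / of_nat (order G)) * (\<Sum>g\<in>carrier G. D_basis (\<one>, g) r))"

end


section \<open>The field algebra\<close>

text \<open>\<open>Delta g x\<close> and \<open>Rho h l\<close> stand for the generators \<open>\<delta>\<^sub>g(x)\<close> and \<open>\<rho>\<^sub>h(l)\<close>.\<close>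

datatype 'a field_gen = Delta 'a rat | Rho 'a rat

definition half_odd :: "rat set" where
  "half_odd = {l. l - 1/2 \<in> \<int>}"

text \<open>The intervals \<open>\<Lambda>\<^sub>m\<close>, for \<open>m = 2 n\<close> and \<open>m = 2 n + 1\<close>.\<close>

definition Lambda :: "nat \<Rightarrow> rat set" where
  "Lambda m = (let n = of_nat (m div 2) in
     {s. 2 * s \<in> \<int> \<and> (if even m then - n + 1/2 else - n - 1/2) \<le> s \<and> s \<le> n})"

context
  fixes G :: "('a, 'm) monoid_scheme" (structure) and H :: "'a set"
begin

definition field_gens :: "rat set \<Rightarrow> 'a field_gen set" where
  "field_gens \<Lambda> = {Delta g x | g x. g \<in> carrier G \<and> x \<in> \<Lambda> \<inter> \<int>} \<union>
                   {Rho h l | h l. h \<in> H \<and> l \<in> \<Lambda> \<inter> half_odd}"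

fun field_gen_star :: "'a field_gen \<Rightarrow> 'a field_gen" where
  "field_gen_star (Delta g x) = Delta g x"
| "field_gen_star (Rho h l) = Rho (inv h) l"

definition free_field :: "('a field_gen list \<Rightarrow> complex) star_algebra" where
  "free_field = free_star_algebra (field_gens UNIV) field_gen_star"

text \<open>\<open>field_rel u v\<close>: the defining relation \<open>u = v\<close>.\<close>

inductive field_rel ::
    "('a field_gen list \<Rightarrow> complex) \<Rightarrow> ('a field_gen list \<Rightarrow> complex) \<Rightarrow> bool" where
  delta_sum: "x \<in> \<int> \<Longrightarrow>
    field_rel (\<Oplus>\<^bsub>free_field\<^esub>g\<in>carrier G. gen_elem (Delta g x)) \<one>\<^bsub>free_field\<^esub>"
| rho_one: "l \<in> half_odd \<Longrightarrow> field_rel (gen_elem (Rho \<one> l)) \<one>\<^bsub>free_field\<^esub>"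
| delta_delta: "g1 \<in> carrier G \<Longrightarrow> g2 \<in> carrier G \<Longrightarrow> x \<in> \<int> \<Longrightarrow>
    field_rel (gen_elem (Delta g1 x) \<otimes>\<^bsub>free_field\<^esub> gen_elem (Delta g2 x))
      (if g1 = g2 then gen_elem (Delta g1 x) else \<zero>\<^bsub>free_field\<^esub>)"
| rho_rho: "h1 \<in> H \<Longrightarrow> h2 \<in> H \<Longrightarrow> l \<in> half_odd \<Longrightarrow>
    field_rel (gen_elem (Rho h1 l) \<otimes>\<^bsub>free_field\<^esub> gen_elem (Rho h2 l))
      (gen_elem (Rho (h1 \<otimes> h2) l))"
| delta_comm: "g1 \<in> carrier G \<Longrightarrow> g2 \<in> carrier G \<Longrightarrow> x \<in> \<int> \<Longrightarrow> x' \<in> \<int> \<Longrightarrow>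
    field_rel (gen_elem (Delta g1 x) \<otimes>\<^bsub>free_field\<^esub> gen_elem (Delta g2 x'))
      (gen_elem (Delta g2 x') \<otimes>\<^bsub>free_field\<^esub> gen_elem (Delta g1 x))"
| rho_delta_less: "h \<in> H \<Longrightarrow> g \<in> carrier G \<Longrightarrow> l \<in> half_odd \<Longrightarrow> x \<in> \<int> \<Longrightarrow> l < x \<Longrightarrow>
    field_rel (gen_elem (Rho h l) \<otimes>\<^bsub>free_field\<^esub> gen_elem (Delta g x))
      (gen_elem (Delta (h \<otimes> g) x) \<otimes>\<^bsub>free_field\<^esub> gen_elem (Rho h l))"
| rho_delta_greater: "h \<in> H \<Longrightarrow> g \<in> carrier G \<Longrightarrow> l \<in> half_odd \<Longrightarrow> x \<in> \<int> \<Longrightarrow> l > x \<Longrightarrow>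
    field_rel (gen_elem (Rho h l) \<otimes>\<^bsub>free_field\<^esub> gen_elem (Delta g x))
      (gen_elem (Delta g x) \<otimes>\<^bsub>free_field\<^esub> gen_elem (Rho h l))"
| rho_comm: "h1 \<in> H \<Longrightarrow> h2 \<in> H \<Longrightarrow> l \<in> half_odd \<Longrightarrow> l' \<in> half_odd \<Longrightarrow> l > l' \<Longrightarrow>
    field_rel (gen_elem (Rho h1 l) \<otimes>\<^bsub>free_field\<^esub> gen_elem (Rho h2 l'))
      (gen_elem (Rho h2 l') \<otimes>\<^bsub>free_field\<^esub> gen_elem (Rho (inv h2 \<otimes> h1 \<otimes> h2) l))"

definition field_ideal :: "('a field_gen list \<Rightarrow> complex) set" where
  "field_ideal = genideal free_field {u \<ominus>\<^bsub>free_field\<^esub> v | u v. field_rel u v}"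

definition local_field_algebra :: "('a field_gen list \<Rightarrow> complex) set star_algebra" where
  "local_field_algebra = quotient_star_algebra free_field field_ideal"

definition field_gen_class :: "'a field_gen \<Rightarrow> ('a field_gen list \<Rightarrow> complex) set" where
  "field_gen_class x = field_ideal +>\<^bsub>free_field\<^esub> gen_elem x"

definition field_subalgebra :: "rat set \<Rightarrow> ('a field_gen list \<Rightarrow> complex) set set" where
  "field_subalgebra \<Lambda> = generated_subalgebra local_field_algebra (field_gen_class ` field_gens \<Lambda>)"

text \<open>The norm of the inductive limit: each \<open>field_subalgebra (Lambda n)\<close> is a finite-dimensional
  C*-algebra and thus has exactly one C*-norm; these norms are compatible with the inclusions,
  and every element lies in \<open>field_subalgebra (Lambda n)\<close> for some \<open>n\<close>.\<close>

definition local_norm :: "('a field_gen list \<Rightarrow> complex) set \<Rightarrow> real" where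
  "local_norm F = (THE r. \<exists>n N. F \<in> field_subalgebra (Lambda n) \<and>
     is_cstar_norm local_field_algebra (field_subalgebra (Lambda n)) N \<and> r = N F)"

definition field_algebra ::
    "(nat \<Rightarrow> ('a field_gen list \<Rightarrow> complex) set) set normed_star_algebra" where
  "field_algebra = completion local_field_algebra local_norm"


subsection \<open>The action of \<open>D(H;G)\<close> and the observable algebra\<close>

text \<open>The extensional function space only serves to fix the values outside the carriers, so that
  the action is unique as a HOL function.\<close>

definition is_local_action ::
    "(('a \<times> 'a \<Rightarrow> complex) \<Rightarrow> ('a field_gen list \<Rightarrow> complex) set \<Rightarrow>
      ('a field_gen list \<Rightarrow> complex) set) \<Rightarrow> bool" where
  "is_local_action act \<longleftrightarrow> (let D = D_algebra G H; L = local_field_algebra in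
     act \<in> carrier D \<rightarrow>\<^sub>E (carrier L \<rightarrow>\<^sub>E carrier L) \<and>
     (\<forall>a\<in>carrier D. \<forall>b\<in>carrier D. \<forall>F\<in>carrier L.
        act (a \<oplus>\<^bsub>D\<^esub> b) F = act a F \<oplus>\<^bsub>L\<^esub> act b F) \<and>
     (\<forall>c. \<forall>a\<in>carrier D. \<forall>F\<in>carrier L. act (c \<odot>\<^bsub>D\<^esub> a) F = c \<odot>\<^bsub>L\<^esub> act a F) \<and>
     (\<forall>a\<in>carrier D. \<forall>F\<in>carrier L. \<forall>F'\<in>carrier L.
        act a (F \<oplus>\<^bsub>L\<^esub> F') = act a F \<oplus>\<^bsub>L\<^esub> act a F') \<and>
     (\<forall>a\<in>carrier D. \<forall>c. \<forall>F\<in>carrier L. act a (c \<odot>\<^bsub>L\<^esub> F) = c \<odot>\<^bsub>L\<^esub> act a F) \<and>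
     (\<forall>F\<in>carrier L. act \<one>\<^bsub>D\<^esub> F = F) \<and>
     (\<forall>a\<in>carrier D. \<forall>b\<in>carrier D. \<forall>F\<in>carrier L. act (a \<otimes>\<^bsub>D\<^esub> b) F = act a (act b F)) \<and>
     (\<forall>a\<in>carrier D. \<forall>F1\<in>carrier L. \<forall>F2\<in>carrier L.
        act a (F1 \<otimes>\<^bsub>L\<^esub> F2) =
          (\<Oplus>\<^bsub>L\<^esub>r\<in>(H \<times> carrier G) \<times> (H \<times> carrier G).
             D_coproduct G H a r \<odot>\<^bsub>L\<^esub>
               (act (D_basis (fst r)) F1 \<otimes>\<^bsub>L\<^esub> act (D_basis (snd r)) F2))) \<and>
     (\<forall>a\<in>carrier D. act a \<one>\<^bsub>L\<^esub> = D_counit G H a \<odot>\<^bsub>L\<^esub> \<one>\<^bsub>L\<^esub>) \<and>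
     (\<forall>a\<in>carrier D. \<forall>F\<in>carrier L.
        act a (star L F) = star L (act (D_antipode G H (star D a)) F)) \<and>
     (\<forall>h\<in>H. \<forall>g\<in>carrier G. \<forall>f\<in>carrier G. \<forall>x\<in>\<int>.
        act (D_basis (h, g)) (field_gen_class (Delta f x)) =
          (if h = \<one> then field_gen_class (Delta (g \<otimes> f) x) else \<zero>\<^bsub>L\<^esub>)) \<and>
     (\<forall>h\<in>H. \<forall>g\<in>carrier G. \<forall>t\<in>H. \<forall>l\<in>half_odd.
        act (D_basis (h, g)) (field_gen_class (Rho t l)) =
          (if h = g \<otimes> t \<otimes> inv g then field_gen_class (Rho h l) else \<zero>\<^bsub>L\<^esub>)))"

definition local_act ::
    "('a \<times> 'a \<Rightarrow> complex) \<Rightarrow> ('a field_gen list \<Rightarrow> complex) set \<Rightarrow>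
     ('a field_gen list \<Rightarrow> complex) set" where
  "local_act = (THE act. is_local_action act)"

definition field_act ::
    "('a \<times> 'a \<Rightarrow> complex) \<Rightarrow> (nat \<Rightarrow> ('a field_gen list \<Rightarrow> complex) set) set \<Rightarrow>
     (nat \<Rightarrow> ('a field_gen list \<Rightarrow> complex) set) set" where
  "field_act a = completion_lift local_field_algebra local_norm (local_act a)"

definition observable_algebra :: "(nat \<Rightarrow> ('a field_gen list \<Rightarrow> complex) set) set set" where
  "observable_algebra = {F \<in> carrier field_algebra. field_act (z_elem G) F = F}"

end

end

theory Submission
  imports Defs "HOL-Analysis.L2_Norm"
begin

text \<open>The field algebra acts on functions of configurations \<open>c : \<int> \<rightarrow> G\<close>, \<open>\<delta>\<^sub>g(x)\<close> as the indicator
  of \<open>c x = g\<close> and \<open>\<rho>\<^sub>h(l)\<close> as the translation of all sites to the right of \<open>l\<close>.  The relations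
  bring every word into a normal form, and the matrix coefficients separate normal forms; so this
  representation is faithful and its operator norm is a C*-norm.  On each local algebra, where all
  C*-norms are equivalent by finite dimension, the identity \<open>N (h\<^sup>2) = (N h)\<^sup>2\<close> makes it the only one.

  The action of \<open>D(H;G)\<close> is \<open>(h, g) w = \<delta>\<^bsub>h, t(gw)\<^esub> gw\<close>, where \<open>gw\<close> is the relabelled word and
  \<open>t\<close> the product of its \<open>\<rho>\<close>-labels.  The relabelling is an automorphism,
  hence isometric, and the component of degree \<open>h\<close> of \<open>F\<close> is
  \<open>\<Sum>\<^sub>k \<delta>\<^bsub>hk\<^esub>(x) F \<delta>\<^sub>k(x)\<close> for \<open>x\<close> to the right of \<open>F\<close>, hence bounded; so the action extends to
  the completion.

  The elements \<open>sqrt |G| \<delta>\<^sub>k(0) \<rho>\<^sub>h(1/2)\<close> form a quasi-basis for \<open>z\<^sub>H\<close>: they satisfy its identities on the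
  local algebra, and the identities pass to limits.  Each of the \<open>|H|\<close> elements \<open>h\<close> contributes
  \<open>|G| \<Sum>\<^sub>k \<delta>\<^sub>k(0) = |G| I\<close> to the index.\<close>

section \<open>C*-norms and completions\<close>

text \<open>Why these elements form a quasi-basis: z_H forgets every component of nontrivial degree
  and averages the translates of the rest. Multiplying by \<rho>_h^{-1} on the left moves the
  component of degree h into degree 1, so summing over h loses nothing; multiplying by \<delta>_k
  separates the translates, because \<delta>_k and \<delta>_{gk} are orthogonal for g \<noteq> 1.
  The factor sqrt |G| undoes the average. These computations rest on a few algebraic rules,
  collected in the locale \<open>crossed_action\<close>, and are carried out for an abstract normed
  star algebra and its completion. The labour lies in reaching these rules. The norm and the action
  of the field algebra are definite descriptions: the norm is the value of any C*-norm on a local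
  algebra, the action is the map with the required properties. Both say nothing until existence and
  uniqueness are shown, and existence requires to know which elements of the free algebra vanish in
  the quotient. This is why the ideal has to be identified with the kernel of a concrete
  representation.\<close>

locale star_alg = ring A for A :: "('b, 'm) star_algebra_scheme" (structure) +
  assumes smult_closed [simp, intro]: "x \<in> carrier A \<Longrightarrow> c \<odot> x \<in> carrier A"
    and smult_l_distr: "x \<in> carrier A \<Longrightarrow> (c + d) \<odot> x = c \<odot> x \<oplus> d \<odot> x"
    and smult_r_distr: "x \<in> carrier A \<Longrightarrow> y \<in> carrier A \<Longrightarrow> c \<odot> (x \<oplus> y) = c \<odot> x \<oplus> c \<odot> y"
    and smult_smult: "x \<in> carrier A \<Longrightarrow> c \<odot> (d \<odot> x) = (c * d) \<odot> x"
    and smult_one [simp]: "x \<in> carrier A \<Longrightarrow> 1 \<odot> x = x"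
    and smult_mult_l: "x \<in> carrier A \<Longrightarrow> y \<in> carrier A \<Longrightarrow> (c \<odot> x) \<otimes> y = c \<odot> (x \<otimes> y)"
    and smult_mult_r: "x \<in> carrier A \<Longrightarrow> y \<in> carrier A \<Longrightarrow> x \<otimes> (c \<odot> y) = c \<odot> (x \<otimes> y)"
    and star_closed [simp, intro]: "x \<in> carrier A \<Longrightarrow> star A x \<in> carrier A"
    and star_star [simp]: "x \<in> carrier A \<Longrightarrow> star A (star A x) = x"
    and star_add: "x \<in> carrier A \<Longrightarrow> y \<in> carrier A \<Longrightarrow> star A (x \<oplus> y) = star A x \<oplus> star A y"
    and star_smult: "x \<in> carrier A \<Longrightarrow> star A (c \<odot> x) = cnj c \<odot> star A x"
    and star_mult: "x \<in> carrier A \<Longrightarrow> y \<in> carrier A \<Longrightarrow> star A (x \<otimes> y) = star A y \<otimes> star A x"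
begin

lemma smult_zero_l [simp]: "x \<in> carrier A \<Longrightarrow> 0 \<odot> x = \<zero>"
  using smult_l_distr[of x 0 0] by (simp add: local.add.r_cancel_one)

lemma smult_zero_r [simp]: "c \<odot> \<zero> = \<zero>"
  using smult_r_distr[of \<zero> \<zero> c] by (simp add: local.add.r_cancel_one)

lemma minus_eq_smult: "x \<in> carrier A \<Longrightarrow> \<ominus> x = (-1) \<odot> x"
  using smult_l_distr[of x 1 "-1"] by (metis add.right_inverse local.minus_equality local.smult_one smult_closed smult_zero_l a_comm)

lemma diff_eq_smult: "x \<in> carrier A \<Longrightarrow> y \<in> carrier A \<Longrightarrow> x \<ominus> y = x \<oplus> (-1) \<odot> y"
  by (simp add: a_minus_def minus_eq_smult)

lemma finsum_smult:
  assumes "\<And>i. i \<in> I \<Longrightarrow> f i \<in> carrier A"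
  shows "c \<odot> (\<Oplus>i\<in>I. f i) = (\<Oplus>i\<in>I. c \<odot> f i)"
  using assms
proof (induction I rule: infinite_finite_induct)
  case (insert i I)
  then show ?case by (subst (1 2) finsum_insert) (auto simp: smult_r_distr)
qed auto

end

locale cstar_normed = star_alg A for A :: "('b, 'm) star_algebra_scheme" (structure) +
  fixes N :: "'b \<Rightarrow> real"
  assumes cstar_norm: "is_cstar_norm A (carrier A) N"
begin

lemma norm_nonneg [simp]: "x \<in> carrier A \<Longrightarrow> 0 \<le> N x"
  and norm_eq_zero: "x \<in> carrier A \<Longrightarrow> N x = 0 \<longleftrightarrow> x = \<zero>"
  and norm_smult: "x \<in> carrier A \<Longrightarrow> N (c \<odot> x) = cmod c * N x"
  and norm_add: "x \<in> carrier A \<Longrightarrow> y \<in> carrier A \<Longrightarrow> N (x \<oplus> y) \<le> N x + N y"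
  and norm_mult: "x \<in> carrier A \<Longrightarrow> y \<in> carrier A \<Longrightarrow> N (x \<otimes> y) \<le> N x * N y"
  and norm_star_mult: "x \<in> carrier A \<Longrightarrow> N (star A x \<otimes> x) = (N x)\<^sup>2"
  using cstar_norm by (auto simp: is_cstar_norm_def)

lemma norm_zero [simp]: "N \<zero> = 0"
  by (simp add: norm_eq_zero)

text \<open>With y' the star of y, N(y)^2 = N(y' y) \<le> N(y') N(y), and one factor N(y) cancels.
  Applied to x and to its star this gives both inequalities.\<close>

lemma norm_star [simp]:
  assumes x: "x \<in> carrier A" shows "N (star A x) = N x"
proof -
  have le: "N y \<le> N (star A y)" if y: "y \<in> carrier A" for y
  proof -
    have "N y * N y \<le> N (star A y) * N y"
      using norm_mult[of "star A y" y] norm_star_mult[of y] y by (simp add: power2_eq_square)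
    then show ?thesis
      using y norm_nonneg[of "star A y"] norm_nonneg[of y]
      by (cases "N y = 0") (simp_all add: mult_le_cancel_right less_le)
  qed
  show ?thesis using le[OF x] le[of "star A x"] x by simp
qed

lemma norm_diff_commute:
  assumes "x \<in> carrier A" "y \<in> carrier A" shows "N (x \<ominus> y) = N (y \<ominus> x)"
proof -
  have "y \<ominus> x = (-1) \<odot> (x \<ominus> y)"
    using assms by (simp add: minus_eq_smult[symmetric] a_minus_def minus_add local.add.inv_solve_right a_comm)
  then show ?thesis using assms by (simp add: norm_smult)
qed

lemma norm_diff_triangle:
  assumes "x \<in> carrier A" "y \<in> carrier A" "z \<in> carrier A"
  shows "N (x \<ominus> z) \<le> N (x \<ominus> y) + N (y \<ominus> z)"
proof -
  have "x \<ominus> z = (x \<ominus> y) \<oplus> (y \<ominus> z)"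
    using assms by (simp add: a_minus_def a_ac) (metis a_assoc add.inv_closed r_neg1 r_neg2)
  then show ?thesis using assms by (simp add: norm_add)
qed

section \<open>Classes of Cauchy sequences and lifted operations\<close>

abbreviation C where "C \<equiv> cauchy_seqs A N"
abbreviation cls where "cls \<equiv> seq_class A N"
abbreviation B where "B \<equiv> completion A N"

definition near where "near F F' \<longleftrightarrow> (\<lambda>n. N (F n \<ominus> F' n)) \<longlonglongrightarrow> 0"

lemma C_closed: "F \<in> C \<Longrightarrow> F n \<in> carrier A"
  by (auto simp: cauchy_seqs_def)

lemma CI:
  assumes "\<And>n. F n \<in> carrier A"
    and "\<And>e. e > 0 \<Longrightarrow> \<exists>M. \<forall>m\<ge>M. \<forall>n\<ge>M. N (F m \<ominus> F n) < e"
  shows "F \<in> C"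
  using assms by (auto simp: cauchy_seqs_def)

lemma CD: "F \<in> C \<Longrightarrow> e > 0 \<Longrightarrow> \<exists>M. \<forall>m\<ge>M. \<forall>n\<ge>M. N (F m \<ominus> F n) < e"
  by (auto simp: cauchy_seqs_def)

lemma const_in_C [intro]: "x \<in> carrier A \<Longrightarrow> (\<lambda>n. x) \<in> C"
  by (rule CI) (auto simp: a_minus_def r_neg)

lemma C_norm_bounded:
  assumes F: "F \<in> C" obtains K where "K > 0" "\<And>n. N (F n) \<le> K"
proof -
  obtain M where M: "\<And>m n. m \<ge> M \<Longrightarrow> n \<ge> M \<Longrightarrow> N (F m \<ominus> F n) < 1"
    using CD[OF F, of 1] by auto
  have 1: "N (F n) \<le> N (F M) + 1" if "n \<ge> M" for n
  proof -
    have "F n = (F n \<ominus> F M) \<oplus> F M"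
      using C_closed[OF F] by (simp add: a_minus_def a_assoc l_neg)
    then have "N (F n) \<le> N (F n \<ominus> F M) + N (F M)"
      using norm_add[of "F n \<ominus> F M" "F M"] C_closed[OF F] by simp
    with M[of n M] that show ?thesis by simp
  qed
  \<comment> \<open>The added 1 covers the tail, whose norms exceed \<open>N (F M)\<close> by at
    most 1.\<close>
  let ?K = "Max ((\<lambda>n. N (F n)) ` {..M}) + 1"
  have 2: "N (F n) + 1 \<le> ?K" if "n \<le> M" for n
    using that by simp
  have "N (F n) \<le> ?K" for n
    using 1[of n] 2[of n] 2[of M] by (cases "n \<le> M") linarith+
  moreover have "?K > 0" using 2[OF order_refl] norm_nonneg[OF C_closed[OF F, of M]] by linarith
  ultimately show ?thesis by (rule that[rotated])
qed

text \<open>Operations on sequences are handled uniformly through estimates of the form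
  \<open>N (f x \<ominus> f y) \<le> K * N (x \<ominus> y)\<close>, which give both Cauchyness and invariance under nearness.\<close>

lemma near_refl: "F \<in> C \<Longrightarrow> near F F"
  by (simp add: near_def C_closed a_minus_def r_neg)

lemma near_sym: "F \<in> C \<Longrightarrow> F' \<in> C \<Longrightarrow> near F F' \<Longrightarrow> near F' F"
  using norm_diff_commute by (simp add: near_def C_closed)

lemma near_trans:
  assumes "F \<in> C" "F' \<in> C" "F'' \<in> C" "near F F'" "near F' F''" shows "near F F''"
  unfolding near_def
proof (rule tendsto_sandwich[OF _ _ tendsto_const])
  show "(\<lambda>n. N (F n \<ominus> F' n) + N (F' n \<ominus> F'' n)) \<longlonglongrightarrow> 0"
    using tendsto_add[OF assms(4)[unfolded near_def] assms(5)[unfolded near_def]] by simp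
qed (use assms C_closed norm_diff_triangle in \<open>auto intro!: always_eventually\<close>)

lemma cls_eq_iff:
  assumes "F \<in> C" "F' \<in> C" shows "cls F = cls F' \<longleftrightarrow> near F F'"
proof
  assume "cls F = cls F'"
  moreover have "F' \<in> cls F'" using near_refl[OF assms(2)] assms by (simp add: seq_class_def near_def)
  ultimately show "near F F'" by (auto simp: seq_class_def near_def)
next
  assume *: "near F F'"
  show "cls F = cls F'"
    unfolding seq_class_def near_def[symmetric]
    using near_trans near_sym * assms by blast
qed

lemma in_cls_iff: "F' \<in> cls F \<longleftrightarrow> F' \<in> C \<and> near F F'"
  by (simp add: seq_class_def near_def)

text \<open>The completion defines an operation as a union over all representatives. If equivalent
  sequences have equivalent images, all members of this union are one class, and the union
  collapses.\<close>

lemma lift_cls: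
  assumes F: "F \<in> C" and \<phi>: "\<And>F. F \<in> C \<Longrightarrow> (\<lambda>n. \<phi> (F n)) \<in> C"
    and near: "\<And>F F'. F \<in> C \<Longrightarrow> F' \<in> C \<Longrightarrow> near F F' \<Longrightarrow> near (\<lambda>n. \<phi> (F n)) (\<lambda>n. \<phi> (F' n))"
  shows "completion_lift A N \<phi> (cls F) = cls (\<lambda>n. \<phi> (F n))"
proof -
  have "cls (\<lambda>n. \<phi> (F' n)) = cls (\<lambda>n. \<phi> (F n))" if "F' \<in> cls F" for F'
    using that near[of F' F] near_sym[of F F'] \<phi> F by (simp add: cls_eq_iff in_cls_iff)
  moreover have "F \<in> cls F" using F by (simp add: in_cls_iff near_refl)
  ultimately show ?thesis unfolding completion_lift_def by blast
qed

lemma lift2_cls: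
  assumes F: "F \<in> C" "G \<in> C" and \<phi>: "\<And>F G. F \<in> C \<Longrightarrow> G \<in> C \<Longrightarrow> (\<lambda>n. \<phi> (F n) (G n)) \<in> C"
    and near: "\<And>F F' G G'. F \<in> C \<Longrightarrow> F' \<in> C \<Longrightarrow> G \<in> C \<Longrightarrow> G' \<in> C \<Longrightarrow> near F F' \<Longrightarrow> near G G' \<Longrightarrow>
      near (\<lambda>n. \<phi> (F n) (G n)) (\<lambda>n. \<phi> (F' n) (G' n))"
  shows "completion_lift2 A N \<phi> (cls F) (cls G) = cls (\<lambda>n. \<phi> (F n) (G n))"
proof -
  have "cls (\<lambda>n. \<phi> (F' n) (G' n)) = cls (\<lambda>n. \<phi> (F n) (G n))" if "F' \<in> cls F" "G' \<in> cls G" for F' G'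
    using that near[of F' F G' G] near_sym[of F F'] near_sym[of G G'] \<phi> F
    by (simp add: cls_eq_iff in_cls_iff)
  moreover have "F \<in> cls F" "G \<in> cls G" using F by (simp_all add: in_cls_iff near_refl)
  ultimately show ?thesis unfolding completion_lift2_def by blast
qed

text \<open>A Lipschitz condition on differences instead of a norm bound for linear maps, so that it
  also covers the antilinear \<open>star A\<close>.\<close>

definition bounded_map where
  "bounded_map \<phi> \<longleftrightarrow> (\<forall>x\<in>carrier A. \<phi> x \<in> carrier A) \<and>
     (\<exists>K. \<forall>x\<in>carrier A. \<forall>y\<in>carrier A. N (\<phi> x \<ominus> \<phi> y) \<le> K * N (x \<ominus> y))"

lemma bounded_map_C:
  assumes \<phi>: "bounded_map \<phi>" and F: "F \<in> C" shows "(\<lambda>n. \<phi> (F n)) \<in> C"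
proof (rule CI)
  obtain K where "\<forall>x\<in>carrier A. \<forall>y\<in>carrier A. N (\<phi> x \<ominus> \<phi> y) \<le> K * N (x \<ominus> y)"
    using \<phi> by (auto simp: bounded_map_def)
  \<comment> \<open>K may be zero or negative; the larger constant |K| + 1 is positive and can be
    divided by.\<close>
  then have K: "N (\<phi> x \<ominus> \<phi> y) \<le> (\<bar>K\<bar> + 1) * N (x \<ominus> y)" if "x \<in> carrier A" "y \<in> carrier A" for x y
    using that order_trans[of _ "K * N (x \<ominus> y)" "(\<bar>K\<bar> + 1) * N (x \<ominus> y)"]
    by (simp add: mult_right_mono)
  show "\<phi> (F n) \<in> carrier A" for n using \<phi> C_closed[OF F] by (auto simp: bounded_map_def)
  fix e :: real assume e: "e > 0"
  then obtain M where M: "\<And>m n. m \<ge> M \<Longrightarrow> n \<ge> M \<Longrightarrow> N (F m \<ominus> F n) < e / (\<bar>K\<bar> + 1)"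
    using CD[OF F, of "e / (\<bar>K\<bar> + 1)"] by (metis abs_ge_zero add_nonneg_pos divide_pos_pos zero_less_one)
  have "N (\<phi> (F m) \<ominus> \<phi> (F n)) < e" if "m \<ge> M" "n \<ge> M" for m n
  proof -
    have "(\<bar>K\<bar> + 1) * N (F m \<ominus> F n) < e"
      using M[OF that] by (simp add: pos_less_divide_eq mult.commute)
    then show ?thesis using K[of "F m" "F n"] C_closed[OF F] by fastforce
  qed
  then show "\<exists>M. \<forall>m\<ge>M. \<forall>n\<ge>M. N (\<phi> (F m) \<ominus> \<phi> (F n)) < e" by blast
qed

lemma bounded_map_near:
  assumes \<phi>: "bounded_map \<phi>" and F: "F \<in> C" "F' \<in> C" "near F F'"
  shows "near (\<lambda>n. \<phi> (F n)) (\<lambda>n. \<phi> (F' n))"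
proof -
  obtain K where K: "\<forall>x\<in>carrier A. \<forall>y\<in>carrier A. N (\<phi> x \<ominus> \<phi> y) \<le> K * N (x \<ominus> y)"
    using \<phi> by (auto simp: bounded_map_def)
  show ?thesis unfolding near_def
  proof (rule tendsto_sandwich[OF _ _ tendsto_const])
    show "(\<lambda>n. K * N (F n \<ominus> F' n)) \<longlonglongrightarrow> 0"
      using tendsto_mult_left[OF F(3)[unfolded near_def]] by simp
    show "\<forall>\<^sub>F n in sequentially. N (\<phi> (F n) \<ominus> \<phi> (F' n)) \<le> K * N (F n \<ominus> F' n)"
      using K F C_closed by (intro always_eventually) auto
    show "\<forall>\<^sub>F n in sequentially. 0 \<le> N (\<phi> (F n) \<ominus> \<phi> (F' n))"
      using \<phi> F C_closed by (intro always_eventually) (auto simp: bounded_map_def)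
  qed
qed

lemma bounded_map_lift:
  assumes "bounded_map \<phi>" "F \<in> C"
  shows "completion_lift A N \<phi> (cls F) = cls (\<lambda>n. \<phi> (F n))"
  using lift_cls[where \<phi> = \<phi>, OF assms(2)] bounded_map_C[OF assms(1)] bounded_map_near[OF assms(1)] by blast

lemma smult_diff: "x \<in> carrier A \<Longrightarrow> y \<in> carrier A \<Longrightarrow> c \<odot> x \<ominus> c \<odot> y = c \<odot> (x \<ominus> y)"
  by (simp add: diff_eq_smult smult_r_distr smult_smult mult.commute)

lemma star_diff: "x \<in> carrier A \<Longrightarrow> y \<in> carrier A \<Longrightarrow> star A x \<ominus> star A y = star A (x \<ominus> y)"
  by (simp add: diff_eq_smult star_add star_smult)

lemma bounded_map_smult: "bounded_map (smult A c)"
  unfolding bounded_map_def by (auto simp: smult_diff norm_smult)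

lemma bounded_map_star: "bounded_map (star A)"
  unfolding bounded_map_def by (auto simp: star_diff intro!: exI[of _ 1])

lemma norm_add_diff:
  assumes "x \<in> carrier A" "x' \<in> carrier A" "y \<in> carrier A" "y' \<in> carrier A"
  shows "N ((x \<oplus> y) \<ominus> (x' \<oplus> y')) \<le> N (x \<ominus> x') + N (y \<ominus> y')"
proof -
  have "(x \<oplus> y) \<ominus> (x' \<oplus> y') = (x \<ominus> x') \<oplus> (y \<ominus> y')"
    using assms by (simp add: diff_eq_smult smult_r_distr a_ac)
  then show ?thesis using assms by (simp add: norm_add)
qed

text \<open>The difference is split at x' y, so the bound K is asked of y and x'; for Cauchy
  sequences it can be chosen uniformly in the index.\<close>

lemma norm_mult_diff:
  assumes "x \<in> carrier A" "x' \<in> carrier A" "y \<in> carrier A" "y' \<in> carrier A" "N y \<le> K" "N x' \<le> K"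
  shows "N (x \<otimes> y \<ominus> x' \<otimes> y') \<le> K * (N (x \<ominus> x') + N (y \<ominus> y'))"
proof -
  have "x \<otimes> y \<ominus> x' \<otimes> y' = ((x \<ominus> x') \<otimes> y) \<oplus> (x' \<otimes> (y \<ominus> y'))"
  proof -
    have *: "a \<oplus> (-1) \<odot> b \<oplus> (b \<oplus> d) = a \<oplus> d" if "a \<in> carrier A" "b \<in> carrier A" "d \<in> carrier A" for a b d
    proof -
      have "(-1) \<odot> b \<oplus> b = \<zero>" using that by (simp add: minus_eq_smult[symmetric] l_neg)
      then have "a \<oplus> ((-1) \<odot> b \<oplus> b) \<oplus> d = a \<oplus> d" using that by simp
      then show ?thesis using that by (simp add: a_assoc)
    qed
    show ?thesis
      using assms *[of "x \<otimes> y" "x' \<otimes> y" "(-1) \<odot> (x' \<otimes> y')"]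
      by (simp add: diff_eq_smult l_distr r_distr smult_mult_l smult_mult_r)
  qed
  then have "N (x \<otimes> y \<ominus> x' \<otimes> y') \<le> N (x \<ominus> x') * N y + N x' * N (y \<ominus> y')"
    using assms norm_add[of "(x \<ominus> x') \<otimes> y" "x' \<otimes> (y \<ominus> y')"]
      norm_mult[of "x \<ominus> x'" y] norm_mult[of x' "y \<ominus> y'"] by simp
  also have "\<dots> \<le> N (x \<ominus> x') * K + K * N (y \<ominus> y')"
    using assms by (intro add_mono mult_mono) (auto intro: order_trans[OF norm_nonneg])
  finally show ?thesis by (simp add: algebra_simps)
qed

lemma add_C: assumes F: "F \<in> C" "G \<in> C" shows "(\<lambda>n. F n \<oplus> G n) \<in> C"
proof (rule CI)
  fix e :: real assume e: "e > 0"
  obtain M where M: "\<And>m n. m \<ge> M \<Longrightarrow> n \<ge> M \<Longrightarrow> N (F m \<ominus> F n) < e / 2"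
    using CD[OF F(1), of "e/2"] e by auto
  obtain M' where M': "\<And>m n. m \<ge> M' \<Longrightarrow> n \<ge> M' \<Longrightarrow> N (G m \<ominus> G n) < e / 2"
    using CD[OF F(2), of "e/2"] e by auto
  have "N ((F m \<oplus> G m) \<ominus> (F n \<oplus> G n)) < e" if "m \<ge> max M M'" "n \<ge> max M M'" for m n
    using M[of m n] M'[of m n] that
      norm_add_diff[of "F m" "F n" "G m" "G n"] C_closed[OF F(1)] C_closed[OF F(2)] by simp
  then show "\<exists>M. \<forall>m\<ge>M. \<forall>n\<ge>M. N ((F m \<oplus> G m) \<ominus> (F n \<oplus> G n)) < e" by blast
qed (use C_closed F in auto)

lemma add_near:
  assumes "F \<in> C" "F' \<in> C" "G \<in> C" "G' \<in> C" "near F F'" "near G G'"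
  shows "near (\<lambda>n. F n \<oplus> G n) (\<lambda>n. F' n \<oplus> G' n)"
  unfolding near_def
proof (rule tendsto_sandwich[OF _ _ tendsto_const])
  show "(\<lambda>n. N (F n \<ominus> F' n) + N (G n \<ominus> G' n)) \<longlonglongrightarrow> 0"
    using tendsto_add[OF assms(5,6)[unfolded near_def]] by simp
qed (use assms C_closed norm_add_diff in \<open>auto intro!: always_eventually\<close>)

lemma mult_C: assumes F: "F \<in> C" "G \<in> C" shows "(\<lambda>n. F n \<otimes> G n) \<in> C"
proof (rule CI)
  fix e :: real assume e: "e > 0"
  obtain K1 where K1: "K1 > 0" "\<And>n. N (F n) \<le> K1" using C_norm_bounded[OF F(1)] by blast
  obtain K2 where K2: "K2 > 0" "\<And>n. N (G n) \<le> K2" using C_norm_bounded[OF F(2)] by blast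
  define K where "K = max K1 K2"
  have K: "K > 0" "\<And>n. N (F n) \<le> K" "\<And>n. N (G n) \<le> K"
    using K1 K2 by (simp_all add: K_def le_max_iff_disj less_max_iff_disj)
  have e': "e / (2 * K) > 0" using e K by simp
  obtain M where M: "\<And>m n. m \<ge> M \<Longrightarrow> n \<ge> M \<Longrightarrow> N (F m \<ominus> F n) < e / (2 * K)"
    using CD[OF F(1) e'] by auto
  obtain M' where M': "\<And>m n. m \<ge> M' \<Longrightarrow> n \<ge> M' \<Longrightarrow> N (G m \<ominus> G n) < e / (2 * K)"
    using CD[OF F(2) e'] by auto
  have "N (F m \<otimes> G m \<ominus> F n \<otimes> G n) < e" if "m \<ge> max M M'" "n \<ge> max M M'" for m n
  proof -
    have "N (F m \<ominus> F n) + N (G m \<ominus> G n) < e / K"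
      using M[of m n] M'[of m n] that by (simp add: field_simps)
    then have "K * (N (F m \<ominus> F n) + N (G m \<ominus> G n)) < e"
      using K(1) by (simp add: pos_less_divide_eq mult.commute)
    then show ?thesis
      using norm_mult_diff[of "F m" "F n" "G m" "G n" K] C_closed[OF F(1)] C_closed[OF F(2)] K by fastforce
  qed
  then show "\<exists>M. \<forall>m\<ge>M. \<forall>n\<ge>M. N (F m \<otimes> G m \<ominus> F n \<otimes> G n) < e" by blast
qed (use C_closed F in auto)

lemma mult_near:
  assumes "F \<in> C" "F' \<in> C" "G \<in> C" "G' \<in> C" "near F F'" "near G G'"
  shows "near (\<lambda>n. F n \<otimes> G n) (\<lambda>n. F' n \<otimes> G' n)"
proof -
  obtain K1 where K1: "K1 > 0" "\<And>n. N (F' n) \<le> K1" using C_norm_bounded[OF assms(2)] by blast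
  obtain K2 where K2: "K2 > 0" "\<And>n. N (G n) \<le> K2" using C_norm_bounded[OF assms(3)] by blast
  define K where "K = max K1 K2"
  have K: "\<And>n. N (F' n) \<le> K" "\<And>n. N (G n) \<le> K"
    using K1 K2 by (simp_all add: K_def le_max_iff_disj less_max_iff_disj)
  show ?thesis
    unfolding near_def
  proof (rule tendsto_sandwich[OF _ _ tendsto_const])
    show "(\<lambda>n. K * (N (F n \<ominus> F' n) + N (G n \<ominus> G' n))) \<longlonglongrightarrow> 0"
      using tendsto_mult_left[OF tendsto_add[OF assms(5,6)[unfolded near_def]], of K] by simp
  qed (use assms C_closed norm_mult_diff K in \<open>auto intro!: always_eventually\<close>)
qed

lemma B_simps:
  shows carrier_B: "carrier B = cls ` C" and one_B: "\<one>\<^bsub>B\<^esub> = cls (\<lambda>n. \<one>)"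
    and zero_B: "\<zero>\<^bsub>B\<^esub> = cls (\<lambda>n. \<zero>)"
  by (simp_all add: completion_def)

lemma cls_ops:
  assumes F: "F \<in> C"
  shows add_cls: "G \<in> C \<Longrightarrow> cls F \<oplus>\<^bsub>B\<^esub> cls G = cls (\<lambda>n. F n \<oplus> G n)"
    and mult_cls: "G \<in> C \<Longrightarrow> cls F \<otimes>\<^bsub>B\<^esub> cls G = cls (\<lambda>n. F n \<otimes> G n)"
    and smult_cls: "c \<odot>\<^bsub>B\<^esub> cls F = cls (\<lambda>n. c \<odot> F n)"
    and star_cls: "star B (cls F) = cls (\<lambda>n. star A (F n))"
proof -
  show "cls F \<oplus>\<^bsub>B\<^esub> cls G = cls (\<lambda>n. F n \<oplus> G n)" if "G \<in> C"
    using lift2_cls[where \<phi> = "add A", OF F that] add_C add_near by (simp add: completion_def)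
  show "cls F \<otimes>\<^bsub>B\<^esub> cls G = cls (\<lambda>n. F n \<otimes> G n)" if "G \<in> C"
    using lift2_cls[where \<phi> = "mult A", OF F that] mult_C mult_near by (simp add: completion_def)
  show "c \<odot>\<^bsub>B\<^esub> cls F = cls (\<lambda>n. c \<odot> F n)"
    using bounded_map_lift[OF bounded_map_smult F] by (simp add: completion_def)
  show "star B (cls F) = cls (\<lambda>n. star A (F n))"
    using bounded_map_lift[OF bounded_map_star F] by (simp add: completion_def)
qed

lemma smult_C: "F \<in> C \<Longrightarrow> (\<lambda>n. c \<odot> F n) \<in> C"
  by (rule bounded_map_C[OF bounded_map_smult])

lemma star_C: "F \<in> C \<Longrightarrow> (\<lambda>n. star A (F n)) \<in> C"
  by (rule bounded_map_C[OF bounded_map_star])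

lemmas C_intros = add_C mult_C smult_C star_C const_in_C[OF one_closed] const_in_C[OF zero_closed]

lemma carrier_BE:
  assumes "X \<in> carrier B"
  obtains F where "F \<in> C" "X = cls F" "\<And>n. F n \<in> carrier A"
proof -
  from assms obtain F where "F \<in> C" "X = cls F" by (auto simp: carrier_B)
  with C_closed[of F] show ?thesis by (intro that[of F])
qed

text \<open>Operations act termwise on representatives, so every axiom is the corresponding axiom of
  A at each index.\<close>

lemma star_alg_completion: "star_alg B"
proof -
  note simps = one_B zero_B cls_ops C_intros
  have in_B: "F \<in> C \<Longrightarrow> cls F \<in> carrier B" for F by (simp add: carrier_B)
  have "abelian_group B"
  proof (rule abelian_groupI)
    fix X assume "X \<in> carrier B"
    then obtain F where F: "F \<in> C" "X = cls F" "\<And>n. F n \<in> carrier A" by (rule carrier_BE) blast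
    have "cls (\<lambda>n. (-1) \<odot> F n) \<oplus>\<^bsub>B\<^esub> X = \<zero>\<^bsub>B\<^esub>"
    proof -
      have "(\<lambda>n. (-1) \<odot> F n \<oplus> F n) = (\<lambda>n. \<zero>)"
        using F(3) by (simp add: minus_eq_smult[symmetric] l_neg)
      then show ?thesis using F by (simp add: simps)
    qed
    then show "\<exists>Y\<in>carrier B. Y \<oplus>\<^bsub>B\<^esub> X = \<zero>\<^bsub>B\<^esub>"
      using F(1) by (intro bexI[of _ "cls (\<lambda>n. (-1) \<odot> F n)"] in_B smult_C)
  qed ((elim carrier_BE)?, simp add: simps in_B a_ac)+
  moreover have "Group.monoid B"
    by (rule Group.monoidI; (elim carrier_BE)?; simp add: simps in_B m_assoc)
  ultimately have "ring B"
    by (rule ringI; elim carrier_BE; simp add: simps in_B l_distr r_distr)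
  then show ?thesis
    by (rule star_alg.intro, unfold_locales; elim carrier_BE;
      simp add: simps in_B smult_l_distr smult_r_distr smult_smult smult_mult_l smult_mult_r
        star_add star_smult star_mult)
qed

text \<open>Both claims go through one induction: adding a class to a partial sum presupposes that
  the partial sum is Cauchy.\<close>

lemma finsum_C:
  assumes "finite I" "\<And>i. i \<in> I \<Longrightarrow> F i \<in> C"
  shows "(\<lambda>n. \<Oplus>i\<in>I. F i n) \<in> C \<and> (\<Oplus>\<^bsub>B\<^esub>i\<in>I. cls (F i)) = cls (\<lambda>n. \<Oplus>i\<in>I. F i n)"
proof -
  interpret B: star_alg B by (rule star_alg_completion)
  show ?thesis
    using assms
  proof (induction I)
    case empty
    then show ?case by (simp add: zero_B const_in_C)
  next
    case (insert i I)
    have "(\<Oplus>i\<in>insert i I. F i n) = F i n \<oplus> (\<Oplus>i\<in>I. F i n)" for n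
      using insert C_closed by (subst finsum_insert) auto
    moreover have "(\<Oplus>\<^bsub>B\<^esub>i\<in>insert i I. cls (F i)) = cls (F i) \<oplus>\<^bsub>B\<^esub> (\<Oplus>\<^bsub>B\<^esub>i\<in>I. cls (F i))"
      using insert by (subst B.finsum_insert) (auto simp: carrier_B)
    ultimately show ?case using insert by (simp add: add_C add_cls)
  qed
qed

lemma bounded_map_linear:
  assumes closed: "\<And>x. x \<in> carrier A \<Longrightarrow> \<phi> x \<in> carrier A"
    and add: "\<And>x y. x \<in> carrier A \<Longrightarrow> y \<in> carrier A \<Longrightarrow> \<phi> (x \<oplus> y) = \<phi> x \<oplus> \<phi> y"
    and smult: "\<And>c x. x \<in> carrier A \<Longrightarrow> \<phi> (c \<odot> x) = c \<odot> \<phi> x"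
    and bound: "\<And>x. x \<in> carrier A \<Longrightarrow> N (\<phi> x) \<le> K * N x"
  shows "bounded_map \<phi>"
proof -
  have "N (\<phi> x \<ominus> \<phi> y) \<le> K * N (x \<ominus> y)" if "x \<in> carrier A" "y \<in> carrier A" for x y
    using bound[of "x \<ominus> y"] that by (simp add: diff_eq_smult add smult closed)
  then show ?thesis unfolding bounded_map_def using closed by blast
qed

lemma bounded_map_comp:
  assumes "bounded_map \<phi>" "bounded_map \<psi>" shows "bounded_map (\<lambda>x. \<phi> (\<psi> x))"
proof -
  obtain K1 where K1: "\<forall>x\<in>carrier A. \<forall>y\<in>carrier A. N (\<phi> x \<ominus> \<phi> y) \<le> K1 * N (x \<ominus> y)"
    using assms by (auto simp: bounded_map_def)
  obtain K2 where K2: "\<forall>x\<in>carrier A. \<forall>y\<in>carrier A. N (\<psi> x \<ominus> \<psi> y) \<le> K2 * N (x \<ominus> y)"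
    using assms by (auto simp: bounded_map_def)
  have cl: "\<And>x. x \<in> carrier A \<Longrightarrow> \<phi> x \<in> carrier A" "\<And>x. x \<in> carrier A \<Longrightarrow> \<psi> x \<in> carrier A"
    using assms by (auto simp: bounded_map_def)
  have "N (\<phi> (\<psi> x) \<ominus> \<phi> (\<psi> y)) \<le> (\<bar>K1\<bar> * K2) * N (x \<ominus> y)"
    if "x \<in> carrier A" "y \<in> carrier A" for x y
  proof -
    have "N (\<phi> (\<psi> x) \<ominus> \<phi> (\<psi> y)) \<le> K1 * N (\<psi> x \<ominus> \<psi> y)" using K1 cl that by blast
    also have "\<dots> \<le> \<bar>K1\<bar> * N (\<psi> x \<ominus> \<psi> y)" using cl that by (intro mult_right_mono) auto
    also have "\<dots> \<le> \<bar>K1\<bar> * (K2 * N (x \<ominus> y))" using K2 that by (intro mult_left_mono) auto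
    finally show ?thesis by (simp add: mult.assoc)
  qed
  then show ?thesis unfolding bounded_map_def using cl by blast
qed

lemma bounded_map_add:
  assumes "bounded_map \<phi>" "bounded_map \<psi>" shows "bounded_map (\<lambda>x. \<phi> x \<oplus> \<psi> x)"
proof -
  obtain K1 where K1: "\<forall>x\<in>carrier A. \<forall>y\<in>carrier A. N (\<phi> x \<ominus> \<phi> y) \<le> K1 * N (x \<ominus> y)"
    using assms by (auto simp: bounded_map_def)
  obtain K2 where K2: "\<forall>x\<in>carrier A. \<forall>y\<in>carrier A. N (\<psi> x \<ominus> \<psi> y) \<le> K2 * N (x \<ominus> y)"
    using assms by (auto simp: bounded_map_def)
  have cl: "\<And>x. x \<in> carrier A \<Longrightarrow> \<phi> x \<in> carrier A" "\<And>x. x \<in> carrier A \<Longrightarrow> \<psi> x \<in> carrier A"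
    using assms by (auto simp: bounded_map_def)
  have "N ((\<phi> x \<oplus> \<psi> x) \<ominus> (\<phi> y \<oplus> \<psi> y)) \<le> (K1 + K2) * N (x \<ominus> y)"
    if "x \<in> carrier A" "y \<in> carrier A" for x y
  proof -
    have "N (\<phi> x \<ominus> \<phi> y) \<le> K1 * N (x \<ominus> y)" "N (\<psi> x \<ominus> \<psi> y) \<le> K2 * N (x \<ominus> y)"
      using K1 K2 that by blast+
    then show ?thesis
      using norm_add_diff[of "\<phi> x" "\<phi> y" "\<psi> x" "\<psi> y"] cl that by (simp add: distrib_right)
  qed
  then show ?thesis unfolding bounded_map_def using cl by blast
qed

lemma bounded_map_finsum:
  assumes "finite I" "\<And>i. i \<in> I \<Longrightarrow> bounded_map (\<phi> i)"
  shows "bounded_map (\<lambda>x. \<Oplus>i\<in>I. \<phi> i x)"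
  using assms
proof (induction I)
  case empty
  then show ?case by (auto simp: bounded_map_def a_minus_def r_neg intro!: exI[of _ 0])
next
  case (insert i I)
  have cl: "\<phi> j x \<in> carrier A" if "j \<in> insert i I" "x \<in> carrier A" for j x
    using insert.prems[OF that(1)] that(2) by (auto simp: bounded_map_def)
  have eq: "(\<Oplus>j\<in>insert i I. \<phi> j x) = \<phi> i x \<oplus> (\<Oplus>j\<in>I. \<phi> j x)" if "x \<in> carrier A" for x
    using insert cl that by (subst finsum_insert) auto
  have "bounded_map (\<lambda>x. \<phi> i x \<oplus> (\<Oplus>j\<in>I. \<phi> j x))"
    using insert by (intro bounded_map_add) auto
  then show ?case unfolding bounded_map_def by (simp add: eq)
qed

end

section \<open>Quasi-bases and the index\<close>

lemma (in abelian_monoid) finsum_Times: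
  assumes "finite I" "finite J" "\<And>i j. i \<in> I \<Longrightarrow> j \<in> J \<Longrightarrow> f (i, j) \<in> carrier G"
  shows "(\<Oplus>p\<in>I \<times> J. f p) = (\<Oplus>i\<in>I. \<Oplus>j\<in>J. f (i, j))"
  using assms
proof (induction I)
  case (insert i I)
  have "(\<Oplus>p\<in>insert i I \<times> J. f p) = (\<Oplus>p\<in>Pair i ` J \<union> I \<times> J. f p)"
    by (rule arg_cong[where f = "finsum G f"]) auto
  also have "\<dots> = (\<Oplus>p\<in>Pair i ` J. f p) \<oplus> (\<Oplus>p\<in>I \<times> J. f p)"
    using insert by (intro finsum_Un_disjoint) auto
  also have "(\<Oplus>p\<in>Pair i ` J. f p) = (\<Oplus>j\<in>J. f (i, j))"
    using insert by (intro finsum_reindex) (auto simp: inj_on_def)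
  finally show ?case using insert by (subst finsum_insert) (auto intro!: finsum_closed)
qed simp

text \<open>\<open>quasi_basis\<close>, \<open>cstar_index\<close> and \<open>positive_cone\<close>
  sum over the positions of a list, whereas the computations sum over a finite set. For an
  enumeration without repetition the two agree.\<close>

lemma (in abelian_monoid) finsum_nth:
  assumes "distinct xs" "\<And>x. x \<in> set xs \<Longrightarrow> f x \<in> carrier G"
  shows "(\<Oplus>i\<in>{..<length xs}. f (xs ! i)) = (\<Oplus>x\<in>set xs. f x)"
proof -
  have "set xs = (\<lambda>i. xs ! i) ` {..<length xs}" by (auto simp: set_conv_nth)
  moreover have "inj_on (\<lambda>i. xs ! i) {..<length xs}"
    using assms(1) by (auto simp: inj_on_def nth_eq_iff_index_eq)
  ultimately show ?thesis
    using finsum_reindex[of f "\<lambda>i. xs ! i" "{..<length xs}"] assms(2) by auto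
qed

lemma (in abelian_monoid) finsum_delta:
  assumes "finite I" "i \<in> I" "\<And>j. j \<in> I \<Longrightarrow> f j \<in> carrier G"
    and "\<And>j. j \<in> I \<Longrightarrow> j \<noteq> i \<Longrightarrow> f j = \<zero>"
  shows "(\<Oplus>j\<in>I. f j) = f i"
proof -
  have "(\<Oplus>j\<in>I. f j) = (\<Oplus>j\<in>I. if i = j then f j else \<zero>)"
    using assms by (intro finsum_cong') auto
  also have "\<dots> = f i" using assms by (intro finsum_singleton) auto
  finally show ?thesis .
qed

lemma (in abelian_monoid) finsum_swap:
  assumes "finite I" "finite J" "\<And>i j. i \<in> I \<Longrightarrow> j \<in> J \<Longrightarrow> f i j \<in> carrier G"
  shows "(\<Oplus>i\<in>I. \<Oplus>j\<in>J. f i j) = (\<Oplus>j\<in>J. \<Oplus>i\<in>I. f i j)"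
  using assms
proof (induction I)
  case (insert i I)
  then have "(\<Oplus>i\<in>insert i I. \<Oplus>j\<in>J. f i j) = (\<Oplus>j\<in>J. f i j) \<oplus> (\<Oplus>j\<in>J. \<Oplus>i\<in>I. f i j)"
    by (subst finsum_insert) (auto intro!: finsum_closed)
  also have "\<dots> = (\<Oplus>j\<in>J. f i j \<oplus> (\<Oplus>i\<in>I. f i j))"
    using insert by (intro finsum_addf[symmetric]) (auto intro!: finsum_closed)
  also have "\<dots> = (\<Oplus>j\<in>J. \<Oplus>i\<in>insert i I. f i j)"
    using insert by (intro finsum_cong' refl) (auto simp: Pi_iff)
  finally show ?case .
qed simp

section \<open>Positive cones and independence of the index from the quasi-basis\<close>

context star_alg
begin

lemma positive_cone_finsum:
  assumes "finite I" "\<And>i. i \<in> I \<Longrightarrow> y i \<in> carrier A"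
  shows "(\<Oplus>i\<in>I. star A (y i) \<otimes> y i) \<in> positive_cone A"
proof -
  obtain xs where xs: "set xs = I" "distinct xs" using assms(1) finite_distinct_list by blast
  have "(\<Oplus>i\<in>{..<length xs}. star A (y (xs ! i)) \<otimes> y (xs ! i)) = (\<Oplus>i\<in>I. star A (y i) \<otimes> y i)"
    using finsum_nth[OF xs(2), of "\<lambda>i. star A (y i) \<otimes> y i"] xs assms(2) by auto
  moreover have "(\<Oplus>i\<in>{..<length xs}. star A (y (xs ! i)) \<otimes> y (xs ! i)) =
      (\<Oplus>i\<in>{..<length (map y xs)}. star A (map y xs ! i) \<otimes> (map y xs ! i))"
    using xs assms(2) by (intro finsum_cong') auto
  moreover have "set (map y xs) \<subseteq> carrier A" using xs assms(2) by auto
  ultimately show ?thesis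
    unfolding positive_cone_def by (intro CollectI exI[of _ "map y xs"] conjI) simp
qed

lemma sum_squares_snoc:
  assumes "set ys \<subseteq> carrier A" "z \<in> carrier A"
  shows "(\<Oplus>i\<in>{..<length (ys @ [z])}. star A ((ys @ [z]) ! i) \<otimes> ((ys @ [z]) ! i)) =
    (\<Oplus>i\<in>{..<length ys}. star A (ys ! i) \<otimes> (ys ! i)) \<oplus> star A z \<otimes> z"
proof -
  have c: "ys ! i \<in> carrier A" if "i < length ys" for i using assms that nth_mem by blast
  have "{..<length (ys @ [z])} = insert (length ys) {..<length ys}" by auto
  then have "(\<Oplus>i\<in>{..<length (ys @ [z])}. star A ((ys @ [z]) ! i) \<otimes> ((ys @ [z]) ! i)) =
      star A z \<otimes> z \<oplus> (\<Oplus>i\<in>{..<length ys}. star A ((ys @ [z]) ! i) \<otimes> ((ys @ [z]) ! i))"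
    using assms c by (simp del: length_append, subst finsum_insert) (auto simp: nth_append)
  also have "(\<Oplus>i\<in>{..<length ys}. star A ((ys @ [z]) ! i) \<otimes> ((ys @ [z]) ! i)) =
      (\<Oplus>i\<in>{..<length ys}. star A (ys ! i) \<otimes> (ys ! i))"
    using c by (intro finsum_cong') (auto simp: nth_append)
  finally show ?thesis using assms c by (simp add: a_comm finsum_closed Pi_iff)
qed

lemma positive_cone_closed: "positive_cone A \<subseteq> carrier A"
  unfolding positive_cone_def by (auto intro!: finsum_closed dest: nth_mem)

text \<open>Lists of summands are built up at the end, which gives induction by adding one square at
  a time. Positivity of an additive map then has to be checked on single squares.\<close>

lemma positive_cone_induct [consumes 1, case_names zero step]:
  assumes "x \<in> positive_cone A" and "P \<zero>"
    and "\<And>x z. x \<in> positive_cone A \<Longrightarrow> P x \<Longrightarrow> z \<in> carrier A \<Longrightarrow> P (x \<oplus> star A z \<otimes> z)"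
  shows "P x"
proof -
  have "P (\<Oplus>i\<in>{..<length ys}. star A (ys ! i) \<otimes> (ys ! i))" if "set ys \<subseteq> carrier A" for ys
    using that
  proof (induction ys rule: rev_induct)
    case (snoc z ys)
    then show ?case
      using assms(3)[of "\<Oplus>i\<in>{..<length ys}. star A (ys ! i) \<otimes> (ys ! i)" z]
      by (subst sum_squares_snoc) (auto simp: positive_cone_def)
  qed (use assms(2) in simp)
  with assms(1) show ?thesis by (auto simp: positive_cone_def)
qed

lemma positive_cone_step:
  "x \<in> positive_cone A \<Longrightarrow> z \<in> carrier A \<Longrightarrow> x \<oplus> star A z \<otimes> z \<in> positive_cone A"
proof -
  assume "x \<in> positive_cone A" and z: "z \<in> carrier A"
  then obtain ys where ys: "set ys \<subseteq> carrier A" "x = (\<Oplus>i\<in>{..<length ys}. star A (ys ! i) \<otimes> (ys ! i))"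
    by (auto simp: positive_cone_def)
  have "set (ys @ [z]) \<subseteq> carrier A" using ys z by auto
  moreover have "x \<oplus> star A z \<otimes> z = (\<Oplus>i\<in>{..<length (ys @ [z])}. star A ((ys @ [z]) ! i) \<otimes> ((ys @ [z]) ! i))"
    using sum_squares_snoc[OF ys(1) z] ys(2) by simp
  ultimately show ?thesis
    unfolding positive_cone_def by (intro CollectI exI[of _ "ys @ [z]"] conjI)
qed

lemma positive_cone_zero: "\<zero> \<in> positive_cone A"
  using positive_cone_finsum[of "{}"] by simp

lemma positive_cone_add:
  assumes "x \<in> positive_cone A" "y \<in> positive_cone A" shows "x \<oplus> y \<in> positive_cone A"
  using assms(2)
proof (induction rule: positive_cone_induct)
  case zero
  then show ?case using assms(1) positive_cone_closed by (auto simp: subset_iff)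
next
  case (step y z)
  then have "x \<oplus> (y \<oplus> star A z \<otimes> z) = (x \<oplus> y) \<oplus> star A z \<otimes> z"
    using assms(1) positive_cone_closed by (simp add: a_assoc subset_iff)
  then show ?case using step positive_cone_step by simp
qed

lemma positive_cone_image:
  assumes add: "\<And>x y. x \<in> carrier A \<Longrightarrow> y \<in> carrier A \<Longrightarrow> \<Gamma> (x \<oplus> y) = \<Gamma> x \<oplus> \<Gamma> y"
    and map_zero: "\<Gamma> \<zero> = \<zero>"
    and sq: "\<And>y. y \<in> carrier A \<Longrightarrow> \<Gamma> (star A y \<otimes> y) \<in> positive_cone A"
    and x: "x \<in> positive_cone A"
  shows "\<Gamma> x \<in> positive_cone A"
  using x
proof (induction rule: positive_cone_induct)
  case zero
  then show ?case by (simp add: map_zero positive_cone_zero)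
next
  case (step x z)
  then show ?case using positive_cone_closed by (subst add) (auto intro!: positive_cone_add sq)
qed

text \<open>Watatani's argument: each u_i is expanded in the family vs, the two sums are
  interchanged, and the inner sum over i is the second quasi-basis identity of us at the star of
  v_j.\<close>

lemma quasi_basis_index_unique:
  assumes \<Gamma>: "\<And>x. x \<in> carrier A \<Longrightarrow> \<Gamma> x \<in> carrier A"
    and us: "quasi_basis A \<Gamma> us" and vs: "quasi_basis A \<Gamma> vs"
  shows "(\<Oplus>i\<in>{..<length us}. (us ! i) \<otimes> star A (us ! i)) = (\<Oplus>i\<in>{..<length vs}. (vs ! i) \<otimes> star A (vs ! i))"
proof -
  let ?I = "{..<length us}" and ?J = "{..<length vs}"
  have [simp]: "i < length us \<Longrightarrow> us ! i \<in> carrier A" "j < length vs \<Longrightarrow> vs ! j \<in> carrier A" for i j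
    using us vs by (auto simp: quasi_basis_def dest: nth_mem)
  note [simp] = \<Gamma>
  have v: "(\<Oplus>j\<in>?J. (vs ! j) \<otimes> \<Gamma> (star A (vs ! j) \<otimes> a)) = a" if "a \<in> carrier A" for a
    using vs that by (simp add: quasi_basis_def)
  have u: "(\<Oplus>i\<in>?I. \<Gamma> (a \<otimes> (us ! i)) \<otimes> star A (us ! i)) = a" if "a \<in> carrier A" for a
    using us that by (simp add: quasi_basis_def)
  have "(\<Oplus>i\<in>?I. (us ! i) \<otimes> star A (us ! i)) =
      (\<Oplus>i\<in>?I. (\<Oplus>j\<in>?J. (vs ! j) \<otimes> \<Gamma> (star A (vs ! j) \<otimes> (us ! i))) \<otimes> star A (us ! i))"
    by (intro finsum_cong' refl) (auto simp: v)
  also have "\<dots> = (\<Oplus>i\<in>?I. \<Oplus>j\<in>?J. (vs ! j) \<otimes> \<Gamma> (star A (vs ! j) \<otimes> (us ! i)) \<otimes> star A (us ! i))"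
    by (intro finsum_cong' refl) (auto intro!: finsum_closed finsum_ldistr)
  also have "\<dots> = (\<Oplus>j\<in>?J. \<Oplus>i\<in>?I. (vs ! j) \<otimes> \<Gamma> (star A (vs ! j) \<otimes> (us ! i)) \<otimes> star A (us ! i))"
    by (intro finsum_swap) auto
  also have "\<dots> = (\<Oplus>j\<in>?J. (vs ! j) \<otimes> (\<Oplus>i\<in>?I. \<Gamma> (star A (vs ! j) \<otimes> (us ! i)) \<otimes> star A (us ! i)))"
  proof (intro finsum_cong' refl)
    fix j assume j: "j \<in> ?J"
    have "(\<Oplus>i\<in>?I. (vs ! j) \<otimes> \<Gamma> (star A (vs ! j) \<otimes> (us ! i)) \<otimes> star A (us ! i)) =
        (\<Oplus>i\<in>?I. (vs ! j) \<otimes> (\<Gamma> (star A (vs ! j) \<otimes> (us ! i)) \<otimes> star A (us ! i)))"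
      using j by (intro finsum_cong' refl) (auto simp: m_assoc)
    also have "\<dots> = (vs ! j) \<otimes> (\<Oplus>i\<in>?I. \<Gamma> (star A (vs ! j) \<otimes> (us ! i)) \<otimes> star A (us ! i))"
      using j by (intro finsum_rdistr[symmetric]) auto
    finally show "(\<Oplus>i\<in>?I. (vs ! j) \<otimes> \<Gamma> (star A (vs ! j) \<otimes> (us ! i)) \<otimes> star A (us ! i)) =
        (vs ! j) \<otimes> (\<Oplus>i\<in>?I. \<Gamma> (star A (vs ! j) \<otimes> (us ! i)) \<otimes> star A (us ! i))" .
  qed (auto intro!: finsum_closed)
  also have "\<dots> = (\<Oplus>j\<in>?J. (vs ! j) \<otimes> star A (vs ! j))"
    by (intro finsum_cong' refl) (auto simp: u)
  finally show ?thesis .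
qed

end

text \<open>\<open>\<beta> h g\<close> stands for the action of the basis element (h, g),
  \<open>d\<close> and \<open>r\<close> for the generators at one site and one bond,
  \<open>\<Gamma>\<close> for z_H. The assumptions are the rules of a module algebra over D(H;G)
  written out for basis elements: the sum over t comes from the coproduct, and \<open>inv h\<close>
  in the star rule from the antipode of the star of (h, g), which is (h^{-1}, g).\<close>

locale crossed_action = cstar_normed A N for A :: "('b, 'm) star_algebra_scheme" (structure) and N +
  fixes G :: "('g, 'k) monoid_scheme" and H :: "'g set"
    and \<beta> :: "'g \<Rightarrow> 'g \<Rightarrow> 'b \<Rightarrow> 'b" and d r :: "'g \<Rightarrow> 'b" and \<Gamma> :: "'b \<Rightarrow> 'b"
  assumes group_G: "group G" and finite_G: "finite (carrier G)" and normal_H: "H \<lhd> G"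
    and \<beta>_bounded: "h \<in> H \<Longrightarrow> g \<in> carrier G \<Longrightarrow> bounded_map (\<beta> h g)"
    and \<beta>_add: "h \<in> H \<Longrightarrow> g \<in> carrier G \<Longrightarrow> x \<in> carrier A \<Longrightarrow> y \<in> carrier A \<Longrightarrow>
      \<beta> h g (x \<oplus> y) = \<beta> h g x \<oplus> \<beta> h g y"
    and \<beta>_smult: "h \<in> H \<Longrightarrow> g \<in> carrier G \<Longrightarrow> x \<in> carrier A \<Longrightarrow> \<beta> h g (c \<odot> x) = c \<odot> \<beta> h g x"
    and \<beta>_one: "h \<in> H \<Longrightarrow> g \<in> carrier G \<Longrightarrow> \<beta> h g \<one> = (if h = \<one>\<^bsub>G\<^esub> then \<one> else \<zero>)"
    and \<beta>_mult: "h \<in> H \<Longrightarrow> g \<in> carrier G \<Longrightarrow> x \<in> carrier A \<Longrightarrow> y \<in> carrier A \<Longrightarrow>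
      \<beta> h g (x \<otimes> y) = (\<Oplus>t\<in>H. \<beta> t g x \<otimes> \<beta> (inv\<^bsub>G\<^esub> t \<otimes>\<^bsub>G\<^esub> h) g y)"
    and \<beta>_star: "h \<in> H \<Longrightarrow> g \<in> carrier G \<Longrightarrow> x \<in> carrier A \<Longrightarrow>
      \<beta> h g (star A x) = star A (\<beta> (inv\<^bsub>G\<^esub> h) g x)"
    and \<beta>_\<beta>: "h \<in> H \<Longrightarrow> g \<in> carrier G \<Longrightarrow> h' \<in> H \<Longrightarrow> g' \<in> carrier G \<Longrightarrow> x \<in> carrier A \<Longrightarrow>
      \<beta> h g (\<beta> h' g' x) = (if h \<otimes>\<^bsub>G\<^esub> g = g \<otimes>\<^bsub>G\<^esub> h' then \<beta> h (g \<otimes>\<^bsub>G\<^esub> g') x else \<zero>)"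
    and \<beta>_sum: "x \<in> carrier A \<Longrightarrow> (\<Oplus>h\<in>H. \<beta> h \<one>\<^bsub>G\<^esub> x) = x"
    and d_closed: "g \<in> carrier G \<Longrightarrow> d g \<in> carrier A" and r_closed: "h \<in> H \<Longrightarrow> r h \<in> carrier A"
    and \<beta>_d: "h \<in> H \<Longrightarrow> g \<in> carrier G \<Longrightarrow> k \<in> carrier G \<Longrightarrow>
      \<beta> h g (d k) = (if h = \<one>\<^bsub>G\<^esub> then d (g \<otimes>\<^bsub>G\<^esub> k) else \<zero>)"
    and \<beta>_r: "h \<in> H \<Longrightarrow> g \<in> carrier G \<Longrightarrow> t \<in> H \<Longrightarrow>
      \<beta> h g (r t) = (if h = g \<otimes>\<^bsub>G\<^esub> t \<otimes>\<^bsub>G\<^esub> inv\<^bsub>G\<^esub> g then r h else \<zero>)"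
    and d_d: "k \<in> carrier G \<Longrightarrow> k' \<in> carrier G \<Longrightarrow> d k \<otimes> d k' = (if k = k' then d k else \<zero>)"
    and d_sum: "(\<Oplus>k\<in>carrier G. d k) = \<one>"
    and r_r: "h \<in> H \<Longrightarrow> h' \<in> H \<Longrightarrow> r h \<otimes> r h' = r (h \<otimes>\<^bsub>G\<^esub> h')"
    and r_one: "r \<one>\<^bsub>G\<^esub> = \<one>"
    and r_d: "h \<in> H \<Longrightarrow> k \<in> carrier G \<Longrightarrow> r h \<otimes> d k = d k \<otimes> r h"
    and star_d: "k \<in> carrier G \<Longrightarrow> star A (d k) = d k"
    and star_r: "h \<in> H \<Longrightarrow> star A (r h) = r (inv\<^bsub>G\<^esub> h)"
    and \<Gamma>_eq: "x \<in> carrier A \<Longrightarrow> \<Gamma> x = (1 / of_nat (order G)) \<odot> (\<Oplus>g\<in>carrier G. \<beta> \<one>\<^bsub>G\<^esub> g x)"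
begin

section \<open>Homogeneous components and the averaging map\<close>

interpretation Gr: group G by (rule group_G)
interpretation HN: normal H G by (rule normal_H)

lemma finite_H: "finite H"
  using finite_G HN.subset finite_subset by blast

lemma H_mem [simp, intro]:
  "h \<in> H \<Longrightarrow> h \<in> carrier G" "\<one>\<^bsub>G\<^esub> \<in> H"
  "h \<in> H \<Longrightarrow> inv\<^bsub>G\<^esub> h \<in> H" "h \<in> H \<Longrightarrow> t \<in> H \<Longrightarrow> h \<otimes>\<^bsub>G\<^esub> t \<in> H"
  "h \<in> H \<Longrightarrow> g \<in> carrier G \<Longrightarrow> g \<otimes>\<^bsub>G\<^esub> h \<otimes>\<^bsub>G\<^esub> inv\<^bsub>G\<^esub> g \<in> H"
  using HN.inv_op_closed2 HN.subset by auto

lemma \<beta>_closed [simp, intro]: "h \<in> H \<Longrightarrow> g \<in> carrier G \<Longrightarrow> x \<in> carrier A \<Longrightarrow> \<beta> h g x \<in> carrier A"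
  using \<beta>_bounded by (auto simp: bounded_map_def)

lemmas [simp, intro] = d_closed r_closed

text \<open>Used when one factor has a single nonzero component: the coproduct sum then has a single
  term, the one at s.\<close>

lemma \<beta>_mult_delta:
  assumes "h \<in> H" "g \<in> carrier G" "x \<in> carrier A" "y \<in> carrier A" "s \<in> H"
    and "\<And>t. t \<in> H \<Longrightarrow> t \<noteq> s \<Longrightarrow> \<beta> t g x = \<zero> \<or> \<beta> (inv\<^bsub>G\<^esub> t \<otimes>\<^bsub>G\<^esub> h) g y = \<zero>"
  shows "\<beta> h g (x \<otimes> y) = \<beta> s g x \<otimes> \<beta> (inv\<^bsub>G\<^esub> s \<otimes>\<^bsub>G\<^esub> h) g y"
  unfolding \<beta>_mult[OF assms(1-4)]
proof (rule finsum_delta)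
  fix t assume t: "t \<in> H" "t \<noteq> s"
  have "\<beta> t g x \<in> carrier A" "\<beta> (inv\<^bsub>G\<^esub> t \<otimes>\<^bsub>G\<^esub> h) g y \<in> carrier A"
    using t assms by auto
  with assms(6)[OF t] show "\<beta> t g x \<otimes> \<beta> (inv\<^bsub>G\<^esub> t \<otimes>\<^bsub>G\<^esub> h) g y = \<zero>"
    by auto
qed (use assms finite_H in auto)

lemma \<beta>_d_mult:
  assumes "h \<in> H" "g \<in> carrier G" "k \<in> carrier G" "x \<in> carrier A"
  shows "\<beta> h g (d k \<otimes> x) = d (g \<otimes>\<^bsub>G\<^esub> k) \<otimes> \<beta> h g x"
  using \<beta>_mult_delta[of h g "d k" x "\<one>\<^bsub>G\<^esub>"] assms by (simp add: \<beta>_d)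

lemma \<beta>_mult_d:
  assumes "h \<in> H" "g \<in> carrier G" "k \<in> carrier G" "x \<in> carrier A"
  shows "\<beta> h g (x \<otimes> d k) = \<beta> h g x \<otimes> d (g \<otimes>\<^bsub>G\<^esub> k)"
proof -
  have "inv\<^bsub>G\<^esub> t \<otimes>\<^bsub>G\<^esub> h \<noteq> \<one>\<^bsub>G\<^esub>" if "t \<in> H" "t \<noteq> h" for t
    using that assms by (metis Gr.inv_equality Gr.inv_inv H_mem(1,3))
  then show ?thesis
    using \<beta>_mult_delta[of h g x "d k" h] assms by (simp add: \<beta>_d)
qed

text \<open>Translation by g conjugates the degree t of \<open>r t\<close> to t'; the remaining
  degree t'^{-1} h has to be carried by x.\<close>

lemma \<beta>_r_mult:
  assumes "h \<in> H" "g \<in> carrier G" "t \<in> H" "x \<in> carrier A"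
  defines "t' \<equiv> g \<otimes>\<^bsub>G\<^esub> t \<otimes>\<^bsub>G\<^esub> inv\<^bsub>G\<^esub> g"
  shows "\<beta> h g (r t \<otimes> x) = r t' \<otimes> \<beta> (inv\<^bsub>G\<^esub> t' \<otimes>\<^bsub>G\<^esub> h) g x"
  using \<beta>_mult_delta[of h g "r t" x t'] assms by (simp add: \<beta>_r)

lemma \<beta>_mult_r:
  assumes "h \<in> H" "g \<in> carrier G" "t \<in> H" "x \<in> carrier A"
  defines "t' \<equiv> g \<otimes>\<^bsub>G\<^esub> t \<otimes>\<^bsub>G\<^esub> inv\<^bsub>G\<^esub> g"
  shows "\<beta> h g (x \<otimes> r t) = \<beta> (h \<otimes>\<^bsub>G\<^esub> inv\<^bsub>G\<^esub> t') g x \<otimes> r t'"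
proof -
  have t': "t' \<in> H" using assms by simp
  have 1: "inv\<^bsub>G\<^esub> s \<otimes>\<^bsub>G\<^esub> h \<noteq> t'" if "s \<in> H" "s \<noteq> h \<otimes>\<^bsub>G\<^esub> inv\<^bsub>G\<^esub> t'" for s
    using that assms(1) t' by (metis Gr.inv_solve_left' Gr.inv_solve_right H_mem(1) Gr.inv_solve_left)
  have 2: "inv\<^bsub>G\<^esub> (h \<otimes>\<^bsub>G\<^esub> inv\<^bsub>G\<^esub> t') \<otimes>\<^bsub>G\<^esub> h = t'"
    using assms(1) t' by (simp add: Gr.inv_mult_group Gr.m_assoc)
  show ?thesis
    using \<beta>_mult_delta[of h g x "r t" "h \<otimes>\<^bsub>G\<^esub> inv\<^bsub>G\<^esub> t'"] assms(1-4) t' 1 2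
    by (simp add: \<beta>_r t'_def[symmetric])
qed

lemma order_pos: "order G > 0"
  by (simp add: Gr.order_gt_0_iff_finite finite_G)

lemma bounded_map_\<Gamma>: "bounded_map \<Gamma>"
proof -
  have *: "bounded_map (\<lambda>x. \<Oplus>g\<in>carrier G. \<beta> \<one>\<^bsub>G\<^esub> g x)"
    by (rule bounded_map_finsum) (auto simp: finite_G \<beta>_bounded)
  show ?thesis
    using bounded_map_comp[OF bounded_map_smult *, of "1 / of_nat (order G)"]
    unfolding bounded_map_def by (simp add: \<Gamma>_eq)
qed

lemma \<Gamma>_closed [simp, intro]: "x \<in> carrier A \<Longrightarrow> \<Gamma> x \<in> carrier A"
  using bounded_map_\<Gamma> by (auto simp: bounded_map_def)

text \<open>Clears the averaging factor, so that products with \<Gamma> can be computed as plain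
  sums over G; \<open>order_smult_cancel\<close> restores it at the end.\<close>

lemma order_smult_\<Gamma>:
  assumes "x \<in> carrier A"
  shows "of_nat (order G) \<odot> \<Gamma> x = (\<Oplus>g\<in>carrier G. \<beta> \<one>\<^bsub>G\<^esub> g x)"
  using assms order_pos unfolding \<Gamma>_eq[OF assms]
  by (subst smult_smult) (auto intro!: finsum_closed)

lemma order_smult_cancel:
  assumes "x \<in> carrier A" "y \<in> carrier A" "of_nat (order G) \<odot> x = of_nat (order G) \<odot> y"
  shows "x = y"
proof -
  have "(1 / of_nat (order G)) \<odot> (of_nat (order G) \<odot> z) = z" if "z \<in> carrier A" for z
    using that order_pos by (subst smult_smult) auto
  from this[OF assms(1)] this[OF assms(2)] assms(3) show ?thesis by metis
qed

lemma \<Gamma>_add: "x \<in> carrier A \<Longrightarrow> y \<in> carrier A \<Longrightarrow> \<Gamma> (x \<oplus> y) = \<Gamma> x \<oplus> \<Gamma> y"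
proof -
  assume xy: "x \<in> carrier A" "y \<in> carrier A"
  have "(\<Oplus>g\<in>carrier G. \<beta> \<one>\<^bsub>G\<^esub> g (x \<oplus> y)) =
    (\<Oplus>g\<in>carrier G. \<beta> \<one>\<^bsub>G\<^esub> g x \<oplus> \<beta> \<one>\<^bsub>G\<^esub> g y)"
    using xy by (intro finsum_cong') (auto simp: \<beta>_add)
  also have "\<dots> = (\<Oplus>g\<in>carrier G. \<beta> \<one>\<^bsub>G\<^esub> g x) \<oplus> (\<Oplus>g\<in>carrier G. \<beta> \<one>\<^bsub>G\<^esub> g y)"
    using xy by (intro finsum_addf) auto
  finally show ?thesis using xy by (simp add: \<Gamma>_eq smult_r_distr finsum_closed Pi_iff)
qed

lemma \<Gamma>_smult: "x \<in> carrier A \<Longrightarrow> \<Gamma> (c \<odot> x) = c \<odot> \<Gamma> x"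
proof -
  assume x: "x \<in> carrier A"
  have "(\<Oplus>g\<in>carrier G. \<beta> \<one>\<^bsub>G\<^esub> g (c \<odot> x)) = (\<Oplus>g\<in>carrier G. c \<odot> \<beta> \<one>\<^bsub>G\<^esub> g x)"
    using x by (intro finsum_cong') (auto simp: \<beta>_smult)
  also have "\<dots> = c \<odot> (\<Oplus>g\<in>carrier G. \<beta> \<one>\<^bsub>G\<^esub> g x)"
    using x by (intro finsum_smult[symmetric]) auto
  finally show ?thesis using x by (simp add: \<Gamma>_eq smult_smult finsum_closed Pi_iff mult.commute)
qed

lemma finsum_const_smult: "finite I \<Longrightarrow> x \<in> carrier A \<Longrightarrow> (\<Oplus>i\<in>I. x) = of_nat (card I) \<odot> x"
  by (induction I rule: finite_induct) (auto simp: smult_l_distr a_comm)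

lemma \<Gamma>_fixed:
  assumes "x \<in> carrier A" "\<And>g. g \<in> carrier G \<Longrightarrow> \<beta> \<one>\<^bsub>G\<^esub> g x = x"
  shows "\<Gamma> x = x"
proof -
  have "(\<Oplus>g\<in>carrier G. \<beta> \<one>\<^bsub>G\<^esub> g x) = (\<Oplus>g\<in>carrier G. x)"
    using assms by (intro finsum_cong') auto
  then have "of_nat (order G) \<odot> \<Gamma> x = of_nat (order G) \<odot> x"
    using assms(1) by (simp add: order_smult_\<Gamma> finsum_const_smult finite_G flip: order_def)
  then show ?thesis using assms(1) order_smult_cancel by simp
qed

lemma \<Gamma>_one: "\<Gamma> \<one> = \<one>"
  by (rule \<Gamma>_fixed) (auto simp: \<beta>_one)

lemma \<beta>_finsum:
  assumes "h \<in> H" "g \<in> carrier G" "\<And>i. i \<in> I \<Longrightarrow> f i \<in> carrier A"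
  shows "\<beta> h g (\<Oplus>i\<in>I. f i) = (\<Oplus>i\<in>I. \<beta> h g (f i))"
proof -
  have z: "\<beta> h g \<zero> = \<zero>" using \<beta>_smult[OF assms(1,2), of \<zero> 0] assms by simp
  show ?thesis using assms(3)
  proof (induction I rule: infinite_finite_induct)
    case (insert i I)
    then show ?case using assms(1,2) by (subst (1 2) finsum_insert) (auto simp: \<beta>_add finsum_closed)
  qed (use z in auto)
qed

text \<open>z_H is an integral of D(H;G): (h, g) z_H equals the counit of (h, g) times z_H. The
  condition h g = g excludes every h \<noteq> 1, and for h = 1 left translation by g permutes the
  summands.\<close>

lemma \<beta>_\<Gamma>:
  assumes "h \<in> H" "g \<in> carrier G" "x \<in> carrier A"
  shows "\<beta> h g (\<Gamma> x) = (if h = \<one>\<^bsub>G\<^esub> then \<Gamma> x else \<zero>)"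
proof -
  have "h \<otimes>\<^bsub>G\<^esub> g = g \<longleftrightarrow> h = \<one>\<^bsub>G\<^esub>" using assms by simp
  then have "\<beta> h g (\<beta> \<one>\<^bsub>G\<^esub> k x) = (if h = \<one>\<^bsub>G\<^esub> then \<beta> \<one>\<^bsub>G\<^esub> (g \<otimes>\<^bsub>G\<^esub> k) x else \<zero>)"
    if "k \<in> carrier G" for k using that assms by (simp add: \<beta>_\<beta>)
  then have "(\<Oplus>k\<in>carrier G. \<beta> h g (\<beta> \<one>\<^bsub>G\<^esub> k x)) =
      (\<Oplus>k\<in>carrier G. if h = \<one>\<^bsub>G\<^esub> then \<beta> \<one>\<^bsub>G\<^esub> (g \<otimes>\<^bsub>G\<^esub> k) x else \<zero>)"
    using assms by (intro finsum_cong') auto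
  also have "\<dots> = (if h = \<one>\<^bsub>G\<^esub> then (\<Oplus>k\<in>carrier G. \<beta> \<one>\<^bsub>G\<^esub> k x) else \<zero>)"
  proof (cases "h = \<one>\<^bsub>G\<^esub>")
    case True
    have "(\<lambda>k. g \<otimes>\<^bsub>G\<^esub> k) ` carrier G = carrier G"
      using assms Gr.surj_const_mult by simp
    moreover have "inj_on (\<lambda>k. g \<otimes>\<^bsub>G\<^esub> k) (carrier G)"
      using assms Gr.inj_on_cmult by simp
    ultimately show ?thesis
      using True finsum_reindex[of "\<lambda>k. \<beta> \<one>\<^bsub>G\<^esub> k x" "\<lambda>k. g \<otimes>\<^bsub>G\<^esub> k" "carrier G"] assms by auto
  qed simp
  finally show ?thesis
    using assms by (simp add: \<Gamma>_eq \<beta>_smult \<beta>_finsum finsum_closed Pi_iff)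
qed

lemma \<Gamma>_\<Gamma>: "x \<in> carrier A \<Longrightarrow> \<Gamma> (\<Gamma> x) = \<Gamma> x"
  by (rule \<Gamma>_fixed) (auto simp: \<beta>_\<Gamma>)

text \<open>An averaged element has only the component of degree 1 and is fixed by translations, so
  it leaves the coproduct sum as a constant factor.\<close>

lemma \<Gamma>_mult_l:
  assumes x: "x \<in> carrier A" "y \<in> carrier A" shows "\<Gamma> (\<Gamma> x \<otimes> y) = \<Gamma> x \<otimes> \<Gamma> y"
proof (rule order_smult_cancel)
  have 1: "\<beta> \<one>\<^bsub>G\<^esub> g (\<Gamma> x \<otimes> y) = \<Gamma> x \<otimes> \<beta> \<one>\<^bsub>G\<^esub> g y" if "g \<in> carrier G" for g
    using \<beta>_mult_delta[of "\<one>\<^bsub>G\<^esub>" g "\<Gamma> x" y "\<one>\<^bsub>G\<^esub>"] that x by (simp add: \<beta>_\<Gamma>)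
  have "(\<Oplus>g\<in>carrier G. \<beta> \<one>\<^bsub>G\<^esub> g (\<Gamma> x \<otimes> y)) = (\<Oplus>g\<in>carrier G. \<Gamma> x \<otimes> \<beta> \<one>\<^bsub>G\<^esub> g y)"
    using x 1 by (intro finsum_cong') auto
  also have "\<dots> = \<Gamma> x \<otimes> (\<Oplus>g\<in>carrier G. \<beta> \<one>\<^bsub>G\<^esub> g y)"
    using x finite_G by (intro finsum_rdistr[symmetric]) auto
  finally show "of_nat (order G) \<odot> \<Gamma> (\<Gamma> x \<otimes> y) = of_nat (order G) \<odot> (\<Gamma> x \<otimes> \<Gamma> y)"
    using x by (simp add: order_smult_\<Gamma> smult_mult_r[symmetric])
qed (use x in auto)

lemma \<Gamma>_mult_r:
  assumes x: "x \<in> carrier A" "y \<in> carrier A" shows "\<Gamma> (y \<otimes> \<Gamma> x) = \<Gamma> y \<otimes> \<Gamma> x"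
proof (rule order_smult_cancel)
  have 1: "\<beta> \<one>\<^bsub>G\<^esub> g (y \<otimes> \<Gamma> x) = \<beta> \<one>\<^bsub>G\<^esub> g y \<otimes> \<Gamma> x" if "g \<in> carrier G" for g
    using \<beta>_mult_delta[of "\<one>\<^bsub>G\<^esub>" g y "\<Gamma> x" "\<one>\<^bsub>G\<^esub>"] that x by (simp add: \<beta>_\<Gamma>)
  have "(\<Oplus>g\<in>carrier G. \<beta> \<one>\<^bsub>G\<^esub> g (y \<otimes> \<Gamma> x)) = (\<Oplus>g\<in>carrier G. \<beta> \<one>\<^bsub>G\<^esub> g y \<otimes> \<Gamma> x)"
    using x 1 by (intro finsum_cong') auto
  also have "\<dots> = (\<Oplus>g\<in>carrier G. \<beta> \<one>\<^bsub>G\<^esub> g y) \<otimes> \<Gamma> x"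
    using x finite_G by (intro finsum_ldistr[symmetric]) auto
  finally show "of_nat (order G) \<odot> \<Gamma> (y \<otimes> \<Gamma> x) = of_nat (order G) \<odot> (\<Gamma> y \<otimes> \<Gamma> x)"
    using x by (simp add: order_smult_\<Gamma> smult_mult_l[symmetric])
qed (use x in auto)

text \<open>A square root of the averaging factor 1/|G|. It is moved inside the squares, so that
  each summand of \<Gamma> applied to a square is itself a square.\<close>

definition s where "s = complex_of_real (1 / sqrt (real (order G)))"

lemma s_square: "cnj s * s = 1 / of_nat (order G)"
proof -
  have "1 / sqrt (real (order G)) * (1 / sqrt (real (order G))) = 1 / real (order G)" by simp
  then have "cnj s * s = complex_of_real (1 / real (order G))"
    by (simp only: s_def complex_cnj_complex_of_real of_real_mult[symmetric])
  then show ?thesis by simp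
qed

lemma inj_inv_H: "inj_on (\<lambda>t. inv\<^bsub>G\<^esub> t) H"
  by (rule inj_onI) (metis Gr.inv_inv H_mem(1))

lemma inv_image_H: "(\<lambda>t. inv\<^bsub>G\<^esub> t) ` H = H"
  by (force simp: image_iff intro!: bexI[of _ "inv\<^bsub>G\<^esub> _"])

text \<open>Positivity: the Hopf module rule splits
  \<open>\<Gamma> (y\<^sup>* y)\<close> into the squares of the homogeneous components of the translates of \<open>y\<close>.\<close>

lemma \<Gamma>_star_mult:
  assumes y: "y \<in> carrier A"
  shows "\<Gamma> (star A y \<otimes> y) =
    (\<Oplus>p\<in>carrier G \<times> H. star A (s \<odot> \<beta> (snd p) (fst p) y) \<otimes> (s \<odot> \<beta> (snd p) (fst p) y))"
proof -
  have 1: "\<beta> \<one>\<^bsub>G\<^esub> g (star A y \<otimes> y) = (\<Oplus>t\<in>H. star A (\<beta> t g y) \<otimes> \<beta> t g y)" if g: "g \<in> carrier G" for g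
  proof -
    \<comment> \<open>The first factor has degree t and, by \<open>\<beta>_star\<close>, is the star
      of the component t^{-1} of y; the second factor is this component itself.\<close>
    have "\<beta> \<one>\<^bsub>G\<^esub> g (star A y \<otimes> y) = (\<Oplus>t\<in>H. star A (\<beta> (inv\<^bsub>G\<^esub> t) g y) \<otimes> \<beta> (inv\<^bsub>G\<^esub> t) g y)"
      using g y by (subst \<beta>_mult) (auto intro!: finsum_cong' simp: \<beta>_star)
    also have "\<dots> = (\<Oplus>t\<in>(\<lambda>t. inv\<^bsub>G\<^esub> t) ` H. star A (\<beta> t g y) \<otimes> \<beta> t g y)"
      using g y inj_inv_H inv_image_H by (subst finsum_reindex) auto
    finally show ?thesis by (simp add: inv_image_H)
  qed
  have "\<Gamma> (star A y \<otimes> y) = (1 / of_nat (order G)) \<odot>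
      (\<Oplus>g\<in>carrier G. \<Oplus>t\<in>H. star A (\<beta> t g y) \<otimes> \<beta> t g y)"
    using 1 y by (subst \<Gamma>_eq, simp, intro arg_cong[where f = "smult A _"] finsum_cong') (auto intro!: finsum_closed)
  also have "\<dots> = (\<Oplus>g\<in>carrier G. \<Oplus>t\<in>H. (1 / of_nat (order G)) \<odot> (star A (\<beta> t g y) \<otimes> \<beta> t g y))"
    using y by (subst finsum_smult, force intro!: finsum_closed, intro finsum_cong' refl)
      (auto intro!: finsum_closed simp: finsum_smult)
  also have "\<dots> = (\<Oplus>g\<in>carrier G. \<Oplus>t\<in>H. star A (s \<odot> \<beta> t g y) \<otimes> (s \<odot> \<beta> t g y))"
    using y by (intro finsum_cong' refl)
      (auto intro!: finsum_closed simp: star_smult smult_mult_l smult_mult_r smult_smult s_square mult.commute[of s])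
  also have "\<dots> = (\<Oplus>p\<in>carrier G \<times> H. star A (s \<odot> \<beta> (snd p) (fst p) y) \<otimes> (s \<odot> \<beta> (snd p) (fst p) y))"
    using y by (subst finsum_Times) (auto simp: finite_G finite_H)
  finally show ?thesis .
qed

section \<open>The quasi-basis on the local algebra\<close>

definition u where "u p = complex_of_real (sqrt (real (order G))) \<odot> (d (fst p) \<otimes> r (snd p))"

lemma u_closed [simp, intro]: "p \<in> carrier G \<times> H \<Longrightarrow> u p \<in> carrier A"
  by (auto simp: u_def)

text \<open>The square root enters once through u and once through its star. The product cancels the
  1/|G| of \<Gamma> in the quasi-basis identities, and it is the factor |G| of the index.\<close>

lemma sqrt_order_square:
  "complex_of_real (sqrt (real (order G))) * complex_of_real (sqrt (real (order G))) = of_nat (order G)"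
proof -
  have "sqrt (real (order G)) * sqrt (real (order G)) = real (order G)" by simp
  then show ?thesis by (simp only: of_real_mult[symmetric]) simp
qed

lemma star_u:
  assumes "k \<in> carrier G" "h \<in> H"
  shows "star A (u (k, h)) = complex_of_real (sqrt (real (order G))) \<odot> (r (inv\<^bsub>G\<^esub> h) \<otimes> d k)"
  using assms by (simp add: u_def star_smult star_mult star_d star_r)

lemma u_u_star: "(\<Oplus>p\<in>carrier G \<times> H. u p \<otimes> star A (u p)) = of_nat (order G * card H) \<odot> \<one>"
proof -
  have 1: "u (k, h) \<otimes> star A (u (k, h)) = of_nat (order G) \<odot> d k" if "k \<in> carrier G" "h \<in> H" for k h
  proof -
    have "(d k \<otimes> r h) \<otimes> (r (inv\<^bsub>G\<^esub> h) \<otimes> d k) = d k \<otimes> (r h \<otimes> r (inv\<^bsub>G\<^esub> h)) \<otimes> d k"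
      using that by (simp add: m_assoc)
    also have "\<dots> = d k" using that by (simp add: r_r r_one d_d)
    finally show ?thesis
      using that by (simp add: star_u[unfolded u_def fst_conv snd_conv] u_def smult_mult_l smult_mult_r smult_smult sqrt_order_square)
  qed
  have "(\<Oplus>p\<in>carrier G \<times> H. u p \<otimes> star A (u p)) = (\<Oplus>k\<in>carrier G. \<Oplus>h\<in>H. u (k, h) \<otimes> star A (u (k, h)))"
    by (rule finsum_Times) (auto simp: finite_G finite_H)
  also have "\<dots> = (\<Oplus>k\<in>carrier G. \<Oplus>h\<in>H. of_nat (order G) \<odot> d k)"
    by (intro finsum_cong' refl) (auto simp: 1 intro!: finsum_closed)
  also have "\<dots> = (\<Oplus>k\<in>carrier G. of_nat (order G * card H) \<odot> d k)"
    by (intro finsum_cong' refl) (auto simp: finsum_const_smult finite_H smult_smult mult.commute)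
  also have "\<dots> = of_nat (order G * card H) \<odot> \<one>"
    by (subst finsum_smult[symmetric]) (auto simp: d_sum)
  finally show ?thesis .
qed

text \<open>The generators \<open>r h\<close> and \<open>d k\<close> commute, so \<open>d k\<close> meets \<open>d (g k)\<close> and only
  the summand \<open>g = 1\<close> survives.\<close>

lemma quasi_left:
  assumes a: "a \<in> carrier A"
  shows "(\<Oplus>p\<in>carrier G \<times> H. u p \<otimes> \<Gamma> (star A (u p) \<otimes> a)) = a"
proof -
  have 1: "(d k \<otimes> r h) \<otimes> \<beta> \<one>\<^bsub>G\<^esub> g (r (inv\<^bsub>G\<^esub> h) \<otimes> d k \<otimes> a) = (if g = \<one>\<^bsub>G\<^esub> then d k \<otimes> \<beta> h g a else \<zero>)"
    if k: "k \<in> carrier G" and h: "h \<in> H" and g: "g \<in> carrier G" for k h g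
  proof -
    define t where "t = g \<otimes>\<^bsub>G\<^esub> inv\<^bsub>G\<^esub> h \<otimes>\<^bsub>G\<^esub> inv\<^bsub>G\<^esub> g"
    have t: "t \<in> H" "inv\<^bsub>G\<^esub> t \<in> H" using h g by (auto simp: t_def)
    define b where "b = \<beta> (inv\<^bsub>G\<^esub> t) g a"
    have b: "b \<in> carrier A" using t g a by (simp add: b_def)
    have "\<beta> \<one>\<^bsub>G\<^esub> g (r (inv\<^bsub>G\<^esub> h) \<otimes> d k \<otimes> a) = r t \<otimes> (d (g \<otimes>\<^bsub>G\<^esub> k) \<otimes> b)"
      using k h g a t by (simp add: m_assoc \<beta>_r_mult \<beta>_d_mult t_def[symmetric] b_def)
    then have "(d k \<otimes> r h) \<otimes> \<beta> \<one>\<^bsub>G\<^esub> g (r (inv\<^bsub>G\<^esub> h) \<otimes> d k \<otimes> a) =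
        d k \<otimes> ((r h \<otimes> r t) \<otimes> d (g \<otimes>\<^bsub>G\<^esub> k)) \<otimes> b"
      using k h g t b by (simp add: m_assoc)
    also have "(r h \<otimes> r t) \<otimes> d (g \<otimes>\<^bsub>G\<^esub> k) = d (g \<otimes>\<^bsub>G\<^esub> k) \<otimes> r (h \<otimes>\<^bsub>G\<^esub> t)"
      using k h g t by (simp add: r_r r_d)
    also have "d k \<otimes> (d (g \<otimes>\<^bsub>G\<^esub> k) \<otimes> r (h \<otimes>\<^bsub>G\<^esub> t)) \<otimes> b = (d k \<otimes> d (g \<otimes>\<^bsub>G\<^esub> k)) \<otimes> r (h \<otimes>\<^bsub>G\<^esub> t) \<otimes> b"
      using k h g t b by (simp add: m_assoc)
    also have "\<dots> = (if g = \<one>\<^bsub>G\<^esub> then d k \<otimes> \<beta> h g a else \<zero>)"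
    proof (cases "g = \<one>\<^bsub>G\<^esub>")
      case True
      then have "t = inv\<^bsub>G\<^esub> h" using h by (simp add: t_def)
      then show ?thesis using True k h a by (simp add: d_d r_one b_def)
    next
      case False
      then have "k \<noteq> g \<otimes>\<^bsub>G\<^esub> k" using k g by (metis Gr.l_cancel_one' Gr.r_cancel_one')
      then show ?thesis using False k h g t b by (simp add: d_d)
    qed
    finally show ?thesis .
  qed
  \<comment> \<open>Of the average over g only g = 1 is left, and the component of a of degree h
    appears because \<open>r (inv h)\<close> carries the degree h^{-1}.\<close>
  have 2: "u (k, h) \<otimes> \<Gamma> (star A (u (k, h)) \<otimes> a) = d k \<otimes> \<beta> h \<one>\<^bsub>G\<^esub> a"
    if k: "k \<in> carrier G" and h: "h \<in> H" for k h
  proof -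
    have "u (k, h) \<otimes> \<Gamma> (star A (u (k, h)) \<otimes> a) =
        (d k \<otimes> r h) \<otimes> (of_nat (order G) \<odot> \<Gamma> (r (inv\<^bsub>G\<^esub> h) \<otimes> d k \<otimes> a))"
      using k h a by (simp add: star_u[unfolded u_def fst_conv snd_conv] u_def smult_mult_l smult_mult_r \<Gamma>_smult smult_smult sqrt_order_square)
    also have "\<dots> = (\<Oplus>g\<in>carrier G. (d k \<otimes> r h) \<otimes> \<beta> \<one>\<^bsub>G\<^esub> g (r (inv\<^bsub>G\<^esub> h) \<otimes> d k \<otimes> a))"
      using k h a by (subst order_smult_\<Gamma>) (auto intro!: finsum_rdistr simp: finite_G)
    also have "\<dots> = (\<Oplus>g\<in>carrier G. if g = \<one>\<^bsub>G\<^esub> then d k \<otimes> \<beta> h g a else \<zero>)"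
      using 1 k h a by (intro finsum_cong' refl) auto
    also have "\<dots> = (if \<one>\<^bsub>G\<^esub> = \<one>\<^bsub>G\<^esub> then d k \<otimes> \<beta> h \<one>\<^bsub>G\<^esub> a else \<zero>)"
      by (rule finsum_delta) (use k h a finite_G in auto)
    finally show ?thesis by simp
  qed
  have "(\<Oplus>p\<in>carrier G \<times> H. u p \<otimes> \<Gamma> (star A (u p) \<otimes> a)) =
      (\<Oplus>k\<in>carrier G. \<Oplus>h\<in>H. u (k, h) \<otimes> \<Gamma> (star A (u (k, h)) \<otimes> a))"
    using a by (intro finsum_Times) (auto simp: finite_G finite_H)
  also have "\<dots> = (\<Oplus>k\<in>carrier G. \<Oplus>h\<in>H. d k \<otimes> \<beta> h \<one>\<^bsub>G\<^esub> a)"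
    using a by (intro finsum_cong' refl) (auto simp: 2 intro!: finsum_closed)
  also have "\<dots> = (\<Oplus>k\<in>carrier G. d k \<otimes> a)"
    using a by (intro finsum_cong' refl)
      (auto simp: finsum_rdistr[OF finite_H, symmetric] \<beta>_sum Pi_iff)
  also have "\<dots> = (\<Oplus>k\<in>carrier G. d k) \<otimes> a"
    using a finite_G by (intro finsum_ldistr[symmetric]) auto
  finally show ?thesis using a by (simp add: d_sum)
qed

text \<open>The mirror image of \<open>quasi_left\<close>: a d_k r_h has a part of degree 1 only
  through the component of a of degree h^{-1}, so the sum over h restores a after an inversion in
  H.\<close>

lemma quasi_right:
  assumes a: "a \<in> carrier A"
  shows "(\<Oplus>p\<in>carrier G \<times> H. \<Gamma> (a \<otimes> u p) \<otimes> star A (u p)) = a"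
proof -
  have 1: "\<beta> \<one>\<^bsub>G\<^esub> g (a \<otimes> (d k \<otimes> r h)) \<otimes> (r (inv\<^bsub>G\<^esub> h) \<otimes> d k) =
      (if g = \<one>\<^bsub>G\<^esub> then \<beta> (inv\<^bsub>G\<^esub> h) g a \<otimes> d k else \<zero>)"
    if k: "k \<in> carrier G" and h: "h \<in> H" and g: "g \<in> carrier G" for k h g
  proof -
    define t where "t = g \<otimes>\<^bsub>G\<^esub> h \<otimes>\<^bsub>G\<^esub> inv\<^bsub>G\<^esub> g"
    have t: "t \<in> H" "inv\<^bsub>G\<^esub> t \<in> H" using h g by (auto simp: t_def)
    define b where "b = \<beta> (inv\<^bsub>G\<^esub> t) g a"
    have b: "b \<in> carrier A" using t g a by (simp add: b_def)
    have "\<beta> \<one>\<^bsub>G\<^esub> g (a \<otimes> (d k \<otimes> r h)) = b \<otimes> d (g \<otimes>\<^bsub>G\<^esub> k) \<otimes> r t"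
      using k h g a t by (simp add: m_assoc[symmetric] \<beta>_mult_r \<beta>_mult_d t_def[symmetric] b_def)
    then have "\<beta> \<one>\<^bsub>G\<^esub> g (a \<otimes> (d k \<otimes> r h)) \<otimes> (r (inv\<^bsub>G\<^esub> h) \<otimes> d k) =
        b \<otimes> (d (g \<otimes>\<^bsub>G\<^esub> k) \<otimes> ((r t \<otimes> r (inv\<^bsub>G\<^esub> h)) \<otimes> d k))"
      using k h g t b by (simp add: m_assoc)
    also have "(r t \<otimes> r (inv\<^bsub>G\<^esub> h)) \<otimes> d k = d k \<otimes> r (t \<otimes>\<^bsub>G\<^esub> inv\<^bsub>G\<^esub> h)"
      using k h g t by (simp add: r_r r_d)
    also have "b \<otimes> (d (g \<otimes>\<^bsub>G\<^esub> k) \<otimes> (d k \<otimes> r (t \<otimes>\<^bsub>G\<^esub> inv\<^bsub>G\<^esub> h))) =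
        b \<otimes> (d (g \<otimes>\<^bsub>G\<^esub> k) \<otimes> d k \<otimes> r (t \<otimes>\<^bsub>G\<^esub> inv\<^bsub>G\<^esub> h))"
      using k h g t b by (simp add: m_assoc)
    also have "\<dots> = (if g = \<one>\<^bsub>G\<^esub> then \<beta> (inv\<^bsub>G\<^esub> h) g a \<otimes> d k else \<zero>)"
    proof (cases "g = \<one>\<^bsub>G\<^esub>")
      case True
      then have "t = h" using h by (simp add: t_def)
      then show ?thesis using True k h a by (simp add: d_d r_one b_def)
    next
      case False
      then have "g \<otimes>\<^bsub>G\<^esub> k \<noteq> k" using k g by (metis Gr.l_cancel_one' Gr.r_cancel_one')
      then show ?thesis using False k h g t b by (simp add: d_d)
    qed
    finally show ?thesis .
  qed
  have 2: "\<Gamma> (a \<otimes> u (k, h)) \<otimes> star A (u (k, h)) = \<beta> (inv\<^bsub>G\<^esub> h) \<one>\<^bsub>G\<^esub> a \<otimes> d k"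
    if k: "k \<in> carrier G" and h: "h \<in> H" for k h
  proof -
    have "\<Gamma> (a \<otimes> u (k, h)) \<otimes> star A (u (k, h)) =
        (of_nat (order G) \<odot> \<Gamma> (a \<otimes> (d k \<otimes> r h))) \<otimes> (r (inv\<^bsub>G\<^esub> h) \<otimes> d k)"
      using k h a by (simp add: star_u[unfolded u_def fst_conv snd_conv] u_def smult_mult_l smult_mult_r \<Gamma>_smult smult_smult sqrt_order_square)
    also have "\<dots> = (\<Oplus>g\<in>carrier G. \<beta> \<one>\<^bsub>G\<^esub> g (a \<otimes> (d k \<otimes> r h)) \<otimes> (r (inv\<^bsub>G\<^esub> h) \<otimes> d k))"
      using k h a by (subst order_smult_\<Gamma>) (auto intro!: finsum_ldistr simp: finite_G)
    also have "\<dots> = (\<Oplus>g\<in>carrier G. if g = \<one>\<^bsub>G\<^esub> then \<beta> (inv\<^bsub>G\<^esub> h) g a \<otimes> d k else \<zero>)"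
      using 1 k h a by (intro finsum_cong' refl) auto
    also have "\<dots> = (if \<one>\<^bsub>G\<^esub> = \<one>\<^bsub>G\<^esub> then \<beta> (inv\<^bsub>G\<^esub> h) \<one>\<^bsub>G\<^esub> a \<otimes> d k else \<zero>)"
      by (rule finsum_delta) (use k h a finite_G in auto)
    finally show ?thesis by simp
  qed
  have "(\<Oplus>p\<in>carrier G \<times> H. \<Gamma> (a \<otimes> u p) \<otimes> star A (u p)) =
      (\<Oplus>k\<in>carrier G. \<Oplus>h\<in>H. \<Gamma> (a \<otimes> u (k, h)) \<otimes> star A (u (k, h)))"
    using a by (intro finsum_Times) (auto simp: finite_G finite_H)
  also have "\<dots> = (\<Oplus>k\<in>carrier G. \<Oplus>h\<in>H. \<beta> (inv\<^bsub>G\<^esub> h) \<one>\<^bsub>G\<^esub> a \<otimes> d k)"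
    using a by (intro finsum_cong' refl) (auto simp: 2 intro!: finsum_closed)
  also have "\<dots> = (\<Oplus>k\<in>carrier G. (\<Oplus>h\<in>H. \<beta> (inv\<^bsub>G\<^esub> h) \<one>\<^bsub>G\<^esub> a) \<otimes> d k)"
    using a by (intro finsum_cong' refl)
      (auto simp: finsum_ldistr[OF finite_H, symmetric] Pi_iff intro!: finsum_closed)
  also have "(\<Oplus>h\<in>H. \<beta> (inv\<^bsub>G\<^esub> h) \<one>\<^bsub>G\<^esub> a) = (\<Oplus>h\<in>(\<lambda>t. inv\<^bsub>G\<^esub> t) ` H. \<beta> h \<one>\<^bsub>G\<^esub> a)"
    using a inj_inv_H inv_image_H by (subst finsum_reindex) auto
  also have "\<dots> = a" using a by (simp add: inv_image_H \<beta>_sum)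
  also have "(\<Oplus>k\<in>carrier G. a \<otimes> d k) = a \<otimes> (\<Oplus>k\<in>carrier G. d k)"
    using a finite_G by (intro finsum_rdistr[symmetric]) auto
  finally show ?thesis using a by (simp add: d_sum)
qed

section \<open>Passage to the completion\<close>

abbreviation \<Gamma>B where "\<Gamma>B \<equiv> completion_lift A N \<Gamma>"

lemmas \<Gamma>_C = bounded_map_C[OF bounded_map_\<Gamma>]
lemmas \<Gamma>B_cls = bounded_map_lift[OF bounded_map_\<Gamma>]

lemma cls_in_B: "F \<in> C \<Longrightarrow> cls F \<in> carrier B"
  by (simp add: carrier_B)

lemma \<Gamma>B_closed: "X \<in> carrier B \<Longrightarrow> \<Gamma>B X \<in> carrier B"
  by (elim carrier_BE) (simp add: \<Gamma>B_cls \<Gamma>_C cls_in_B)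

lemma conditional_expectation_\<Gamma>B: "conditional_expectation B {X \<in> carrier B. \<Gamma>B X = X} \<Gamma>B"
proof -
  interpret SB: star_alg B by (rule star_alg_completion)
  note simps = \<Gamma>B_cls \<Gamma>_C cls_ops C_intros one_B zero_B
  have add: "\<Gamma>B (X \<oplus>\<^bsub>B\<^esub> Y) = \<Gamma>B X \<oplus>\<^bsub>B\<^esub> \<Gamma>B Y" if "X \<in> carrier B" "Y \<in> carrier B" for X Y
    using that by (elim carrier_BE) (simp add: simps \<Gamma>_add)
  have smult: "\<Gamma>B (c \<odot>\<^bsub>B\<^esub> X) = c \<odot>\<^bsub>B\<^esub> \<Gamma>B X" if "X \<in> carrier B" for X c
    using that by (elim carrier_BE) (simp add: simps \<Gamma>_smult)
  have idem: "\<Gamma>B (\<Gamma>B X) = \<Gamma>B X" if "X \<in> carrier B" for X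
    using that by (elim carrier_BE) (simp add: simps \<Gamma>_\<Gamma>)
  have one: "\<Gamma>B \<one>\<^bsub>B\<^esub> = \<one>\<^bsub>B\<^esub>" by (simp add: simps \<Gamma>_one)
  have zero: "\<Gamma>B \<zero>\<^bsub>B\<^esub> = \<zero>\<^bsub>B\<^esub>" using smult[of "\<zero>\<^bsub>B\<^esub>" 0] \<Gamma>B_closed by simp
  have l: "\<Gamma>B (\<Gamma>B X \<otimes>\<^bsub>B\<^esub> Y) = \<Gamma>B X \<otimes>\<^bsub>B\<^esub> \<Gamma>B Y" if "X \<in> carrier B" "Y \<in> carrier B" for X Y
    using that by (elim carrier_BE) (simp add: simps \<Gamma>_mult_l)
  have r: "\<Gamma>B (Y \<otimes>\<^bsub>B\<^esub> \<Gamma>B X) = \<Gamma>B Y \<otimes>\<^bsub>B\<^esub> \<Gamma>B X" if "X \<in> carrier B" "Y \<in> carrier B" for X Y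
    using that by (elim carrier_BE) (simp add: simps \<Gamma>_mult_r)
  have pos: "\<Gamma>B (star B Y \<otimes>\<^bsub>B\<^esub> Y) \<in> positive_cone B" if Y: "Y \<in> carrier B" for Y
  proof -
    obtain F where F: "F \<in> C" "Y = cls F" "\<And>n. F n \<in> carrier A" using Y by (rule carrier_BE) blast
    \<comment> \<open>The components of a representative are Cauchy because \<open>\<beta>\<close>
      is bounded. Hence the local decomposition \<open>\<Gamma>_star_mult\<close>, applied at every
      n, is a sum of squares in the completion.\<close>
    define y where "y p n = s \<odot> \<beta> (snd p) (fst p) (F n)" for p n
    have y: "y p \<in> C" if "p \<in> carrier G \<times> H" for p
      unfolding y_def using that F(1) by (intro smult_C bounded_map_C[OF \<beta>_bounded]) auto
    have "\<Gamma>B (star B Y \<otimes>\<^bsub>B\<^esub> Y) = cls (\<lambda>n. \<Gamma> (star A (F n) \<otimes> F n))"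
      using F by (simp add: simps)
    also have "\<dots> = cls (\<lambda>n. \<Oplus>p\<in>carrier G \<times> H. star A (y p n) \<otimes> y p n)"
      using F(3) by (simp add: \<Gamma>_star_mult y_def)
    also have "\<dots> = (\<Oplus>\<^bsub>B\<^esub>p\<in>carrier G \<times> H. cls (\<lambda>n. star A (y p n) \<otimes> y p n))"
      using y by (intro finsum_C[THEN conjunct2, symmetric])
        (auto simp: finite_G finite_H intro!: C_intros)
    also have "\<dots> = (\<Oplus>\<^bsub>B\<^esub>p\<in>carrier G \<times> H. star B (cls (y p)) \<otimes>\<^bsub>B\<^esub> cls (y p))"
      using y by (intro SB.finsum_cong' refl) (auto simp: cls_ops C_intros cls_in_B)
    also have "\<dots> \<in> positive_cone B"
      using y by (intro SB.positive_cone_finsum) (auto simp: finite_G finite_H cls_in_B)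
    finally show ?thesis .
  qed
  show ?thesis
    unfolding conditional_expectation_def
  proof (intro conjI ballI allI)
    show "\<Gamma>B ` carrier B = {X \<in> carrier B. \<Gamma>B X = X}"
      using idem \<Gamma>B_closed by (auto simp: image_iff)
    show "\<Gamma>B X \<in> positive_cone B" if "X \<in> positive_cone B" for X
      by (rule SB.positive_cone_image[of "\<Gamma>B", OF add zero pos that])
    show "\<Gamma>B (a \<otimes>\<^bsub>B\<^esub> X) = a \<otimes>\<^bsub>B\<^esub> \<Gamma>B X" if "a \<in> {X \<in> carrier B. \<Gamma>B X = X}" "X \<in> carrier B" for a X
      using l[of a X] that by simp
    show "\<Gamma>B (X \<otimes>\<^bsub>B\<^esub> a) = \<Gamma>B X \<otimes>\<^bsub>B\<^esub> a" if "a \<in> {X \<in> carrier B. \<Gamma>B X = X}" "X \<in> carrier B" for a X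
      using r[of a X] that by simp
  qed (use add smult one in auto)
qed

text \<open>The quasi-basis consists of constant sequences, so each identity in the completion is
  the local identity at every term of a representative.\<close>

theorem index_completion:
  "index_finite_type B {X \<in> carrier B. \<Gamma>B X = X} \<Gamma>B \<and>
    cstar_index B \<Gamma>B = of_nat (order G * card H) \<odot>\<^bsub>B\<^esub> \<one>\<^bsub>B\<^esub>"
proof -
  interpret SB: star_alg B by (rule star_alg_completion)
  note simps = \<Gamma>B_cls \<Gamma>_C cls_ops C_intros one_B zero_B
  obtain ps where ps: "set ps = carrier G \<times> H" "distinct ps"
    using finite_distinct_list[of "carrier G \<times> H"] finite_G finite_H by auto
  define uB where "uB p = cls (\<lambda>n. u p)" for p
  have uC: "(\<lambda>n. u p) \<in> C" if "p \<in> carrier G \<times> H" for p using that by (intro const_in_C) auto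
  have uB [simp]: "uB p \<in> carrier B" if "p \<in> carrier G \<times> H" for p
    using uC[OF that] by (simp add: uB_def cls_in_B)
  define us where "us = map uB ps"
  have us: "set us \<subseteq> carrier B" using ps by (auto simp: us_def)
  have sum_us: "(\<Oplus>\<^bsub>B\<^esub>i\<in>{..<length us}. f (us ! i)) = (\<Oplus>\<^bsub>B\<^esub>p\<in>carrier G \<times> H. f (uB p))"
    if "\<And>p. p \<in> carrier G \<times> H \<Longrightarrow> f (uB p) \<in> carrier B" for f
  proof -
    have "(\<Oplus>\<^bsub>B\<^esub>i\<in>{..<length us}. f (us ! i)) = (\<Oplus>\<^bsub>B\<^esub>i\<in>{..<length ps}. f (uB (ps ! i)))"
      using that ps nth_mem[of _ ps] by (intro SB.finsum_cong') (auto simp: us_def)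
    then show ?thesis using SB.finsum_nth[OF ps(2), of "\<lambda>p. f (uB p)"] that ps by auto
  qed
  have q: "quasi_basis B \<Gamma>B us"
    unfolding quasi_basis_def
  proof (intro conjI us ballI)
    fix X assume "X \<in> carrier B"
    then obtain F where F: "F \<in> C" "X = cls F" "\<And>n. F n \<in> carrier A" by (rule carrier_BE) blast
    have 1: "uB p \<otimes>\<^bsub>B\<^esub> \<Gamma>B (star B (uB p) \<otimes>\<^bsub>B\<^esub> X) = cls (\<lambda>n. u p \<otimes> \<Gamma> (star A (u p) \<otimes> F n)) \<and>
        (\<lambda>n. u p \<otimes> \<Gamma> (star A (u p) \<otimes> F n)) \<in> C" if "p \<in> carrier G \<times> H" for p
      using uC[OF that] F by (simp add: uB_def simps)
    have "(\<Oplus>\<^bsub>B\<^esub>i\<in>{..<length us}. (us ! i) \<otimes>\<^bsub>B\<^esub> \<Gamma>B (star B (us ! i) \<otimes>\<^bsub>B\<^esub> X)) =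
        (\<Oplus>\<^bsub>B\<^esub>p\<in>carrier G \<times> H. uB p \<otimes>\<^bsub>B\<^esub> \<Gamma>B (star B (uB p) \<otimes>\<^bsub>B\<^esub> X))"
      using 1 by (intro sum_us[of "\<lambda>x. x \<otimes>\<^bsub>B\<^esub> \<Gamma>B (star B x \<otimes>\<^bsub>B\<^esub> X)"]) (simp add: cls_in_B)
    also have "\<dots> = (\<Oplus>\<^bsub>B\<^esub>p\<in>carrier G \<times> H. cls (\<lambda>n. u p \<otimes> \<Gamma> (star A (u p) \<otimes> F n)))"
      using 1 by (intro SB.finsum_cong' refl) (auto simp: cls_in_B)
    also have "\<dots> = X"
      using 1 F by (subst finsum_C[THEN conjunct2]) (simp_all add: finite_G finite_H quasi_left)
    finally show "(\<Oplus>\<^bsub>B\<^esub>i\<in>{..<length us}. (us ! i) \<otimes>\<^bsub>B\<^esub> \<Gamma>B (star B (us ! i) \<otimes>\<^bsub>B\<^esub> X)) = X" .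
    have 2: "\<Gamma>B (X \<otimes>\<^bsub>B\<^esub> uB p) \<otimes>\<^bsub>B\<^esub> star B (uB p) = cls (\<lambda>n. \<Gamma> (F n \<otimes> u p) \<otimes> star A (u p)) \<and>
        (\<lambda>n. \<Gamma> (F n \<otimes> u p) \<otimes> star A (u p)) \<in> C" if "p \<in> carrier G \<times> H" for p
      using uC[OF that] F by (simp add: uB_def simps)
    have "(\<Oplus>\<^bsub>B\<^esub>i\<in>{..<length us}. \<Gamma>B (X \<otimes>\<^bsub>B\<^esub> (us ! i)) \<otimes>\<^bsub>B\<^esub> star B (us ! i)) =
        (\<Oplus>\<^bsub>B\<^esub>p\<in>carrier G \<times> H. \<Gamma>B (X \<otimes>\<^bsub>B\<^esub> uB p) \<otimes>\<^bsub>B\<^esub> star B (uB p))"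
      using 2 by (intro sum_us[of "\<lambda>x. \<Gamma>B (X \<otimes>\<^bsub>B\<^esub> x) \<otimes>\<^bsub>B\<^esub> star B x"]) (simp add: cls_in_B)
    also have "\<dots> = (\<Oplus>\<^bsub>B\<^esub>p\<in>carrier G \<times> H. cls (\<lambda>n. \<Gamma> (F n \<otimes> u p) \<otimes> star A (u p)))"
      using 2 by (intro SB.finsum_cong' refl) (auto simp: cls_in_B)
    also have "\<dots> = X"
      using 2 F by (subst finsum_C[THEN conjunct2]) (simp_all add: finite_G finite_H quasi_right)
    finally show "(\<Oplus>\<^bsub>B\<^esub>i\<in>{..<length us}. \<Gamma>B (X \<otimes>\<^bsub>B\<^esub> (us ! i)) \<otimes>\<^bsub>B\<^esub> star B (us ! i)) = X" .
  qed
  have ind: "(\<Oplus>\<^bsub>B\<^esub>i\<in>{..<length us}. (us ! i) \<otimes>\<^bsub>B\<^esub> star B (us ! i)) = of_nat (order G * card H) \<odot>\<^bsub>B\<^esub> \<one>\<^bsub>B\<^esub>"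
  proof -
    have 1: "uB p \<otimes>\<^bsub>B\<^esub> star B (uB p) = cls (\<lambda>n. u p \<otimes> star A (u p)) \<and>
        (\<lambda>n. u p \<otimes> star A (u p)) \<in> C" if "p \<in> carrier G \<times> H" for p
      using uC[OF that] by (simp add: uB_def simps)
    have "(\<Oplus>\<^bsub>B\<^esub>i\<in>{..<length us}. (us ! i) \<otimes>\<^bsub>B\<^esub> star B (us ! i)) =
        (\<Oplus>\<^bsub>B\<^esub>p\<in>carrier G \<times> H. uB p \<otimes>\<^bsub>B\<^esub> star B (uB p))"
      by (intro sum_us[of "\<lambda>x. x \<otimes>\<^bsub>B\<^esub> star B x"]) simp
    also have "\<dots> = (\<Oplus>\<^bsub>B\<^esub>p\<in>carrier G \<times> H. cls (\<lambda>n. u p \<otimes> star A (u p)))"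
      using 1 by (intro SB.finsum_cong' refl) (auto simp: cls_in_B)
    also have "\<dots> = cls (\<lambda>n. of_nat (order G * card H) \<odot> \<one>)"
      using 1 by (subst finsum_C[THEN conjunct2]) (simp_all add: finite_G finite_H u_u_star del: of_nat_mult)
    also have "\<dots> = of_nat (order G * card H) \<odot>\<^bsub>B\<^esub> \<one>\<^bsub>B\<^esub>"
      by (simp add: simps del: of_nat_mult)
    finally show ?thesis .
  qed
  have "cstar_index B \<Gamma>B = of_nat (order G * card H) \<odot>\<^bsub>B\<^esub> \<one>\<^bsub>B\<^esub>"
    unfolding cstar_index_def ind[symmetric]
    using SB.quasi_basis_index_unique[OF \<Gamma>B_closed _ q] q by (intro the_equality) blast+
  then show ?thesis
    using conditional_expectation_\<Gamma>B q unfolding index_finite_type_def by blast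
qed

end

section \<open>Free star algebras and their quotients\<close>

text \<open>The linear extension of \<phi> from words to the free algebra, evaluated at f. Elements
  are compared by testing against all \<phi> (\<open>lin_eqI\<close>), which replaces sums over the
  cuts of a word by double sums over words (\<open>lin_conv\<close>).\<close>

definition lin :: "('w \<Rightarrow> complex) \<Rightarrow> ('w \<Rightarrow> complex) \<Rightarrow> complex" where
  "lin f \<phi> = (\<Sum>w\<in>{w. f w \<noteq> 0}. f w * \<phi> w)"

lemma lin_superset:
  assumes "finite S" "{w. f w \<noteq> 0} \<subseteq> S" shows "lin f \<phi> = (\<Sum>w\<in>S. f w * \<phi> w)"
  unfolding lin_def using assms by (intro sum.mono_neutral_left) auto

lemma lin_indicator: "finite {w. f w \<noteq> 0} \<Longrightarrow> lin f (\<lambda>v. if v = w then 1 else 0) = f w"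
  by (simp add: lin_def if_distrib[of "\<lambda>x. _ * x"] cong: if_cong)

lemma lin_eqI:
  assumes "finite {w. f w \<noteq> 0}" "finite {w. g w \<noteq> 0}" "\<And>\<phi>. lin f \<phi> = lin g \<phi>"
  shows "f = g"
  using assms(3)[of "\<lambda>v. if v = _ then 1 else 0"] by (intro ext) (metis assms(1,2) lin_indicator)

lemma lin_add:
  assumes "finite {w. f w \<noteq> 0}" "finite {w. g w \<noteq> 0}"
  shows "lin (\<lambda>w. f w + g w) \<phi> = lin f \<phi> + lin g \<phi>"
proof -
  let ?S = "{w. f w \<noteq> 0} \<union> {w. g w \<noteq> 0}"
  have "lin (\<lambda>w. f w + g w) \<phi> = (\<Sum>w\<in>?S. (f w + g w) * \<phi> w)"
    using assms by (intro lin_superset) auto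
  also have "\<dots> = (\<Sum>w\<in>?S. f w * \<phi> w) + (\<Sum>w\<in>?S. g w * \<phi> w)"
    by (simp add: distrib_right sum.distrib)
  finally show ?thesis using assms lin_superset[of ?S f \<phi>] lin_superset[of ?S g \<phi>] by auto
qed

lemma lin_scale: "lin (\<lambda>w. c * f w) \<phi> = c * lin f \<phi>"
  by (cases "c = 0") (simp_all add: lin_def sum_distrib_left mult.assoc)

lemma lin_scale_right: "lin f (\<lambda>w. c * \<phi> w) = c * lin f \<phi>"
  by (simp add: lin_def sum_distrib_left mult.left_commute)

lemma lin_zero_right [simp]: "lin f (\<lambda>w. 0) = 0"
  by (simp add: lin_def)

lemma lin_cong: "(\<And>w. f w \<noteq> 0 \<Longrightarrow> \<phi> w = \<psi> w) \<Longrightarrow> lin f \<phi> = lin f \<psi>"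
  by (simp add: lin_def)

definition wmono :: "'w \<Rightarrow> 'w \<Rightarrow> complex" where
  "wmono u = (\<lambda>w. if w = u then 1 else 0)"

lemma finite_wmono [simp]: "finite {w. wmono u w \<noteq> 0}"
  by (simp add: wmono_def)

lemma lin_wmono [simp]: "lin (wmono u) \<phi> = \<phi> u"
  by (simp add: lin_def wmono_def)

lemma lin_zero [simp]: "lin (\<lambda>w. 0) \<phi> = 0"
  by (simp add: lin_def)

definition conv :: "('x list \<Rightarrow> complex) \<Rightarrow> ('x list \<Rightarrow> complex) \<Rightarrow> 'x list \<Rightarrow> complex" where
  "conv f g w = (\<Sum>k\<le>length w. f (take k w) * g (drop k w))"

lemma conv_supp: "{w. conv f g w \<noteq> 0} \<subseteq> (\<lambda>(u, v). u @ v) ` ({w. f w \<noteq> 0} \<times> {w. g w \<noteq> 0})"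
proof
  fix w assume "w \<in> {w. conv f g w \<noteq> 0}"
  then obtain k where "f (take k w) * g (drop k w) \<noteq> 0"
    unfolding conv_def mem_Collect_eq by (meson sum.neutral)
  then show "w \<in> (\<lambda>(u, v). u @ v) ` ({w. f w \<noteq> 0} \<times> {w. g w \<noteq> 0})"
    by (intro image_eqI[of _ _ "(take k w, drop k w)"]) auto
qed

lemma finite_conv:
  "finite {w. f w \<noteq> 0} \<Longrightarrow> finite {w. g w \<noteq> 0} \<Longrightarrow> finite {w. conv f g w \<noteq> 0}"
  using finite_subset[OF conv_supp] by blast

text \<open>A cut of w at a position k is the same as a pair u, v with u @ v = w; this turns the
  convolution into a double sum over the two supports.\<close>

lemma lin_conv:
  assumes f: "finite {w. f w \<noteq> 0}" and g: "finite {w. g w \<noteq> 0}"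
  shows "lin (conv f g) \<phi> = lin f (\<lambda>u. lin g (\<lambda>v. \<phi> (u @ v)))"
proof -
  let ?S = "{w. f w \<noteq> 0}" and ?T = "{w. g w \<noteq> 0}"
  let ?A = "(\<lambda>(u, v). u @ v) ` (?S \<times> ?T)"
  \<comment> \<open>All cuts of words of \<open>?A\<close>. Among them are pairs outside the two
    supports; their terms vanish and are discarded once the sum runs over pairs.\<close>
  let ?P = "{(u, v). u @ v \<in> ?A}"
  have A: "finite ?A" using f g by simp
  have P: "?P = (\<lambda>(w, k). (take k w, drop k w)) ` (SIGMA w:?A. {..length w})"
  proof (intro equalityI subsetI)
    fix p assume "p \<in> ?P"
    then obtain u v where uv: "p = (u, v)" "u @ v \<in> ?A" by blast
    then have "(u @ v, length u) \<in> (SIGMA w:?A. {..length w})" by auto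
    then have "(\<lambda>(w, k). (take k w, drop k w)) (u @ v, length u) \<in>
        (\<lambda>(w, k). (take k w, drop k w)) ` (SIGMA w:?A. {..length w})" by (rule imageI)
    then show "p \<in> (\<lambda>(w, k). (take k w, drop k w)) ` (SIGMA w:?A. {..length w})" by (simp add: uv)
  next
    fix p assume "p \<in> (\<lambda>(w, k). (take k w, drop k w)) ` (SIGMA w:?A. {..length w})"
    then obtain w k where "w \<in> ?A" "p = (take k w, drop k w)" by auto
    then show "p \<in> ?P" by (simp del: image_iff)
  qed
  have finP: "finite ?P" unfolding P by (rule finite_imageI, rule finite_SigmaI[OF A]) simp
  have "lin (conv f g) \<phi> = (\<Sum>w\<in>?A. conv f g w * \<phi> w)"
    by (rule lin_superset[OF A conv_supp])
  also have "\<dots> = (\<Sum>w\<in>?A. \<Sum>k\<le>length w. f (take k w) * g (drop k w) * \<phi> w)"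
    by (simp add: conv_def sum_distrib_right)
  also have "\<dots> = (\<Sum>(w, k)\<in>(SIGMA w:?A. {..length w}). f (take k w) * g (drop k w) * \<phi> w)"
    by (intro sum.Sigma A) simp
  also have "\<dots> = (\<Sum>(u, v)\<in>?P. f u * g v * \<phi> (u @ v))"
    unfolding P
  proof (subst sum.reindex)
    show "inj_on (\<lambda>(w, k). (take k w, drop k w)) (SIGMA w:?A. {..length w})"
    proof (rule inj_onI)
      fix p p' assume p: "p \<in> (SIGMA w:?A. {..length w})" "p' \<in> (SIGMA w:?A. {..length w})"
        and eq: "(\<lambda>(w, k). (take k w, drop k w)) p = (\<lambda>(w, k). (take k w, drop k w)) p'"
      obtain w k w' k' where wk: "p = (w, k)" "p' = (w', k')" by (cases p, cases p') auto
      have "take k w = take k' w'" "drop k w = drop k' w'" using eq wk by auto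
      then have "w = w'" by (metis append_take_drop_id)
      moreover have "k = length (take k w)" "k' = length (take k' w')" using p wk by auto
      ultimately show "p = p'" using wk \<open>take k w = take k' w'\<close> by metis
    qed
  qed (auto intro!: sum.cong simp del: take_append drop_append)
  also have "\<dots> = (\<Sum>(u, v)\<in>?S \<times> ?T. f u * g v * \<phi> (u @ v))"
    using finP by (intro sum.mono_neutral_right) auto
  also have "\<dots> = (\<Sum>u\<in>?S. \<Sum>v\<in>?T. f u * g v * \<phi> (u @ v))"
    by (simp add: sum.cartesian_product)
  also have "\<dots> = lin f (\<lambda>u. lin g (\<lambda>v. \<phi> (u @ v)))"
    by (simp add: lin_def sum_distrib_left mult.assoc)
  finally show ?thesis .
qed

lemma free_simps:
  "carrier (free_star_algebra X \<sigma>) = {f. finite {w. f w \<noteq> 0} \<and> {w. f w \<noteq> 0} \<subseteq> lists X}"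
  "f \<otimes>\<^bsub>free_star_algebra X \<sigma>\<^esub> g = conv f g"
  "\<one>\<^bsub>free_star_algebra X \<sigma>\<^esub> = wmono []"
  "\<zero>\<^bsub>free_star_algebra X \<sigma>\<^esub> = (\<lambda>w. 0)"
  "f \<oplus>\<^bsub>free_star_algebra X \<sigma>\<^esub> g = (\<lambda>w. f w + g w)"
  "c \<odot>\<^bsub>free_star_algebra X \<sigma>\<^esub> f = (\<lambda>w. c * f w)"
  "star (free_star_algebra X \<sigma>) f = (\<lambda>w. if w \<in> lists X then cnj (f (rev (map \<sigma> w))) else 0)"
  by (auto simp: free_star_algebra_def conv_def wmono_def fun_eq_iff)

lemma conv_wmono: "conv (wmono u) (wmono v) = wmono (u @ v)"
  by (rule lin_eqI) (auto simp: finite_conv lin_conv)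

lemma gen_elem_eq_wmono: "gen_elem x = wmono [x]"
  by (simp add: gen_elem_def wmono_def)

lemma star_alg_free:
  assumes \<sigma>: "\<And>x. x \<in> X \<Longrightarrow> \<sigma> x \<in> X" "\<And>x. x \<in> X \<Longrightarrow> \<sigma> (\<sigma> x) = x"
  shows "star_alg (free_star_algebra X \<sigma>)"
proof -
  let ?F = "free_star_algebra X \<sigma>"
  have rev_lists: "rev (map \<sigma> w) \<in> lists X" if "w \<in> lists X" for w
    using that \<sigma> by (auto simp: in_lists_conv_set)
  have rev_rev: "rev (map \<sigma> (rev (map \<sigma> w))) = w" if "w \<in> lists X" for w
    using that \<sigma> by (simp add: rev_map comp_def in_lists_conv_set map_idI)
  have add_cl: "f \<oplus>\<^bsub>?F\<^esub> g \<in> carrier ?F" if "f \<in> carrier ?F" "g \<in> carrier ?F" for f g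
  proof -
    have "{w. f w + g w \<noteq> 0} \<subseteq> {w. f w \<noteq> 0} \<union> {w. g w \<noteq> 0}" by auto
    then show ?thesis using that finite_subset[of "{w. f w + g w \<noteq> 0}" "{w. f w \<noteq> 0} \<union> {w. g w \<noteq> 0}"]
      by (auto simp: free_simps)
  qed
  have smult_cl: "c \<odot>\<^bsub>?F\<^esub> f \<in> carrier ?F" if "f \<in> carrier ?F" for c f
    using that finite_subset[of "{w. c * f w \<noteq> 0}" "{w. f w \<noteq> 0}"] by (auto simp: free_simps)
  have mult_cl: "f \<otimes>\<^bsub>?F\<^esub> g \<in> carrier ?F" if "f \<in> carrier ?F" "g \<in> carrier ?F" for f g
  proof -
    have "(\<lambda>(u, v). u @ v) ` ({w. f w \<noteq> 0} \<times> {w. g w \<noteq> 0}) \<subseteq> lists X"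
      using that by (auto simp: free_simps(1) subset_iff in_lists_conv_set)
    then show ?thesis using that conv_supp[of f g] by (auto simp: free_simps finite_conv)
  qed
  have "abelian_group ?F"
  proof (rule abelian_groupI)
    fix f assume f: "f \<in> carrier ?F"
    show "\<exists>g\<in>carrier ?F. g \<oplus>\<^bsub>?F\<^esub> f = \<zero>\<^bsub>?F\<^esub>"
      using smult_cl[OF f, of "-1"] by (intro bexI[of _ "(-1) \<odot>\<^bsub>?F\<^esub> f"]) (auto simp: free_simps)
  qed (use add_cl in \<open>auto simp: free_simps\<close>)
  moreover have "Group.monoid ?F"
  proof (rule Group.monoidI)
    fix f g h assume fgh: "f \<in> carrier ?F" "g \<in> carrier ?F" "h \<in> carrier ?F"
    show "f \<otimes>\<^bsub>?F\<^esub> g \<otimes>\<^bsub>?F\<^esub> h = f \<otimes>\<^bsub>?F\<^esub> (g \<otimes>\<^bsub>?F\<^esub> h)"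
      \<comment> \<open>Against a test function \<phi> both bracketings evaluate \<phi> on the
        concatenation of three words.\<close>
      using fgh unfolding free_simps by (intro lin_eqI) (auto simp: finite_conv lin_conv)
    show "\<one>\<^bsub>?F\<^esub> \<otimes>\<^bsub>?F\<^esub> f = f" "f \<otimes>\<^bsub>?F\<^esub> \<one>\<^bsub>?F\<^esub> = f"
      using fgh unfolding free_simps by (intro lin_eqI; auto simp: finite_conv lin_conv)+
  qed (use mult_cl in \<open>auto simp: free_simps wmono_def\<close>)
  ultimately have "ring ?F"
    by (rule ringI) (auto simp: free_simps conv_def distrib_left distrib_right sum.distrib)
  moreover have "star ?F f \<in> carrier ?F" if f: "f \<in> carrier ?F" for f
  proof -
    have "{w. star ?F f w \<noteq> 0} \<subseteq> (\<lambda>w. rev (map \<sigma> w)) ` {w. f w \<noteq> 0}"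
    proof
      fix w assume "w \<in> {w. star ?F f w \<noteq> 0}"
      then have "w \<in> lists X" "f (rev (map \<sigma> w)) \<noteq> 0" by (auto simp: free_simps split: if_splits)
      then show "w \<in> (\<lambda>w. rev (map \<sigma> w)) ` {w. f w \<noteq> 0}"
        using rev_rev by (intro image_eqI[of _ _ "rev (map \<sigma> w)"]) auto
    qed
    then have "finite {w. star ?F f w \<noteq> 0}"
      using f finite_subset by (fastforce simp: free_simps(1))
    moreover have "{w. star ?F f w \<noteq> 0} \<subseteq> lists X" by (auto simp: free_simps(7) split: if_splits)
    ultimately show ?thesis by (simp add: free_simps(1))
  qed
  moreover have "star ?F (f \<otimes>\<^bsub>?F\<^esub> g) = star ?F g \<otimes>\<^bsub>?F\<^esub> star ?F f" for f g
  proof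
    fix w
    show "star ?F (f \<otimes>\<^bsub>?F\<^esub> g) w = (star ?F g \<otimes>\<^bsub>?F\<^esub> star ?F f) w"
    proof (cases "w \<in> lists X")
      case True
      let ?w = "rev (map \<sigma> w)" and ?n = "length w"
      have td: "take k w \<in> lists X" "drop k w \<in> lists X" for k
        using True by (auto simp: in_lists_conv_set dest: in_set_takeD in_set_dropD)
      have "star ?F (f \<otimes>\<^bsub>?F\<^esub> g) w = (\<Sum>k\<le>?n. cnj (f (take k ?w)) * cnj (g (drop k ?w)))"
        using True by (simp add: free_simps conv_def)
      \<comment> \<open>Reversal exchanges prefixes and suffixes: a cut of w at k is a cut of the
        reversed word at \<open>?n - k\<close>.\<close>
      also have "\<dots> = (\<Sum>k\<le>?n. cnj (f (take (?n - k) ?w)) * cnj (g (drop (?n - k) ?w)))"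
        by (rule sum.reindex_bij_witness[of _ "\<lambda>k. ?n - k" "\<lambda>k. ?n - k"]) auto
      also have "\<dots> = (\<Sum>k\<le>?n. star ?F g (take k w) * star ?F f (drop k w))"
        using td by (intro sum.cong refl) (simp add: free_simps take_rev drop_rev drop_map take_map)
      finally show ?thesis by (simp add: free_simps(2) conv_def)
    next
      case False
      have "take k w \<notin> lists X \<or> drop k w \<notin> lists X" for k
        using False by (metis append_in_lists_conv append_take_drop_id)
      then have "(star ?F g \<otimes>\<^bsub>?F\<^esub> star ?F f) w = 0"
        unfolding free_simps(2) conv_def by (intro sum.neutral) (auto simp: free_simps(7))
      then show ?thesis using False by (simp add: free_simps(7))
    qed
  qed
  moreover have "star ?F (star ?F f) = f" if "f \<in> carrier ?F" for f
  proof
    fix w show "star ?F (star ?F f) w = f w"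
      using that rev_lists[of w] rev_rev[of w] by (auto simp: free_simps)
  qed
  moreover have "(c \<odot>\<^bsub>?F\<^esub> f) \<otimes>\<^bsub>?F\<^esub> g = c \<odot>\<^bsub>?F\<^esub> (f \<otimes>\<^bsub>?F\<^esub> g)"
    "f \<otimes>\<^bsub>?F\<^esub> (c \<odot>\<^bsub>?F\<^esub> g) = c \<odot>\<^bsub>?F\<^esub> (f \<otimes>\<^bsub>?F\<^esub> g)" for c f g
    by (simp_all add: free_simps conv_def fun_eq_iff sum_distrib_left mult_ac)
  moreover have "(c + d) \<odot>\<^bsub>?F\<^esub> f = c \<odot>\<^bsub>?F\<^esub> f \<oplus>\<^bsub>?F\<^esub> d \<odot>\<^bsub>?F\<^esub> f"
    "c \<odot>\<^bsub>?F\<^esub> (f \<oplus>\<^bsub>?F\<^esub> g) = c \<odot>\<^bsub>?F\<^esub> f \<oplus>\<^bsub>?F\<^esub> c \<odot>\<^bsub>?F\<^esub> g"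
    "c \<odot>\<^bsub>?F\<^esub> (d \<odot>\<^bsub>?F\<^esub> f) = (c * d) \<odot>\<^bsub>?F\<^esub> f" "1 \<odot>\<^bsub>?F\<^esub> f = f"
    "star ?F (f \<oplus>\<^bsub>?F\<^esub> g) = star ?F f \<oplus>\<^bsub>?F\<^esub> star ?F g"
    "star ?F (c \<odot>\<^bsub>?F\<^esub> f) = cnj c \<odot>\<^bsub>?F\<^esub> star ?F f" for c d f g
    by (auto simp: free_simps distrib_left distrib_right)
  ultimately show ?thesis
    using smult_cl by (intro star_alg.intro star_alg_axioms.intro) blast+
qed

section \<open>Quotients by ideals\<close>

locale alg_ideal = star_alg A + ideal I A for A :: "('b, 'm) star_algebra_scheme" (structure) and I
begin

abbreviation Q where "Q \<equiv> quotient_star_algebra A I"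

lemma q_eq_iff: "x \<in> carrier A \<Longrightarrow> y \<in> carrier A \<Longrightarrow> I +> x = I +> y \<longleftrightarrow> x \<ominus> y \<in> I"
  using quotient_eq_iff_same_a_r_cos[OF ideal_axioms] by simp

text \<open>Scalars act through the unit, c x = (c 1) x, so a ring ideal is a subspace.\<close>

lemma smult_I: "x \<in> I \<Longrightarrow> c \<odot> x \<in> I"
  using I_l_closed[of x "c \<odot> \<one>"] a_subset by (auto simp: smult_mult_l subset_iff)

lemma carrier_Q: "carrier Q = (+>) I ` carrier A"
  by (auto simp: quotient_star_algebra_def FactRing_def A_RCOSETS_def')

lemma in_q_iff:
  assumes "x \<in> carrier A"
  shows "z \<in> I +> x \<longleftrightarrow> z \<in> carrier A \<and> I +> z = I +> x"
  using a_r_coset_subset_G[OF a_subset assms] a_repr_independence'[OF _ assms] a_rcos_self assms by blast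

lemma q_ops:
  assumes x: "x \<in> carrier A"
  shows add_q: "y \<in> carrier A \<Longrightarrow> (I +> x) \<oplus>\<^bsub>Q\<^esub> (I +> y) = I +> (x \<oplus> y)"
    and mult_q: "y \<in> carrier A \<Longrightarrow> (I +> x) \<otimes>\<^bsub>Q\<^esub> (I +> y) = I +> (x \<otimes> y)"
    and smult_q: "c \<odot>\<^bsub>Q\<^esub> (I +> x) = I +> (c \<odot> x)"
proof -
  note mem = in_q_iff
  show "(I +> x) \<oplus>\<^bsub>Q\<^esub> (I +> y) = I +> (x \<oplus> y)" if "y \<in> carrier A"
    using a_rcos_sum[OF x that] by (simp add: quotient_star_algebra_def FactRing_def)
  show "(I +> x) \<otimes>\<^bsub>Q\<^esub> (I +> y) = I +> (x \<otimes> y)" if "y \<in> carrier A"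
    using rcoset_mult_add[OF x that] by (simp add: quotient_star_algebra_def FactRing_def)
  have c: "I +> (c \<odot> z) = I +> (c \<odot> x)" if "z \<in> I +> x" for z
  proof -
    have z: "z \<in> carrier A" "z \<ominus> x \<in> I" using that mem[OF x] q_eq_iff x by auto
    have "c \<odot> z \<ominus> c \<odot> x = c \<odot> (z \<ominus> x)"
      using z(1) x by (simp add: diff_eq_smult smult_r_distr smult_smult mult.commute)
    then have "c \<odot> z \<ominus> c \<odot> x \<in> I" using smult_I[OF z(2)] by simp
    then show ?thesis using z(1) x q_eq_iff[of "c \<odot> z" "c \<odot> x"] by simp
  qed
  have xx: "x \<in> I +> x" using mem[OF x] x by simp
  have "(\<Union>z\<in>I +> x. I +> (c \<odot> z)) = (\<Union>z\<in>I +> x. I +> (c \<odot> x))"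
    by (intro SUP_cong refl c)
  then show "c \<odot>\<^bsub>Q\<^esub> (I +> x) = I +> (c \<odot> x)"
    using xx by (simp add: quotient_star_algebra_def) blast
qed

lemma one_Q: "\<one>\<^bsub>Q\<^esub> = I +> \<one>"
  by (simp add: quotient_star_algebra_def FactRing_def)

lemma zero_Q: "\<zero>\<^bsub>Q\<^esub> = I +> \<zero>"
  using a_coset_join2[of \<zero> I] a_subgroup by (simp add: quotient_star_algebra_def FactRing_def)

lemma q_closed [simp, intro]: "x \<in> carrier A \<Longrightarrow> I +> x \<in> carrier Q"
  by (simp add: carrier_Q)

lemma carrier_QE:
  assumes "X \<in> carrier Q" obtains x where "x \<in> carrier A" "X = I +> x"
  using assms by (auto simp: carrier_Q)

end

text \<open>Kept apart from \<open>alg_ideal\<close> because the field ideal is seen to be closed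
  under the star only after its identification with the kernel of the representation, and that
  identification already computes in the quotient.\<close>

locale star_ideal = alg_ideal +
  assumes star_I: "x \<in> I \<Longrightarrow> star A x \<in> I"
begin

lemma star_q:
  assumes x: "x \<in> carrier A" shows "star Q (I +> x) = I +> star A x"
proof -
  note mem = in_q_iff
  have st: "star A z \<in> I +> star A y" if "z \<in> I +> y" "y \<in> carrier A" for z y
  proof -
    have z: "z \<in> carrier A" "z \<ominus> y \<in> I" using that mem q_eq_iff by auto
    have "star A z \<ominus> star A y = star A (z \<ominus> y)"
      using z(1) that(2) by (simp add: diff_eq_smult star_add star_smult)
    then have "star A z \<ominus> star A y \<in> I" using star_I[OF z(2)] by simp
    then show ?thesis using z(1) that(2) q_eq_iff[of "star A z" "star A y"] mem[of "star A y" "star A z"] by simp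
  qed
  have "star A ` (I +> x) = I +> star A x"
  proof (intro equalityI subsetI)
    fix z assume z: "z \<in> I +> star A x"
    then have "z \<in> carrier A" using mem[of "star A x"] x by simp
    then show "z \<in> star A ` (I +> x)"
      using st[OF z] x by (intro image_eqI[of _ _ "star A z"]) auto
  qed (use st x in auto)
  then show "star Q (I +> x) = I +> star A x"
    by (simp add: quotient_star_algebra_def)
qed

lemma star_alg_Q: "star_alg Q"
proof -
  note simps = one_Q zero_Q q_ops star_q
  have "abelian_group Q"
  proof (rule abelian_groupI)
    fix X assume "X \<in> carrier Q"
    then obtain x where x: "x \<in> carrier A" "X = I +> x" by (rule carrier_QE) blast
    then have "(I +> (\<ominus> x)) \<oplus>\<^bsub>Q\<^esub> X = \<zero>\<^bsub>Q\<^esub>" by (simp add: simps l_neg)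
    then show "\<exists>Y\<in>carrier Q. Y \<oplus>\<^bsub>Q\<^esub> X = \<zero>\<^bsub>Q\<^esub>" using x(1) by blast
  qed ((elim carrier_QE)?, simp add: simps a_ac)+
  moreover have "Group.monoid Q"
    by (rule Group.monoidI; (elim carrier_QE)?; simp add: simps m_assoc)
  ultimately have "ring Q"
    by (rule ringI; elim carrier_QE; simp add: simps l_distr r_distr)
  then show ?thesis
    by (rule star_alg.intro, unfold_locales; elim carrier_QE;
      simp add: simps smult_l_distr smult_r_distr smult_smult smult_mult_l smult_mult_r
        star_add star_smult star_mult)
qed

lemma finsum_Q:
  assumes "finite J" "\<And>j. j \<in> J \<Longrightarrow> f j \<in> carrier A"
  shows "(\<Oplus>\<^bsub>Q\<^esub>j\<in>J. I +> f j) = I +> (\<Oplus>j\<in>J. f j)"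
proof -
  interpret Q: star_alg Q by (rule star_alg_Q)
  show ?thesis
    using assms
  proof (induction J)
    case empty
    then show ?case by (simp add: zero_Q)
  next
    case (insert j J)
    have "(\<Oplus>\<^bsub>Q\<^esub>j\<in>insert j J. I +> f j) = (I +> f j) \<oplus>\<^bsub>Q\<^esub> (I +> (\<Oplus>j\<in>J. f j))"
      using insert by (subst Q.finsum_insert) auto
    also have "\<dots> = I +> (\<Oplus>j\<in>insert j J. f j)"
      using insert by (subst finsum_insert) (auto simp: add_q finsum_closed Pi_iff)
    finally show ?case .
  qed
qed

end

section \<open>The representation on configurations\<close>

text \<open>\<open>pull\<close> reads a word from the left, so that it is compatible with products in the order in which
  they are written; \<open>kern G f\<close> is the matrix of \<open>f\<close>.\<close>

primrec step :: "('a, 'm) monoid_scheme \<Rightarrow> 'a field_gen \<Rightarrow> (rat \<Rightarrow> 'a) \<Rightarrow> (rat \<Rightarrow> 'a) option" where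
  "step G (Delta g x) c = (if c x = g then Some c else None)"
| "step G (Rho h l) c = Some (\<lambda>y. if l < y then inv\<^bsub>G\<^esub> h \<otimes>\<^bsub>G\<^esub> c y else c y)"

primrec pull :: "('a, 'm) monoid_scheme \<Rightarrow> 'a field_gen list \<Rightarrow> (rat \<Rightarrow> 'a) \<Rightarrow> (rat \<Rightarrow> 'a) option" where
  "pull G [] c = Some c"
| "pull G (a # w) c = Option.bind (step G a c) (pull G w)"

lemma pull_append: "pull G (u @ v) c = Option.bind (pull G u c) (pull G v)"
  by (induction u arbitrary: c) (auto split: bind_splits)

definition kern :: "('a, 'm) monoid_scheme \<Rightarrow> ('a field_gen list \<Rightarrow> complex) \<Rightarrow> (rat \<Rightarrow> 'a) \<Rightarrow> (rat \<Rightarrow> 'a) \<Rightarrow> complex" where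
  "kern G f c b = lin f (\<lambda>w. if pull G w c = Some b then 1 else 0)"

lemma kern_wmono: "kern G (wmono w) c b = (if pull G w c = Some b then 1 else 0)"
  by (simp add: kern_def)

lemma kern_zero [simp]: "kern G (\<lambda>w. 0) c b = 0"
  by (simp add: kern_def)

lemma kern_add: "finite {w. f w \<noteq> 0} \<Longrightarrow> finite {w. g w \<noteq> 0} \<Longrightarrow>
    kern G (\<lambda>w. f w + g w) c b = kern G f c b + kern G g c b"
  by (simp add: kern_def lin_add)

lemma kern_scale: "kern G (\<lambda>w. k * f w) c b = k * kern G f c b"
  by (simp add: kern_def lin_scale)

lemma kern_minus: "kern G (\<lambda>w. - f w) c b = - kern G f c b"
  using kern_scale[of G "-1" f c b] by simp

lemma kern_conv:
  assumes "finite {w. f w \<noteq> 0}" "finite {w. g w \<noteq> 0}"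
  shows "kern G (conv f g) c b = lin f (\<lambda>u. case pull G u c of None \<Rightarrow> 0 | Some d \<Rightarrow> kern G g d b)"
  unfolding kern_def lin_conv[OF assms] pull_append by (intro lin_cong) (auto split: option.splits)

text \<open>Words are grouped by the configuration they lead to, which turns a sum over words into a
  row of a matrix product. \<open>D\<close> may be any finite set that contains the targets at which
  \<psi> does not vanish.\<close>

lemma lin_pull:
  assumes f: "finite {w. f w \<noteq> 0}"
    and D: "finite D" "\<And>w d. f w \<noteq> 0 \<Longrightarrow> pull G w c = Some d \<Longrightarrow> \<psi> d \<noteq> 0 \<Longrightarrow> d \<in> D"
  shows "lin f (\<lambda>u. case pull G u c of None \<Rightarrow> 0 | Some d \<Rightarrow> \<psi> d) = (\<Sum>d\<in>D. kern G f c d * \<psi> d)"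
proof -
  have "(case pull G u c of None \<Rightarrow> 0 | Some d \<Rightarrow> \<psi> d) = (\<Sum>d\<in>D. (if pull G u c = Some d then 1 else 0) * \<psi> d)"
    if "f u \<noteq> 0" for u
  proof (cases "pull G u c")
    case (Some d)
    have "(\<Sum>e\<in>D. (if Some d = Some e then 1 else 0) * \<psi> e) = (\<Sum>e\<in>D. if e = d then \<psi> e else 0)"
      by (intro sum.cong) auto
    then show ?thesis using Some D that by auto
  qed simp
  then have "lin f (\<lambda>u. case pull G u c of None \<Rightarrow> 0 | Some d \<Rightarrow> \<psi> d) =
      lin f (\<lambda>u. \<Sum>d\<in>D. (if pull G u c = Some d then 1 else 0) * \<psi> d)"
    by (rule lin_cong)
  also have "\<dots> = (\<Sum>d\<in>D. kern G f c d * \<psi> d)"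
    unfolding lin_def kern_def
    by (simp add: sum_distrib_left sum_distrib_right mult.assoc) (rule sum.swap)
  finally show ?thesis .
qed

text \<open>The coefficients of the words with a common target cancel, so every continuation \<psi>
  gives zero. This is the right ideal property of the kernel.\<close>

lemma lin_pull_zero:
  assumes f: "finite {w. f w \<noteq> 0}" and "\<And>d. kern G f c d = 0"
  shows "lin f (\<lambda>u. case pull G u c of None \<Rightarrow> 0 | Some d \<Rightarrow> \<psi> d) = 0"
proof -
  let ?D = "(\<lambda>w. the (pull G w c)) ` {w. f w \<noteq> 0}"
  have "lin f (\<lambda>u. case pull G u c of None \<Rightarrow> 0 | Some d \<Rightarrow> \<psi> d) = (\<Sum>d\<in>?D. kern G f c d * \<psi> d)"
    using f by (intro lin_pull) (auto intro!: image_eqI[of _ _ "_ :: _ list"])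
  then show ?thesis using assms(2) by simp
qed

text \<open>A bond moves only the sites to its right, and a \<delta> letter moves none.\<close>

lemma pull_outside:
  assumes "\<And>h l. Rho h l \<in> set w \<Longrightarrow> \<not> l < y" and "pull G w c = Some b"
  shows "b y = c y"
  using assms
proof (induction w arbitrary: c)
  case (Cons a w)
  then obtain d where d: "step G a c = Some d" "pull G w d = Some b" by (auto split: bind_splits)
  then have "b y = d y" using Cons by (metis list.set_intros(2))
  moreover have "d y = c y"
  proof (cases a)
    case (Rho h l)
    then show ?thesis using d(1) Cons.prems(1)[of h l] by auto
  qed (use d(1) in \<open>auto split: if_splits\<close>)
  ultimately show ?case by simp
qed simp

section \<open>The representation satisfies the defining relations\<close>

locale field_alg = group G for G :: "('a, 'm) monoid_scheme" (structure) + fixes H :: "'a set"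
  assumes finite_G: "finite (carrier G)" and normal_H: "H \<lhd> G"
begin

abbreviation X where "X \<equiv> field_gens G H UNIV"
abbreviation F where "F \<equiv> free_field G H"
abbreviation I where "I \<equiv> field_ideal G H"
abbreviation L where "L \<equiv> local_field_algebra G H"

sublocale HN: normal H G by (rule normal_H)

lemma H_mem [simp, intro]:
  "h \<in> H \<Longrightarrow> h \<in> carrier G" "\<one> \<in> H"
  "h \<in> H \<Longrightarrow> inv h \<in> H" "h \<in> H \<Longrightarrow> t \<in> H \<Longrightarrow> h \<otimes> t \<in> H"
  "h \<in> H \<Longrightarrow> g \<in> carrier G \<Longrightarrow> g \<otimes> h \<otimes> inv g \<in> H"
  "h \<in> H \<Longrightarrow> g \<in> carrier G \<Longrightarrow> inv g \<otimes> h \<otimes> g \<in> H"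
  using HN.inv_op_closed1 HN.inv_op_closed2 HN.subset by auto

lemma finite_H: "finite H"
  using finite_G HN.subset finite_subset by blast

lemma X_iff [simp]:
  "Delta g x \<in> field_gens G H \<Lambda> \<longleftrightarrow> g \<in> carrier G \<and> x \<in> \<Lambda> \<inter> \<int>"
  "Rho h l \<in> field_gens G H \<Lambda> \<longleftrightarrow> h \<in> H \<and> l \<in> \<Lambda> \<inter> half_odd"
  by (auto simp: field_gens_def)

lemma F_simps:
  "carrier F = {f. finite {w. f w \<noteq> 0} \<and> {w. f w \<noteq> 0} \<subseteq> lists X}"
  "f \<otimes>\<^bsub>F\<^esub> g = conv f g"
  "\<one>\<^bsub>F\<^esub> = wmono []"
  "\<zero>\<^bsub>F\<^esub> = (\<lambda>w. 0)"
  "f \<oplus>\<^bsub>F\<^esub> g = (\<lambda>w. f w + g w)"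
  "k \<odot>\<^bsub>F\<^esub> f = (\<lambda>w. k * f w)"
  "star F f = (\<lambda>w. if w \<in> lists X then cnj (f (rev (map (field_gen_star G) w))) else 0)"
  by (simp_all add: free_field_def free_simps)

lemma finite_supp: "f \<in> carrier F \<Longrightarrow> finite {w. f w \<noteq> 0}"
  by (simp add: F_simps)

lemma supp_lists: "f \<in> carrier F \<Longrightarrow> f w \<noteq> 0 \<Longrightarrow> w \<in> lists X"
  by (auto simp: F_simps(1))

lemma wmono_closed [simp, intro]: "w \<in> lists X \<Longrightarrow> wmono w \<in> carrier F"
  by (auto simp: F_simps wmono_def)

sublocale F: star_alg F
  unfolding free_field_def
proof (rule star_alg_free)
  fix x assume "x \<in> X"
  then show "field_gen_star G x \<in> X" "field_gen_star G (field_gen_star G x) = x"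
    by (cases x; auto)+
qed

lemma finsum_F:
  assumes "finite J" "\<And>j. j \<in> J \<Longrightarrow> f j \<in> carrier F"
  shows "(\<Oplus>\<^bsub>F\<^esub>j\<in>J. f j) = (\<lambda>w. \<Sum>j\<in>J. f j w)"
  using assms
proof (induction J)
  case empty
  then show ?case by (simp add: F_simps(4))
next
  case (insert j J)
  have "(\<Oplus>\<^bsub>F\<^esub>j\<in>insert j J. f j) = f j \<oplus>\<^bsub>F\<^esub> (\<Oplus>\<^bsub>F\<^esub>j\<in>J. f j)"
    using insert by (intro F.finsum_insert) auto
  then show ?case using insert by (simp add: F_simps(5))
qed

definition Conf :: "(rat \<Rightarrow> 'a) set" where
  "Conf = {c. \<forall>x. c x \<in> carrier G}"

lemma Conf_mem: "c \<in> Conf \<Longrightarrow> c x \<in> carrier G"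
  by (simp add: Conf_def)

lemma step_Conf: "a \<in> X \<Longrightarrow> c \<in> Conf \<Longrightarrow> step G a c = Some b \<Longrightarrow> b \<in> Conf"
  by (cases a) (auto simp: Conf_def split: if_splits)

lemma pull_Conf: "w \<in> lists X \<Longrightarrow> c \<in> Conf \<Longrightarrow> pull G w c = Some b \<Longrightarrow> b \<in> Conf"
proof (induction w arbitrary: c)
  case (Cons a w)
  then obtain d where d: "step G a c = Some d" "pull G w d = Some b" by (auto split: bind_splits)
  then show ?case using Cons step_Conf[of a c d] by auto
qed auto

text \<open>The kernel of the representation, as a set of elements of the free algebra. Its rows
  come from \<open>Conf\<close> because the relations hold for group-valued configurations.\<close>

definition ker :: "('a field_gen list \<Rightarrow> complex) set" where
  "ker = {f \<in> carrier F. \<forall>c\<in>Conf. \<forall>b. kern G f c b = 0}"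

lemma kern_diff:
  assumes f: "f \<in> carrier F" and g: "g \<in> carrier F"
  shows "kern G (f \<ominus>\<^bsub>F\<^esub> g) c b = kern G f c b - kern G g c b"
proof -
  have eq: "f \<ominus>\<^bsub>F\<^esub> g = (\<lambda>w. f w + - g w)"
    using f g by (simp add: F.diff_eq_smult F_simps(5,6))
  have "finite {w. - g w \<noteq> 0}" using finite_supp[OF g] by simp
  from kern_add[OF finite_supp[OF f] this, of G c b] show ?thesis
    unfolding eq kern_minus by simp
qed

lemma ideal_ker: "ideal ker F"
proof (rule idealI)
  show "subgroup ker (add_monoid F)"
  proof (rule F.add.subgroupI)
    show "ker \<noteq> {}" using F.zero_closed by (auto simp: ker_def F_simps(4) intro!: exI[of _ "\<lambda>w. 0"])
    fix f assume f: "f \<in> ker"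
    then show "\<ominus>\<^bsub>F\<^esub> f \<in> ker"
    proof -
      have "\<ominus>\<^bsub>F\<^esub> f = \<zero>\<^bsub>F\<^esub> \<ominus>\<^bsub>F\<^esub> f" using f by (simp add: ker_def a_minus_def)
      then have "kern G (\<ominus>\<^bsub>F\<^esub> f) c b = - kern G f c b" for c b
        using kern_diff[OF F.zero_closed, of f] f by (simp add: ker_def F_simps(4))
      then show ?thesis using f by (simp add: ker_def)
    qed
    fix g assume "g \<in> ker"
    then show "f \<oplus>\<^bsub>F\<^esub> g \<in> ker"
      using f F.add.m_closed[of f g] by (auto simp: ker_def F_simps(5) kern_add finite_supp)
  qed (auto simp: ker_def)
  fix f g assume f: "f \<in> ker" and g: "g \<in> carrier F"
  then have f': "f \<in> carrier F" by (simp add: ker_def)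
  show "g \<otimes>\<^bsub>F\<^esub> f \<in> ker"
    unfolding ker_def
  proof (intro CollectI conjI ballI allI)
    fix c b assume c: "c \<in> Conf"
    have "kern G (g \<otimes>\<^bsub>F\<^esub> f) c b = lin g (\<lambda>u. case pull G u c of None \<Rightarrow> 0 | Some d \<Rightarrow> kern G f d b)"
      using f' g by (simp add: F_simps(2) kern_conv finite_supp)
    also have "\<dots> = lin g (\<lambda>u. 0)"
      using f c pull_Conf[OF supp_lists[OF g] c] by (intro lin_cong) (auto simp: ker_def split: option.splits)
    finally show "kern G (g \<otimes>\<^bsub>F\<^esub> f) c b = 0" by simp
  qed (use f' g in auto)
  show "f \<otimes>\<^bsub>F\<^esub> g \<in> ker"
    unfolding ker_def
  proof (intro CollectI conjI ballI allI)
    fix c b assume c: "c \<in> Conf"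
    have "kern G (f \<otimes>\<^bsub>F\<^esub> g) c b = lin f (\<lambda>u. case pull G u c of None \<Rightarrow> 0 | Some d \<Rightarrow> kern G g d b)"
      using f' g by (simp add: F_simps(2) kern_conv finite_supp)
    also have "\<dots> = 0" using f c by (intro lin_pull_zero) (auto simp: ker_def finite_supp)
    finally show "kern G (f \<otimes>\<^bsub>F\<^esub> g) c b = 0" .
  qed (use f' g in auto)
qed (rule F.ring_axioms)

lemma kern_sum:
  assumes "finite J" "\<And>j. j \<in> J \<Longrightarrow> f j \<in> carrier F"
  shows "kern G (\<lambda>w. \<Sum>j\<in>J. f j w) c b = (\<Sum>j\<in>J. kern G (f j) c b)"
  using assms
proof (induction J)
  case (insert j J)
  have "(\<lambda>w. \<Sum>j\<in>J. f j w) \<in> carrier F"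
    using insert F.finsum_closed[of f J] by (subst finsum_F[symmetric]) auto
  then show ?case using insert by (simp add: kern_add finite_supp)
qed simp

lemma rel_closed:
  assumes "field_rel G H u v" shows "u \<in> carrier F \<and> v \<in> carrier F"
  using assms
proof cases
  case (delta_sum x)
  then show ?thesis by (auto simp: gen_elem_eq_wmono intro!: F.finsum_closed)
qed (auto simp: gen_elem_eq_wmono F_simps(2) conv_wmono intro!: wmono_closed F.zero_closed)

lemma kern_rel:
  assumes "field_rel G H u v" and c: "c \<in> Conf"
  shows "kern G u c b = kern G v c b"
  using assms(1)
proof cases
  case (delta_sum x)
  have "u = (\<lambda>w. \<Sum>g\<in>carrier G. wmono [Delta g x] w)"
    unfolding delta_sum gen_elem_eq_wmono using delta_sum(3) by (intro finsum_F finite_G) auto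
  then have "kern G u c b = (\<Sum>g\<in>carrier G. kern G (wmono [Delta g x]) c b)"
    using delta_sum(3) finite_G by (simp only:) (intro kern_sum, auto)
  also have "\<dots> = (\<Sum>g\<in>carrier G. if g = c x then (if b = c then 1 else 0) else 0)"
    by (intro sum.cong) (auto simp: kern_wmono)
  also have "\<dots> = (if b = c then 1 else 0)" using finite_G Conf_mem[OF c] by simp
  finally show ?thesis by (auto simp: delta_sum F_simps kern_wmono)
next
  case (rho_one l)
  then show ?thesis using Conf_mem[OF c] by (auto simp: gen_elem_eq_wmono F_simps kern_wmono)
next
  case (delta_delta g1 g2 x)
  then show ?thesis by (auto simp: gen_elem_eq_wmono F_simps conv_wmono kern_wmono)
next
  case (rho_rho h1 h2 l)
  then show ?thesis using Conf_mem[OF c]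
    by (auto simp: gen_elem_eq_wmono F_simps conv_wmono kern_wmono inv_mult_group m_assoc cong: if_cong)
next
  case (delta_comm g1 g2 x x')
  then show ?thesis by (auto simp: gen_elem_eq_wmono F_simps conv_wmono kern_wmono)
next
  case (rho_delta_less h g l x)
  have "inv h \<otimes> (h \<otimes> k) = k" "h \<otimes> (inv h \<otimes> k) = k" if "k \<in> carrier G" for k
    using that rho_delta_less by (simp_all add: m_assoc[symmetric])
  then have "inv h \<otimes> c x = g \<longleftrightarrow> c x = h \<otimes> g"
    using rho_delta_less Conf_mem[OF c] by metis
  then show ?thesis using rho_delta_less by (simp add: gen_elem_eq_wmono F_simps conv_wmono kern_wmono)
next
  case (rho_delta_greater h g l x)
  then show ?thesis by (simp add: gen_elem_eq_wmono F_simps conv_wmono kern_wmono)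
next
  case (rho_comm h1 h2 l l')
  \<comment> \<open>To the right of l both bonds act. The left word multiplies by h2^{-1} h1^{-1};
    in the right word h2^{-1} is applied before, and the conjugated label compensates for
    this.\<close>
  have "inv (inv h2 \<otimes> h1 \<otimes> h2) \<otimes> (inv h2 \<otimes> k) = inv h2 \<otimes> (inv h1 \<otimes> k)" if "k \<in> carrier G" for k
  proof -
    have "h2 \<otimes> (inv h2 \<otimes> k) = k" using rho_comm that by (simp add: m_assoc[symmetric])
    then show ?thesis using rho_comm that by (simp add: inv_mult_group m_assoc)
  qed
  then have "pull G [Rho h1 l, Rho h2 l'] c = pull G [Rho h2 l', Rho (inv h2 \<otimes> h1 \<otimes> h2) l] c"
    using rho_comm Conf_mem[OF c] by (auto simp: fun_eq_iff)
  then show ?thesis using rho_comm by (simp add: gen_elem_eq_wmono F_simps(2) conv_wmono kern_wmono del: pull.simps)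
qed

lemma gens_closed: "{u \<ominus>\<^bsub>F\<^esub> v | u v. field_rel G H u v} \<subseteq> carrier F"
  using rel_closed by auto

lemma ideal_I: "ideal I F"
  unfolding field_ideal_def by (rule F.genideal_ideal[OF gens_closed])

lemma I_subset_ker: "I \<subseteq> ker"
  unfolding field_ideal_def
proof (rule F.genideal_minimal[OF ideal_ker])
  have "u \<ominus>\<^bsub>F\<^esub> v \<in> ker" if uv: "field_rel G H u v" for u v
    using rel_closed[OF uv] kern_rel[OF uv] by (simp add: ker_def kern_diff)
  then show "{u \<ominus>\<^bsub>F\<^esub> v | u v. field_rel G H u v} \<subseteq> ker" by blast
qed

sublocale L: alg_ideal F I
  by (rule alg_ideal.intro[OF F.star_alg_axioms ideal_I])

lemma rel_eq:
  assumes "field_rel G H u v" shows "I +>\<^bsub>F\<^esub> u = I +>\<^bsub>F\<^esub> v"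
proof -
  have "u \<ominus>\<^bsub>F\<^esub> v \<in> {u \<ominus>\<^bsub>F\<^esub> v | u v. field_rel G H u v}" using assms by blast
  then have "u \<ominus>\<^bsub>F\<^esub> v \<in> I" unfolding field_ideal_def using F.genideal_self[OF gens_closed] by (rule subsetD[rotated])
  then show ?thesis using rel_closed[OF assms] L.q_eq_iff[of u v] by blast
qed

section \<open>Rewriting words in the quotient\<close>

abbreviation q where "q f \<equiv> I +>\<^bsub>F\<^esub> f"
abbreviation W where "W w \<equiv> q (wmono w)"

lemma wmono_append: "wmono (u @ v) = wmono u \<otimes>\<^bsub>F\<^esub> wmono v"
  by (simp add: F_simps(2) conv_wmono)

text \<open>Classes multiply like words, so a relation may be applied inside any word. The
  reductions below have this form, with prefix and suffix written out even where they are
  empty.\<close>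

lemma W_context:
  assumes "W u = W v" "u \<in> lists X" "v \<in> lists X" "x \<in> lists X" "y \<in> lists X"
  shows "W (x @ u @ y) = W (x @ v @ y)"
proof -
  have "W (x @ w @ y) = W x \<otimes>\<^bsub>L.Q\<^esub> (W w \<otimes>\<^bsub>L.Q\<^esub> W y)" if "w \<in> lists X" for w
    using that assms by (simp add: wmono_append L.mult_q)
  then show ?thesis using assms by simp
qed

lemma W_context_zero:
  assumes "W u = q \<zero>\<^bsub>F\<^esub>" "u \<in> lists X" "x \<in> lists X" "y \<in> lists X"
  shows "W (x @ u @ y) = q \<zero>\<^bsub>F\<^esub>"
proof -
  have "W (x @ u @ y) = W x \<otimes>\<^bsub>L.Q\<^esub> (W u \<otimes>\<^bsub>L.Q\<^esub> W y)"
    using assms(2-4) by (simp add: wmono_append L.mult_q)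
  also have "\<dots> = q (wmono x \<otimes>\<^bsub>F\<^esub> (\<zero>\<^bsub>F\<^esub> \<otimes>\<^bsub>F\<^esub> wmono y))"
    unfolding assms(1) using assms by (simp add: L.mult_q)
  finally show ?thesis using assms by simp
qed

lemma W_rels:
  shows W_dd: "g1 \<in> carrier G \<Longrightarrow> g2 \<in> carrier G \<Longrightarrow> x \<in> \<int> \<Longrightarrow>
      W [Delta g1 x, Delta g2 x] = (if g1 = g2 then W [Delta g1 x] else q \<zero>\<^bsub>F\<^esub>)"
    and W_r_one: "l \<in> half_odd \<Longrightarrow> W [Rho \<one> l] = W []"
    and W_rr: "h1 \<in> H \<Longrightarrow> h2 \<in> H \<Longrightarrow> l \<in> half_odd \<Longrightarrow> W [Rho h1 l, Rho h2 l] = W [Rho (h1 \<otimes> h2) l]"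
    and W_dd_comm: "g1 \<in> carrier G \<Longrightarrow> g2 \<in> carrier G \<Longrightarrow> x \<in> \<int> \<Longrightarrow> x' \<in> \<int> \<Longrightarrow>
      W [Delta g1 x, Delta g2 x'] = W [Delta g2 x', Delta g1 x]"
    and W_rd_less: "h \<in> H \<Longrightarrow> g \<in> carrier G \<Longrightarrow> l \<in> half_odd \<Longrightarrow> x \<in> \<int> \<Longrightarrow> l < x \<Longrightarrow>
      W [Rho h l, Delta g x] = W [Delta (h \<otimes> g) x, Rho h l]"
    and W_rd_greater: "h \<in> H \<Longrightarrow> g \<in> carrier G \<Longrightarrow> l \<in> half_odd \<Longrightarrow> x \<in> \<int> \<Longrightarrow> x < l \<Longrightarrow>
      W [Rho h l, Delta g x] = W [Delta g x, Rho h l]"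
    and W_rr_comm: "h1 \<in> H \<Longrightarrow> h2 \<in> H \<Longrightarrow> l \<in> half_odd \<Longrightarrow> l' \<in> half_odd \<Longrightarrow> l' < l \<Longrightarrow>
      W [Rho h1 l, Rho h2 l'] = W [Rho h2 l', Rho (inv h2 \<otimes> h1 \<otimes> h2) l]"
  using rel_eq[OF field_rel.delta_delta[of g1 G g2 x H]] rel_eq[OF field_rel.rho_one[of l G H]]
    rel_eq[OF field_rel.rho_rho[of h1 H h2 l G]] rel_eq[OF field_rel.delta_comm[of g1 G g2 x x' H]]
    rel_eq[OF field_rel.rho_delta_less[of h H g G l x]] rel_eq[OF field_rel.rho_delta_greater[of h H g G l x]]
    rel_eq[OF field_rel.rho_comm[of h1 H h2 l l' G]]
  by (simp_all add: gen_elem_eq_wmono F_simps(2,3) conv_wmono split: if_splits)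

text \<open>Otherwise 1/2 would be an integer. A bond is therefore strictly on one side of a site,
  and the two relations between \<rho> and \<delta> exhaust all cases.\<close>

lemma int_half_odd_neq: "x \<in> \<int> \<Longrightarrow> l \<in> half_odd \<Longrightarrow> l \<noteq> x"
proof
  assume "x \<in> \<int>" "l \<in> half_odd" "l = x"
  then have "(1/2 :: rat) \<in> \<int>" using Ints_diff[of x "l - 1/2"] by (simp add: half_odd_def)
  then obtain i where "(1/2 :: rat) = of_int i" by (auto elim: Ints_cases)
  then have "(1 :: rat) = of_int (2 * i)" by simp
  then have "1 = 2 * i" by (metis of_int_1 of_int_eq_iff)
  then show False by presburger
qed

subsection \<open>Normal forms\<close>

definition dw :: "(rat \<Rightarrow> 'a) \<Rightarrow> rat list \<Rightarrow> 'a field_gen list" where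
  "dw c xs = map (\<lambda>x. Delta (c x) x) xs"

text \<open>Each site x is paired with the bond x - 1/2 on its left, so that one list of sites
  enumerates the generators of both kinds in an interval.\<close>

definition rw :: "(rat \<Rightarrow> 'a) \<Rightarrow> rat list \<Rightarrow> 'a field_gen list" where
  "rw k xs = map (\<lambda>x. Rho (k x) (x - 1/2)) xs"

definition KH :: "(rat \<Rightarrow> 'a) set" where
  "KH = {k. \<forall>x. k x \<in> H}"

lemma KH_D: "k \<in> KH \<Longrightarrow> k x \<in> H"
  by (simp add: KH_def)

lemma dw_lists: "c \<in> Conf \<Longrightarrow> set xs \<subseteq> \<int> \<Longrightarrow> dw c xs \<in> lists X"
  by (auto simp: dw_def in_lists_conv_set Conf_mem)

lemma half_odd_minus [simp]: "x \<in> \<int> \<Longrightarrow> x - 1/2 \<in> half_odd"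
  by (simp add: half_odd_def)

lemma rw_lists: "k \<in> KH \<Longrightarrow> set xs \<subseteq> \<int> \<Longrightarrow> rw k xs \<in> lists X"
  by (auto simp: rw_def in_lists_conv_set KH_D subset_iff)

lemma dw_Cons [simp]: "dw c (x # xs) = Delta (c x) x # dw c xs"
  and dw_Nil [simp]: "dw c [] = []"
  and rw_Cons [simp]: "rw k (x # xs) = Rho (k x) (x - 1/2) # rw k xs"
  and rw_Nil [simp]: "rw k [] = []"
  by (simp_all add: dw_def rw_def)

text \<open>The letter commutes past the projections at other sites until it meets the one at y,
  which absorbs or annihilates it.\<close>

lemma W_delta_dw:
  assumes "distinct xs" "set xs \<subseteq> \<int>" "y \<in> set xs" "c \<in> Conf" "g \<in> carrier G"
  shows "W (Delta g y # dw c xs) = (if c y = g then W (dw c xs) else q \<zero>\<^bsub>F\<^esub>)"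
  using assms(1-3)
proof (induction xs)
  case (Cons x xs)
  have xs: "dw c xs \<in> lists X" using Cons.prems assms by (intro dw_lists) auto
  have x: "x \<in> \<int>" "c x \<in> carrier G" using Cons.prems assms(4) by (auto simp: Conf_mem)
  show ?case
  proof (cases "y = x")
    case True
    show ?thesis
    proof (cases "c y = g")
      case True
      then have "W ([] @ [Delta g y, Delta (c x) x] @ dw c xs) = W ([] @ [Delta g y] @ dw c xs)"
        using \<open>y = x\<close> x xs by (intro W_context) (auto simp: W_dd)
      then show ?thesis using True \<open>y = x\<close> by simp
    next
      case False
      then have "W ([] @ [Delta g y, Delta (c x) x] @ dw c xs) = q \<zero>\<^bsub>F\<^esub>"
        using \<open>y = x\<close> x xs assms(5) by (intro W_context_zero) (auto simp: W_dd)
      then show ?thesis using False \<open>y = x\<close> by simp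
    qed
  next
    case False
    then have y: "y \<in> set xs" "y \<in> \<int>" using Cons by auto
    have IH: "W (Delta g y # dw c xs) = (if c y = g then W (dw c xs) else q \<zero>\<^bsub>F\<^esub>)"
      using Cons y by auto
    have "W ([] @ [Delta g y, Delta (c x) x] @ dw c xs) = W ([] @ [Delta (c x) x, Delta g y] @ dw c xs)"
      using x y xs assms(5) by (intro W_context) (auto simp: W_dd_comm)
    then have 1: "W (Delta g y # dw c (x # xs)) = W ([Delta (c x) x] @ (Delta g y # dw c xs) @ [])" by simp
    show ?thesis
    proof (cases "c y = g")
      case True
      have "W ([Delta (c x) x] @ (Delta g y # dw c xs) @ []) = W ([Delta (c x) x] @ dw c xs @ [])"
        using IH True x y xs assms(5) by (intro W_context) auto
      then show ?thesis using 1 True by simp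
    next
      case False
      have "W ([Delta (c x) x] @ (Delta g y # dw c xs) @ []) = q \<zero>\<^bsub>F\<^esub>"
        using IH False x y xs assms(5) by (intro W_context_zero) auto
      then show ?thesis using 1 False by simp
    qed
  qed
qed simp

definition shift :: "'a \<Rightarrow> rat \<Rightarrow> (rat \<Rightarrow> 'a) \<Rightarrow> rat \<Rightarrow> 'a" where
  "shift h l c = (\<lambda>y. if l < y then h \<otimes> c y else c y)"

lemma shift_Conf: "h \<in> H \<Longrightarrow> c \<in> Conf \<Longrightarrow> shift h l c \<in> Conf"
  by (auto simp: Conf_def shift_def)

text \<open>Since a bond never coincides with a site, one of the two \<rho>-\<delta> relations
  applies at each letter; \<open>shift\<close> records both outcomes at once.\<close>

lemma W_rho_dw:
  assumes "set xs \<subseteq> \<int>" "c \<in> Conf" "h \<in> H" "l \<in> half_odd"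
  shows "W (Rho h l # dw c xs) = W (dw (shift h l c) xs @ [Rho h l])"
  using assms(1)
proof (induction xs)
  case (Cons x xs)
  have xs: "dw c xs \<in> lists X" "dw (shift h l c) xs \<in> lists X"
    using Cons.prems assms by (intro dw_lists shift_Conf; simp)+
  have x: "x \<in> \<int>" "c x \<in> carrier G" "shift h l c x \<in> carrier G"
    using Cons.prems Conf_mem[OF assms(2)] Conf_mem[OF shift_Conf[OF assms(3,2)]] by auto
  have "l < x \<or> x < l" using int_half_odd_neq[OF x(1) assms(4)] by auto
  then have rel: "W [Rho h l, Delta (c x) x] = W [Delta (shift h l c x) x, Rho h l]"
    using W_rd_less[of h "c x" l x] W_rd_greater[of h "c x" l x] assms x by (auto simp: shift_def)
  have "W ([] @ [Rho h l, Delta (c x) x] @ dw c xs) = W ([] @ [Delta (shift h l c x) x, Rho h l] @ dw c xs)"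
    using rel x xs assms by (intro W_context) auto
  also have "\<dots> = W ([Delta (shift h l c x) x] @ (Rho h l # dw c xs) @ [])" by simp
  also have "\<dots> = W ([Delta (shift h l c x) x] @ (dw (shift h l c) xs @ [Rho h l]) @ [])"
    using Cons xs x assms by (intro W_context) auto
  finally show ?case by simp
qed simp

text \<open>Strictly increasing lists of integers. The gap is written as 1 so that linear arithmetic
  sees that the bond y - 1/2 of a later site y lies to the right of x.\<close>

definition sites_list :: "rat list \<Rightarrow> bool" where
  "sites_list xs \<longleftrightarrow> set xs \<subseteq> \<int> \<and> sorted_wrt (\<lambda>x y. x + 1 \<le> y) xs"

lemma sites_Cons: "sites_list (x # xs) \<longleftrightarrow> x \<in> \<int> \<and> (\<forall>y\<in>set xs. x + 1 \<le> y) \<and> sites_list xs"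
  by (auto simp: sites_list_def)

lemma sites_distinct: "sites_list xs \<Longrightarrow> distinct xs"
proof (induction xs)
  case (Cons x xs)
  then show ?case by (force simp: sites_Cons)
qed simp

lemma sites_ints: "sites_list xs \<Longrightarrow> set xs \<subseteq> \<int>"
  by (simp add: sites_list_def)

text \<open>Passing an earlier bond conjugates h, hence h is arbitrary in the induction. The last
  clause guarantees that the labels of the bonds already passed survive in k'.\<close>

lemma W_rho_rw:
  assumes "sites_list xs" "y \<in> set xs" "k \<in> KH" "h \<in> H"
  shows "\<exists>k'\<in>KH. W (Rho h (y - 1/2) # rw k xs) = W (rw k' xs) \<and> (\<forall>x. x \<notin> set xs \<longrightarrow> k' x = k x)"
  using assms(1,2,4)
proof (induction xs arbitrary: h)
  case (Cons x xs)
  have kx: "k x \<in> H" using assms KH_D by blast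
  have xs: "sites_list xs" "x \<in> \<int>" "x \<notin> set xs" "set xs \<subseteq> \<int>"
    using Cons.prems sites_distinct[OF Cons.prems(1)] by (auto simp: sites_Cons sites_ints)
  have lk: "rw k xs \<in> lists X" using assms xs by (intro rw_lists)
  show ?case
  proof (cases "y = x")
    case True
    let ?k = "k(x := h \<otimes> k x)"
    have "W ([] @ [Rho h (y - 1/2), Rho (k x) (x - 1/2)] @ rw k xs) = W ([] @ [Rho (h \<otimes> k x) (x - 1/2)] @ rw k xs)"
      using True xs lk kx Cons.prems(3) by (intro W_context) (auto simp: W_rr)
    then have f1: "W (Rho h (y - 1/2) # rw k (x # xs)) = W (Rho (h \<otimes> k x) (x - 1/2) # rw k xs)" by simp
    have "rw ?k xs = rw k xs" using xs(3) by (auto simp: rw_def)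
    then have f2: "rw ?k (x # xs) = Rho (h \<otimes> k x) (x - 1/2) # rw k xs" by simp
    have eq: "W (Rho h (y - 1/2) # rw k (x # xs)) = W (rw ?k (x # xs))"
      unfolding f2 by (rule f1)
    have "?k \<in> KH" using assms(3) kx Cons.prems(3) by (auto simp: KH_def)
    moreover have "\<forall>z. z \<notin> set (x # xs) \<longrightarrow> ?k z = k z" by simp
    ultimately show ?thesis using eq by blast
  next
    case False
    then have y: "y \<in> set xs" "y \<in> \<int>" "x + 1 \<le> y" using Cons.prems xs by (auto simp: sites_Cons)
    let ?h = "inv (k x) \<otimes> h \<otimes> k x"
    have h: "?h \<in> H" using kx Cons.prems(3) by auto
    obtain k' where k': "k' \<in> KH" "W (Rho ?h (y - 1/2) # rw k xs) = W (rw k' xs)"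
      "\<And>x. x \<notin> set xs \<Longrightarrow> k' x = k x"
      using Cons.IH[OF xs(1) y(1) h] by blast
    have "W ([] @ [Rho h (y - 1/2), Rho (k x) (x - 1/2)] @ rw k xs) =
        W ([] @ [Rho (k x) (x - 1/2), Rho ?h (y - 1/2)] @ rw k xs)"
      using xs lk y kx h Cons.prems(3) by (intro W_context W_rr_comm) auto
    also have "\<dots> = W ([Rho (k x) (x - 1/2)] @ (Rho ?h (y - 1/2) # rw k xs) @ [])" by simp
    also have "\<dots> = W ([Rho (k x) (x - 1/2)] @ rw k' xs @ [])"
      using xs lk rw_lists[OF k'(1) xs(4)] y kx h k'(2) by (intro W_context) auto
    finally show ?thesis using k' xs(3) by (intro bexI[of _ k']) auto
  qed
qed simp

section \<open>Spanning by normal forms\<close>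

lemma F_induct [consumes 2, case_names zero step]:
  assumes f: "f \<in> carrier F" "{w. f w \<noteq> 0} \<subseteq> S"
    and zero: "P (\<lambda>w. 0)"
    and step: "\<And>f w k. f \<in> carrier F \<Longrightarrow> P f \<Longrightarrow> w \<in> S \<Longrightarrow> w \<in> lists X \<Longrightarrow> P (f \<oplus>\<^bsub>F\<^esub> k \<odot>\<^bsub>F\<^esub> wmono w)"
  shows "P f"
proof -
  have "\<forall>f\<in>carrier F. {w. f w \<noteq> 0} \<subseteq> A \<longrightarrow> P f" if "finite A" "A \<subseteq> S \<inter> lists X" for A
    using that
  proof (induction A)
    case empty
    have "f = (\<lambda>w. 0)" if "{w. f w \<noteq> 0} \<subseteq> {}" for f :: "'a field_gen list \<Rightarrow> complex" using that by auto
    then show ?case using zero by metis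
  next
    case (insert u A)
    show ?case
    proof (intro ballI impI)
      fix f assume f: "f \<in> carrier F" "{w. f w \<noteq> 0} \<subseteq> insert u A"
      define g where "g = f(u := 0)"
      have g: "g \<in> carrier F" "{w. g w \<noteq> 0} \<subseteq> A"
      proof -
        have sub: "{w. g w \<noteq> 0} \<subseteq> {w. f w \<noteq> 0}" by (auto simp: g_def)
        with f show "g \<in> carrier F" using finite_subset[OF sub] by (auto simp: F_simps(1))
        show "{w. g w \<noteq> 0} \<subseteq> A" using f by (auto simp: g_def)
      qed
      have "f = g \<oplus>\<^bsub>F\<^esub> f u \<odot>\<^bsub>F\<^esub> wmono u"
        by (auto simp: g_def F_simps wmono_def)
      moreover have "P g" using insert g by auto
      ultimately show "P f" using step[OF g(1), of u "f u"] insert by auto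
    qed
  qed
  then show ?thesis using f by (auto simp: F_simps(1))
qed

text \<open>The preimage under the quotient map of the linear span of the words in S.\<close>

definition Span :: "'a field_gen list set \<Rightarrow> ('a field_gen list \<Rightarrow> complex) set" where
  "Span S = {f \<in> carrier F. \<exists>a\<in>carrier F. {w. a w \<noteq> 0} \<subseteq> S \<and> q f = q a}"

lemma Span_closed: "f \<in> Span S \<Longrightarrow> f \<in> carrier F"
  by (simp add: Span_def)

lemma Span_base: "f \<in> carrier F \<Longrightarrow> {w. f w \<noteq> 0} \<subseteq> S \<Longrightarrow> f \<in> Span S"
  by (auto simp: Span_def)

lemma Span_cong: "g \<in> Span S \<Longrightarrow> f \<in> carrier F \<Longrightarrow> q f = q g \<Longrightarrow> f \<in> Span S"
  by (auto simp: Span_def)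

lemma Span_wmono: "w \<in> S \<Longrightarrow> w \<in> lists X \<Longrightarrow> wmono w \<in> Span S"
  by (rule Span_base, simp, auto simp: wmono_def)

lemma Span_zero: "\<zero>\<^bsub>F\<^esub> \<in> Span S"
  by (rule Span_base, simp) (auto simp: F_simps(4))

lemma Span_add:
  assumes "f \<in> Span S" "g \<in> Span S" shows "f \<oplus>\<^bsub>F\<^esub> g \<in> Span S"
proof -
  obtain a b where a: "a \<in> carrier F" "{w. a w \<noteq> 0} \<subseteq> S" "q f = q a"
    and b: "b \<in> carrier F" "{w. b w \<noteq> 0} \<subseteq> S" "q g = q b" using assms by (auto simp: Span_def)
  have "q (f \<oplus>\<^bsub>F\<^esub> g) = q (a \<oplus>\<^bsub>F\<^esub> b)"
    using a b assms Span_closed by (metis L.add_q)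
  moreover have "{w. (a \<oplus>\<^bsub>F\<^esub> b) w \<noteq> 0} \<subseteq> {w. a w \<noteq> 0} \<union> {w. b w \<noteq> 0}" by (auto simp: F_simps(5))
  then have "{w. (a \<oplus>\<^bsub>F\<^esub> b) w \<noteq> 0} \<subseteq> S" using a(2) b(2) by blast
  ultimately show ?thesis using a(1) b(1) assms[THEN Span_closed] unfolding Span_def by blast
qed

lemma Span_smult:
  assumes "f \<in> Span S" shows "k \<odot>\<^bsub>F\<^esub> f \<in> Span S"
proof -
  obtain a where a: "a \<in> carrier F" "{w. a w \<noteq> 0} \<subseteq> S" "q f = q a"
    using assms by (auto simp: Span_def)
  have "q (k \<odot>\<^bsub>F\<^esub> f) = q (k \<odot>\<^bsub>F\<^esub> a)"
    using a assms Span_closed by (metis L.smult_q)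
  moreover have "{w. (k \<odot>\<^bsub>F\<^esub> a) w \<noteq> 0} \<subseteq> S" using a(2) by (auto simp: F_simps(6))
  ultimately show ?thesis using a assms Span_closed unfolding Span_def by blast
qed

lemma Span_finsum:
  assumes "finite J" "\<And>j. j \<in> J \<Longrightarrow> f j \<in> Span S" shows "(\<Oplus>\<^bsub>F\<^esub>j\<in>J. f j) \<in> Span S"
  using assms
proof (induction J)
  case (insert j J)
  then show ?case by (subst F.finsum_insert) (auto simp: Span_closed[of _ S] Span_add)
qed (simp add: Span_zero)

lemma Span_linear:
  assumes f: "f \<in> carrier F" "{w. f w \<noteq> 0} \<subseteq> S" and S: "\<And>w. w \<in> S \<Longrightarrow> w \<in> lists X \<Longrightarrow> wmono w \<in> Span T"
  shows "f \<in> Span T"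
  using f
proof (induction rule: F_induct)
  case zero
  then show ?case using Span_zero by (simp add: F_simps(4))
next
  case (step f w k)
  then show ?case by (intro Span_add Span_smult S)
qed

lemma Span_trans:
  assumes f: "f \<in> Span S" and S: "\<And>w. w \<in> S \<Longrightarrow> w \<in> lists X \<Longrightarrow> wmono w \<in> Span T"
  shows "f \<in> Span T"
proof -
  obtain a where a: "a \<in> carrier F" "{w. a w \<noteq> 0} \<subseteq> S" "q f = q a"
    using f by (auto simp: Span_def)
  have "a \<in> Span T" by (rule Span_linear[OF a(1,2) S])
  then show ?thesis by (rule Span_cong[OF _ Span_closed[OF f] a(3)])
qed

text \<open>The relation \<Sum>_g \<delta>_g(x) = I is inserted once for each site.\<close>

lemma one_in_Span_dw:
  assumes "set xs \<subseteq> \<int>" "distinct xs"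
  shows "wmono [] \<in> Span {dw c xs | c. c \<in> Conf}"
  using assms
proof (induction xs)
  case Nil
  have "(\<lambda>_. \<one>) \<in> Conf" by (simp add: Conf_def)
  then show ?case by (intro Span_wmono) auto
next
  case (Cons x xs)
  show ?case
  proof (rule Span_trans[OF Cons.IH])
    fix w assume "w \<in> {dw c xs | c. c \<in> Conf}" and wX: "w \<in> lists X"
    then obtain c where c: "c \<in> Conf" "w = dw c xs" by blast
    have x: "x \<in> \<int>" "x \<notin> set xs" using Cons by auto
    let ?s = "\<Oplus>\<^bsub>F\<^esub>g\<in>carrier G. wmono [Delta g x]"
    have s: "?s \<in> carrier F" using x by (intro F.finsum_closed) auto
    have "q ?s = q \<one>\<^bsub>F\<^esub>"
      using rel_eq[OF field_rel.delta_sum[OF x(1)]] by (simp add: gen_elem_eq_wmono)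
    then have "q (?s \<otimes>\<^bsub>F\<^esub> wmono w) = q (\<one>\<^bsub>F\<^esub> \<otimes>\<^bsub>F\<^esub> wmono w)"
      using s wX by (simp only: L.mult_q[symmetric] wmono_closed F.one_closed)
    then have eq: "q (wmono w) = q (?s \<otimes>\<^bsub>F\<^esub> wmono w)" using wX by simp
    have "?s \<otimes>\<^bsub>F\<^esub> wmono w = (\<Oplus>\<^bsub>F\<^esub>g\<in>carrier G. wmono [Delta g x] \<otimes>\<^bsub>F\<^esub> wmono w)"
      using x wX finite_G by (intro F.finsum_ldistr) auto
    also have "\<dots> \<in> Span {dw c (x # xs) | c. c \<in> Conf}"
    proof (rule Span_finsum[OF finite_G])
      fix g assume g: "g \<in> carrier G"
      \<comment> \<open>x is not among the remaining sites, so a new label at x leaves the rest of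
        the word alone.\<close>
      have "dw (c(x := g)) xs = dw c xs" using x(2) by (auto simp: dw_def)
      then have "Delta g x # w = dw (c(x := g)) (x # xs)" using c by simp
      moreover have "c(x := g) \<in> Conf" using c g unfolding Conf_def by (simp)
      ultimately have "Delta g x # w \<in> {dw c (x # xs) | c. c \<in> Conf}" by blast
      then show "wmono [Delta g x] \<otimes>\<^bsub>F\<^esub> wmono w \<in> Span {dw c (x # xs) | c. c \<in> Conf}"
        using g x wX by (simp add: wmono_append[symmetric] Span_wmono)
    qed
    finally show "wmono w \<in> Span {dw c (x # xs) | c. c \<in> Conf}"
      using Span_cong eq wX by blast
  qed (use Cons in auto)
qed

text \<open>Every site and every bond of the list occurs, with \<rho>_1 written out. All normal
  forms over xs thus have the same shape and can be compared letter by letter.\<close>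

definition NF :: "rat list \<Rightarrow> 'a field_gen list set" where
  "NF xs = {dw c xs @ rw k xs | c k. c \<in> Conf \<and> k \<in> KH}"

lemma NF_lists: "sites_list xs \<Longrightarrow> w \<in> NF xs \<Longrightarrow> w \<in> lists X"
proof -
  assume xs: "sites_list xs" and "w \<in> NF xs"
  then obtain c k where "c \<in> Conf" "k \<in> KH" "w = dw c xs @ rw k xs" by (auto simp: NF_def)
  then show ?thesis using dw_lists rw_lists sites_ints[OF xs] by simp
qed

lemma finite_NF: "finite (NF xs)"
proof (rule finite_subset)
  let ?A = "(\<lambda>(g, x). Delta g x) ` (carrier G \<times> set xs) \<union> (\<lambda>(h, x). Rho h (x - 1/2)) ` (H \<times> set xs)"
  show "NF xs \<subseteq> {w. set w \<subseteq> ?A \<and> length w = length xs + length xs}"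
    by (auto simp: NF_def dw_def rw_def image_iff KH_D Conf_mem)
  show "finite {w. set w \<subseteq> ?A \<and> length w = length xs + length xs}"
    using finite_G finite_H by (intro finite_lists_length_eq) auto
qed

lemma W_rw_one: "set xs \<subseteq> \<int> \<Longrightarrow> W (rw (\<lambda>_. \<one>) xs) = W []"
proof (induction xs)
  case (Cons x xs)
  have "rw (\<lambda>_. \<one>) xs \<in> lists X" using Cons.prems by (intro rw_lists) (auto simp: KH_def)
  then have "W ([] @ [Rho \<one> (x - 1/2)] @ rw (\<lambda>_. \<one>) xs) = W ([] @ [] @ rw (\<lambda>_. \<one>) xs)"
    using Cons.prems by (intro W_context) (auto simp: W_r_one)
  then show ?case using Cons by simp
qed simp

lemma one_in_Span_NF:
  assumes xs: "sites_list xs" shows "wmono [] \<in> Span (NF xs)"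
proof (rule Span_trans[OF one_in_Span_dw])
  fix w assume "w \<in> {dw c xs | c. c \<in> Conf}" and w: "w \<in> lists X"
  then obtain c where c: "c \<in> Conf" "w = dw c xs" by blast
  have 1: "(\<lambda>_. \<one>) \<in> KH" by (simp add: KH_def)
  have "W (w @ rw (\<lambda>_. \<one>) xs @ []) = W (w @ [] @ [])"
    using W_rw_one[OF sites_ints[OF xs]] w 1 rw_lists sites_ints[OF xs] by (intro W_context) auto
  moreover have "w @ rw (\<lambda>_. \<one>) xs \<in> NF xs" using c 1 by (auto simp: NF_def)
  ultimately show "wmono w \<in> Span (NF xs)"
    using Span_cong[OF Span_wmono[OF _ NF_lists[OF xs]]] w by (metis append_Nil2 wmono_closed)
qed (use sites_distinct sites_ints xs in auto)

text \<open>A \<delta> is absorbed or gives zero in the \<delta> part. A \<rho> first crosses the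
  \<delta> part, shifting its labels, and is then merged into the \<rho> part; both parts keep their
  shape.\<close>

lemma letter_NF:
  assumes xs: "sites_list xs" and a: "a = Delta g x \<and> g \<in> carrier G \<and> x \<in> set xs \<or>
      a = Rho h (x - 1/2) \<and> h \<in> H \<and> x \<in> set xs" and w: "w \<in> NF xs"
  shows "wmono (a # w) \<in> Span (NF xs)"
proof -
  obtain c k where ck: "c \<in> Conf" "k \<in> KH" "w = dw c xs @ rw k xs" using w by (auto simp: NF_def)
  have l: "dw c xs \<in> lists X" "rw k xs \<in> lists X" "set xs \<subseteq> \<int>"
    using ck sites_ints[OF xs] dw_lists rw_lists by auto
  have wX: "w \<in> lists X" by (rule NF_lists[OF xs w])
  from a show ?thesis
  proof
    assume a: "a = Delta g x \<and> g \<in> carrier G \<and> x \<in> set xs"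
    then have aX: "a \<in> X" using l by auto
    have D: "W (Delta g x # dw c xs) = (if c x = g then W (dw c xs) else q \<zero>\<^bsub>F\<^esub>)"
      using a W_delta_dw[OF sites_distinct[OF xs] l(3) _ ck(1)] by blast
    show ?thesis
    proof (cases "c x = g")
      case True
      have "W ([] @ (a # dw c xs) @ rw k xs) = W ([] @ dw c xs @ rw k xs)"
        using D True a l aX by (intro W_context) auto
      then show ?thesis using Span_cong[OF Span_wmono[OF w wX], of "wmono (a # w)"] wX aX ck by auto
    next
      case False
      have "W ([] @ (a # dw c xs) @ rw k xs) = q \<zero>\<^bsub>F\<^esub>"
        using D False a l aX by (intro W_context_zero) auto
      then show ?thesis using Span_cong[OF Span_zero, of "wmono (a # w)"] wX aX ck by auto
    qed
  next
    assume a: "a = Rho h (x - 1/2) \<and> h \<in> H \<and> x \<in> set xs"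
    then have aX: "a \<in> X" using l by auto
    let ?c = "shift h (x - 1/2) c"
    have c: "?c \<in> Conf" using a ck shift_Conf by blast
    then have lc: "dw ?c xs \<in> lists X" using l dw_lists by blast
    obtain k' where k': "k' \<in> KH" "W (a # rw k xs) = W (rw k' xs)"
      using W_rho_rw[OF xs _ ck(2), of x h] a by blast
    have lk: "rw k' xs \<in> lists X" using k' l rw_lists by blast
    have "W ([] @ (a # dw c xs) @ rw k xs) = W ([] @ (dw ?c xs @ [a]) @ rw k xs)"
      using W_rho_dw[OF l(3) ck(1)] a l lc aX by (intro W_context) auto
    also have "\<dots> = W (dw ?c xs @ (a # rw k xs) @ [])" by simp
    also have "\<dots> = W (dw ?c xs @ rw k' xs @ [])"
      using k' l lc lk aX by (intro W_context) auto
    finally have eq: "W (a # w) = W (dw ?c xs @ rw k' xs)" using ck by simp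
    have n: "dw ?c xs @ rw k' xs \<in> NF xs" using c k'(1) unfolding NF_def by blast
    have "wmono (a # w) \<in> carrier F" using wX aX by simp
    then show ?thesis by (rule Span_cong[OF Span_wmono[OF n NF_lists[OF xs n]] _ eq])
  qed
qed

definition gens_on :: "rat list \<Rightarrow> 'a field_gen set" where
  "gens_on xs = {Delta g x | g x. g \<in> carrier G \<and> x \<in> set xs} \<union> {Rho h (x - 1/2) | h x. h \<in> H \<and> x \<in> set xs}"

lemma gens_on_X: "sites_list xs \<Longrightarrow> gens_on xs \<subseteq> X"
proof
  fix a assume xs: "sites_list xs" and "a \<in> gens_on xs"
  then consider (Delta) g x where "a = Delta g x" "g \<in> carrier G" "x \<in> set xs"
    | (Rho) h x where "a = Rho h (x - 1/2)" "h \<in> H" "x \<in> set xs"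
    unfolding gens_on_def by blast
  then show "a \<in> X"
  proof cases
    case Delta
    then show ?thesis using sites_ints[OF xs] by auto
  next
    case Rho
    then show ?thesis using half_odd_minus[of x] sites_ints[OF xs] by auto
  qed
qed

lemma word_in_Span_NF:
  assumes xs: "sites_list xs" and w: "w \<in> lists (gens_on xs)"
  shows "wmono w \<in> Span (NF xs)"
  using w
proof (induction w)
  case Nil
  then show ?case by (rule one_in_Span_NF[OF xs])
next
  case (Cons a w)
  have aX: "a \<in> X" "w \<in> lists X" using Cons gens_on_X[OF xs] by auto
  obtain f where f: "f \<in> carrier F" "{w. f w \<noteq> 0} \<subseteq> NF xs" "W w = q f"
    using Cons.IH by (auto simp: Span_def)
  have "wmono [a] \<otimes>\<^bsub>F\<^esub> f \<in> Span (NF xs)"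
    using f(1,2)
  proof (induction rule: F_induct)
    case zero
    have "wmono [a] \<otimes>\<^bsub>F\<^esub> \<zero>\<^bsub>F\<^esub> = \<zero>\<^bsub>F\<^esub>" using aX by (intro F.r_null) auto
    then show ?case using Span_zero by (simp add: F_simps(4))
  next
    case (step f w k)
    have w: "w \<in> NF xs" using step by blast
    have "wmono (a # w) \<in> Span (NF xs)"
      using Cons.hyps letter_NF[OF xs _ w] by (auto simp: gens_on_def)
    moreover have "wmono [a] \<otimes>\<^bsub>F\<^esub> (f \<oplus>\<^bsub>F\<^esub> k \<odot>\<^bsub>F\<^esub> wmono w) = (wmono [a] \<otimes>\<^bsub>F\<^esub> f) \<oplus>\<^bsub>F\<^esub> k \<odot>\<^bsub>F\<^esub> wmono (a # w)"
      using step aX wmono_append[of "[a]" w] by (simp add: F.r_distr F.smult_mult_r)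
    ultimately show ?case using step by (simp add: Span_add Span_smult)
  qed
  moreover have "wmono (a # w) \<in> carrier F" using aX by simp
  moreover have "W (a # w) = q (wmono [a] \<otimes>\<^bsub>F\<^esub> f)"
    using f aX wmono_append[of "[a]" w] by (simp add: L.mult_q[symmetric])
  ultimately show ?case by (rule Span_cong)
qed

lemma in_Span_NF:
  assumes "sites_list xs" "f \<in> carrier F" "{w. f w \<noteq> 0} \<subseteq> lists (gens_on xs)"
  shows "f \<in> Span (NF xs)"
  by (rule Span_linear[OF assms(2,3)]) (rule word_in_Span_NF[OF assms(1)])

end

section \<open>The intervals as lists of sites\<close>

definition sites :: "nat \<Rightarrow> rat list" where
  "sites n = map of_int [int (n div 2) - int n + 1..int (n div 2)]"

lemma rat_half_le_iff: "rat_of_int a + 1/2 \<le> rat_of_int b \<longleftrightarrow> a + 1 \<le> b"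
proof -
  have "rat_of_int a + 1/2 \<le> rat_of_int b \<longleftrightarrow> rat_of_int (2 * a + 1) \<le> rat_of_int (2 * b)" by (simp add: field_simps)
  also have "\<dots> \<longleftrightarrow> a + 1 \<le> b" unfolding of_int_le_iff by presburger
  finally show ?thesis .
qed

text \<open>For n = 2m both sides are -m + 1, ..., m; for n = 2m + 1 they are -m, ..., m.\<close>

lemma Lambda_Ints: "Lambda n \<inter> \<int> = set (sites n)"
proof -
  define k where "k = int (n div 2)"
  have k: "rat_of_nat (n div 2) = rat_of_int k" by (simp add: k_def)
  have *: "of_int i \<in> Lambda n \<longleftrightarrow> i \<in> {k - int n + 1..k}" for i
  proof (cases "even n")
    case True
    then have n: "int n = 2 * k" unfolding k_def by presburger
    have "- rat_of_int k + 1/2 \<le> of_int i \<longleftrightarrow> - k + 1 \<le> i"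
      using rat_half_le_iff[of "- k" i] by simp
    then show ?thesis using True n by (simp add: Lambda_def Let_def k)
  next
    case False
    then have n: "int n = 2 * k + 1" unfolding k_def by presburger
    have "- rat_of_int k - 1/2 \<le> of_int i \<longleftrightarrow> - k \<le> i"
    proof -
      have "- rat_of_int k - 1/2 \<le> of_int i \<longleftrightarrow> rat_of_int (- k - 1) + 1/2 \<le> of_int i"
        unfolding of_int_diff of_int_minus of_int_1 by (rule iffI) linarith+
      then show ?thesis unfolding rat_half_le_iff by simp
    qed
    then show ?thesis using False n by (simp add: Lambda_def Let_def k)
  qed
  have "Lambda n \<inter> \<int> = of_int ` {i. of_int i \<in> Lambda n}" by (auto simp: Ints_def)
  also have "\<dots> = of_int ` {k - int n + 1..k}" unfolding * Collect_mem_eq ..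
  finally show ?thesis unfolding sites_def k_def[symmetric] by simp
qed

text \<open>In either parity a nonempty interval begins with the bond to the left of its first site
  and ends with a site, so its bonds are its sites moved by 1/2.\<close>

lemma Lambda_half: "Lambda n \<inter> half_odd = (\<lambda>x. x - 1/2) ` set (sites n)"
proof -
  define k where "k = int (n div 2)"
  have k: "rat_of_nat (n div 2) = rat_of_int k" by (simp add: k_def)
  have *: "of_int i - 1/2 \<in> Lambda n \<longleftrightarrow> i \<in> {k - int n + 1..k}" for i
  proof -
    have int: "2 * (rat_of_int i - 1/2) \<in> \<int>"
    proof -
      have "2 * (rat_of_int i - 1/2) = rat_of_int (2 * i - 1)" by simp
      then show ?thesis by (metis Ints_of_int)
    qed
    have up: "rat_of_int i - 1/2 \<le> of_int k \<longleftrightarrow> i \<le> k"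
      using rat_half_le_iff[of "i - 1" k] by simp
    show ?thesis
    proof (cases "even n")
      case True
      then have n: "int n = 2 * k" unfolding k_def by presburger
      have "- rat_of_int k + 1/2 \<le> of_int i - 1/2 \<longleftrightarrow> - k + 1 \<le> i"
      proof -
        have "- rat_of_int k + 1/2 \<le> of_int i - 1/2 \<longleftrightarrow> rat_of_int (- k + 1) \<le> rat_of_int i"
          unfolding of_int_add of_int_minus of_int_1 by (rule iffI) linarith+
        then show ?thesis unfolding of_int_le_iff .
      qed
      then show ?thesis using True n int up by (simp add: Lambda_def Let_def k)
    next
      case False
      then have n: "int n = 2 * k + 1" unfolding k_def by presburger
      have "- rat_of_int k - 1/2 \<le> of_int i - 1/2 \<longleftrightarrow> - k \<le> i"
      proof -
        have "- rat_of_int k - 1/2 \<le> of_int i - 1/2 \<longleftrightarrow> rat_of_int (- k) \<le> rat_of_int i" by simp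
        then show ?thesis unfolding of_int_le_iff .
      qed
      then show ?thesis using False n int up by (simp add: Lambda_def Let_def k)
    qed
  qed
  have "l \<in> half_odd \<longleftrightarrow> (\<exists>i. l = of_int i - 1/2)" for l :: rat
  proof
    assume "l \<in> half_odd"
    then obtain j where "l - 1/2 = of_int j" unfolding half_odd_def by (auto elim: Ints_cases)
    then have "l = of_int (j + 1) - 1/2" by simp
    then show "\<exists>i. l = of_int i - 1/2" by blast
  next
    assume "\<exists>i. l = of_int i - 1/2"
    then obtain i where "l - 1/2 = rat_of_int (i - 1)" by auto
    then show "l \<in> half_odd" unfolding half_odd_def by (metis Ints_of_int mem_Collect_eq)
  qed
  then have half: "half_odd = range (\<lambda>i. rat_of_int i - 1/2)" by (simp add: set_eq_iff image_iff)
  have "Lambda n \<inter> half_odd = (\<lambda>i. of_int i - 1/2) ` {i. of_int i - 1/2 \<in> Lambda n}"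
    unfolding half by auto
  also have "\<dots> = (\<lambda>i. of_int i - 1/2) ` {k - int n + 1..k}" unfolding * Collect_mem_eq ..
  finally show ?thesis unfolding sites_def k_def[symmetric] by (simp add: image_image)
qed

lemma Lambda_Suc: "Lambda n \<subseteq> Lambda (Suc n)"
proof
  fix s assume s: "s \<in> Lambda n"
  show "s \<in> Lambda (Suc n)"
  proof (cases "even n")
    case True
    then have "Suc n div 2 = n div 2" by simp
    then show ?thesis using s True by (auto simp: Lambda_def Let_def)
  next
    case False
    then have "Suc n div 2 = n div 2 + 1" by presburger
    then show ?thesis using s False by (auto simp: Lambda_def Let_def)
  qed
qed

lemma Lambda_mono: "n \<le> m \<Longrightarrow> Lambda n \<subseteq> Lambda m"
  using Lambda_Suc by (rule lift_Suc_mono_le)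

lemma Lambda_covers:
  assumes "2 * s \<in> \<int>" shows "\<exists>n. s \<in> Lambda n"
proof -
  obtain m where "\<bar>s\<bar> + 1 < of_nat m" using reals_Archimedean2 by blast
  then have "s \<in> Lambda (2 * m)" using assms by (auto simp: Lambda_def Let_def)
  then show ?thesis by blast
qed

context field_alg
begin

lemma sites_list_sites: "sites_list (sites n)"
proof -
  have "sorted_wrt (\<lambda>x y. x + 1 \<le> y) (map rat_of_int [a..b])" for a b
  proof -
    have "sorted_wrt (\<lambda>x y. rat_of_int x + 1 \<le> rat_of_int y) [a..b]"
    proof (rule sorted_wrt_mono_rel[OF _ sorted_wrt_upto])
      fix x y :: int assume "x < y"
      then have "rat_of_int (x + 1) \<le> rat_of_int y" unfolding of_int_le_iff by simp
      then show "rat_of_int x + 1 \<le> rat_of_int y" by simp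
    qed
    then show ?thesis by (simp add: sorted_wrt_map)
  qed
  then show ?thesis by (auto simp: sites_list_def sites_def)
qed

lemma gens_Lambda: "field_gens G H (Lambda n) = gens_on (sites n)"
  unfolding field_gens_def gens_on_def Lambda_Ints Lambda_half by blast

lemma gens_mono: "\<Lambda> \<subseteq> \<Lambda>' \<Longrightarrow> field_gens G H \<Lambda> \<subseteq> field_gens G H \<Lambda>'"
  unfolding field_gens_def by blast

lemma X_covers: "a \<in> X \<Longrightarrow> \<exists>n. a \<in> field_gens G H (Lambda n)"
proof (cases a)
  case (Delta g x)
  assume a: "a \<in> X"
  then have "x \<in> \<int>" using Delta by simp
  then have "2 * x \<in> \<int>" by simp
  then show ?thesis using Lambda_covers[of x] a Delta by auto
next
  case (Rho h l)
  assume a: "a \<in> X"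
  then have "l - 1/2 \<in> \<int>" using Rho by (simp add: half_odd_def)
  then obtain j where "l - 1/2 = of_int j" by (auto elim: Ints_cases)
  then have "2 * l = of_int (2 * j + 1)" by (simp add: field_simps)
  then have "2 * l \<in> \<int>" by (metis Ints_of_int)
  then show ?thesis using Lambda_covers[of l] a Rho by auto
qed

lemma supp_covers:
  assumes "f \<in> carrier F" shows "\<exists>n. {w. f w \<noteq> 0} \<subseteq> lists (field_gens G H (Lambda n))"
proof -
  have fin: "finite (\<Union>w\<in>{w. f w \<noteq> 0}. set w)" using finite_supp[OF assms] by auto
  have "\<exists>n. A \<subseteq> field_gens G H (Lambda n)" if "finite A" "A \<subseteq> X" for A
    using that
  proof (induction A)
    case (insert a A)
    then obtain n m where n: "A \<subseteq> field_gens G H (Lambda n)" "a \<in> field_gens G H (Lambda m)"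
      using X_covers[of a] by auto
    have "field_gens G H (Lambda n) \<subseteq> field_gens G H (Lambda (max n m))"
      "field_gens G H (Lambda m) \<subseteq> field_gens G H (Lambda (max n m))"
      by (intro gens_mono Lambda_mono; simp)+
    then show ?case using n by blast
  qed simp
  moreover have "(\<Union>w\<in>{w. f w \<noteq> 0}. set w) \<subseteq> X"
    using supp_lists[OF assms] by (auto simp: in_lists_conv_set)
  ultimately obtain n where n: "(\<Union>w\<in>{w. f w \<noteq> 0}. set w) \<subseteq> field_gens G H (Lambda n)"
    using fin by blast
  have "{w. f w \<noteq> 0} \<subseteq> lists (field_gens G H (Lambda n))"
  proof
    fix w assume "w \<in> {w. f w \<noteq> 0}"
    then have "set w \<subseteq> field_gens G H (Lambda n)" using n by blast
    then show "w \<in> lists (field_gens G H (Lambda n))" by (auto simp: in_lists_conv_set)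
  qed
  then show ?thesis by blast
qed

section \<open>Faithfulness of the representation\<close>

lemma pull_dw: "pull G (dw c0 xs) c = (if \<forall>x\<in>set xs. c x = c0 x then Some c else None)"
  by (induction xs) auto

lemma pull_rw_total: "\<exists>e. pull G (rw k xs) c = Some e"
  by (induction xs arbitrary: c) auto

text \<open>All later bonds lie to the right of x, so the value at x is final after the first
  letter.\<close>

lemma pull_rw_head:
  assumes "sites_list (x # xs)" "pull G (rw k (x # xs)) c = Some e"
  shows "e x = inv (k x) \<otimes> c x"
proof -
  let ?c = "\<lambda>y. if x - 1/2 < y then inv (k x) \<otimes> c y else c y"
  have 1: "pull G (rw k xs) ?c = Some e" using assms(2) by simp
  have "\<not> l < x" if "Rho h l \<in> set (rw k xs)" for h l
    using that assms(1) by (fastforce simp: rw_def sites_Cons)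
  from pull_outside[OF this 1] show ?thesis by simp
qed

text \<open>The bond \<open>x - 1/2\<close> is the last one that moves the site \<open>x\<close>, so the coefficients \<open>k\<close> can be read
  off successively from the image configuration.\<close>

lemma pull_rw_agree_iff:
  assumes "sites_list xs" "k \<in> KH" "k' \<in> KH" "c \<in> Conf" "c' \<in> Conf"
    and "\<forall>x\<in>set xs. c x = c' x" "pull G (rw k xs) c = Some e" "pull G (rw k' xs) c' = Some e'"
  shows "(\<forall>x\<in>set xs. e x = e' x) \<longleftrightarrow> (\<forall>x\<in>set xs. k x = k' x)"
  using assms(1,4-8)
proof (induction xs arbitrary: c c')
  case (Cons x xs)
  have ex: "e x = inv (k x) \<otimes> c x" "e' x = inv (k' x) \<otimes> c' x"
    using pull_rw_head[OF Cons.prems(1)] Cons.prems by blast+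
  have mem: "k x \<in> H" "k' x \<in> H" "c x \<in> carrier G" "c x = c' x"
    using assms(2,3) KH_D Conf_mem Cons.prems by auto
  have head: "e x = e' x \<longleftrightarrow> k x = k' x"
  proof
    assume "e x = e' x"
    then have "inv (k x) = inv (k' x)" using ex mem by (metis H_mem(1) inv_closed right_cancel)
    then show "k x = k' x" using mem by (metis H_mem(1) inv_inv)
  qed (use ex mem in auto)
  show ?case
  proof (cases "k x = k' x")
    case False
    then show ?thesis using head by auto
  next
    case True
    let ?c = "\<lambda>c y. if x - 1/2 < y then inv (k x) \<otimes> c y else c y"
    have "inv (k x) \<in> H" using mem by simp
    then have cc: "?c c \<in> Conf" "?c c' \<in> Conf"
      using Cons.prems Conf_mem[OF Cons.prems(2)] Conf_mem[OF Cons.prems(3)] unfolding Conf_def by auto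
    have "(\<forall>x\<in>set xs. e x = e' x) \<longleftrightarrow> (\<forall>x\<in>set xs. k x = k' x)"
    proof (rule Cons.IH[OF _ cc])
      show "sites_list xs" using Cons.prems(1) by (simp add: sites_Cons)
      show "\<forall>y\<in>set xs. ?c c y = ?c c' y" using Cons.prems(4) by auto
      show "pull G (rw k xs) (?c c) = Some e" using Cons.prems(5) by simp
      show "pull G (rw k' xs) (?c c') = Some e'" using Cons.prems(6) unfolding True by simp
    qed
    then show ?thesis using head True by auto
  qed
qed simp

text \<open>Here c carries the \<delta> labels of u, and b is the image of c under u. The left
  projection fixes the \<delta> labels of v, the right one its \<rho> labels, so u is the only
  normal form that survives both. The row d is arbitrary, hence the whole corner is known and not
  just one matrix entry.\<close>

lemma NF_corner:
  assumes xs: "sites_list xs" and u: "u \<in> NF xs"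
  obtains c b where "c \<in> Conf" "b \<in> Conf" "pull G u c = Some b"
    and "\<And>v d. v \<in> NF xs \<Longrightarrow> d \<in> Conf \<Longrightarrow>
      pull G (dw c xs @ v @ dw b xs) d = (if v = u then pull G u d else None)"
proof -
  obtain c k where u': "c \<in> Conf" "k \<in> KH" "u = dw c xs @ rw k xs" using u by (auto simp: NF_def)
  obtain b where b: "pull G (rw k xs) c = Some b" using pull_rw_total by blast
  have uX: "u \<in> lists X" by (rule NF_lists[OF xs u])
  have ub: "pull G u c = Some b" using u' b by (simp add: pull_append pull_dw)
  then have bC: "b \<in> Conf" using pull_Conf[OF uX u'(1)] by simp
  show ?thesis
  proof (rule that[OF u'(1) bC ub])
    fix v d assume v: "v \<in> NF xs" and d: "d \<in> Conf"
    obtain c1 k1 where v': "c1 \<in> Conf" "k1 \<in> KH" "v = dw c1 xs @ rw k1 xs" using v by (auto simp: NF_def)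
    obtain e where e: "pull G (rw k1 xs) d = Some e" using pull_rw_total by blast
    have dw_eq: "dw c1 xs = dw c xs \<longleftrightarrow> (\<forall>x\<in>set xs. c1 x = c x)" by (auto simp: dw_def)
    have rw_eq: "rw k1 xs = rw k xs \<longleftrightarrow> (\<forall>x\<in>set xs. k1 x = k x)" by (auto simp: rw_def)
    have vu: "v = u \<longleftrightarrow> dw c1 xs = dw c xs \<and> rw k1 xs = rw k xs"
      unfolding v'(3) u'(3) by (rule append_eq_append_conv) (simp add: dw_def)
    show "pull G (dw c xs @ v @ dw b xs) d = (if v = u then pull G u d else None)"
    proof (cases "\<forall>x\<in>set xs. d x = c x")
      case False
      then show ?thesis by (auto simp: pull_append pull_dw u')
    next
      case dc: True
      show ?thesis
      proof (cases "\<forall>x\<in>set xs. d x = c1 x")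
        case False
        then have "v \<noteq> u" using dc vu dw_eq by auto
        then show ?thesis using False by (auto simp: pull_append pull_dw v')
      next
        case True
        then have c1: "dw c1 xs = dw c xs" using dc dw_eq by auto
        \<comment> \<open>The right projection tests whether the image of d agrees with b on the
          sites; since d and c agree there, this compares the \<rho> labels.\<close>
        have "(\<forall>x\<in>set xs. e x = b x) \<longleftrightarrow> rw k1 xs = rw k xs"
          unfolding rw_eq by (rule pull_rw_agree_iff[OF xs v'(2) u'(2) d u'(1) dc e b])
        then have "pull G (dw c xs @ v @ dw b xs) d = (if rw k1 xs = rw k xs then Some e else None)"
          using dc e unfolding v'(3) c1 by (simp add: pull_append pull_dw)
        moreover have "pull G u d = Some e" if "rw k1 xs = rw k xs"
          using that dc e unfolding u'(3) by (simp add: pull_append pull_dw)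
        ultimately show ?thesis using vu c1 by auto
      qed
    qed
  qed
qed

lemma kern_cong_conf:
  "f \<in> carrier F \<Longrightarrow> g \<in> carrier F \<Longrightarrow>
    f \<ominus>\<^bsub>F\<^esub> g \<in> ker \<longleftrightarrow> (\<forall>c\<in>Conf. \<forall>b. kern G f c b = kern G g c b)"
  by (simp add: ker_def kern_diff)

text \<open>The linear version: of a combination of normal forms only the coefficient at u is left,
  times the matrix of u. It serves twice, for faithfulness and for the comparison of norms on a
  local algebra.\<close>

lemma NF_corner_kern:
  assumes xs: "sites_list xs" and u: "u \<in> NF xs"
  obtains c b where "c \<in> Conf" "b \<in> Conf" "pull G u c = Some b"
    and "\<And>a d e. a \<in> carrier F \<Longrightarrow> {w. a w \<noteq> 0} \<subseteq> NF xs \<Longrightarrow> d \<in> Conf \<Longrightarrow>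
      kern G (wmono (dw c xs) \<otimes>\<^bsub>F\<^esub> a \<otimes>\<^bsub>F\<^esub> wmono (dw b xs)) d e = a u * (if pull G u d = Some e then 1 else 0)"
proof -
  obtain c b where cb: "c \<in> Conf" "b \<in> Conf" "pull G u c = Some b"
    and corner: "\<And>v d. v \<in> NF xs \<Longrightarrow> d \<in> Conf \<Longrightarrow>
      pull G (dw c xs @ v @ dw b xs) d = (if v = u then pull G u d else None)"
    using NF_corner[OF xs u] by metis
  have "kern G (wmono (dw c xs) \<otimes>\<^bsub>F\<^esub> a \<otimes>\<^bsub>F\<^esub> wmono (dw b xs)) d e = a u * (if pull G u d = Some e then 1 else 0)"
    if a: "a \<in> carrier F" "{w. a w \<noteq> 0} \<subseteq> NF xs" and d: "d \<in> Conf" for a d e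
  proof -
    have "kern G (wmono (dw c xs) \<otimes>\<^bsub>F\<^esub> a \<otimes>\<^bsub>F\<^esub> wmono (dw b xs)) d e =
        lin a (\<lambda>v. if pull G (dw c xs @ v @ dw b xs) d = Some e then 1 else 0)"
      using finite_supp[OF a(1)] by (simp add: F_simps(2) kern_def lin_conv finite_conv)
    also have "\<dots> = lin a (\<lambda>v. (if pull G u d = Some e then 1 else 0) * (if v = u then 1 else 0))"
      using a(2) corner[OF _ d] by (intro lin_cong) auto
    also have "\<dots> = a u * (if pull G u d = Some e then 1 else 0)"
      unfolding lin_scale_right lin_indicator[OF finite_supp[OF a(1)]] by simp
    finally show ?thesis .
  qed
  with cb show ?thesis by (rule that)
qed

text \<open>Modulo the ideal, an element of the kernel is a combination a of normal forms, and a
  lies in the kernel as well. So do its corners; these have the matrix of a single normal form times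
  a coefficient of a, and that matrix is nonzero, so all coefficients vanish.\<close>

theorem ker_eq_I: "ker = I"
proof
  show "ker \<subseteq> I"
  proof
    fix f assume f: "f \<in> ker"
    then have fF: "f \<in> carrier F" by (simp add: ker_def)
    obtain n where n: "{w. f w \<noteq> 0} \<subseteq> lists (field_gens G H (Lambda n))" using supp_covers[OF fF] by blast
    note xs = sites_list_sites[of n]
    have "f \<in> Span (NF (sites n))" using in_Span_NF[OF xs fF] n by (simp add: gens_Lambda)
    then obtain a where a: "a \<in> carrier F" "{w. a w \<noteq> 0} \<subseteq> NF (sites n)" "q f = q a"
      by (auto simp: Span_def)
    have "f \<ominus>\<^bsub>F\<^esub> a \<in> I" using a(3) L.q_eq_iff[OF fF a(1)] by simp
    then have "f \<ominus>\<^bsub>F\<^esub> a \<in> ker" using I_subset_ker by blast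
    then have k: "kern G a c b = 0" if "c \<in> Conf" for c b
      using f that fF a(1) unfolding kern_cong_conf[OF fF a(1)] by (simp add: ker_def)
    have "a u = 0" for u
    proof (rule ccontr)
      assume "a u \<noteq> 0"
      then have u: "u \<in> NF (sites n)" using a(2) by blast
      obtain c b where cb: "c \<in> Conf" "b \<in> Conf" "pull G u c = Some b"
        and corner: "\<And>a d e. a \<in> carrier F \<Longrightarrow> {w. a w \<noteq> 0} \<subseteq> NF (sites n) \<Longrightarrow> d \<in> Conf \<Longrightarrow>
          kern G (wmono (dw c (sites n)) \<otimes>\<^bsub>F\<^esub> a \<otimes>\<^bsub>F\<^esub> wmono (dw b (sites n))) d e =
            a u * (if pull G u d = Some e then 1 else 0)"
        using NF_corner_kern[OF xs u] by metis
      have l: "dw c (sites n) \<in> lists X" "dw b (sites n) \<in> lists X"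
        using dw_lists cb sites_ints[OF xs] by blast+
      have "a \<in> ker" using a(1) k by (simp add: ker_def)
      then have "wmono (dw c (sites n)) \<otimes>\<^bsub>F\<^esub> a \<otimes>\<^bsub>F\<^esub> wmono (dw b (sites n)) \<in> ker"
        using ideal.I_l_closed[OF ideal_ker] ideal.I_r_closed[OF ideal_ker] l wmono_closed by blast
      then have "a u * (if pull G u c = Some b then 1 else 0) = 0"
        using corner[OF a(1,2) cb(1), of b] cb(1) by (simp add: ker_def)
      then show False using cb(3) \<open>a u \<noteq> 0\<close> by simp
    qed
    then have "a = \<zero>\<^bsub>F\<^esub>" by (auto simp: F_simps(4))
    then have "f \<ominus>\<^bsub>F\<^esub> \<zero>\<^bsub>F\<^esub> \<in> I" using \<open>f \<ominus>\<^bsub>F\<^esub> a \<in> I\<close> by simp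
    then show "f \<in> I" using fF by (simp add: a_minus_def)
  qed
qed (rule I_subset_ker)

lemma q_eq_iff_kern:
  assumes "f \<in> carrier F" "g \<in> carrier F"
  shows "q f = q g \<longleftrightarrow> (\<forall>c\<in>Conf. \<forall>b. kern G f c b = kern G g c b)"
  using L.q_eq_iff[OF assms] kern_cong_conf[OF assms] by (simp add: ker_eq_I)

section \<open>The involution in the representation\<close>

lemma star_X: "a \<in> X \<Longrightarrow> field_gen_star G a \<in> X"
  by (cases a) auto

lemma star_lists: "w \<in> lists X \<Longrightarrow> rev (map (field_gen_star G) w) \<in> lists X"
  using star_X by (auto simp: in_lists_conv_set)

lemma star_star_word: "w \<in> lists X \<Longrightarrow> rev (map (field_gen_star G) (rev (map (field_gen_star G) w))) = w"
proof -
  have "field_gen_star G (field_gen_star G a) = a" if "a \<in> X" for a using that by (cases a) auto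
  moreover assume "w \<in> lists X"
  ultimately show ?thesis by (simp add: rev_map comp_def in_lists_conv_set map_idI)
qed

lemma step_star_iff:
  assumes "a \<in> X" "b \<in> Conf" "d \<in> Conf"
  shows "step G (field_gen_star G a) d = Some b \<longleftrightarrow> step G a b = Some d"
proof (cases a)
  case (Delta g x)
  then show ?thesis by auto
next
  case (Rho h l)
  then have h: "h \<in> H" using assms(1) by simp
  have "h \<otimes> (inv h \<otimes> y) = y" "inv h \<otimes> (h \<otimes> y) = y" if "y \<in> carrier G" for y
    using that h by (simp_all add: m_assoc[symmetric])
  then have "h \<otimes> d x = b x \<longleftrightarrow> inv h \<otimes> b x = d x" for x
    using Conf_mem[OF assms(2)] Conf_mem[OF assms(3)] by metis
  then show ?thesis using Rho h by (auto simp: fun_eq_iff)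
qed

text \<open>Every letter acts as a partial bijection of configurations whose inverse is given by the
  starred letter; reversing the word is the rule for the inverse of a composition.\<close>

lemma pull_star_iff:
  assumes "w \<in> lists X" "c \<in> Conf" "b \<in> Conf"
  shows "pull G (rev (map (field_gen_star G) w)) c = Some b \<longleftrightarrow> pull G w b = Some c"
  using assms(1,3)
proof (induction w arbitrary: b)
  case Nil
  then show ?case by auto
next
  case (Cons a w)
  have wX: "a \<in> X" "w \<in> lists X" "rev (map (field_gen_star G) w) \<in> lists X"
    using Cons.hyps star_lists[of w] by simp_all
  have "pull G (rev (map (field_gen_star G) (a # w))) c = Some b \<longleftrightarrow>
      (\<exists>d. pull G (rev (map (field_gen_star G) w)) c = Some d \<and> step G (field_gen_star G a) d = Some b)"
    by (auto simp: pull_append bind_eq_Some_conv)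
  also have "\<dots> \<longleftrightarrow> (\<exists>d\<in>Conf. pull G w d = Some c \<and> step G a b = Some d)"
    using pull_Conf[OF wX(3) assms(2)] Cons.IH step_star_iff[OF wX(1) Cons.prems] step_Conf[OF wX(1) Cons.prems]
    by blast
  also have "\<dots> \<longleftrightarrow> pull G (a # w) b = Some c"
    using step_Conf[OF wX(1) Cons.prems] by (auto simp: bind_eq_Some_conv)
  finally show ?case .
qed

lemma lin_star:
  assumes f: "f \<in> carrier F"
  shows "lin (star F f) \<phi> = cnj (lin f (\<lambda>w. cnj (\<phi> (rev (map (field_gen_star G) w)))))"
proof -
  let ?s = "\<lambda>w. rev (map (field_gen_star G) w)"
  have sub: "{w. f w \<noteq> 0} \<subseteq> lists X" using supp_lists[OF f] by blast
  have supp: "{w. star F f w \<noteq> 0} = ?s ` {w. f w \<noteq> 0}"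
  proof (intro equalityI subsetI)
    fix w assume "w \<in> {w. star F f w \<noteq> 0}"
    then have "w \<in> lists X" "f (?s w) \<noteq> 0" by (auto simp: F_simps(7) split: if_splits)
    then show "w \<in> ?s ` {w. f w \<noteq> 0}"
      using star_star_word[of w] by (intro image_eqI[of _ _ "?s w"]) simp_all
  next
    fix w assume "w \<in> ?s ` {w. f w \<noteq> 0}"
    then obtain v where v: "w = ?s v" "f v \<noteq> 0" by blast
    then have "v \<in> lists X" using sub by blast
    then have "star F f w = cnj (f v)"
      using star_lists[of v] star_star_word[of v] v(1) by (simp only: F_simps(7)) simp
    then show "w \<in> {w. star F f w \<noteq> 0}" using v(2) by simp
  qed
  have inj: "inj_on ?s {w. f w \<noteq> 0}"
    using star_star_word sub by (intro inj_on_inverseI[of _ ?s]) blast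
  have "lin (star F f) \<phi> = (\<Sum>w\<in>{w. f w \<noteq> 0}. star F f (?s w) * \<phi> (?s w))"
    unfolding lin_def supp by (subst sum.reindex[OF inj]) simp
  also have "\<dots> = (\<Sum>w\<in>{w. f w \<noteq> 0}. cnj (f w) * \<phi> (?s w))"
  proof (intro sum.cong refl)
    fix w assume "w \<in> {w. f w \<noteq> 0}"
    then have "w \<in> lists X" using sub by blast
    then have "star F f (?s w) = cnj (f w)"
      using star_lists[of w] star_star_word[of w] by (simp only: F_simps(7)) simp
    then show "star F f (?s w) * \<phi> (?s w) = cnj (f w) * \<phi> (?s w)" by simp
  qed
  finally show ?thesis by (simp add: lin_def)
qed

lemma kern_star:
  assumes f: "f \<in> carrier F" and "c \<in> Conf" "b \<in> Conf"
  shows "kern G (star F f) c b = cnj (kern G f b c)"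
proof -
  have "kern G (star F f) c b =
      cnj (lin f (\<lambda>w. cnj (if pull G (rev (map (field_gen_star G) w)) c = Some b then 1 else 0)))"
    unfolding kern_def by (rule lin_star[OF f])
  also have "\<dots> = cnj (kern G f b c)"
    unfolding kern_def using pull_star_iff[OF supp_lists[OF f] assms(2,3)]
    by (intro arg_cong[where f = cnj] lin_cong) simp
  finally show ?thesis .
qed

lemma kern_outside:
  assumes "f \<in> carrier F" "c \<in> Conf" "b \<notin> Conf" shows "kern G f c b = 0"
proof -
  have "kern G f c b = lin f (\<lambda>w. 0)"
    unfolding kern_def using pull_Conf[OF supp_lists[OF assms(1)] assms(2)] assms(3) by (intro lin_cong) auto
  then show ?thesis by simp
qed

text \<open>The matrix of the star is the conjugate transpose, so the kernel is closed under the
  star, and the ideal is this kernel.\<close>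

sublocale S: star_ideal F I
proof
  fix f assume f: "f \<in> I"
  then have fF: "f \<in> carrier F" using L.a_subset by blast
  have "kern G (star F f) c b = 0" if c: "c \<in> Conf" for c b
  proof (cases "b \<in> Conf")
    case True
    then show ?thesis using kern_star[OF fF c] f unfolding ker_eq_I[symmetric] by (simp add: ker_def)
  next
    case False
    then show ?thesis using kern_outside F.star_closed[OF fF] c by blast
  qed
  then show "star F f \<in> I" unfolding ker_eq_I[symmetric] ker_def using fF by simp
qed

lemma star_alg_L: "star_alg L"
  unfolding local_field_algebra_def by (rule S.star_alg_Q)

end

section \<open>The C*-norm\<close>

text \<open>The l2 norm of a finitely supported function. With \<open>ip\<close>, antilinear in its
  first argument, it makes these functions a pre-Hilbert space in which all sums are finite.\<close>

definition nv :: "('c \<Rightarrow> complex) \<Rightarrow> real" where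
  "nv v = L2_set (\<lambda>c. cmod (v c)) {c. v c \<noteq> 0}"

definition ip :: "('c \<Rightarrow> complex) \<Rightarrow> ('c \<Rightarrow> complex) \<Rightarrow> complex" where
  "ip u v = (\<Sum>c\<in>{c. u c \<noteq> 0}. cnj (u c) * v c)"

lemma nv_superset: "finite S \<Longrightarrow> {c. v c \<noteq> 0} \<subseteq> S \<Longrightarrow> nv v = L2_set (\<lambda>c. cmod (v c)) S"
  unfolding nv_def L2_set_def by (intro arg_cong[where f = sqrt] sum.mono_neutral_left) auto

lemma ip_superset: "finite S \<Longrightarrow> {c. u c \<noteq> 0} \<subseteq> S \<Longrightarrow> ip u v = (\<Sum>c\<in>S. cnj (u c) * v c)"
  unfolding ip_def by (intro sum.mono_neutral_left) auto

lemma nv_nonneg [simp]: "nv v \<ge> 0"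
  by (simp add: nv_def)

lemma nv_eq_0: "finite {c. v c \<noteq> 0} \<Longrightarrow> nv v = 0 \<longleftrightarrow> (\<forall>c. v c = 0)"
  by (auto simp: nv_def L2_set_eq_0_iff)

lemma nv_zero [simp]: "nv (\<lambda>c. 0) = 0"
  by (simp add: nv_def)

lemma nv_add:
  assumes "finite {c. u c \<noteq> 0}" "finite {c. v c \<noteq> 0}"
  shows "nv (\<lambda>c. u c + v c) \<le> nv u + nv v"
proof -
  let ?S = "{c. u c \<noteq> 0} \<union> {c. v c \<noteq> 0}"
  have fin: "finite ?S" using assms by simp
  have "nv (\<lambda>c. u c + v c) = L2_set (\<lambda>c. cmod (u c + v c)) ?S"
    using fin by (intro nv_superset) auto
  also have "\<dots> \<le> L2_set (\<lambda>c. cmod (u c) + cmod (v c)) ?S"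
    by (intro L2_set_mono norm_triangle_ineq) simp
  also have "\<dots> \<le> L2_set (\<lambda>c. cmod (u c)) ?S + L2_set (\<lambda>c. cmod (v c)) ?S"
    by (rule L2_set_triangle_ineq)
  also have "\<dots> = nv u + nv v" using fin nv_superset[of ?S u] nv_superset[of ?S v] by auto
  finally show ?thesis .
qed

lemma nv_scale:
  assumes "finite {c. v c \<noteq> 0}" shows "nv (\<lambda>c. k * v c) = cmod k * nv v"
proof -
  have "nv (\<lambda>c. k * v c) = L2_set (\<lambda>c. cmod k * cmod (v c)) {c. v c \<noteq> 0}"
    using assms by (subst nv_superset[of "{c. v c \<noteq> 0}"]) (auto simp: norm_mult)
  then show ?thesis by (simp add: nv_def L2_set_right_distrib)
qed

lemma ip_self:
  assumes "finite {c. v c \<noteq> 0}" shows "ip v v = complex_of_real ((nv v)\<^sup>2)"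
proof -
  have "ip v v = (\<Sum>c\<in>{c. v c \<noteq> 0}. complex_of_real ((cmod (v c))\<^sup>2))"
    unfolding ip_def complex_norm_square by (intro sum.cong refl mult.commute)
  also have "\<dots> = complex_of_real ((nv v)\<^sup>2)"
    unfolding nv_def L2_set_def by (subst real_sqrt_pow2) (auto intro: sum_nonneg)
  finally show ?thesis .
qed

lemma cauchy_schwarz:
  assumes "finite {c. u c \<noteq> 0}" "finite {c. v c \<noteq> 0}" shows "cmod (ip u v) \<le> nv u * nv v"
proof -
  let ?S = "{c. u c \<noteq> 0} \<union> {c. v c \<noteq> 0}"
  have fin: "finite ?S" using assms by simp
  have "ip u v = (\<Sum>c\<in>?S. cnj (u c) * v c)" using fin by (intro ip_superset) auto
  then have "cmod (ip u v) \<le> (\<Sum>c\<in>?S. \<bar>cmod (u c)\<bar> * \<bar>cmod (v c)\<bar>)"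
    by (auto intro!: order_trans[OF norm_sum] simp: norm_mult)
  also have "\<dots> \<le> L2_set (\<lambda>c. cmod (u c)) ?S * L2_set (\<lambda>c. cmod (v c)) ?S"
    by (rule L2_set_mult_ineq)
  also have "\<dots> = nv u * nv v" using fin nv_superset[of ?S u] nv_superset[of ?S v] by auto
  finally show ?thesis .
qed

section \<open>The operator norm\<close>

context field_alg
begin

definition V :: "((rat \<Rightarrow> 'a) \<Rightarrow> complex) set" where
  "V = {v. finite {c. v c \<noteq> 0} \<and> {c. v c \<noteq> 0} \<subseteq> Conf}"

text \<open>The matrix \<open>kern\<close> applied to v, written through words so that no finite set
  of columns has to be chosen; \<open>op_kern\<close> is the matrix form. The value 0 outside
  \<open>Conf\<close> keeps the support inside \<open>Conf\<close>.\<close>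

definition op :: "('a field_gen list \<Rightarrow> complex) \<Rightarrow> ((rat \<Rightarrow> 'a) \<Rightarrow> complex) \<Rightarrow> (rat \<Rightarrow> 'a) \<Rightarrow> complex" where
  "op f v c = (if c \<in> Conf then lin f (\<lambda>w. case pull G w c of None \<Rightarrow> 0 | Some b \<Rightarrow> v b) else 0)"

lemma V_fin: "v \<in> V \<Longrightarrow> finite {c. v c \<noteq> 0}"
  by (simp add: V_def)

lemma op_kern:
  assumes "f \<in> carrier F" "c \<in> Conf" "finite S" "{b. v b \<noteq> 0} \<subseteq> S"
  shows "op f v c = (\<Sum>b\<in>S. kern G f c b * v b)"
  unfolding op_def using assms lin_pull[OF finite_supp[OF assms(1)] assms(3), of G c v] by auto

lemma op_V:
  assumes f: "f \<in> carrier F" and v: "v \<in> V" shows "op f v \<in> V"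
proof -
  \<comment> \<open>A point c in the support of \<open>op f v\<close> leads by some word of f to a
    point b in the support of v; the starred word leads back from b to c.\<close>
  let ?T = "(\<lambda>(w, b). the (pull G (rev (map (field_gen_star G) w)) b)) ` ({w. f w \<noteq> 0} \<times> {b. v b \<noteq> 0})"
  have "{c. op f v c \<noteq> 0} \<subseteq> ?T"
  proof
    fix c assume c: "c \<in> {c. op f v c \<noteq> 0}"
    then have cC: "c \<in> Conf" by (auto simp: op_def split: if_splits)
    have "\<exists>w\<in>{w. f w \<noteq> 0}. f w * (case pull G w c of None \<Rightarrow> 0 | Some b \<Rightarrow> v b) \<noteq> 0"
      using c cC unfolding op_def lin_def by (metis (mono_tags, lifting) mem_Collect_eq sum.neutral)
    then obtain w b where w: "f w \<noteq> 0" "pull G w c = Some b" "v b \<noteq> 0"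
      by (auto split: option.splits)
    have wX: "w \<in> lists X" by (rule supp_lists[OF f w(1)])
    have bC: "b \<in> Conf" using w(3) v by (auto simp: V_def)
    have "pull G (rev (map (field_gen_star G) w)) b = Some c"
      using pull_star_iff[OF wX bC cC] w(2) by simp
    then show "c \<in> ?T" using w by (intro image_eqI[of _ _ "(w, b)"]) auto
  qed
  moreover have "finite ?T" using finite_supp[OF f] V_fin[OF v] by simp
  ultimately have "finite {c. op f v c \<noteq> 0}" by (rule finite_subset)
  then show ?thesis by (auto simp: V_def op_def split: if_splits)
qed

lemma op_add: "f \<in> carrier F \<Longrightarrow> g \<in> carrier F \<Longrightarrow> op (f \<oplus>\<^bsub>F\<^esub> g) v = (\<lambda>c. op f v c + op g v c)"
  by (auto simp: op_def F_simps(5) lin_add finite_supp)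

lemma op_smult: "op (k \<odot>\<^bsub>F\<^esub> f) v = (\<lambda>c. k * op f v c)"
  by (auto simp: op_def F_simps(6) lin_scale)

lemma op_scale_right: "op f (\<lambda>c. k * v c) = (\<lambda>c. k * op f v c)"
proof
  fix c
  have "lin f (\<lambda>w. case pull G w c of None \<Rightarrow> 0 | Some b \<Rightarrow> k * v b) =
      lin f (\<lambda>w. k * (case pull G w c of None \<Rightarrow> 0 | Some b \<Rightarrow> v b))"
    by (intro lin_cong) (auto split: option.splits)
  then show "op f (\<lambda>c. k * v c) c = k * op f v c" by (simp add: op_def lin_scale_right)
qed

lemma op_mult:
  assumes f: "f \<in> carrier F" and g: "g \<in> carrier F" shows "op (f \<otimes>\<^bsub>F\<^esub> g) v = op f (op g v)"
proof
  fix c show "op (f \<otimes>\<^bsub>F\<^esub> g) v c = op f (op g v) c"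
  proof (cases "c \<in> Conf")
    case True
    have "lin g (\<lambda>y. case pull G (x @ y) c of None \<Rightarrow> 0 | Some b \<Rightarrow> v b) =
        (case pull G x c of None \<Rightarrow> 0 | Some b \<Rightarrow> op g v b)" if "f x \<noteq> 0" for x
      using pull_Conf[OF supp_lists[OF f that] True] by (auto simp: pull_append op_def split: option.splits)
    then have "lin f (\<lambda>x. lin g (\<lambda>y. case pull G (x @ y) c of None \<Rightarrow> 0 | Some b \<Rightarrow> v b)) =
        lin f (\<lambda>x. case pull G x c of None \<Rightarrow> 0 | Some b \<Rightarrow> op g v b)"
      by (rule lin_cong)
    then show ?thesis
      unfolding F_simps(2) op_def[of "conv f g"] op_def[of f]
        lin_conv[OF finite_supp[OF f] finite_supp[OF g]] by simp
  qed (simp add: op_def)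
qed

lemma op_adjoint:
  assumes f: "f \<in> carrier F" and u: "u \<in> V" and v: "v \<in> V"
  shows "ip u (op f v) = ip (op (star F f) u) v"
proof -
  let ?g = "star F f"
  have g: "?g \<in> carrier F" using f by simp
  define S where "S = {c. u c \<noteq> 0} \<union> {c. v c \<noteq> 0} \<union> {c. op ?g u c \<noteq> 0}"
  have S: "finite S" "S \<subseteq> Conf" "{c. u c \<noteq> 0} \<subseteq> S" "{c. v c \<noteq> 0} \<subseteq> S" "{c. op ?g u c \<noteq> 0} \<subseteq> S"
    using u v op_V[OF g u] by (auto simp: S_def V_def)
  have "ip u (op f v) = (\<Sum>c\<in>S. cnj (u c) * (\<Sum>b\<in>S. kern G f c b * v b))"
    unfolding ip_superset[OF S(1,3)] using op_kern[OF f _ S(1,4)] S(2) by (intro sum.cong refl) auto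
  also have "\<dots> = (\<Sum>c\<in>S. \<Sum>b\<in>S. cnj (u c) * kern G f c b * v b)"
    by (simp add: sum_distrib_left mult.assoc)
  also have "\<dots> = (\<Sum>b\<in>S. \<Sum>c\<in>S. cnj (u c) * kern G f c b * v b)"
    by (rule sum.swap)
  also have "\<dots> = (\<Sum>b\<in>S. cnj (\<Sum>c\<in>S. kern G ?g b c * u c) * v b)"
  proof (intro sum.cong refl)
    fix b assume "b \<in> S"
    then have "kern G f c b = cnj (kern G ?g b c)" if "c \<in> S" for c
    proof -
      have "b \<in> Conf" "c \<in> Conf" using \<open>b \<in> S\<close> that S(2) by auto
      then show ?thesis by (simp add: kern_star[OF f])
    qed
    then have "(\<Sum>c\<in>S. cnj (u c) * kern G f c b * v b) = (\<Sum>c\<in>S. cnj (kern G ?g b c * u c) * v b)"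
      by (intro sum.cong refl) (simp add: mult.commute)
    then show "(\<Sum>c\<in>S. cnj (u c) * kern G f c b * v b) = cnj (\<Sum>c\<in>S. kern G ?g b c * u c) * v b"
      by (simp add: sum_distrib_right)
  qed
  also have "\<dots> = (\<Sum>b\<in>S. cnj (op ?g u b) * v b)"
    using op_kern[OF g _ S(1,3)] S(2) by (intro sum.cong refl) auto
  also have "\<dots> = ip (op ?g u) v" unfolding ip_superset[OF S(1,5)] ..
  finally show ?thesis .
qed

text \<open>A word acts as a partial injection of configurations, hence as a partial isometry: the
  nonzero values of the image are values of v at distinct points.\<close>

lemma op_word_contractive:
  assumes w: "w \<in> lists X" and v: "v \<in> V" shows "nv (op (wmono w) v) \<le> nv v"
proof -
  let ?S = "{c. op (wmono w) v c \<noteq> 0}" and ?p = "\<lambda>c. the (pull G w c)"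
  have S: "c \<in> Conf \<and> ?p c \<in> Conf \<and> pull G w c = Some (?p c) \<and> op (wmono w) v c = v (?p c)"
    if "c \<in> ?S" for c
  proof -
    have c: "c \<in> Conf" using that by (auto simp: op_def split: if_splits)
    then have "(case pull G w c of None \<Rightarrow> 0 | Some b \<Rightarrow> v b) \<noteq> 0" using that by (simp add: op_def)
    then obtain b where "pull G w c = Some b" by (cases "pull G w c") auto
    then show ?thesis using c pull_Conf[OF w c] by (simp add: op_def)
  qed
  have inj: "inj_on ?p ?S"
  proof (rule inj_onI)
    fix c d assume cd: "c \<in> ?S" "d \<in> ?S" "?p c = ?p d"
    have *: "pull G (rev (map (field_gen_star G) w)) (?p e) = Some e" if "e \<in> ?S" for e
      using S[OF that] pull_star_iff[OF w] by blast
    have "Some c = Some d" unfolding *[OF cd(1), symmetric] *[OF cd(2), symmetric] cd(3) ..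
    then show "c = d" by simp
  qed
  have "(\<Sum>c\<in>?S. (cmod (op (wmono w) v c))\<^sup>2) = (\<Sum>c\<in>?S. (cmod (v (?p c)))\<^sup>2)"
  proof (intro sum.cong refl)
    fix c assume "c \<in> ?S"
    then have "op (wmono w) v c = v (?p c)" using S by blast
    then show "(cmod (op (wmono w) v c))\<^sup>2 = (cmod (v (?p c)))\<^sup>2" by (simp only:)
  qed
  also have "\<dots> = (\<Sum>b\<in>?p ` ?S. (cmod (v b))\<^sup>2)" by (simp add: sum.reindex[OF inj])
  also have "\<dots> \<le> (\<Sum>b\<in>{b. v b \<noteq> 0}. (cmod (v b))\<^sup>2)"
  proof (rule sum_mono2[OF V_fin[OF v]])
    show "?p ` ?S \<subseteq> {b. v b \<noteq> 0}"
    proof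
      fix b assume "b \<in> ?p ` ?S"
      then obtain c where c: "c \<in> ?S" "b = ?p c" by blast
      then have "op (wmono w) v c = v b" using S[OF c(1)] by (simp only:)
      then show "b \<in> {b. v b \<noteq> 0}" using c(1) by (simp only: mem_Collect_eq) simp
    qed
  qed simp
  finally show ?thesis unfolding nv_def L2_set_def by (rule real_sqrt_le_mono)
qed

text \<open>Words are contractive, so the moduli of the coefficients add up to a bound. It makes the
  supremum in \<open>opn\<close> finite.\<close>

lemma op_bounded:
  assumes "f \<in> carrier F" shows "\<exists>K\<ge>0. \<forall>v\<in>V. nv (op f v) \<le> K * nv v"
  using assms subset_UNIV
proof (induction rule: F_induct)
  case zero
  have "op (\<lambda>w. 0) v = (\<lambda>c. 0)" for v by (auto simp: op_def)
  then show ?case by (intro exI[of _ 0]) simp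
next
  case (step f w k)
  then obtain K where K: "K \<ge> 0" "\<And>v. v \<in> V \<Longrightarrow> nv (op f v) \<le> K * nv v" by blast
  have wF: "wmono w \<in> carrier F" using step by blast
  have "nv (op (f \<oplus>\<^bsub>F\<^esub> k \<odot>\<^bsub>F\<^esub> wmono w) v) \<le> (K + cmod k) * nv v" if v: "v \<in> V" for v
  proof -
    have "nv (op (f \<oplus>\<^bsub>F\<^esub> k \<odot>\<^bsub>F\<^esub> wmono w) v) = nv (\<lambda>c. op f v c + op (k \<odot>\<^bsub>F\<^esub> wmono w) v c)"
      using step wF by (simp add: op_add)
    also have "\<dots> \<le> nv (op f v) + nv (op (k \<odot>\<^bsub>F\<^esub> wmono w) v)"
      using V_fin[OF op_V[OF step(1) v]] V_fin[OF op_V[OF F.smult_closed[OF wF] v]] by (rule nv_add)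
    also have "nv (op (k \<odot>\<^bsub>F\<^esub> wmono w) v) = cmod k * nv (op (wmono w) v)"
      unfolding op_smult using V_fin[OF op_V[OF wF v]] by (rule nv_scale)
    also have "nv (op f v) + cmod k * nv (op (wmono w) v) \<le> K * nv v + cmod k * nv v"
      using K(2)[OF v] op_word_contractive[OF _ v, of w] step by (intro add_mono mult_left_mono) auto
    finally show ?thesis by (simp add: distrib_right)
  qed
  moreover have "0 \<le> K + cmod k" using K(1) by simp
  ultimately show ?case by blast
qed

definition opn :: "('a field_gen list \<Rightarrow> complex) \<Rightarrow> real" where
  "opn f = (SUP v\<in>{v\<in>V. nv v \<le> 1}. nv (op f v))"

lemma zero_V: "(\<lambda>c. 0) \<in> V"
  by (simp add: V_def)

lemma scale_V: "v \<in> V \<Longrightarrow> (\<lambda>c. k * v c) \<in> V"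
  by (auto simp: V_def)

lemma opn_bdd: assumes f: "f \<in> carrier F" shows "bdd_above ((\<lambda>v. nv (op f v)) ` {v\<in>V. nv v \<le> 1})"
proof -
  obtain K where K: "K \<ge> 0" "\<forall>v\<in>V. nv (op f v) \<le> K * nv v" using op_bounded[OF f] by blast
  have "nv (op f v) \<le> K" if "v \<in> V" "nv v \<le> 1" for v
    using K mult_left_mono[OF that(2) K(1)] that(1) by fastforce
  then show ?thesis by (intro bdd_aboveI2[of _ _ K]) auto
qed

lemma opn_upper: assumes f: "f \<in> carrier F" and v: "v \<in> V" shows "nv (op f v) \<le> opn f * nv v"
proof (cases "nv v = 0")
  case True
  then have "v = (\<lambda>c. 0)" using nv_eq_0[OF V_fin[OF v]] by auto
  then have "op f v = (\<lambda>c. 0)" using op_scale_right[of f 0 v] by simp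
  then show ?thesis using True by simp
next
  case False
  then have pos: "nv v > 0" using nv_nonneg[of v] by linarith
  let ?k = "complex_of_real (1 / nv v)"
  have "nv (\<lambda>c. ?k * v c) = 1"
    unfolding nv_scale[OF V_fin[OF v]] norm_of_real using pos by simp
  then have le: "nv (op f (\<lambda>c. ?k * v c)) \<le> opn f"
    unfolding opn_def
    by (intro cSUP_upper opn_bdd[OF f] CollectI conjI scale_V[OF v]) (simp only: order_refl)
  have eq: "nv (op f (\<lambda>c. ?k * v c)) = 1 / nv v * nv (op f v)"
    unfolding op_scale_right nv_scale[OF V_fin[OF op_V[OF f v]]] norm_of_real using pos by simp
  have "1 / nv v * nv (op f v) \<le> opn f" using le unfolding eq .
  then show ?thesis using pos by (simp add: field_simps)
qed

lemma opn_least: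
  assumes "K \<ge> 0" "\<And>v. v \<in> V \<Longrightarrow> nv (op f v) \<le> K * nv v" shows "opn f \<le> K"
  unfolding opn_def
proof (rule cSUP_least)
  show "{v\<in>V. nv v \<le> 1} \<noteq> {}" using zero_V by auto
  fix v assume "v \<in> {v\<in>V. nv v \<le> 1}"
  then show "nv (op f v) \<le> K" using assms(2)[of v] mult_left_mono[of "nv v" 1 K] assms(1) by auto
qed

lemma opn_nonneg: "f \<in> carrier F \<Longrightarrow> opn f \<ge> 0"
  unfolding opn_def by (rule cSUP_upper2[OF opn_bdd, of _ "\<lambda>c. 0"]) (auto simp: zero_V)

lemma opn_cong:
  assumes "f \<in> carrier F" "g \<in> carrier F" "q f = q g" shows "opn f = opn g"
proof -
  have "op f v = op g v" if v: "v \<in> V" for v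
  proof
    fix c show "op f v c = op g v c"
    proof (cases "c \<in> Conf")
      case True
      then show ?thesis
        using op_kern[OF assms(1) True V_fin[OF v] order_refl] op_kern[OF assms(2) True V_fin[OF v] order_refl]
          assms(3) q_eq_iff_kern[OF assms(1,2)] by simp
    qed (simp add: op_def)
  qed
  then show ?thesis unfolding opn_def by (intro SUP_cong) auto
qed

text \<open>Applied to the indicator of b the operator shows its column b, so norm zero forces all
  matrix coefficients to vanish; faithfulness turns this into vanishing in the quotient.\<close>

lemma opn_eq_0:
  assumes f: "f \<in> carrier F" shows "opn f = 0 \<longleftrightarrow> q f = q \<zero>\<^bsub>F\<^esub>"
proof
  assume 0: "opn f = 0"
  have "kern G f c b = 0" if c: "c \<in> Conf" for c b
  proof (cases "b \<in> Conf")
    case True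
    let ?v = "\<lambda>d. if d = b then 1 else 0 :: complex"
    have v: "?v \<in> V" using True by (auto simp: V_def)
    have "op f ?v c = kern G f c b" using op_kern[OF f c, of "{b}" ?v] by auto
    moreover have "nv (op f ?v) = 0" using opn_upper[OF f v] 0 nv_nonneg[of "op f ?v"] by simp
    then have "op f ?v c = 0" using nv_eq_0[OF V_fin[OF op_V[OF f v]]] by blast
    ultimately show ?thesis by simp
  qed (rule kern_outside[OF f c])
  then show "q f = q \<zero>\<^bsub>F\<^esub>" unfolding q_eq_iff_kern[OF f F.zero_closed] by (simp add: F_simps(4))
next
  assume "q f = q \<zero>\<^bsub>F\<^esub>"
  then have "opn f = opn \<zero>\<^bsub>F\<^esub>" by (rule opn_cong[OF f F.zero_closed])
  moreover have "op \<zero>\<^bsub>F\<^esub> v = (\<lambda>c. 0)" for v by (auto simp: op_def F_simps(4))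
  then have "opn \<zero>\<^bsub>F\<^esub> \<le> 0" by (intro opn_least) simp_all
  ultimately show "opn f = 0" using opn_nonneg[OF f] by simp
qed

lemma opn_add:
  assumes f: "f \<in> carrier F" and g: "g \<in> carrier F" shows "opn (f \<oplus>\<^bsub>F\<^esub> g) \<le> opn f + opn g"
proof (rule opn_least)
  fix v assume v: "v \<in> V"
  have "nv (op (f \<oplus>\<^bsub>F\<^esub> g) v) \<le> nv (op f v) + nv (op g v)"
    unfolding op_add[OF f g] using V_fin[OF op_V[OF f v]] V_fin[OF op_V[OF g v]] by (rule nv_add)
  also have "\<dots> \<le> opn f * nv v + opn g * nv v"
    using opn_upper[OF f v] opn_upper[OF g v] by simp
  finally show "nv (op (f \<oplus>\<^bsub>F\<^esub> g) v) \<le> (opn f + opn g) * nv v" by (simp add: distrib_right)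
qed (use opn_nonneg f g in simp)

lemma opn_smult:
  assumes f: "f \<in> carrier F" shows "opn (k \<odot>\<^bsub>F\<^esub> f) = cmod k * opn f"
proof -
  have le: "opn (k \<odot>\<^bsub>F\<^esub> f) \<le> cmod k * opn f" if f: "f \<in> carrier F" for k f
  proof (rule opn_least)
    fix v assume v: "v \<in> V"
    have "nv (op (k \<odot>\<^bsub>F\<^esub> f) v) = cmod k * nv (op f v)"
      unfolding op_smult using V_fin[OF op_V[OF f v]] by (rule nv_scale)
    then show "nv (op (k \<odot>\<^bsub>F\<^esub> f) v) \<le> cmod k * opn f * nv v"
      using opn_upper[OF f v] by (simp add: mult_left_mono mult.assoc)
  qed (use opn_nonneg[OF f] in simp)
  show ?thesis
  proof (cases "k = 0")
    case True
    then show ?thesis using le[OF f, of k] opn_nonneg[OF F.smult_closed[OF f, of k]] by simp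
  next
    case False
    have "opn ((1 / k) \<odot>\<^bsub>F\<^esub> (k \<odot>\<^bsub>F\<^esub> f)) \<le> cmod (1 / k) * opn (k \<odot>\<^bsub>F\<^esub> f)"
      using le[OF F.smult_closed[OF f]] .
    moreover have "(1 / k) \<odot>\<^bsub>F\<^esub> (k \<odot>\<^bsub>F\<^esub> f) = f" using False f by (simp add: F.smult_smult)
    ultimately have "cmod k * opn f \<le> opn (k \<odot>\<^bsub>F\<^esub> f)"
      using False by (simp add: norm_divide field_simps)
    then show ?thesis using le[OF f, of k] by simp
  qed
qed

lemma opn_mult:
  assumes f: "f \<in> carrier F" and g: "g \<in> carrier F" shows "opn (f \<otimes>\<^bsub>F\<^esub> g) \<le> opn f * opn g"
proof (rule opn_least)
  fix v assume v: "v \<in> V"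
  have "nv (op (f \<otimes>\<^bsub>F\<^esub> g) v) \<le> opn f * nv (op g v)"
    unfolding op_mult[OF f g] by (rule opn_upper[OF f op_V[OF g v]])
  also have "\<dots> \<le> opn f * (opn g * nv v)"
    using opn_upper[OF g v] opn_nonneg[OF f] by (rule mult_left_mono)
  finally show "nv (op (f \<otimes>\<^bsub>F\<^esub> g) v) \<le> opn f * opn g * nv v" by (simp add: mult.assoc)
qed (use opn_nonneg f g in simp)

text \<open>With f' the star of f, the square of the norm of f v is the inner product of f' f v and
  v, which Cauchy-Schwarz bounds by the norm of f' f times the square of the norm of v.\<close>

lemma opn_star_mult:
  assumes f: "f \<in> carrier F" shows "opn (star F f \<otimes>\<^bsub>F\<^esub> f) = (opn f)\<^sup>2"
proof -
  have sq: "(opn f)\<^sup>2 \<le> opn (star F f \<otimes>\<^bsub>F\<^esub> f)" if f: "f \<in> carrier F" for f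
  proof -
    have ff: "star F f \<otimes>\<^bsub>F\<^esub> f \<in> carrier F" using f by simp
    have "opn f \<le> sqrt (opn (star F f \<otimes>\<^bsub>F\<^esub> f))"
    proof (rule opn_least)
      fix v assume v: "v \<in> V"
      note fv = op_V[OF f v]
      have "complex_of_real ((nv (op f v))\<^sup>2) = ip (op f v) (op f v)"
        by (rule ip_self[OF V_fin[OF fv], symmetric])
      also have "\<dots> = ip (op (star F f) (op f v)) v" by (rule op_adjoint[OF f fv v])
      also have "\<dots> = ip (op (star F f \<otimes>\<^bsub>F\<^esub> f) v) v" using f by (simp add: op_mult)
      finally have "(nv (op f v))\<^sup>2 = cmod (ip (op (star F f \<otimes>\<^bsub>F\<^esub> f) v) v)"
        by (metis abs_of_nonneg norm_of_real zero_le_power2)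
      also have "\<dots> \<le> nv (op (star F f \<otimes>\<^bsub>F\<^esub> f) v) * nv v"
        by (rule cauchy_schwarz[OF V_fin[OF op_V[OF ff v]] V_fin[OF v]])
      also have "\<dots> \<le> opn (star F f \<otimes>\<^bsub>F\<^esub> f) * nv v * nv v"
        by (rule mult_right_mono[OF opn_upper[OF ff v]]) simp
      finally have "(nv (op f v))\<^sup>2 \<le> opn (star F f \<otimes>\<^bsub>F\<^esub> f) * (nv v)\<^sup>2"
        by (simp add: power2_eq_square mult.assoc)
      then have "sqrt ((nv (op f v))\<^sup>2) \<le> sqrt (opn (star F f \<otimes>\<^bsub>F\<^esub> f) * (nv v)\<^sup>2)"
        by (rule real_sqrt_le_mono)
      then show "nv (op f v) \<le> sqrt (opn (star F f \<otimes>\<^bsub>F\<^esub> f)) * nv v" by (simp add: real_sqrt_mult)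
    qed (use opn_nonneg[OF ff] in simp)
    then have "(opn f)\<^sup>2 \<le> (sqrt (opn (star F f \<otimes>\<^bsub>F\<^esub> f)))\<^sup>2"
      using opn_nonneg[OF f] by (rule power_mono)
    then show ?thesis using opn_nonneg[OF ff] by simp
  qed
  \<comment> \<open>The inequality just shown, taken for the star of f, bounds the norm of the star
    by that of f; the reverse inequality of the claim follows by submultiplicativity.\<close>
  have "opn (star F f) * opn (star F f) \<le> opn f * opn (star F f)"
    using sq[of "star F f"] opn_mult[of f "star F f"] f by (simp add: power2_eq_square)
  then have "opn (star F f) \<le> opn f"
    using opn_nonneg[of "star F f"] opn_nonneg[OF f] f
    by (cases "opn (star F f) = 0") (simp_all add: mult_le_cancel_right less_le)
  then have "opn (star F f) * opn f \<le> (opn f)\<^sup>2"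
    using opn_nonneg[OF f] by (simp add: power2_eq_square mult_right_mono)
  then show ?thesis using opn_mult[of "star F f" f] sq[OF f] f by simp
qed

definition opnorm :: "('a field_gen list \<Rightarrow> complex) set \<Rightarrow> real" where
  "opnorm Y = opn (SOME f. f \<in> carrier F \<and> Y = q f)"

lemma opnorm_q:
  assumes f: "f \<in> carrier F" shows "opnorm (q f) = opn f"
proof -
  define g where "g = (SOME g. g \<in> carrier F \<and> q f = q g)"
  have "g \<in> carrier F \<and> q f = q g"
    unfolding g_def by (rule someI[of "\<lambda>g. g \<in> carrier F \<and> q f = q g" f]) (intro conjI f refl)
  then have "opn f = opn g" by (intro opn_cong[OF f]) blast+
  then show ?thesis unfolding opnorm_def g_def ..
qed

lemma L_ops:
  shows carrier_L: "carrier L = q ` carrier F" and one_L: "\<one>\<^bsub>L\<^esub> = q \<one>\<^bsub>F\<^esub>" and zero_L: "\<zero>\<^bsub>L\<^esub> = q \<zero>\<^bsub>F\<^esub>"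
    and add_L: "f \<in> carrier F \<Longrightarrow> g \<in> carrier F \<Longrightarrow> q f \<oplus>\<^bsub>L\<^esub> q g = q (f \<oplus>\<^bsub>F\<^esub> g)"
    and mult_L: "f \<in> carrier F \<Longrightarrow> g \<in> carrier F \<Longrightarrow> q f \<otimes>\<^bsub>L\<^esub> q g = q (f \<otimes>\<^bsub>F\<^esub> g)"
    and smult_L: "f \<in> carrier F \<Longrightarrow> k \<odot>\<^bsub>L\<^esub> q f = q (k \<odot>\<^bsub>F\<^esub> f)"
    and star_L: "f \<in> carrier F \<Longrightarrow> star L (q f) = q (star F f)"
  unfolding local_field_algebra_def
  by (simp_all only: L.carrier_Q L.one_Q L.zero_Q L.q_ops S.star_q)

lemma q_L [simp, intro]: "f \<in> carrier F \<Longrightarrow> q f \<in> carrier L"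
  unfolding carrier_L by (rule imageI)

lemma carrier_LE:
  assumes "Y \<in> carrier L" obtains f where "f \<in> carrier F" "Y = q f"
  using assms unfolding carrier_L by blast

lemma cstar_opnorm: "is_cstar_norm L (carrier L) opnorm"
  unfolding is_cstar_norm_def
proof (intro conjI ballI allI)
  fix Y k assume "Y \<in> carrier L"
  then obtain f where f: "f \<in> carrier F" and Y: "Y = q f" by (rule carrier_LE)
  show "0 \<le> opnorm Y" unfolding Y opnorm_q[OF f] by (rule opn_nonneg[OF f])
  show "opnorm (star L Y \<otimes>\<^bsub>L\<^esub> Y) = (opnorm Y)\<^sup>2"
    unfolding Y star_L[OF f] mult_L[OF F.star_closed[OF f] f] opnorm_q[OF f]
      opnorm_q[OF F.m_closed[OF F.star_closed[OF f] f]] by (rule opn_star_mult[OF f])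
  show "opnorm Y = 0 \<longleftrightarrow> Y = \<zero>\<^bsub>L\<^esub>"
    unfolding Y zero_L opnorm_q[OF f] by (rule opn_eq_0[OF f])
  show "opnorm (k \<odot>\<^bsub>L\<^esub> Y) = cmod k * opnorm Y"
    unfolding Y smult_L[OF f] opnorm_q[OF f] opnorm_q[OF F.smult_closed[OF f]] by (rule opn_smult[OF f])
  fix Z assume "Z \<in> carrier L"
  then obtain g where g: "g \<in> carrier F" and Z: "Z = q g" by (rule carrier_LE)
  show "opnorm (Y \<oplus>\<^bsub>L\<^esub> Z) \<le> opnorm Y + opnorm Z"
    unfolding Y Z add_L[OF f g] opnorm_q[OF f] opnorm_q[OF g] opnorm_q[OF F.a_closed[OF f g]]
    by (rule opn_add[OF f g])
  show "opnorm (Y \<otimes>\<^bsub>L\<^esub> Z) \<le> opnorm Y * opnorm Z"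
    unfolding Y Z mult_L[OF f g] opnorm_q[OF f] opnorm_q[OF g] opnorm_q[OF F.m_closed[OF f g]]
    by (rule opn_mult[OF f g])
qed

end

section \<open>Uniqueness of the C*-norm on local algebras\<close>

lemma supp_wmono: "{w. wmono u w \<noteq> 0} = {u}"
  by (auto simp: wmono_def)

text \<open>If a > b > 0, the powers of a/b exceed every K, and the exponents 2^k are large enough
  because n \<le> 2^n.\<close>

lemma le_of_power_bound:
  fixes a b K :: real
  assumes "a \<ge> 0" "b \<ge> 0" and le: "\<And>k. a ^ (2 ^ k) \<le> K * b ^ (2 ^ k)"
  shows "a \<le> b"
proof (rule ccontr)
  assume "\<not> a \<le> b"
  then have ab: "a > b" by simp
  have a: "a \<le> K * b" using le[of 0] by simp
  \<comment> \<open>The case k = 0 of the bound reads a \<le> K b; with b = 0 it would contradict a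
    > b.\<close>
  then have b: "b > 0" using assms ab by (cases "b = 0") auto
  define r where "r = a / b"
  have r: "r > 1" using ab b by (simp add: r_def)
  then obtain n where n: "K < r ^ n" using real_arch_pow by blast
  have "r ^ n \<le> r ^ (2 ^ n)" using r by (intro power_increasing) (auto simp: less_imp_le less_exp)
  moreover have "r ^ (2 ^ n) \<le> K" using le[of n] b by (simp add: r_def power_divide divide_le_eq)
  ultimately show False using n by simp
qed

context star_alg
begin

text \<open>On a self-adjoint \<open>h\<close> a C*-norm satisfies \<open>N (h\<^sup>2) = (N h)\<^sup>2\<close>; repeated squaring turns the
  comparison of two equivalent C*-norms into a comparison with constant 1.\<close>

lemma cstar_norm_le:
  assumes M: "M \<subseteq> carrier A" "\<And>x y. x \<in> M \<Longrightarrow> y \<in> M \<Longrightarrow> x \<otimes> y \<in> M" "\<And>x. x \<in> M \<Longrightarrow> star A x \<in> M"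
    and N: "is_cstar_norm A M N" and N': "is_cstar_norm A M N'"
    and K: "\<And>x. x \<in> M \<Longrightarrow> N' x \<le> K * N x" and x: "x \<in> M"
  shows "N' x \<le> N x"
proof -
  \<comment> \<open>\<open>h k\<close> is the 2^k-th power of \<open>star A x \<otimes> x\<close>.
    It is self-adjoint and stays in M, so the C*-identity applies again at each squaring.\<close>
  define h where "h = rec_nat (star A x \<otimes> x) (\<lambda>_ y. y \<otimes> y)"
  have h0: "h 0 = star A x \<otimes> x" and hS: "h (Suc k) = h k \<otimes> h k" for k
    by (simp_all add: h_def)
  have h: "h k \<in> M \<and> star A (h k) = h k" for k
  proof (induction k)
    case 0
    have "x \<in> carrier A" using x M(1) by blast
    then show ?case using x M(2,3) by (simp add: h0 star_mult)
  next
    case (Suc k)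
    then have "h k \<in> carrier A" using M(1) by blast
    then show ?case using Suc M(2) by (simp add: hS star_mult)
  qed
  have pow: "P (h k) = P (h 0) ^ (2 ^ k)" if P: "is_cstar_norm A M P" for P k
  proof (induction k)
    case (Suc k)
    have "P (star A (h k) \<otimes> h k) = (P (h k))\<^sup>2" using P h[of k] unfolding is_cstar_norm_def by blast
    then have "P (h (Suc k)) = (P (h k))\<^sup>2" using h[of k] by (simp add: hS)
    then show ?case using Suc by (simp add: power_mult[symmetric] mult.commute)
  qed simp
  have pos: "P y \<ge> 0" if "is_cstar_norm A M P" "y \<in> M" for P y
    using that unfolding is_cstar_norm_def by blast
  have "N' (h 0) \<le> N (h 0)"
  proof (rule le_of_power_bound)
    fix k show "N' (h 0) ^ (2 ^ k) \<le> K * N (h 0) ^ (2 ^ k)"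
      using K[of "h k"] h[of k] unfolding pow[OF N, symmetric] pow[OF N', symmetric] by blast
  qed (use pos N N' h in blast)+
  moreover have "P (h 0) = (P x)\<^sup>2" if "is_cstar_norm A M P" for P
    using that x unfolding is_cstar_norm_def h0 by blast
  ultimately have "(N' x)\<^sup>2 \<le> (N x)\<^sup>2" using N N' by simp
  then show ?thesis using pos[OF N x] by (rule power2_le_imp_le)
qed

end

context field_alg
begin

sublocale SL: star_alg L by (rule star_alg_L)

abbreviation M where "M n \<equiv> field_subalgebra G H (Lambda n)"

lemma gen_class: "field_gen_class G H x = W [x]"
  by (simp add: field_gen_class_def gen_elem_eq_wmono)

lemma M_words:
  assumes "Y \<in> M n"
  shows "\<exists>f\<in>carrier F. {w. f w \<noteq> 0} \<subseteq> lists (field_gens G H (Lambda n)) \<and> Y = q f"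
  using assms unfolding field_subalgebra_def
proof (induction rule: generated_subalgebra.induct)
  case (gen Y)
  then obtain x where x: "x \<in> field_gens G H (Lambda n)" "Y = W [x]" by (auto simp: gen_class)
  then have "x \<in> X" using gens_mono[of "Lambda n" UNIV] by blast
  then show ?case using x by (intro bexI[of _ "wmono [x]"]) (auto simp: supp_wmono)
next
  case one
  show ?case unfolding one_L F_simps(3) by (intro bexI[of _ "wmono []"]) (auto simp: supp_wmono)
next
  case (add Y Z)
  then obtain f g where f: "f \<in> carrier F" "{w. f w \<noteq> 0} \<subseteq> lists (field_gens G H (Lambda n))" "Y = q f"
    and g: "g \<in> carrier F" "{w. g w \<noteq> 0} \<subseteq> lists (field_gens G H (Lambda n))" "Z = q g" by blast
  have "{w. (f \<oplus>\<^bsub>F\<^esub> g) w \<noteq> 0} \<subseteq> {w. f w \<noteq> 0} \<union> {w. g w \<noteq> 0}" by (auto simp: F_simps(5))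
  then have "{w. (f \<oplus>\<^bsub>F\<^esub> g) w \<noteq> 0} \<subseteq> lists (field_gens G H (Lambda n))" using f(2) g(2) by blast
  then show ?case using F.a_closed[OF f(1) g(1)] add_L[OF f(1) g(1)] unfolding f(3) g(3) by blast
next
  case (mult Y Z)
  then obtain f g where f: "f \<in> carrier F" "{w. f w \<noteq> 0} \<subseteq> lists (field_gens G H (Lambda n))" "Y = q f"
    and g: "g \<in> carrier F" "{w. g w \<noteq> 0} \<subseteq> lists (field_gens G H (Lambda n))" "Z = q g" by blast
  have "(\<lambda>(u, v). u @ v) ` ({w. f w \<noteq> 0} \<times> {w. g w \<noteq> 0}) \<subseteq> lists (field_gens G H (Lambda n))"
  proof
    fix w assume "w \<in> (\<lambda>(u, v). u @ v) ` ({w. f w \<noteq> 0} \<times> {w. g w \<noteq> 0})"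
    then obtain u v where uv: "w = u @ v" "f u \<noteq> 0" "g v \<noteq> 0" by auto
    then have "u \<in> lists (field_gens G H (Lambda n))" "v \<in> lists (field_gens G H (Lambda n))"
      using f(2) g(2) by blast+
    then show "w \<in> lists (field_gens G H (Lambda n))" unfolding uv(1) by simp
  qed
  then have "{w. (f \<otimes>\<^bsub>F\<^esub> g) w \<noteq> 0} \<subseteq> lists (field_gens G H (Lambda n))"
    unfolding F_simps(2) using conv_supp[of f g] by (rule order_trans[rotated])
  then show ?case using F.m_closed[OF f(1) g(1)] mult_L[OF f(1) g(1)] unfolding f(3) g(3) by blast
next
  case (smult Y k)
  then obtain f where f: "f \<in> carrier F" "{w. f w \<noteq> 0} \<subseteq> lists (field_gens G H (Lambda n))" "Y = q f" by blast
  have "{w. (k \<odot>\<^bsub>F\<^esub> f) w \<noteq> 0} \<subseteq> {w. f w \<noteq> 0}" by (auto simp: F_simps(6))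
  then have "{w. (k \<odot>\<^bsub>F\<^esub> f) w \<noteq> 0} \<subseteq> lists (field_gens G H (Lambda n))" using f(2) by blast
  then show ?case using F.smult_closed[OF f(1)] smult_L[OF f(1)] unfolding f(3) by blast
qed

lemma words_M:
  assumes "f \<in> carrier F" "{w. f w \<noteq> 0} \<subseteq> lists (field_gens G H (Lambda n))"
  shows "q f \<in> M n"
proof -
  have gX: "field_gens G H (Lambda n) \<subseteq> X" by (rule gens_mono) simp
  have word: "W w \<in> M n" if "w \<in> lists (field_gens G H (Lambda n))" for w
    using that
  proof (induction w)
    case Nil
    show ?case
      using generated_subalgebra.one[of L "field_gen_class G H ` field_gens G H (Lambda n)"]
      unfolding field_subalgebra_def one_L F_simps(3) .
  next
    case (Cons a w)
    then have aX: "[a] \<in> lists X" "w \<in> lists X" using gX by (auto simp: in_lists_conv_set)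
    have "W [a] \<in> M n"
      unfolding field_subalgebra_def gen_class[symmetric]
      using Cons.hyps(1) by (intro generated_subalgebra.gen imageI)
    then have "W [a] \<otimes>\<^bsub>L\<^esub> W w \<in> M n"
      using Cons.IH unfolding field_subalgebra_def by (rule generated_subalgebra.mult)
    then show ?case
      using mult_L[OF wmono_closed[OF aX(1)] wmono_closed[OF aX(2)]] wmono_append[of "[a]" w] by simp
  qed
  show ?thesis
    using assms
  proof (induction rule: F_induct)
    case zero
    have "0 \<odot>\<^bsub>L\<^esub> \<one>\<^bsub>L\<^esub> \<in> M n"
      unfolding field_subalgebra_def by (intro generated_subalgebra.smult generated_subalgebra.one)
    then show ?case by (simp add: zero_L F_simps(4))
  next
    case (step f w k)
    have wF: "wmono w \<in> carrier F" and "w \<in> lists (field_gens G H (Lambda n))" using step by blast+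
    then have "k \<odot>\<^bsub>L\<^esub> W w \<in> M n"
      using word[of w] unfolding field_subalgebra_def by (blast intro: generated_subalgebra.smult)
    with step.IH have "q f \<oplus>\<^bsub>L\<^esub> (k \<odot>\<^bsub>L\<^esub> W w) \<in> M n"
      unfolding field_subalgebra_def by (rule generated_subalgebra.add)
    then show ?case using step wF by (simp add: smult_L add_L)
  qed
qed

lemma M_covers: "Y \<in> carrier L \<Longrightarrow> \<exists>n. Y \<in> M n"
  using supp_covers words_M by (elim carrier_LE) blast

lemma M_subset: "M n \<subseteq> carrier L"
  using M_words q_L by blast

lemma M_mult: "x \<in> M n \<Longrightarrow> y \<in> M n \<Longrightarrow> x \<otimes>\<^bsub>L\<^esub> y \<in> M n"
  unfolding field_subalgebra_def by (rule generated_subalgebra.mult)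

lemma M_star: assumes "x \<in> M n" shows "star L x \<in> M n"
proof -
  obtain f where f: "f \<in> carrier F" "{w. f w \<noteq> 0} \<subseteq> lists (field_gens G H (Lambda n))" "x = q f"
    using M_words[OF assms] by blast
  have st: "field_gen_star G a \<in> field_gens G H (Lambda n) \<longleftrightarrow> a \<in> field_gens G H (Lambda n)" if "a \<in> X" for a
    using that by (cases a) auto
  have "{w. star F f w \<noteq> 0} \<subseteq> lists (field_gens G H (Lambda n))"
  proof
    fix w assume "w \<in> {w. star F f w \<noteq> 0}"
    then have w: "w \<in> lists X" "f (rev (map (field_gen_star G) w)) \<noteq> 0"
      by (auto simp: F_simps(7) split: if_splits)
    then have "rev (map (field_gen_star G) w) \<in> lists (field_gens G H (Lambda n))" using f(2) by blast
    then show "w \<in> lists (field_gens G H (Lambda n))" using w(1) st by (auto simp: in_lists_conv_set)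
  qed
  then show ?thesis unfolding f(3) star_L[OF f(1)] using f(1) by (intro words_M) auto
qed

lemma M_NF:
  assumes "Y \<in> M n" obtains a where "a \<in> carrier F" "{w. a w \<noteq> 0} \<subseteq> NF (sites n)" "Y = q a"
proof -
  obtain f where f: "f \<in> carrier F" "{w. f w \<noteq> 0} \<subseteq> lists (field_gens G H (Lambda n))" "Y = q f"
    using M_words[OF assms] by blast
  have "f \<in> Span (NF (sites n))"
    using in_Span_NF[OF sites_list_sites f(1)] f(2) unfolding gens_Lambda by blast
  then show ?thesis using that f(3) unfolding Span_def by blast
qed

lemma NF_M: assumes "{w. a w \<noteq> 0} \<subseteq> lists (gens_on (sites n))" "a \<in> carrier F" shows "q a \<in> M n"
  using words_M[OF assms(2)] assms(1) unfolding gens_Lambda by blast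

lemma dw_gens: "c \<in> Conf \<Longrightarrow> dw c xs \<in> lists (gens_on xs)"
  using Conf_mem by (auto simp: dw_def gens_on_def in_lists_conv_set)

lemma rw_gens: "k \<in> KH \<Longrightarrow> rw k xs \<in> lists (gens_on xs)"
  using KH_D by (auto simp: rw_def gens_on_def in_lists_conv_set)

lemma NF_gens: "NF xs \<subseteq> lists (gens_on xs)"
proof
  fix w assume "w \<in> NF xs"
  then obtain c k where "c \<in> Conf" "k \<in> KH" "w = dw c xs @ rw k xs" unfolding NF_def by blast
  then show "w \<in> lists (gens_on xs)" using dw_gens[of c xs] rw_gens[of k xs] by simp
qed

lemma word_M: "w \<in> lists (gens_on (sites n)) \<Longrightarrow> W w \<in> M n"
proof -
  assume w: "w \<in> lists (gens_on (sites n))"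
  have "w \<in> lists X" using w gens_on_X[OF sites_list_sites, of n] by (auto simp: in_lists_conv_set)
  then show ?thesis using w by (intro NF_M) (auto simp: supp_wmono)
qed

text \<open>The corner at u equals the coefficient of u times the class of u, and multiplying by the
  two projections is bounded for any submultiplicative norm. So every C*-norm controls the
  coordinates with respect to the normal forms.\<close>

lemma coefficient_bound:
  assumes N: "is_cstar_norm L (M n) N" and u: "u \<in> NF (sites n)"
  shows "\<exists>K\<ge>0. \<forall>a\<in>carrier F. {w. a w \<noteq> 0} \<subseteq> NF (sites n) \<longrightarrow> cmod (a u) \<le> K * N (q a)"
proof -
  note xs = sites_list_sites[of n]
  obtain c b where cb: "c \<in> Conf" "b \<in> Conf" "pull G u c = Some b"
    and corner: "\<And>a d e. a \<in> carrier F \<Longrightarrow> {w. a w \<noteq> 0} \<subseteq> NF (sites n) \<Longrightarrow> d \<in> Conf \<Longrightarrow>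
      kern G (wmono (dw c (sites n)) \<otimes>\<^bsub>F\<^esub> a \<otimes>\<^bsub>F\<^esub> wmono (dw b (sites n))) d e =
        a u * (if pull G u d = Some e then 1 else 0)"
    using NF_corner_kern[OF xs u] by metis
  let ?D = "wmono (dw c (sites n))" and ?E = "wmono (dw b (sites n))"
  have DE: "?D \<in> carrier F" "?E \<in> carrier F" "wmono u \<in> carrier F"
    using dw_lists cb sites_ints[OF xs] NF_lists[OF xs u] by blast+
  have DEM: "q ?D \<in> M n" "q ?E \<in> M n" "W u \<in> M n"
    using cb dw_gens NF_gens u by (blast intro: word_M)+
  note n = N[unfolded is_cstar_norm_def]
  have pos: "N x \<ge> 0" if "x \<in> M n" for x using n that by blast
  have "W u \<noteq> \<zero>\<^bsub>L\<^esub>"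
  proof
    assume "W u = \<zero>\<^bsub>L\<^esub>"
    then have "kern G (wmono u) c b = kern G \<zero>\<^bsub>F\<^esub> c b"
      using q_eq_iff_kern[OF DE(3) F.zero_closed] cb(1) unfolding zero_L by blast
    then show False using cb(3) by (simp add: kern_wmono F_simps(4))
  qed
  then have Wu: "N (W u) > 0" using n DEM(3) pos[OF DEM(3)] by (metis less_eq_real_def)
  \<comment> \<open>The norms of the two cutting projections come from submultiplicativity, the
    denominator from the norm of the class of u, which is nonzero by faithfulness.\<close>
  let ?K = "N (q ?D) * N (q ?E) / N (W u)"
  have "cmod (a u) \<le> ?K * N (q a)" if a: "a \<in> carrier F" "{w. a w \<noteq> 0} \<subseteq> NF (sites n)" for a
  proof -
    have aM: "q a \<in> M n" using a NF_gens by (blast intro: NF_M)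
    have "q (?D \<otimes>\<^bsub>F\<^esub> a \<otimes>\<^bsub>F\<^esub> ?E) = q (a u \<odot>\<^bsub>F\<^esub> wmono u)"
    proof -
      have "kern G (a u \<odot>\<^bsub>F\<^esub> wmono u) d e = a u * (if pull G u d = Some e then 1 else 0)" for d e
        by (simp add: F_simps(6) kern_scale kern_wmono)
      then show ?thesis using corner[OF a] a(1) DE q_eq_iff_kern by simp
    qed
    then have eq: "q ?D \<otimes>\<^bsub>L\<^esub> q a \<otimes>\<^bsub>L\<^esub> q ?E = a u \<odot>\<^bsub>L\<^esub> W u"
      using a(1) DE by (simp add: mult_L smult_L)
    have "cmod (a u) * N (W u) = N (a u \<odot>\<^bsub>L\<^esub> W u)" using n DEM(3) by metis
    also have "\<dots> = N (q ?D \<otimes>\<^bsub>L\<^esub> q a \<otimes>\<^bsub>L\<^esub> q ?E)" by (simp only: eq)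
    also have "\<dots> \<le> N (q ?D \<otimes>\<^bsub>L\<^esub> q a) * N (q ?E)" using n M_mult[OF DEM(1) aM] DEM(2) by blast
    also have "\<dots> \<le> N (q ?D) * N (q a) * N (q ?E)"
      using n DEM(1) aM pos[OF DEM(2)] by (intro mult_right_mono) blast+
    finally show ?thesis using Wu by (simp add: field_simps)
  qed
  moreover have "?K \<ge> 0" using pos DEM Wu by simp
  ultimately show ?thesis by blast
qed

lemma norm_le_coefficients:
  assumes N: "is_cstar_norm L (M n) N" and "finite A" "A \<subseteq> NF (sites n)"
  shows "\<forall>a\<in>carrier F. {w. a w \<noteq> 0} \<subseteq> A \<longrightarrow> N (q a) \<le> (\<Sum>u\<in>A. cmod (a u) * N (W u))"
  using assms(2,3)
proof (induction A)
  case empty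
  have "N \<zero>\<^bsub>L\<^esub> = 0"
  proof -
    have "q \<zero>\<^bsub>F\<^esub> \<in> M n" by (rule words_M[OF F.zero_closed]) (simp add: F_simps(4))
    then show ?thesis using N unfolding is_cstar_norm_def zero_L by blast
  qed
  moreover have "a = \<zero>\<^bsub>F\<^esub>" if "{w. a w \<noteq> 0} \<subseteq> {}" for a :: "'a field_gen list \<Rightarrow> complex"
    using that by (auto simp: F_simps(4))
  ultimately show ?case unfolding zero_L by auto
next
  case (insert u A)
  show ?case
  proof (intro ballI impI)
    fix a assume a: "a \<in> carrier F" "{w. a w \<noteq> 0} \<subseteq> insert u A"
    define g where "g = a(u := 0)"
    have sub: "{w. g w \<noteq> 0} \<subseteq> {w. a w \<noteq> 0}" by (auto simp: g_def)
    have g: "g \<in> carrier F" "{w. g w \<noteq> 0} \<subseteq> A"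
      using a finite_subset[OF sub] sub by (auto simp: F_simps(1) g_def)
    have uF: "wmono u \<in> carrier F" using insert.prems NF_lists[OF sites_list_sites] by blast
    have aeq: "a = g \<oplus>\<^bsub>F\<^esub> a u \<odot>\<^bsub>F\<^esub> wmono u" by (auto simp: g_def F_simps wmono_def)
    have gM: "q g \<in> M n" "W u \<in> M n"
      using g insert.prems NF_gens by (blast intro: NF_M word_M)+
    have kM: "a u \<odot>\<^bsub>L\<^esub> W u \<in> M n"
      using gM(2) unfolding field_subalgebra_def by (rule generated_subalgebra.smult)
    have "q a = q g \<oplus>\<^bsub>L\<^esub> (a u \<odot>\<^bsub>L\<^esub> W u)"
      using g uF by (subst aeq) (simp add: add_L smult_L)
    then have "N (q a) \<le> N (q g) + N (a u \<odot>\<^bsub>L\<^esub> W u)"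
      using N gM(1) kM unfolding is_cstar_norm_def by metis
    also have "N (a u \<odot>\<^bsub>L\<^esub> W u) = cmod (a u) * N (W u)"
      using N gM(2) unfolding is_cstar_norm_def by blast
    also have "N (q g) \<le> (\<Sum>v\<in>A. cmod (g v) * N (W v))" using insert g by blast
    also have "(\<Sum>v\<in>A. cmod (g v) * N (W v)) = (\<Sum>v\<in>A. cmod (a v) * N (W v))"
      using insert.hyps by (intro sum.cong refl) (auto simp: g_def)
    finally show "N (q a) \<le> (\<Sum>v\<in>insert u A. cmod (a v) * N (W v))"
      using insert.hyps by simp
  qed
qed

text \<open>The coordinates with respect to the finitely many normal forms are bounded by N, and N'
  is bounded by the coordinates through the triangle inequality.\<close>

lemma cstar_norms_equivalent:
  assumes N: "is_cstar_norm L (M n) N" and N': "is_cstar_norm L (M n) N'"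
  shows "\<exists>K. \<forall>x\<in>M n. N' x \<le> K * N x"
proof -
  obtain K where K: "\<And>u. u \<in> NF (sites n) \<Longrightarrow> K u \<ge> 0 \<and>
      (\<forall>a\<in>carrier F. {w. a w \<noteq> 0} \<subseteq> NF (sites n) \<longrightarrow> cmod (a u) \<le> K u * N (q a))"
    using coefficient_bound[OF N] by metis
  let ?K = "\<Sum>u\<in>NF (sites n). K u * N' (W u)"
  have "N' x \<le> ?K * N x" if x: "x \<in> M n" for x
  proof -
    obtain a where a: "a \<in> carrier F" "{w. a w \<noteq> 0} \<subseteq> NF (sites n)" "x = q a" by (rule M_NF[OF x])
    have "N' x \<le> (\<Sum>u\<in>NF (sites n). cmod (a u) * N' (W u))"
      using norm_le_coefficients[OF N' finite_NF order_refl] a by blast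
    also have "\<dots> \<le> (\<Sum>u\<in>NF (sites n). K u * N x * N' (W u))"
    proof (intro sum_mono mult_right_mono)
      fix u assume u: "u \<in> NF (sites n)"
      show "cmod (a u) \<le> K u * N x" using K[OF u] a by blast
      have "W u \<in> M n" using u NF_gens by (blast intro: word_M)
      then show "0 \<le> N' (W u)" using N' unfolding is_cstar_norm_def by blast
    qed
    also have "\<dots> = ?K * N x" unfolding sum_distrib_right by (intro sum.cong refl) (simp add: mult_ac)
    finally show ?thesis .
  qed
  then show ?thesis by blast
qed

lemma cstar_norm_unique:
  assumes "is_cstar_norm L (M n) N" "is_cstar_norm L (M n) N'" "x \<in> M n"
  shows "N x = N' x"
proof -
  have le: "P' x \<le> P x" if P: "is_cstar_norm L (M n) P" "is_cstar_norm L (M n) P'" for P P'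
  proof -
    obtain K where K: "\<forall>x\<in>M n. P' x \<le> K * P x" using cstar_norms_equivalent[OF P] by blast
    show ?thesis
    proof (rule SL.cstar_norm_le[where M = "M n"])
      show "P' y \<le> K * P y" if "y \<in> M n" for y using K that by blast
    qed (use M_subset M_mult M_star P assms(3) in blast)+
  qed
  show ?thesis using le[OF assms(1,2)] le[OF assms(2,1)] by simp
qed

lemma is_cstar_norm_subset: "is_cstar_norm A B N \<Longrightarrow> B' \<subseteq> B \<Longrightarrow> is_cstar_norm A B' N"
  unfolding is_cstar_norm_def by (meson subsetD)

text \<open>The operator norm restricts to a C*-norm on every local algebra, so it is a witness for
  the definite description. Uniqueness on each local algebra makes it the only value, whichever
  interval and norm are taken.\<close>

lemma local_norm_eq:
  assumes "Y \<in> carrier L" shows "local_norm G H Y = opnorm Y"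
proof -
  have c: "is_cstar_norm L (M n) opnorm" for n
    by (rule is_cstar_norm_subset[OF cstar_opnorm M_subset])
  obtain n where n: "Y \<in> M n" using M_covers[OF assms] by blast
  show ?thesis
    unfolding local_norm_def
  proof (rule the_equality)
    show "\<exists>n N. Y \<in> M n \<and> is_cstar_norm L (M n) N \<and> opnorm Y = N Y" using n c by blast
    fix r assume "\<exists>n N. Y \<in> M n \<and> is_cstar_norm L (M n) N \<and> r = N Y"
    then obtain m N where "Y \<in> M m" "is_cstar_norm L (M m) N" "r = N Y" by blast
    then show "r = opnorm Y" using cstar_norm_unique[OF _ c] by blast
  qed
qed

lemma is_cstar_norm_cong:
  assumes "star_alg A" "\<And>x. x \<in> carrier A \<Longrightarrow> N x = N' x" "is_cstar_norm A (carrier A) N"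
  shows "is_cstar_norm A (carrier A) N'"
proof -
  interpret SA: star_alg A by fact
  show ?thesis using assms(2,3) unfolding is_cstar_norm_def by simp
qed

sublocale CN: cstar_normed L "local_norm G H"
proof (rule cstar_normed.intro[OF star_alg_L], unfold_locales)
  show "is_cstar_norm L (carrier L) (local_norm G H)"
    by (rule is_cstar_norm_cong[OF star_alg_L local_norm_eq[symmetric] cstar_opnorm])
qed

text \<open>The norm pulled back along \<phi> is again a C*-norm, injectivity giving definiteness;
  on each local algebra it must coincide with the given one.\<close>

lemma injective_hom_isometric:
  assumes \<phi>: "\<And>x. x \<in> carrier L \<Longrightarrow> \<phi> x \<in> carrier L"
    and "\<And>x y. x \<in> carrier L \<Longrightarrow> y \<in> carrier L \<Longrightarrow> \<phi> (x \<oplus>\<^bsub>L\<^esub> y) = \<phi> x \<oplus>\<^bsub>L\<^esub> \<phi> y"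
    and "\<And>x y. x \<in> carrier L \<Longrightarrow> y \<in> carrier L \<Longrightarrow> \<phi> (x \<otimes>\<^bsub>L\<^esub> y) = \<phi> x \<otimes>\<^bsub>L\<^esub> \<phi> y"
    and "\<And>x k. x \<in> carrier L \<Longrightarrow> \<phi> (k \<odot>\<^bsub>L\<^esub> x) = k \<odot>\<^bsub>L\<^esub> \<phi> x"
    and "\<And>x. x \<in> carrier L \<Longrightarrow> \<phi> (star L x) = star L (\<phi> x)"
    and "\<And>x. x \<in> carrier L \<Longrightarrow> \<phi> x = \<zero>\<^bsub>L\<^esub> \<longleftrightarrow> x = \<zero>\<^bsub>L\<^esub>"
    and x: "x \<in> carrier L"
  shows "local_norm G H (\<phi> x) = local_norm G H x"
proof -
  let ?N = "local_norm G H"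
  have "is_cstar_norm L (carrier L) (\<lambda>x. ?N (\<phi> x))"
    unfolding is_cstar_norm_def using assms CN.norm_nonneg CN.norm_eq_zero CN.norm_smult CN.norm_add
      CN.norm_mult CN.norm_star_mult by simp
  then have 1: "is_cstar_norm L (M n) (\<lambda>x. ?N (\<phi> x))" for n by (rule is_cstar_norm_subset[OF _ M_subset])
  have 2: "is_cstar_norm L (M n) ?N" for n by (rule is_cstar_norm_subset[OF CN.cstar_norm M_subset])
  obtain n where n: "x \<in> M n" using M_covers[OF x] by blast
  show ?thesis using cstar_norm_unique[OF 1 2 n] .
qed

section \<open>The action of \<open>D(H;G)\<close>\<close>

primrec tot :: "'a field_gen list \<Rightarrow> 'a" where
  "tot [] = \<one>"
| "tot (a # w) = (case a of Delta g x \<Rightarrow> tot w | Rho h l \<Rightarrow> h \<otimes> tot w)"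

primrec relabel :: "'a \<Rightarrow> 'a field_gen \<Rightarrow> 'a field_gen" where
  "relabel g (Delta f x) = Delta (g \<otimes> f) x"
| "relabel g (Rho t l) = Rho (g \<otimes> t \<otimes> inv g) l"

abbreviation rl where "rl g \<equiv> map (relabel g)"

lemma tot_H: "w \<in> lists X \<Longrightarrow> tot w \<in> H"
proof (induction w)
  case (Cons a w)
  then show ?case by (cases a) auto
qed simp

lemma tot_append: "u \<in> lists X \<Longrightarrow> v \<in> lists X \<Longrightarrow> tot (u @ v) = tot u \<otimes> tot v"
proof (induction u)
  case Nil
  then show ?case using tot_H[of v] by simp
next
  case (Cons a u)
  then show ?case using tot_H[of u] tot_H[of v] by (cases a) (auto simp: m_assoc)
qed

lemma relabel_X: "a \<in> X \<Longrightarrow> g \<in> carrier G \<Longrightarrow> relabel g a \<in> X"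
  by (cases a) auto

lemma rl_lists: "w \<in> lists X \<Longrightarrow> g \<in> carrier G \<Longrightarrow> rl g w \<in> lists X"
  using relabel_X by (auto simp: in_lists_conv_set)

lemma relabel_relabel:
  "a \<in> X \<Longrightarrow> g \<in> carrier G \<Longrightarrow> k \<in> carrier G \<Longrightarrow> relabel g (relabel k a) = relabel (g \<otimes> k) a"
  by (cases a) (auto simp: m_assoc inv_mult_group)

lemma rl_rl: "w \<in> lists X \<Longrightarrow> g \<in> carrier G \<Longrightarrow> k \<in> carrier G \<Longrightarrow> rl g (rl k w) = rl (g \<otimes> k) w"
  using relabel_relabel by (auto simp: in_lists_conv_set)

lemma rl_one: "w \<in> lists X \<Longrightarrow> rl \<one> w = w"
proof -
  have "relabel \<one> a = a" if "a \<in> X" for a using that by (cases a) auto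
  moreover assume "w \<in> lists X"
  ultimately show ?thesis by (auto simp: in_lists_conv_set intro: map_idI)
qed

lemma rl_inv: "w \<in> lists X \<Longrightarrow> g \<in> carrier G \<Longrightarrow> rl g (rl (inv g) w) = w"
  and rl_inv': "w \<in> lists X \<Longrightarrow> g \<in> carrier G \<Longrightarrow> rl (inv g) (rl g w) = w"
  by (simp_all only: rl_rl inv_closed r_inv l_inv rl_one)

lemma conj_mult:
  "g \<in> carrier G \<Longrightarrow> x \<in> carrier G \<Longrightarrow> y \<in> carrier G \<Longrightarrow>
    g \<otimes> x \<otimes> inv g \<otimes> (g \<otimes> y \<otimes> inv g) = g \<otimes> (x \<otimes> y) \<otimes> inv g"
proof -
  assume xy: "g \<in> carrier G" "x \<in> carrier G" "y \<in> carrier G"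
  then have "inv g \<otimes> (g \<otimes> (y \<otimes> inv g)) = y \<otimes> inv g" by (simp add: m_assoc[symmetric])
  then show ?thesis using xy by (simp add: m_assoc)
qed

lemma tot_rl: "w \<in> lists X \<Longrightarrow> g \<in> carrier G \<Longrightarrow> tot (rl g w) = g \<otimes> tot w \<otimes> inv g"
proof (induction w)
  case (Cons a w)
  then show ?case using conj_mult[of g _ "tot w"] tot_H[of w] by (cases a) auto
qed simp

lemma tot_star: "w \<in> lists X \<Longrightarrow> tot (rev (map (field_gen_star G) w)) = inv (tot w)"
proof (induction w)
  case (Cons a w)
  have a: "[field_gen_star G a] \<in> lists X" using Cons.prems star_X by auto
  have w: "w \<in> lists X" using Cons.prems by simp
  have "tot (rev (map (field_gen_star G) (a # w))) = inv (tot w) \<otimes> tot [field_gen_star G a]"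
    using tot_append[OF star_lists[OF w] a] Cons.IH[OF w] by simp
  then show ?case using tot_H[OF w] Cons.prems by (cases a) (auto simp: inv_mult_group)
qed simp

lemma rl_star:
  assumes "w \<in> lists X" "g \<in> carrier G"
  shows "rl g (rev (map (field_gen_star G) w)) = rev (map (field_gen_star G) (rl g w))"
proof -
  have "relabel g (field_gen_star G a) = field_gen_star G (relabel g a)" if "a \<in> X" for a
    using that assms(2) by (cases a) (auto simp: inv_mult_group m_assoc)
  then show ?thesis using assms(1) by (auto simp: rev_map[symmetric] in_lists_conv_set)
qed

text \<open>The coefficient at w collects the words v with gv = w, hence the inverse relabelling.
  The basis element (h, g) contributes exactly if h is the total label of w, hence the argument
  \<open>tot w\<close>.\<close>

definition actF :: "('a \<times> 'a \<Rightarrow> complex) \<Rightarrow> ('a field_gen list \<Rightarrow> complex) \<Rightarrow> 'a field_gen list \<Rightarrow> complex" where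
  "actF a f w = (if w \<in> lists X then \<Sum>g\<in>carrier G. a (tot w, g) * f (rl (inv g) w) else 0)"

text \<open>Translation by g without a condition on the degree. It is multiplicative and compatible
  with the star, which the component maps of \<open>actF\<close> are not in general.\<close>

definition relF :: "'a \<Rightarrow> ('a field_gen list \<Rightarrow> complex) \<Rightarrow> 'a field_gen list \<Rightarrow> complex" where
  "relF g f w = (if w \<in> lists X then f (rl (inv g) w) else 0)"

lemma supp_relF:
  assumes "f \<in> carrier F" "g \<in> carrier G"
  shows "{w. relF g f w \<noteq> 0} = rl g ` {w. f w \<noteq> 0}"
proof (intro equalityI subsetI)
  fix w assume "w \<in> {w. relF g f w \<noteq> 0}"
  then have w: "w \<in> lists X" "f (rl (inv g) w) \<noteq> 0" by (auto simp: relF_def split: if_splits)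
  then show "w \<in> rl g ` {w. f w \<noteq> 0}"
    using rl_inv[OF w(1) assms(2)] by (intro image_eqI[of _ _ "rl (inv g) w"]) auto
next
  fix w assume "w \<in> rl g ` {w. f w \<noteq> 0}"
  then obtain v where v: "w = rl g v" "f v \<noteq> 0" by blast
  have vX: "v \<in> lists X" by (rule supp_lists[OF assms(1) v(2)])
  have "relF g f w = f v" unfolding relF_def v(1) rl_inv'[OF vX assms(2)] using rl_lists[OF vX assms(2)] by (rule if_P)
  then show "w \<in> {w. relF g f w \<noteq> 0}" using v(2) by simp
qed

lemma relF_closed: "f \<in> carrier F \<Longrightarrow> g \<in> carrier G \<Longrightarrow> relF g f \<in> carrier F"
proof -
  assume fg: "f \<in> carrier F" "g \<in> carrier G"
  have "finite {w. relF g f w \<noteq> 0}" unfolding supp_relF[OF fg] using finite_supp[OF fg(1)] by simp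
  moreover have "{w. relF g f w \<noteq> 0} \<subseteq> lists X" by (auto simp: relF_def split: if_splits)
  ultimately show ?thesis unfolding F_simps(1) by blast
qed

lemma lin_relF:
  assumes f: "f \<in> carrier F" and g: "g \<in> carrier G"
  shows "lin (relF g f) \<phi> = lin f (\<lambda>w. \<phi> (rl g w))"
proof -
  have sub: "\<And>w. f w \<noteq> 0 \<Longrightarrow> w \<in> lists X" by (rule supp_lists[OF f])
  have inj: "inj_on (rl g) {w. f w \<noteq> 0}"
    by (rule inj_on_inverseI[of _ "rl (inv g)"]) (use rl_inv' sub g in blast)
  have "lin (relF g f) \<phi> = (\<Sum>w\<in>{w. f w \<noteq> 0}. relF g f (rl g w) * \<phi> (rl g w))"
    unfolding lin_def supp_relF[OF f g] by (subst sum.reindex[OF inj]) simp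
  also have "\<dots> = (\<Sum>w\<in>{w. f w \<noteq> 0}. f w * \<phi> (rl g w))"
  proof (intro sum.cong refl)
    fix w assume "w \<in> {w. f w \<noteq> 0}"
    then have w: "w \<in> lists X" using sub by blast
    show "relF g f (rl g w) * \<phi> (rl g w) = f w * \<phi> (rl g w)"
      unfolding relF_def rl_inv'[OF w g] using rl_lists[OF w g] by (simp only: if_True)
  qed
  finally show ?thesis by (simp add: lin_def)
qed

lemma actF_relF: "actF a f w = (\<Sum>g\<in>carrier G. a (tot w, g) * relF g f w)"
  by (simp add: actF_def relF_def)

lemma actF_closed: assumes f: "f \<in> carrier F" shows "actF a f \<in> carrier F"
proof -
  have sub: "{w. actF a f w \<noteq> 0} \<subseteq> (\<Union>g\<in>carrier G. {w. relF g f w \<noteq> 0})"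
  proof
    fix w assume "w \<in> {w. actF a f w \<noteq> 0}"
    then have "\<exists>g\<in>carrier G. a (tot w, g) * relF g f w \<noteq> 0"
      unfolding actF_relF by (metis (mono_tags, lifting) mem_Collect_eq sum.neutral)
    then show "w \<in> (\<Union>g\<in>carrier G. {w. relF g f w \<noteq> 0})" by auto
  qed
  have "finite (\<Union>g\<in>carrier G. {w. relF g f w \<noteq> 0})"
    using finite_G finite_supp[OF relF_closed[OF f]] by blast
  then have "finite {w. actF a f w \<noteq> 0}" using sub by (rule rev_finite_subset)
  moreover have "{w. actF a f w \<noteq> 0} \<subseteq> lists X" by (auto simp: actF_def split: if_splits)
  ultimately show ?thesis unfolding F_simps(1) by blast
qed

lemma lin_actF:
  assumes f: "f \<in> carrier F"
  shows "lin (actF a f) \<phi> = (\<Sum>g\<in>carrier G. lin (relF g f) (\<lambda>w. a (tot w, g) * \<phi> w))"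
proof -
  let ?S = "{w. actF a f w \<noteq> 0} \<union> (\<Union>g\<in>carrier G. {w. relF g f w \<noteq> 0})"
  have S: "finite ?S"
    using finite_G finite_supp[OF relF_closed[OF f]] finite_supp[OF actF_closed[OF f]] by blast
  have "lin (actF a f) \<phi> = (\<Sum>w\<in>?S. actF a f w * \<phi> w)" using S by (intro lin_superset) auto
  also have "\<dots> = (\<Sum>w\<in>?S. \<Sum>g\<in>carrier G. relF g f w * (a (tot w, g) * \<phi> w))"
    unfolding actF_relF sum_distrib_right by (intro sum.cong refl) (simp add: mult_ac)
  also have "\<dots> = (\<Sum>g\<in>carrier G. \<Sum>w\<in>?S. relF g f w * (a (tot w, g) * \<phi> w))"
    by (rule sum.swap)
  also have "\<dots> = (\<Sum>g\<in>carrier G. lin (relF g f) (\<lambda>w. a (tot w, g) * \<phi> w))"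
    using S by (intro sum.cong refl lin_superset[symmetric]) auto
  finally show ?thesis .
qed

section \<open>The action descends to the quotient\<close>

definition bonds_below :: "'a field_gen list \<Rightarrow> rat \<Rightarrow> bool" where
  "bonds_below w y \<longleftrightarrow> (\<forall>h l. Rho h l \<in> set w \<longrightarrow> l < y)"

text \<open>A site to the right of all bonds is moved by every \<rho> letter, so the product of the
  labels can be read off there from the two configurations.\<close>

lemma pull_tot:
  assumes "w \<in> lists X" "c \<in> Conf" "pull G w c = Some b" "bonds_below w y"
  shows "c y = tot w \<otimes> b y"
  using assms
proof (induction w arbitrary: c)
  case Nil
  then show ?case using Conf_mem[OF Nil.prems(1)] by simp
next
  case (Cons a w)
  then obtain d where d: "step G a c = Some d" "pull G w d = Some b" by (auto simp: bind_eq_Some_conv)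
  have aX: "a \<in> X" "w \<in> lists X" using Cons.hyps by auto
  have dC: "d \<in> Conf" by (rule step_Conf[OF aX(1) Cons.prems(1) d(1)])
  have bb: "bonds_below w y" using Cons.prems(3) unfolding bonds_below_def by auto
  have IH: "d y = tot w \<otimes> b y" by (rule Cons.IH[OF dC d(2) bb])
  have bC: "b \<in> Conf" by (rule pull_Conf[OF aX(2) dC d(2)])
  show ?case
  proof (cases a)
    case (Delta g x)
    then show ?thesis using d(1) IH by (auto split: if_splits)
  next
    case (Rho h l)
    have "l < y" using Cons.prems(3) Rho unfolding bonds_below_def by auto
    then have dy: "d y = inv h \<otimes> c y" using d(1) Rho by auto
    have h: "h \<in> carrier G" using aX(1) Rho by auto
    have "h \<otimes> d y = c y" unfolding dy using h Conf_mem[OF Cons.prems(1)] by (simp add: m_assoc[symmetric])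
    then show ?thesis using Rho IH h tot_H[OF aX(2)] Conf_mem[OF bC] by (simp add: m_assoc)
  qed
qed

text \<open>Finitely many words contain finitely many bonds; the site is an integer so that the
  projections \<delta>_k can be placed there.\<close>

lemma bonds_below_ex: "finite S \<Longrightarrow> \<exists>x\<in>\<int>. \<forall>w\<in>S. bonds_below w x"
proof -
  assume S: "finite S"
  let ?B = "{l. \<exists>w\<in>S. \<exists>h. Rho h l \<in> set w}"
  have "?B \<subseteq> (\<lambda>a. case a of Delta g x \<Rightarrow> x | Rho h l \<Rightarrow> l) ` (\<Union>w\<in>S. set w)"
    by (force simp: image_iff)
  then have fin: "finite ?B" using S by (meson List.finite_set finite_UN finite_imageI finite_subset)
  \<comment> \<open>The 0 is inserted because there may be no bonds at all.\<close>
  obtain n where n: "Max (insert 0 ?B) < rat_of_nat n" using reals_Archimedean2 by blast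
  have "l < rat_of_nat n" if "l \<in> ?B" for l
    using n Max_ge[of "insert 0 ?B" l] fin that by (meson finite_insert insertI2 le_less_trans)
  then show ?thesis by (intro bexI[of _ "of_nat n"]) (auto simp: bonds_below_def)
qed

text \<open>At a site y beyond the bonds of both words the total label is c(y) b(y)^{-1}, the same
  for both. The degree is thus a property of the matrix entry and not of the word.\<close>

lemma tot_unique:
  assumes "c \<in> Conf"
  shows "\<exists>t. \<forall>w\<in>lists X. pull G w c = Some b \<longrightarrow> tot w = t"
proof (cases "\<exists>w0\<in>lists X. pull G w0 c = Some b")
  case True
  then obtain w0 where w0: "w0 \<in> lists X" "pull G w0 c = Some b" by blast
  have "tot w = tot w0" if w: "w \<in> lists X" "pull G w c = Some b" for w
  proof -
    obtain y where y: "bonds_below w y" "bonds_below w0 y"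
      using bonds_below_ex[of "{w, w0}"] by auto
    have "tot w \<otimes> b y = tot w0 \<otimes> b y"
      using pull_tot[OF w(1) assms w(2) y(1)] pull_tot[OF w0(1) assms w0(2) y(2)] by simp
    then show ?thesis
      using tot_H[OF w(1)] tot_H[OF w0(1)] Conf_mem[OF pull_Conf[OF w(1) assms w(2)]] by simp
  qed
  then show ?thesis by blast
qed blast

text \<open>Relabelling corresponds to left multiplication of all values by g: the \<delta> labels
  move along with the configuration, and the conjugated bond labels let the factor g pass to the
  outside.\<close>

lemma pull_rl:
  assumes "w \<in> lists X" "c \<in> Conf" "g \<in> carrier G"
  shows "pull G (rl g w) (\<lambda>y. g \<otimes> c y) = map_option (\<lambda>b y. g \<otimes> b y) (pull G w c)"
  using assms(1,2)
proof (induction w arbitrary: c)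
  case (Cons a w)
  have step: "step G (relabel g a) (\<lambda>y. g \<otimes> c y) = map_option (\<lambda>b y. g \<otimes> b y) (step G a c)"
  proof (cases a)
    case (Delta f x)
    then show ?thesis using Cons.hyps(1) Conf_mem[OF Cons.prems] assms(3) by auto
  next
    case (Rho h l)
    have h: "h \<in> carrier G" using Cons.hyps(1) Rho by auto
    have "inv (g \<otimes> h \<otimes> inv g) \<otimes> (g \<otimes> z) = g \<otimes> (inv h \<otimes> z)" if z: "z \<in> carrier G" for z
    proof -
      have "inv g \<otimes> (g \<otimes> z) = z" using z assms(3) by (simp add: m_assoc[symmetric])
      then show ?thesis using z h assms(3) by (simp add: inv_mult_group m_assoc)
    qed
    then show ?thesis using Rho Conf_mem[OF Cons.prems] by (auto simp: fun_eq_iff)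
  qed
  show ?case
  proof (cases "step G a c")
    case None
    then show ?thesis using step by simp
  next
    case (Some d)
    have "d \<in> Conf" by (rule step_Conf[OF Cons.hyps(1) Cons.prems Some])
    from Cons.IH[OF this] show ?thesis using step Some by simp
  qed
qed simp

definition gmul :: "'a \<Rightarrow> (rat \<Rightarrow> 'a) \<Rightarrow> rat \<Rightarrow> 'a" where
  "gmul g c = (\<lambda>y. g \<otimes> c y)"

lemma gmul_Conf: "c \<in> Conf \<Longrightarrow> g \<in> carrier G \<Longrightarrow> gmul g c \<in> Conf"
  unfolding Conf_def gmul_def by simp

lemma gmul_inv: "c \<in> Conf \<Longrightarrow> g \<in> carrier G \<Longrightarrow> gmul g (gmul (inv g) c) = c"
  and gmul_inv': "c \<in> Conf \<Longrightarrow> g \<in> carrier G \<Longrightarrow> gmul (inv g) (gmul g c) = c"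
  using Conf_mem[of c] by (auto simp: gmul_def fun_eq_iff m_assoc[symmetric])

lemma kern_relF:
  assumes f: "f \<in> carrier F" and g: "g \<in> carrier G" and c: "c \<in> Conf" and b: "b \<in> Conf"
  shows "kern G (relF g f) c b = kern G f (gmul (inv g) c) (gmul (inv g) b)"
proof -
  have "pull G (rl g w) c = Some b \<longleftrightarrow> pull G w (gmul (inv g) c) = Some (gmul (inv g) b)"
    if w: "w \<in> lists X" for w
  proof -
    let ?c = "gmul (inv g) c"
    have cC: "?c \<in> Conf" using c g by (simp add: gmul_Conf)
    have "pull G (rl g w) (gmul g ?c) = map_option (gmul g) (pull G w ?c)"
      using pull_rl[OF w cC g] unfolding gmul_def .
    then have eq: "pull G (rl g w) c = map_option (gmul g) (pull G w ?c)"
      unfolding gmul_inv[OF c g] .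
    show ?thesis
    proof (cases "pull G w ?c")
      case None
      then show ?thesis using eq by simp
    next
      case (Some e)
      have "e \<in> Conf" by (rule pull_Conf[OF w cC Some])
      then have "gmul g e = b \<longleftrightarrow> e = gmul (inv g) b"
        using gmul_inv[OF b g] gmul_inv'[of e g] g by auto
      then show ?thesis using eq Some by simp
    qed
  qed
  then show ?thesis
    unfolding kern_def lin_relF[OF f g] using supp_lists[OF f] by (intro lin_cong) simp
qed

text \<open>For fixed configurations all contributing words have the same total shift \<open>t\<close>; hence the
  action descends to the quotient.\<close>

lemma kern_actF:
  assumes c: "c \<in> Conf" and b: "b \<in> Conf"
  shows "\<exists>t. \<forall>f\<in>carrier F. kern G (actF a f) c b =
    (\<Sum>g\<in>carrier G. a (t, g) * kern G f (gmul (inv g) c) (gmul (inv g) b))"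
proof -
  obtain t where t: "\<forall>w\<in>lists X. pull G w c = Some b \<longrightarrow> tot w = t" using tot_unique[OF c] by blast
  have "kern G (actF a f) c b = (\<Sum>g\<in>carrier G. a (t, g) * kern G f (gmul (inv g) c) (gmul (inv g) b))"
    if f: "f \<in> carrier F" for f
  proof -
    have "kern G (actF a f) c b =
        (\<Sum>g\<in>carrier G. lin (relF g f) (\<lambda>w. a (tot w, g) * (if pull G w c = Some b then 1 else 0)))"
      unfolding kern_def by (rule lin_actF[OF f])
    also have "\<dots> = (\<Sum>g\<in>carrier G. lin (relF g f) (\<lambda>w. a (t, g) * (if pull G w c = Some b then 1 else 0)))"
    proof (intro sum.cong refl lin_cong)
      fix g w assume "g \<in> carrier G" "relF g f w \<noteq> 0"
      then have "w \<in> lists X" using supp_lists[OF relF_closed[OF f]] by blast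
      then show "a (tot w, g) * (if pull G w c = Some b then 1 else 0) =
          a (t, g) * (if pull G w c = Some b then 1 else 0)" using t by auto
    qed
    also have "\<dots> = (\<Sum>g\<in>carrier G. a (t, g) * kern G (relF g f) c b)"
      unfolding lin_scale_right kern_def ..
    also have "\<dots> = (\<Sum>g\<in>carrier G. a (t, g) * kern G f (gmul (inv g) c) (gmul (inv g) b))"
      by (intro sum.cong refl) (simp add: kern_relF[OF f _ c b])
    finally show ?thesis .
  qed
  then show ?thesis by blast
qed

lemma q_actF_cong:
  assumes f: "f \<in> carrier F" and f': "f' \<in> carrier F" and eq: "q f = q f'"
  shows "q (actF a f) = q (actF a f')"
  unfolding q_eq_iff_kern[OF actF_closed[OF f] actF_closed[OF f']]
proof (intro ballI allI)
  fix c b assume c: "c \<in> Conf"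
  show "kern G (actF a f) c b = kern G (actF a f') c b"
  proof (cases "b \<in> Conf")
    case True
    obtain t where t: "\<forall>f\<in>carrier F. kern G (actF a f) c b =
        (\<Sum>g\<in>carrier G. a (t, g) * kern G f (gmul (inv g) c) (gmul (inv g) b))"
      using kern_actF[OF c True] by blast
    have "kern G f (gmul (inv g) c) e = kern G f' (gmul (inv g) c) e" if "g \<in> carrier G" for g e
      using eq gmul_Conf[OF c, of "inv g"] that unfolding q_eq_iff_kern[OF f f'] by simp
    then show ?thesis using t f f' by simp
  next
    case False
    then show ?thesis using kern_outside[OF actF_closed[OF f] c] kern_outside[OF actF_closed[OF f'] c] by simp
  qed
qed

section \<open>Module algebra rules on the free algebra\<close>

lemma actF_add: "f \<in> carrier F \<Longrightarrow> f' \<in> carrier F \<Longrightarrow> actF a (f \<oplus>\<^bsub>F\<^esub> f') = actF a f \<oplus>\<^bsub>F\<^esub> actF a f'"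
  by (auto simp: actF_def F_simps(5) distrib_left sum.distrib)

lemma actF_smult: "actF a (k \<odot>\<^bsub>F\<^esub> f) = k \<odot>\<^bsub>F\<^esub> actF a f"
  by (auto simp: actF_def F_simps(6) sum_distrib_left mult_ac)

lemma actF_basis:
  assumes "g \<in> carrier G"
  shows "actF (D_basis (h, g)) f w = (if w \<in> lists X \<and> tot w = h then f (rl (inv g) w) else 0)"
proof (cases "w \<in> lists X \<and> tot w = h")
  case True
  have "actF (D_basis (h, g)) f w = (\<Sum>g'\<in>carrier G. if g' = g then f (rl (inv g) w) else 0)"
    using True unfolding actF_def D_basis_def by (simp only: if_True) (intro sum.cong, auto)
  then show ?thesis using True finite_G assms by simp
next
  case False
  then show ?thesis by (auto simp: actF_def D_basis_def)
qed

lemma actF_basis_wmono: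
  assumes g: "g \<in> carrier G" and u: "u \<in> lists X"
  shows "actF (D_basis (h, g)) (wmono u) = (if h = g \<otimes> tot u \<otimes> inv g then wmono (rl g u) else (\<lambda>w. 0))"
proof
  fix w
  have "rl (inv g) w = u \<longleftrightarrow> w = rl g u" if "w \<in> lists X"
    using rl_inv[OF that g] rl_inv'[OF u g] by auto
  then have "w \<in> lists X \<and> rl (inv g) w = u \<longleftrightarrow> w = rl g u" using rl_lists[OF u g] rl_inv'[OF u g] by blast
  then show "actF (D_basis (h, g)) (wmono u) w = (if h = g \<otimes> tot u \<otimes> inv g then wmono (rl g u) else (\<lambda>w. 0)) w"
    unfolding actF_basis[OF g] wmono_def using tot_rl[OF u g] by auto
qed

text \<open>In coefficients the condition on b says that b is the antipode of the star of a;
  starring a word inverts its total label, whence \<open>inv h\<close>.\<close>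

lemma actF_star:
  assumes f: "f \<in> carrier F" and b: "\<And>h g. h \<in> H \<Longrightarrow> g \<in> carrier G \<Longrightarrow> b (inv h, g) = cnj (a (h, g))"
  shows "actF a (star F f) = star F (actF b f)"
proof
  fix w show "actF a (star F f) w = star F (actF b f) w"
  proof (cases "w \<in> lists X")
    case True
    let ?s = "\<lambda>w. rev (map (field_gen_star G) w)"
    have "actF a (star F f) w = (\<Sum>g\<in>carrier G. a (tot w, g) * star F f (rl (inv g) w))"
      using True by (simp add: actF_def del: in_lists_conv_set)
    also have "\<dots> = (\<Sum>g\<in>carrier G. a (tot w, g) * cnj (f (?s (rl (inv g) w))))"
      using rl_lists[OF True] by (intro sum.cong refl) (simp add: F_simps(7) del: in_lists_conv_set)
    also have "\<dots> = (\<Sum>g\<in>carrier G. cnj (b (tot (?s w), g) * f (rl (inv g) (?s w))))"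
      using b tot_H[OF True] rl_star[OF True] tot_star[OF True] by (intro sum.cong refl) simp
    also have "\<dots> = cnj (actF b f (?s w))"
      using star_lists[OF True] by (simp add: actF_def del: in_lists_conv_set)
    finally show ?thesis using True by (simp only: F_simps(7) if_True)
  qed (simp add: actF_def F_simps(7))
qed

lemma actF_basis_star:
  assumes f: "f \<in> carrier F" and "h \<in> H" "g \<in> carrier G"
  shows "actF (D_basis (h, g)) (star F f) = star F (actF (D_basis (inv h, g)) f)"
proof (rule actF_star[OF f])
  fix t k assume "t \<in> H" "k \<in> carrier G"
  then have "inv t = inv h \<longleftrightarrow> t = h" using assms(2) by (metis H_mem(1) inv_inv)
  then show "D_basis (inv h, g) (inv t, k) = cnj (D_basis (h, g) (t, k))"
    by (auto simp: D_basis_def)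
qed

lemma actF_mult_expand:
  assumes w: "w \<in> lists X"
  shows "actF a (f \<otimes>\<^bsub>F\<^esub> f') w =
    (\<Sum>k\<le>length w. \<Sum>g\<in>carrier G. a (tot w, g) * (relF g f (take k w) * relF g f' (drop k w)))"
proof -
  have td: "take k w \<in> lists X" "drop k w \<in> lists X" for k
    using w by (auto simp: in_lists_conv_set dest: in_set_takeD in_set_dropD)
  have "actF a (f \<otimes>\<^bsub>F\<^esub> f') w = (\<Sum>g\<in>carrier G. \<Sum>k\<le>length w.
      a (tot w, g) * (relF g f (take k w) * relF g f' (drop k w)))"
    using w td by (simp add: actF_def F_simps(2) conv_def relF_def take_map drop_map sum_distrib_left del: in_lists_conv_set)
  then show ?thesis by (subst sum.swap) simp
qed

text \<open>Total labels multiply when words are joined. For a cut of w into u and v only the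
  summand t = tot u contributes, and then the second factor asks for tot u tot v = h.\<close>

lemma actF_basis_mult:
  assumes "h \<in> H" and g: "g \<in> carrier G" and f: "f \<in> carrier F" "f' \<in> carrier F"
  shows "actF (D_basis (h, g)) (f \<otimes>\<^bsub>F\<^esub> f') =
    (\<Oplus>\<^bsub>F\<^esub>t\<in>H. actF (D_basis (t, g)) f \<otimes>\<^bsub>F\<^esub> actF (D_basis (inv t \<otimes> h, g)) f')"
proof
  fix w
  have R: "(\<Oplus>\<^bsub>F\<^esub>t\<in>H. actF (D_basis (t, g)) f \<otimes>\<^bsub>F\<^esub> actF (D_basis (inv t \<otimes> h, g)) f') =
      (\<lambda>w. \<Sum>t\<in>H. (actF (D_basis (t, g)) f \<otimes>\<^bsub>F\<^esub> actF (D_basis (inv t \<otimes> h, g)) f') w)"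
    using f by (intro finsum_F finite_H F.m_closed actF_closed)
  show "actF (D_basis (h, g)) (f \<otimes>\<^bsub>F\<^esub> f') w =
      (\<Oplus>\<^bsub>F\<^esub>t\<in>H. actF (D_basis (t, g)) f \<otimes>\<^bsub>F\<^esub> actF (D_basis (inv t \<otimes> h, g)) f') w"
  proof (cases "w \<in> lists X")
    case True
    have td: "take k w \<in> lists X" "drop k w \<in> lists X" for k
      using True by (auto simp: in_lists_conv_set dest: in_set_takeD in_set_dropD)
    have tw: "tot w = tot (take k w) \<otimes> tot (drop k w)" for k
      using tot_append[OF td(1)[of k] td(2)[of k]] by simp
    have "(\<Sum>t\<in>H. (actF (D_basis (t, g)) f \<otimes>\<^bsub>F\<^esub> actF (D_basis (inv t \<otimes> h, g)) f') w) =
        (\<Sum>k\<le>length w. \<Sum>t\<in>H. actF (D_basis (t, g)) f (take k w) * actF (D_basis (inv t \<otimes> h, g)) f' (drop k w))"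
      unfolding F_simps(2) conv_def by (rule sum.swap)
    also have "\<dots> = (\<Sum>k\<le>length w. if tot w = h then relF g f (take k w) * relF g f' (drop k w) else 0)"
    proof (intro sum.cong refl)
      fix k
      let ?u = "take k w" and ?v = "drop k w"
      have H: "tot ?u \<in> H" "tot ?v \<in> H" using tot_H td by blast+
      have "(\<Sum>t\<in>H. actF (D_basis (t, g)) f ?u * actF (D_basis (inv t \<otimes> h, g)) f' ?v) =
          (\<Sum>t\<in>H. if t = tot ?u then (if tot ?v = inv (tot ?u) \<otimes> h then relF g f ?u * relF g f' ?v else 0) else 0)"
        using td by (intro sum.cong refl) (simp add: actF_basis[OF g] relF_def del: in_lists_conv_set)
      also have "\<dots> = (if tot ?v = inv (tot ?u) \<otimes> h then relF g f ?u * relF g f' ?v else 0)"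
        using finite_H H by simp
      also have "tot ?v = inv (tot ?u) \<otimes> h \<longleftrightarrow> tot w = h"
      proof -
        have "inv (tot ?u) \<otimes> (tot ?u \<otimes> z) = z" "tot ?u \<otimes> (inv (tot ?u) \<otimes> z) = z" if "z \<in> H" for z
          using that H by (simp_all add: m_assoc[symmetric])
        then have "tot ?v = inv (tot ?u) \<otimes> h \<longleftrightarrow> tot ?u \<otimes> tot ?v = h"
          using H(2) assms(1) by metis
        then show ?thesis by (simp only: tw[of k])
      qed
      finally show "(\<Sum>t\<in>H. actF (D_basis (t, g)) f ?u * actF (D_basis (inv t \<otimes> h, g)) f' ?v) =
          (if tot w = h then relF g f ?u * relF g f' ?v else 0)" .
    qed
    also have "\<dots> = actF (D_basis (h, g)) (f \<otimes>\<^bsub>F\<^esub> f') w"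
    proof (cases "tot w = h")
      case th: True
      then show ?thesis
        using True td unfolding actF_basis[OF g] F_simps(2) conv_def
        by (simp add: relF_def take_map drop_map del: in_lists_conv_set)
    qed (simp add: actF_basis[OF g])
    finally show ?thesis by (simp only: R)
  next
    case False
    have "take k w \<notin> lists X \<or> drop k w \<notin> lists X" for k
      using False by (metis append_in_lists_conv append_take_drop_id)
    then have "(actF b f \<otimes>\<^bsub>F\<^esub> actF b' f') w = 0" for b b'
      unfolding F_simps(2) conv_def by (intro sum.neutral) (auto simp: actF_def)
    then have "(\<Sum>t\<in>H. (actF (D_basis (t, g)) f \<otimes>\<^bsub>F\<^esub> actF (D_basis (inv t \<otimes> h, g)) f') w) = 0" by simp
    moreover have "actF (D_basis (h, g)) (f \<otimes>\<^bsub>F\<^esub> f') w = 0" using False by (simp only: actF_def if_False)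
    ultimately show ?thesis by (simp only: R)
  qed
qed

text \<open>The inner element sees g^{-1} w, whose total label is g^{-1} h g; this must equal h',
  which is the condition h g = g h'.\<close>

lemma actF_basis_comp:
  assumes "g \<in> carrier G" "g' \<in> carrier G" "h \<in> H" "h' \<in> H"
  shows "actF (D_basis (h, g)) (actF (D_basis (h', g')) f) =
    (if h \<otimes> g = g \<otimes> h' then actF (D_basis (h, g \<otimes> g')) f else (\<lambda>w. 0))"
proof
  fix w
  have "inv g \<otimes> (g \<otimes> z) = z" "g \<otimes> (inv g \<otimes> z) = z" if "z \<in> carrier G" for z
    using that assms(1) by (simp_all add: m_assoc[symmetric])
  then have "h \<otimes> g = g \<otimes> h' \<longleftrightarrow> inv g \<otimes> (h \<otimes> g) = h'"
    using assms by (metis H_mem(1) m_closed)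
  then have iff: "h \<otimes> g = g \<otimes> h' \<longleftrightarrow> inv g \<otimes> h \<otimes> g = h'"
    using assms by (simp add: m_assoc)
  show "actF (D_basis (h, g)) (actF (D_basis (h', g')) f) w =
      (if h \<otimes> g = g \<otimes> h' then actF (D_basis (h, g \<otimes> g')) f else (\<lambda>w. 0)) w"
  proof (cases "w \<in> lists X \<and> tot w = h")
    case True
    then have w: "w \<in> lists X" "tot w = h" by blast+
    have "rl (inv g) w \<in> lists X" "tot (rl (inv g) w) = inv g \<otimes> h \<otimes> g"
      "rl (inv g') (rl (inv g) w) = rl (inv (g \<otimes> g')) w"
      using rl_lists[OF w(1)] tot_rl[OF w(1), of "inv g"] rl_rl[OF w(1), of "inv g'" "inv g"] assms w(2)
      by (simp_all add: inv_mult_group del: in_lists_conv_set)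
    then show ?thesis using w assms iff by (auto simp: actF_basis simp del: in_lists_conv_set map_map)
  next
    case False
    then show ?thesis using assms by (auto simp: actF_basis simp del: in_lists_conv_set)
  qed
qed

lemma actF_basis_sum:
  assumes f: "f \<in> carrier F" shows "(\<Oplus>\<^bsub>F\<^esub>h\<in>H. actF (D_basis (h, \<one>)) f) = f"
proof
  fix w
  have "(\<Oplus>\<^bsub>F\<^esub>h\<in>H. actF (D_basis (h, \<one>)) f) w = (\<Sum>h\<in>H. actF (D_basis (h, \<one>)) f w)"
    using f by (subst finsum_F[OF finite_H]) (auto intro: actF_closed)
  also have "\<dots> = f w"
  proof (cases "w \<in> lists X")
    case True
    have "(\<Sum>h\<in>H. actF (D_basis (h, \<one>)) f w) = (\<Sum>h\<in>H. if h = tot w then f w else 0)"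
      using True rl_one[OF True] by (intro sum.cong refl) (auto simp: actF_basis simp del: in_lists_conv_set)
    then show ?thesis using tot_H[OF True] finite_H by simp
  next
    case False
    then have "f w = 0" using supp_lists[OF f] by blast
    then show ?thesis using False by (simp add: actF_def del: in_lists_conv_set)
  qed
  finally show "(\<Oplus>\<^bsub>F\<^esub>h\<in>H. actF (D_basis (h, \<one>)) f) w = f w" .
qed

section \<open>The structure maps of D(H;G) in coefficients\<close>

abbreviation D where "D \<equiv> D_algebra G H"

lemma D_simps:
  "carrier D = {a. \<forall>p. p \<notin> H \<times> carrier G \<longrightarrow> a p = 0}"
  "a \<oplus>\<^bsub>D\<^esub> b = (\<lambda>r. a r + b r)"
  "k \<odot>\<^bsub>D\<^esub> a = (\<lambda>r. k * a r)"
  by (simp_all add: D_algebra_def)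

lemma D_basis_closed: "p \<in> H \<times> carrier G \<Longrightarrow> D_basis p \<in> carrier D"
  by (auto simp: D_simps D_basis_def)

lemma sum_fst_delta:
  assumes "t \<in> H"
  shows "(\<Sum>p\<in>H \<times> carrier G. if fst p = t then \<psi> (snd p) else 0) = (\<Sum>g\<in>carrier G. \<psi> g :: complex)"
proof -
  have "(\<Sum>p\<in>H \<times> carrier G. if fst p = t then \<psi> (snd p) else 0) =
      (\<Sum>h\<in>H. \<Sum>g\<in>carrier G. if h = t then \<psi> g else 0)"
    by (simp add: sum.cartesian_product case_prod_beta)
  also have "\<dots> = (\<Sum>h\<in>H. if h = t then \<Sum>g\<in>carrier G. \<psi> g else 0)" by (intro sum.cong) auto
  finally show ?thesis using assms finite_H by simp
qed

lemma one_D: "\<one>\<^bsub>D\<^esub> r = (if fst r \<in> H \<and> snd r = \<one> then 1 else 0)"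
proof -
  have "\<one>\<^bsub>D\<^esub> r = (\<Sum>h\<in>H. if h = fst r then (if snd r = \<one> then 1 else 0) else 0)"
    by (auto simp: D_algebra_def D_basis_def prod_eq_iff intro!: sum.cong)
  then show ?thesis using finite_H by simp
qed

lemma one_D_closed: "\<one>\<^bsub>D\<^esub> \<in> carrier D"
  by (auto simp: D_simps(1) one_D)

lemma g_cancel:
  "g \<in> carrier G \<Longrightarrow> z \<in> carrier G \<Longrightarrow> inv g \<otimes> (g \<otimes> z) = z"
  "g \<in> carrier G \<Longrightarrow> z \<in> carrier G \<Longrightarrow> g \<otimes> (inv g \<otimes> z) = z"
  by (simp_all add: m_assoc[symmetric])

lemma D_mult_closed: "a \<otimes>\<^bsub>D\<^esub> b \<in> carrier D"
proof -
  have "(a \<otimes>\<^bsub>D\<^esub> b) p = 0" if p: "p \<notin> H \<times> carrier G" for p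
    using p unfolding D_algebra_def by (auto simp: D_basis_def intro!: sum.neutral)
  then show ?thesis by (simp add: D_simps(1))
qed

text \<open>Once the first factor (t, k) is chosen, the Kronecker condition and the product (t, g)
  determine the second one, so the double sum over basis elements becomes a sum over k.\<close>

lemma D_mult:
  assumes t: "t \<in> H" and g: "g \<in> carrier G"
  shows "(a \<otimes>\<^bsub>D\<^esub> b) (t, g) = (\<Sum>k\<in>carrier G. a (t, k) * b (inv k \<otimes> t \<otimes> k, inv k \<otimes> g))"
proof -
  let ?S = "H \<times> carrier G"
  have cond: "(if fst p \<otimes> snd p = snd p \<otimes> fst r then D_basis (fst p, snd p \<otimes> snd r) (t, g) else 0) =
      (if r = (inv (snd p) \<otimes> t \<otimes> snd p, inv (snd p) \<otimes> g) then (if fst p = t then 1 else 0) else (0::complex))"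
    if "p \<in> ?S" "r \<in> ?S" for p r
  proof -
    obtain h1 g1 h2 g2 where pr: "p = (h1, g1)" "r = (h2, g2)" by (cases p, cases r) auto
    have m: "h1 \<in> carrier G" "g1 \<in> carrier G" "h2 \<in> carrier G" "g2 \<in> carrier G" "t \<in> carrier G"
      using that pr t by auto
    have 1: "h1 \<otimes> g1 = g1 \<otimes> h2 \<longleftrightarrow> h2 = inv g1 \<otimes> h1 \<otimes> g1"
      using m g_cancel[OF m(2)] by (metis m_assoc m_closed inv_closed)
    have 2: "g = g1 \<otimes> g2 \<longleftrightarrow> g2 = inv g1 \<otimes> g"
      using m g g_cancel[OF m(2)] by metis
    show ?thesis unfolding pr fst_conv snd_conv D_basis_def 1 prod.inject 2 by auto
  qed
  have "(a \<otimes>\<^bsub>D\<^esub> b) (t, g) = (\<Sum>p\<in>?S. \<Sum>r\<in>?S. a p * b r *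
      (if fst p \<otimes> snd p = snd p \<otimes> fst r then D_basis (fst p, snd p \<otimes> snd r) (t, g) else 0))"
    by (simp add: D_algebra_def case_prod_beta)
  also have "\<dots> = (\<Sum>p\<in>?S. \<Sum>r\<in>?S. if r = (inv (snd p) \<otimes> t \<otimes> snd p, inv (snd p) \<otimes> g)
      then (if fst p = t then a p * b r else 0) else 0)"
    by (intro sum.cong refl) (simp add: cond)
  also have "\<dots> = (\<Sum>p\<in>?S. if fst p = t then a (t, snd p) * b (inv (snd p) \<otimes> t \<otimes> snd p, inv (snd p) \<otimes> g) else 0)"
  proof (intro sum.cong refl)
    fix p assume "p \<in> ?S"
    then have "(inv (snd p) \<otimes> t \<otimes> snd p, inv (snd p) \<otimes> g) \<in> ?S" using t g by auto
    then show "(\<Sum>r\<in>?S. if r = (inv (snd p) \<otimes> t \<otimes> snd p, inv (snd p) \<otimes> g)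
        then (if fst p = t then a p * b r else 0) else 0) =
        (if fst p = t then a (t, snd p) * b (inv (snd p) \<otimes> t \<otimes> snd p, inv (snd p) \<otimes> g) else 0)"
      using finite_H finite_G by (cases p) (simp add: sum.delta)
  qed
  also have "\<dots> = (\<Sum>k\<in>carrier G. a (t, k) * b (inv k \<otimes> t \<otimes> k, inv k \<otimes> g))"
    by (rule sum_fst_delta[OF t])
  finally show ?thesis .
qed

text \<open>The condition says that both tensor factors carry the same group element. It is written
  as an equation for r to match the sum over r in \<open>actF_coproduct\<close>, which then has a
  single term.\<close>

lemma D_coproduct_eval:
  assumes p: "p \<in> H \<times> carrier G" and r: "r \<in> H \<times> carrier G"
  shows "D_coproduct G H a (p, r) = (if r = (fst r, snd p) then a (fst p \<otimes> fst r, snd p) else 0)"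
proof -
  let ?S = "H \<times> carrier G"
  obtain h1 g1 h2 g2 where pr: "p = (h1, g1)" "r = (h2, g2)" by (cases p, cases r) auto
  have m: "h1 \<in> H" "g1 \<in> carrier G" "h2 \<in> H" "g2 \<in> carrier G" using p r pr by auto
  have in_t: "(\<Sum>t\<in>H. a s * (D_basis (t, snd s) p * D_basis (inv t \<otimes> fst s, snd s) r)) =
      (if s = (h1 \<otimes> h2, g1) then (if g2 = g1 then a (h1 \<otimes> h2, g1) else 0) else 0)" if s: "s \<in> ?S" for s
  proof -
    obtain h g where hg: "s = (h, g)" by (cases s)
    have "(\<Sum>t\<in>H. a s * (D_basis (t, snd s) p * D_basis (inv t \<otimes> fst s, snd s) r)) =
        (\<Sum>t\<in>H. if t = h1 then a (h, g) * (if g = g1 \<and> h2 = inv h1 \<otimes> h \<and> g2 = g then 1 else 0) else 0)"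
      unfolding pr hg by (intro sum.cong refl) (auto simp: D_basis_def)
    also have "\<dots> = a (h, g) * (if g = g1 \<and> h2 = inv h1 \<otimes> h \<and> g2 = g then 1 else 0)"
      using finite_H m by simp
    also have "h2 = inv h1 \<otimes> h \<longleftrightarrow> h = h1 \<otimes> h2"
    proof -
      have "h1 \<in> carrier G" "h2 \<in> carrier G" "h \<in> carrier G" using m s hg by auto
      then show ?thesis by (intro inv_solve_left)
    qed
    finally have calc: "(\<Sum>t\<in>H. a s * (D_basis (t, snd s) p * D_basis (inv t \<otimes> fst s, snd s) r)) =
        a (h, g) * (if g = g1 \<and> h = h1 \<otimes> h2 \<and> g2 = g then 1 else 0)" .
    show ?thesis
    proof (cases "h = h1 \<otimes> h2 \<and> g = g1")
      case True
      then have e: "h = h1 \<otimes> h2" "g = g1" by blast+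
      show ?thesis unfolding calc unfolding hg e by simp
    next
      case False
      then have "\<not> (g = g1 \<and> h = h1 \<otimes> h2 \<and> g2 = g)" "s \<noteq> (h1 \<otimes> h2, g1)" unfolding hg by blast+
      then show ?thesis unfolding calc by (simp only: if_False mult_zero_right)
    qed
  qed
  have "D_coproduct G H a (p, r) =
      (\<Sum>s\<in>?S. \<Sum>t\<in>H. a s * (D_basis (t, snd s) p * D_basis (inv t \<otimes> fst s, snd s) r))"
    by (simp add: D_coproduct_def case_prod_beta)
  also have "\<dots> = (\<Sum>s\<in>?S. if s = (h1 \<otimes> h2, g1) then (if g2 = g1 then a (h1 \<otimes> h2, g1) else 0) else 0)"
    by (intro sum.cong refl in_t)
  also have "\<dots> = (if g2 = g1 then a (h1 \<otimes> h2, g1) else 0)"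
    using finite_H finite_G m by (simp add: sum.delta)
  finally show ?thesis by (auto simp: pr)
qed

lemma D_counit_eval: "D_counit G H a = (\<Sum>g\<in>carrier G. a (\<one>, g))"
proof -
  have "D_counit G H a = (\<Sum>p\<in>H \<times> carrier G. if fst p = \<one> then a (\<one>, snd p) else 0)"
    unfolding D_counit_def case_prod_beta by (intro sum.cong refl) auto
  then show ?thesis using sum_fst_delta[of "\<one>" "\<lambda>g. a (\<one>, g)"] by simp
qed

lemma D_star_eval:
  assumes "h \<in> H" "g \<in> carrier G"
  shows "star D a (h, g) = cnj (a (inv g \<otimes> h \<otimes> g, inv g))"
proof -
  let ?S = "H \<times> carrier G"
  have eq: "(h, g) = (inv (snd s) \<otimes> fst s \<otimes> snd s, inv (snd s)) \<longleftrightarrow> s = (inv g \<otimes> h \<otimes> g, inv g)" if s: "s \<in> ?S" for s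
  proof -
    obtain k f where kf: "s = (k, f)" "k \<in> carrier G" "f \<in> carrier G" using s by auto
    have "h = inv f \<otimes> k \<otimes> f \<longleftrightarrow> k = f \<otimes> h \<otimes> inv f"
      using kf(2,3) assms(1) g_cancel[OF kf(3)] by (auto simp: m_assoc)
    moreover have "g = inv f \<longleftrightarrow> f = inv g" using kf assms by auto
    ultimately show ?thesis unfolding kf(1) using kf assms by auto
  qed
  have "star D a (h, g) = (\<Sum>s\<in>?S. cnj (a s) * D_basis (inv (snd s) \<otimes> fst s \<otimes> snd s, inv (snd s)) (h, g))"
    by (simp add: D_algebra_def case_prod_beta)
  also have "\<dots> = (\<Sum>s\<in>?S. if s = (inv g \<otimes> h \<otimes> g, inv g) then cnj (a s) else 0)"
    unfolding D_basis_def by (intro sum.cong refl) (simp only: eq, simp)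
  also have "\<dots> = cnj (a (inv g \<otimes> h \<otimes> g, inv g))"
    using finite_H finite_G assms by (simp add: sum.delta)
  finally show ?thesis .
qed

lemma D_antipode_eval:
  assumes "h \<in> H" "g \<in> carrier G"
  shows "D_antipode G H a (h, g) = a (inv g \<otimes> inv h \<otimes> g, inv g)"
proof -
  let ?S = "H \<times> carrier G"
  have eq: "(h, g) = (inv (snd s) \<otimes> inv (fst s) \<otimes> snd s, inv (snd s)) \<longleftrightarrow> s = (inv g \<otimes> inv h \<otimes> g, inv g)"
    if s: "s \<in> ?S" for s
  proof -
    obtain k f where kf: "s = (k, f)" "k \<in> carrier G" "f \<in> carrier G" using s by auto
    have "h = inv f \<otimes> inv k \<otimes> f \<longleftrightarrow> inv k = f \<otimes> h \<otimes> inv f"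
      using kf(2,3) assms(1) g_cancel[OF kf(3)] by (auto simp: m_assoc)
    also have "\<dots> \<longleftrightarrow> k = f \<otimes> inv h \<otimes> inv f"
    proof -
      have "inv (f \<otimes> h \<otimes> inv f) = f \<otimes> inv h \<otimes> inv f"
        using kf assms by (simp add: inv_mult_group m_assoc)
      then show ?thesis using kf assms by (metis H_mem(1) inv_closed inv_inv m_closed)
    qed
    finally have "h = inv f \<otimes> inv k \<otimes> f \<longleftrightarrow> k = f \<otimes> inv h \<otimes> inv f" .
    moreover have "g = inv f \<longleftrightarrow> f = inv g" using kf assms by auto
    ultimately show ?thesis unfolding kf(1) using kf assms by auto
  qed
  have "D_antipode G H a (h, g) = (\<Sum>s\<in>?S. a s * D_basis (inv (snd s) \<otimes> inv (fst s) \<otimes> snd s, inv (snd s)) (h, g))"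
    by (simp add: D_antipode_def case_prod_beta)
  also have "\<dots> = (\<Sum>s\<in>?S. if s = (inv g \<otimes> inv h \<otimes> g, inv g) then a s else 0)"
    unfolding D_basis_def by (intro sum.cong refl) (simp only: eq, simp)
  also have "\<dots> = a (inv g \<otimes> inv h \<otimes> g, inv g)"
    using finite_H finite_G assms by (simp add: sum.delta)
  finally show ?thesis .
qed

text \<open>Star and antipode both invert g, and their conjugations cancel, so the basis element (h,
  g) becomes (h^{-1}, g). This is the hypothesis of \<open>actF_star\<close>.\<close>

lemma D_antipode_star:
  assumes "h \<in> H" "g \<in> carrier G"
  shows "D_antipode G H (star D a) (inv h, g) = cnj (a (h, g))"
proof -
  have "inv g \<otimes> h \<otimes> g \<in> H" using assms by auto
  moreover have "g \<otimes> (inv g \<otimes> h \<otimes> g) \<otimes> inv g = h"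
    using assms g_cancel[of g] by (simp add: m_assoc)
  ultimately show ?thesis using assms by (simp add: D_antipode_eval D_star_eval)
qed

lemma D_antipode_closed: "D_antipode G H a \<in> carrier D"
proof -
  have "D_antipode G H a p = 0" if p: "p \<notin> H \<times> carrier G" for p
    unfolding D_antipode_def
  proof (intro sum.neutral ballI)
    fix s assume "s \<in> H \<times> carrier G"
    then have "(inv (snd s) \<otimes> inv (fst s) \<otimes> snd s, inv (snd s)) \<in> H \<times> carrier G" by auto
    then show "(case s of (h, g) \<Rightarrow> a (h, g) * D_basis (inv g \<otimes> inv h \<otimes> g, inv g) p) = 0"
      using p by (cases s) (auto simp: D_basis_def)
  qed
  then show ?thesis by (simp add: D_simps(1))
qed

lemma actF_D_mult: "actF (a \<otimes>\<^bsub>D\<^esub> b) f = actF a (actF b f)"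
proof
  fix w show "actF (a \<otimes>\<^bsub>D\<^esub> b) f w = actF a (actF b f) w"
  proof (cases "w \<in> lists X")
    case True
    let ?t = "tot w"
    have t: "?t \<in> H" by (rule tot_H[OF True])
    have "actF (a \<otimes>\<^bsub>D\<^esub> b) f w =
        (\<Sum>g\<in>carrier G. \<Sum>k\<in>carrier G. a (?t, k) * (b (inv k \<otimes> ?t \<otimes> k, inv k \<otimes> g) * f (rl (inv g) w)))"
      unfolding actF_def using True t
      by (simp add: D_mult sum_distrib_right mult.assoc del: in_lists_conv_set)
    also have "\<dots> = (\<Sum>k\<in>carrier G. \<Sum>g\<in>carrier G. a (?t, k) * (b (inv k \<otimes> ?t \<otimes> k, inv k \<otimes> g) * f (rl (inv g) w)))"
      by (rule sum.swap)
    also have "\<dots> = (\<Sum>k\<in>carrier G. a (?t, k) * actF b f (rl (inv k) w))"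
    proof (intro sum.cong refl)
      fix k assume k: "k \<in> carrier G"
      have "(\<Sum>g\<in>carrier G. b (inv k \<otimes> ?t \<otimes> k, inv k \<otimes> g) * f (rl (inv g) w)) =
          (\<Sum>g\<in>carrier G. b (inv k \<otimes> ?t \<otimes> k, g) * f (rl (inv g) (rl (inv k) w)))"
      \<comment> \<open>The translation g is split as k followed on its right by k^{-1} g, which
        becomes the summation variable of the inner action.\<close>
      proof (rule sum.reindex_bij_witness[of _ "\<lambda>g. k \<otimes> g" "\<lambda>g. inv k \<otimes> g"])
        fix g assume g: "g \<in> carrier G"
        have "rl (inv (inv k \<otimes> g)) (rl (inv k) w) = rl (inv g) w"
          using rl_rl[OF True, of "inv (inv k \<otimes> g)" "inv k"] g k by (simp add: inv_mult_group m_assoc)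
        then show "b (inv k \<otimes> ?t \<otimes> k, inv k \<otimes> g) * f (rl (inv (inv k \<otimes> g)) (rl (inv k) w)) =
            b (inv k \<otimes> ?t \<otimes> k, inv k \<otimes> g) * f (rl (inv g) w)" by (simp only:)
      qed (use k g_cancel in auto)
      then show "(\<Sum>g\<in>carrier G. a (?t, k) * (b (inv k \<otimes> ?t \<otimes> k, inv k \<otimes> g) * f (rl (inv g) w))) =
          a (?t, k) * actF b f (rl (inv k) w)"
        unfolding actF_def using rl_lists[OF True, of "inv k"] tot_rl[OF True, of "inv k"] k
        by (simp add: sum_distrib_left[symmetric] del: in_lists_conv_set map_map)
    qed
    finally show ?thesis using True by (simp only: actF_def[of a] if_True)
  qed (simp add: actF_def)
qed

text \<open>For a cut of w into u and v the two degrees must be tot u and tot v and the two group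
  elements must agree. Of the double sum over basis pairs a sum over g is left, with coefficient a
  at (tot u tot v, g).\<close>

lemma actF_coproduct:
  assumes f: "f \<in> carrier F" "f' \<in> carrier F"
  defines "S \<equiv> H \<times> carrier G"
  shows "actF a (f \<otimes>\<^bsub>F\<^esub> f') = (\<Oplus>\<^bsub>F\<^esub>r\<in>S \<times> S.
    D_coproduct G H a r \<odot>\<^bsub>F\<^esub> (actF (D_basis (fst r)) f \<otimes>\<^bsub>F\<^esub> actF (D_basis (snd r)) f'))"
proof
  fix w
  have finS: "finite (S \<times> S)" using finite_G finite_H by (simp add: S_def)
  have R: "(\<Oplus>\<^bsub>F\<^esub>r\<in>S \<times> S. D_coproduct G H a r \<odot>\<^bsub>F\<^esub> (actF (D_basis (fst r)) f \<otimes>\<^bsub>F\<^esub> actF (D_basis (snd r)) f')) w =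
      (\<Sum>r\<in>S \<times> S. D_coproduct G H a r * (actF (D_basis (fst r)) f \<otimes>\<^bsub>F\<^esub> actF (D_basis (snd r)) f') w)"
    unfolding finsum_F[OF finS F.smult_closed[OF F.m_closed[OF actF_closed[OF f(1)] actF_closed[OF f(2)]]]]
    by (simp only: F_simps(6))
  show "actF a (f \<otimes>\<^bsub>F\<^esub> f') w = (\<Oplus>\<^bsub>F\<^esub>r\<in>S \<times> S.
      D_coproduct G H a r \<odot>\<^bsub>F\<^esub> (actF (D_basis (fst r)) f \<otimes>\<^bsub>F\<^esub> actF (D_basis (snd r)) f')) w"
  proof (cases "w \<in> lists X")
    case True
    have td: "take k w \<in> lists X" "drop k w \<in> lists X" for k
      using True by (auto simp: in_lists_conv_set dest: in_set_takeD in_set_dropD)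
    have "(\<Sum>r\<in>S \<times> S. D_coproduct G H a r * (actF (D_basis (fst r)) f \<otimes>\<^bsub>F\<^esub> actF (D_basis (snd r)) f') w) =
        (\<Sum>k\<le>length w. \<Sum>r\<in>S \<times> S. D_coproduct G H a r *
          (actF (D_basis (fst r)) f (take k w) * actF (D_basis (snd r)) f' (drop k w)))"
      unfolding F_simps(2) conv_def sum_distrib_left by (rule sum.swap)
    also have "\<dots> = (\<Sum>k\<le>length w. \<Sum>g\<in>carrier G. a (tot w, g) * (relF g f (take k w) * relF g f' (drop k w)))"
    proof (intro sum.cong refl)
      fix k
      let ?u = "take k w" and ?v = "drop k w"
      have H: "tot ?u \<in> H" "tot ?v \<in> H" using tot_H td by blast+
      have tw: "tot w = tot ?u \<otimes> tot ?v"
        using tot_append[OF td(1)[of k] td(2)[of k]] by simp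
      have "(\<Sum>r\<in>S \<times> S. D_coproduct G H a r * (actF (D_basis (fst r)) f ?u * actF (D_basis (snd r)) f' ?v)) =
          (\<Sum>p\<in>S. \<Sum>r\<in>S. D_coproduct G H a (p, r) * (actF (D_basis p) f ?u * actF (D_basis r) f' ?v))"
        by (simp add: sum.cartesian_product case_prod_beta)
      also have "\<dots> = (\<Sum>p\<in>S. \<Sum>r\<in>S. if r = (tot ?v, snd p) then
          (if fst p = tot ?u then a (tot ?u \<otimes> tot ?v, snd p) * (relF (snd p) f ?u * relF (snd p) f' ?v) else 0) else 0)"
      proof (intro sum.cong refl)
        fix p r assume "p \<in> S" "r \<in> S"
        moreover obtain h1 g1 h2 g2 where pr: "p = (h1, g1)" "r = (h2, g2)" by (cases p, cases r) auto
        ultimately have m: "p \<in> H \<times> carrier G" "r \<in> H \<times> carrier G" "g1 \<in> carrier G" "g2 \<in> carrier G"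
          by (auto simp: S_def)
        show "D_coproduct G H a (p, r) * (actF (D_basis p) f ?u * actF (D_basis r) f' ?v) =
            (if r = (tot ?v, snd p) then
              (if fst p = tot ?u then a (tot ?u \<otimes> tot ?v, snd p) * (relF (snd p) f ?u * relF (snd p) f' ?v) else 0) else 0)"
          unfolding D_coproduct_eval[OF m(1,2)] unfolding pr actF_basis[OF m(3)] actF_basis[OF m(4)] relF_def
          using td by (simp del: in_lists_conv_set)
      qed
      also have "\<dots> = (\<Sum>p\<in>S. if fst p = tot ?u then
          a (tot ?u \<otimes> tot ?v, snd p) * (relF (snd p) f ?u * relF (snd p) f' ?v) else 0)"
      proof (intro sum.cong refl)
        fix p assume "p \<in> S"
        then have "(tot ?v, snd p) \<in> S" using H by (auto simp: S_def)
        moreover have "finite S" using finite_G finite_H by (simp add: S_def)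
        ultimately show "(\<Sum>r\<in>S. if r = (tot ?v, snd p) then
            (if fst p = tot ?u then a (tot ?u \<otimes> tot ?v, snd p) * (relF (snd p) f ?u * relF (snd p) f' ?v) else 0) else 0) =
            (if fst p = tot ?u then a (tot ?u \<otimes> tot ?v, snd p) * (relF (snd p) f ?u * relF (snd p) f' ?v) else 0)"
          by (simp only: sum.delta if_True)
      qed
      also have "\<dots> = (\<Sum>g\<in>carrier G. a (tot w, g) * (relF g f ?u * relF g f' ?v))"
        unfolding S_def tw by (rule sum_fst_delta[OF H(1)])
      finally show "(\<Sum>r\<in>S \<times> S. D_coproduct G H a r * (actF (D_basis (fst r)) f ?u * actF (D_basis (snd r)) f' ?v)) =
          (\<Sum>g\<in>carrier G. a (tot w, g) * (relF g f ?u * relF g f' ?v))" .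
    qed
    also have "\<dots> = actF a (f \<otimes>\<^bsub>F\<^esub> f') w" by (rule actF_mult_expand[OF True, symmetric])
    finally show ?thesis by (simp only: R)
  next
    case False
    have "take k w \<notin> lists X \<or> drop k w \<notin> lists X" for k
      using False by (metis append_in_lists_conv append_take_drop_id)
    then have "(actF b f \<otimes>\<^bsub>F\<^esub> actF b' f') w = 0" for b b'
      unfolding F_simps(2) conv_def by (intro sum.neutral) (auto simp: actF_def)
    then show ?thesis unfolding R using False by (simp add: actF_def del: in_lists_conv_set)
  qed
qed

section \<open>The local action and its uniqueness\<close>

definition lact :: "('a \<times> 'a \<Rightarrow> complex) \<Rightarrow> ('a field_gen list \<Rightarrow> complex) set \<Rightarrow> ('a field_gen list \<Rightarrow> complex) set" where
  "lact a Y = q (actF a (SOME f. f \<in> carrier F \<and> Y = q f))"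

lemma lact_q:
  assumes f: "f \<in> carrier F" shows "lact a (q f) = q (actF a f)"
proof -
  define g where "g = (SOME g. g \<in> carrier F \<and> q f = q g)"
  have "g \<in> carrier F \<and> q f = q g"
    unfolding g_def by (rule someI[of "\<lambda>g. g \<in> carrier F \<and> q f = q g" f]) (intro conjI f refl)
  then have "q (actF a f) = q (actF a g)" by (intro q_actF_cong[OF f]) blast+
  then show ?thesis unfolding lact_def g_def ..
qed

lemma lact_closed: "Y \<in> carrier L \<Longrightarrow> lact a Y \<in> carrier L"
  by (elim carrier_LE) (simp only: lact_q q_L actF_closed)

lemma finsum_L:
  assumes "finite J" "\<And>j. j \<in> J \<Longrightarrow> f j \<in> carrier F"
  shows "(\<Oplus>\<^bsub>L\<^esub>j\<in>J. q (f j)) = q (\<Oplus>\<^bsub>F\<^esub>j\<in>J. f j)"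
  unfolding local_field_algebra_def by (rule S.finsum_Q[OF assms])

text \<open>Restricted in both arguments, because \<open>is_local_action\<close> fixes the values
  outside the carriers and thereby makes the action unique as a function.\<close>

definition act0 :: "('a \<times> 'a \<Rightarrow> complex) \<Rightarrow> ('a field_gen list \<Rightarrow> complex) set \<Rightarrow> ('a field_gen list \<Rightarrow> complex) set" where
  "act0 = (\<lambda>a\<in>carrier D. \<lambda>Y\<in>carrier L. lact a Y)"

lemma act0_q: "a \<in> carrier D \<Longrightarrow> f \<in> carrier F \<Longrightarrow> act0 a (q f) = q (actF a f)"
  by (simp add: act0_def lact_q)

lemma gen_class_L: "x \<in> X \<Longrightarrow> field_gen_class G H x \<in> carrier L"
  unfolding gen_class by (intro q_L wmono_closed) simp

lemma is_local_action_act0: "is_local_action G H act0"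
  unfolding is_local_action_def Let_def
proof (intro conjI ballI allI)
  show "act0 \<in> carrier D \<rightarrow>\<^sub>E carrier L \<rightarrow>\<^sub>E carrier L"
    by (auto simp: act0_def PiE_def extensional_def lact_closed)
next
  fix a b Y assume a: "a \<in> carrier D" and b: "b \<in> carrier D" and "Y \<in> carrier L"
  then obtain f where f: "f \<in> carrier F" "Y = q f" by (auto elim: carrier_LE)
  have ab: "a \<oplus>\<^bsub>D\<^esub> b \<in> carrier D" using a b by (auto simp: D_simps)
  have "actF (a \<oplus>\<^bsub>D\<^esub> b) f = actF a f \<oplus>\<^bsub>F\<^esub> actF b f"
    by (auto simp: actF_def D_simps F_simps(5) distrib_right sum.distrib)
  then show "act0 (a \<oplus>\<^bsub>D\<^esub> b) Y = act0 a Y \<oplus>\<^bsub>L\<^esub> act0 b Y"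
    unfolding f(2) act0_q[OF ab f(1)] act0_q[OF a f(1)] act0_q[OF b f(1)] by (simp add: add_L actF_closed f(1))
  show "act0 (a \<otimes>\<^bsub>D\<^esub> b) Y = act0 a (act0 b Y)"
    unfolding f(2) act0_q[OF D_mult_closed f(1)] act0_q[OF b f(1)] act0_q[OF a actF_closed[OF f(1)]] actF_D_mult ..
next
  fix k a Y assume a: "a \<in> carrier D" and "Y \<in> carrier L"
  then obtain f where f: "f \<in> carrier F" "Y = q f" by (auto elim: carrier_LE)
  have ka: "k \<odot>\<^bsub>D\<^esub> a \<in> carrier D" using a by (auto simp: D_simps)
  have "actF (k \<odot>\<^bsub>D\<^esub> a) f = k \<odot>\<^bsub>F\<^esub> actF a f"
    by (auto simp: actF_def D_simps F_simps(6) sum_distrib_left mult.assoc)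
  then show "act0 (k \<odot>\<^bsub>D\<^esub> a) Y = k \<odot>\<^bsub>L\<^esub> act0 a Y"
    unfolding f(2) act0_q[OF ka f(1)] act0_q[OF a f(1)] by (simp add: smult_L actF_closed f(1))
next
  fix a Y Z assume a: "a \<in> carrier D" and "Y \<in> carrier L" "Z \<in> carrier L"
  then obtain f g where f: "f \<in> carrier F" "Y = q f" and g: "g \<in> carrier F" "Z = q g" by (auto elim!: carrier_LE)
  show "act0 a (Y \<oplus>\<^bsub>L\<^esub> Z) = act0 a Y \<oplus>\<^bsub>L\<^esub> act0 a Z"
    unfolding f(2) g(2) add_L[OF f(1) g(1)] act0_q[OF a F.a_closed[OF f(1) g(1)]] act0_q[OF a f(1)] act0_q[OF a g(1)]
      actF_add[OF f(1) g(1)] by (simp only: add_L actF_closed f(1) g(1))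
  let ?S = "H \<times> carrier G"
  have fin: "finite (?S \<times> ?S)" using finite_G finite_H by simp
  have "(\<Oplus>\<^bsub>L\<^esub>r\<in>?S \<times> ?S. D_coproduct G H a r \<odot>\<^bsub>L\<^esub> (act0 (D_basis (fst r)) Y \<otimes>\<^bsub>L\<^esub> act0 (D_basis (snd r)) Z)) =
      (\<Oplus>\<^bsub>L\<^esub>r\<in>?S \<times> ?S. q (D_coproduct G H a r \<odot>\<^bsub>F\<^esub> (actF (D_basis (fst r)) f \<otimes>\<^bsub>F\<^esub> actF (D_basis (snd r)) g)))"
  proof (intro SL.finsum_cong' refl)
    fix r assume "r \<in> ?S \<times> ?S"
    then have r: "D_basis (fst r) \<in> carrier D" "D_basis (snd r) \<in> carrier D"
      by (auto intro!: D_basis_closed)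
    show "D_coproduct G H a r \<odot>\<^bsub>L\<^esub> (act0 (D_basis (fst r)) Y \<otimes>\<^bsub>L\<^esub> act0 (D_basis (snd r)) Z) =
        q (D_coproduct G H a r \<odot>\<^bsub>F\<^esub> (actF (D_basis (fst r)) f \<otimes>\<^bsub>F\<^esub> actF (D_basis (snd r)) g))"
      unfolding f(2) g(2) act0_q[OF r(1) f(1)] act0_q[OF r(2) g(1)]
      by (simp only: mult_L smult_L actF_closed f(1) g(1) F.m_closed)
  qed (use f g actF_closed in auto)
  also have "\<dots> = q (\<Oplus>\<^bsub>F\<^esub>r\<in>?S \<times> ?S. D_coproduct G H a r \<odot>\<^bsub>F\<^esub> (actF (D_basis (fst r)) f \<otimes>\<^bsub>F\<^esub> actF (D_basis (snd r)) g))"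
    using f g by (intro finsum_L[OF fin] F.smult_closed F.m_closed actF_closed)
  also have "\<dots> = act0 a (Y \<otimes>\<^bsub>L\<^esub> Z)"
    unfolding f(2) g(2) mult_L[OF f(1) g(1)] act0_q[OF a F.m_closed[OF f(1) g(1)]] actF_coproduct[OF f(1) g(1)] ..
  finally show "act0 a (Y \<otimes>\<^bsub>L\<^esub> Z) = (\<Oplus>\<^bsub>L\<^esub>r\<in>?S \<times> ?S. D_coproduct G H a r \<odot>\<^bsub>L\<^esub>
      (act0 (D_basis (fst r)) Y \<otimes>\<^bsub>L\<^esub> act0 (D_basis (snd r)) Z))" ..
next
  fix a k Y assume a: "a \<in> carrier D" and "Y \<in> carrier L"
  then obtain f where f: "f \<in> carrier F" "Y = q f" by (auto elim: carrier_LE)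
  show "act0 a (k \<odot>\<^bsub>L\<^esub> Y) = k \<odot>\<^bsub>L\<^esub> act0 a Y"
    unfolding f(2) smult_L[OF f(1)] act0_q[OF a F.smult_closed[OF f(1)]] act0_q[OF a f(1)] actF_smult
    by (simp only: smult_L actF_closed f(1))
next
  fix Y assume "Y \<in> carrier L"
  then obtain f where f: "f \<in> carrier F" "Y = q f" by (auto elim: carrier_LE)
  have "actF \<one>\<^bsub>D\<^esub> f = f"
  proof
    fix w show "actF \<one>\<^bsub>D\<^esub> f w = f w"
    proof (cases "w \<in> lists X")
      case True
      have "actF \<one>\<^bsub>D\<^esub> f w = (\<Sum>g\<in>carrier G. if g = \<one> then f w else 0)"
        unfolding actF_def one_D using True tot_H[OF True] rl_one[OF True]
        by (simp only: if_True fst_conv snd_conv) (intro sum.cong, auto)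
      then show ?thesis using finite_G by simp
    next
      case False
      then have "f w = 0" using supp_lists[OF f(1)] by blast
      then show ?thesis using False by (simp add: actF_def del: in_lists_conv_set)
    qed
  qed
  then show "act0 \<one>\<^bsub>D\<^esub> Y = Y" unfolding f(2) act0_q[OF one_D_closed f(1)] by simp
next
  fix a assume a: "a \<in> carrier D"
  have "actF a \<one>\<^bsub>F\<^esub> = D_counit G H a \<odot>\<^bsub>F\<^esub> \<one>\<^bsub>F\<^esub>"
    by (auto simp: actF_def F_simps(3,6) wmono_def D_counit_eval)
  then show "act0 a \<one>\<^bsub>L\<^esub> = D_counit G H a \<odot>\<^bsub>L\<^esub> \<one>\<^bsub>L\<^esub>"
    unfolding one_L act0_q[OF a F.one_closed] smult_L[OF F.one_closed] by simp
next
  fix a Y assume a: "a \<in> carrier D" and "Y \<in> carrier L"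
  then obtain f where f: "f \<in> carrier F" "Y = q f" by (auto elim: carrier_LE)
  have "actF a (star F f) = star F (actF (D_antipode G H (star D a)) f)"
    using D_antipode_star by (intro actF_star[OF f(1)])
  then show "act0 a (star L Y) = star L (act0 (D_antipode G H (star D a)) Y)"
    unfolding f(2) star_L[OF f(1)] act0_q[OF a F.star_closed[OF f(1)]] act0_q[OF D_antipode_closed f(1)]
      star_L[OF actF_closed[OF f(1)]] by (simp only:)
next
  fix h g f x assume *: "h \<in> H" "g \<in> carrier G" "f \<in> carrier G" "x \<in> (\<int> :: rat set)"
  have X: "[Delta f x] \<in> lists X" using * by simp
  have D: "D_basis (h, g) \<in> carrier D" using * by (intro D_basis_closed) simp
  have "actF (D_basis (h, g)) (wmono [Delta f x]) = (if h = \<one> then wmono [Delta (g \<otimes> f) x] else \<zero>\<^bsub>F\<^esub>)"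
    using actF_basis_wmono[OF *(2) X] * by (simp add: F_simps(4))
  then show "act0 (D_basis (h, g)) (field_gen_class G H (Delta f x)) =
      (if h = \<one> then field_gen_class G H (Delta (g \<otimes> f) x) else \<zero>\<^bsub>L\<^esub>)"
    unfolding gen_class act0_q[OF D wmono_closed[OF X]] zero_L by simp
next
  fix h g t l assume *: "h \<in> H" "g \<in> carrier G" "t \<in> H" "l \<in> half_odd"
  have X: "[Rho t l] \<in> lists X" using * by simp
  have D: "D_basis (h, g) \<in> carrier D" using * by (intro D_basis_closed) simp
  have "actF (D_basis (h, g)) (wmono [Rho t l]) = (if h = g \<otimes> t \<otimes> inv g then wmono [Rho h l] else \<zero>\<^bsub>F\<^esub>)"
    using actF_basis_wmono[OF *(2) X] * by (simp add: F_simps(4))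
  then show "act0 (D_basis (h, g)) (field_gen_class G H (Rho t l)) =
      (if h = g \<otimes> t \<otimes> inv g then field_gen_class G H (Rho h l) else \<zero>\<^bsub>L\<^esub>)"
    unfolding gen_class act0_q[OF D wmono_closed[OF X]] zero_L by simp
qed

lemma local_actionD:
  assumes "is_local_action G H act"
  shows "act \<in> carrier D \<rightarrow>\<^sub>E carrier L \<rightarrow>\<^sub>E carrier L"
    and "\<forall>a\<in>carrier D. \<forall>b\<in>carrier D. \<forall>Y\<in>carrier L. act (a \<oplus>\<^bsub>D\<^esub> b) Y = act a Y \<oplus>\<^bsub>L\<^esub> act b Y"
    and "\<forall>k. \<forall>a\<in>carrier D. \<forall>Y\<in>carrier L. act (k \<odot>\<^bsub>D\<^esub> a) Y = k \<odot>\<^bsub>L\<^esub> act a Y"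
    and "\<forall>a\<in>carrier D. \<forall>Y\<in>carrier L. \<forall>Z\<in>carrier L. act a (Y \<oplus>\<^bsub>L\<^esub> Z) = act a Y \<oplus>\<^bsub>L\<^esub> act a Z"
    and "\<forall>a\<in>carrier D. \<forall>k. \<forall>Y\<in>carrier L. act a (k \<odot>\<^bsub>L\<^esub> Y) = k \<odot>\<^bsub>L\<^esub> act a Y"
    and "\<forall>a\<in>carrier D. \<forall>Y\<in>carrier L. \<forall>Z\<in>carrier L. act a (Y \<otimes>\<^bsub>L\<^esub> Z) =
      (\<Oplus>\<^bsub>L\<^esub>r\<in>(H \<times> carrier G) \<times> (H \<times> carrier G). D_coproduct G H a r \<odot>\<^bsub>L\<^esub>
        (act (D_basis (fst r)) Y \<otimes>\<^bsub>L\<^esub> act (D_basis (snd r)) Z))"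
    and "\<forall>a\<in>carrier D. act a \<one>\<^bsub>L\<^esub> = D_counit G H a \<odot>\<^bsub>L\<^esub> \<one>\<^bsub>L\<^esub>"
    and "\<forall>h\<in>H. \<forall>g\<in>carrier G. \<forall>f\<in>carrier G. \<forall>x\<in>\<int>. act (D_basis (h, g)) (field_gen_class G H (Delta f x)) =
      (if h = \<one> then field_gen_class G H (Delta (g \<otimes> f) x) else \<zero>\<^bsub>L\<^esub>)"
    and "\<forall>h\<in>H. \<forall>g\<in>carrier G. \<forall>t\<in>H. \<forall>l\<in>half_odd. act (D_basis (h, g)) (field_gen_class G H (Rho t l)) =
      (if h = g \<otimes> t \<otimes> inv g then field_gen_class G H (Rho h l) else \<zero>\<^bsub>L\<^esub>)"
  using assms unfolding is_local_action_def Let_def by - (elim conjE, assumption)+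

lemma local_action_zero:
  assumes A: "is_local_action G H A" and a: "a \<in> carrier D" shows "A a \<zero>\<^bsub>L\<^esub> = \<zero>\<^bsub>L\<^esub>"
proof -
  have cl: "A a \<zero>\<^bsub>L\<^esub> \<in> carrier L" using local_actionD(1)[OF A] a SL.zero_closed by (auto simp: PiE_iff)
  have "A a (0 \<odot>\<^bsub>L\<^esub> \<zero>\<^bsub>L\<^esub>) = 0 \<odot>\<^bsub>L\<^esub> A a \<zero>\<^bsub>L\<^esub>" using local_actionD(5)[OF A] a SL.zero_closed by blast
  then show ?thesis using cl by simp
qed

text \<open>The coproduct rule expresses the action of a basis element on a word through basis
  elements acting on its first letter and on the rest, so the values on generators determine those
  on words. Linearity in both arguments does the rest.\<close>

lemma local_action_unique:
  assumes A: "is_local_action G H A" and A': "is_local_action G H A'"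
  shows "A = A'"
proof -
  let ?S = "H \<times> carrier G"
  note Ad = local_actionD[OF A] and Ad' = local_actionD[OF A']
  have word: "\<forall>p\<in>?S. A (D_basis p) (W w) = A' (D_basis p) (W w)" if "w \<in> lists X" for w
    using that
  proof (induction w)
    case Nil
    have "W [] = \<one>\<^bsub>L\<^esub>" by (simp add: one_L F_simps(3))
    then show ?case using Ad(7) Ad'(7) D_basis_closed by simp
  next
    case (Cons x w)
    have xL: "field_gen_class G H x \<in> carrier L" "W w \<in> carrier L"
      using Cons.hyps gen_class_L by (auto intro!: q_L wmono_closed)
    have gen: "A (D_basis p) (field_gen_class G H x) = A' (D_basis p) (field_gen_class G H x)" if p: "p \<in> ?S" for p
    proof (cases x)
      case (Delta f y)
      then show ?thesis using Cons.hyps(1) p Ad(8) Ad'(8) by (cases p) simp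
    next
      case (Rho t l)
      then show ?thesis using Cons.hyps(1) p Ad(9) Ad'(9) by (cases p) simp
    qed
    have eq: "W (x # w) = field_gen_class G H x \<otimes>\<^bsub>L\<^esub> W w"
      using Cons.hyps wmono_append[of "[x]" w] by (simp add: gen_class mult_L)
    have cl: "A (D_basis p) Y \<in> carrier L" "A' (D_basis p) Y \<in> carrier L" if "p \<in> ?S" "Y \<in> carrier L" for p Y
      using Ad(1) Ad'(1) D_basis_closed[OF that(1)] that(2) by (auto simp: PiE_iff)
    show ?case
    proof
      fix p assume p: "p \<in> ?S"
      have "A (D_basis p) (W (x # w)) = (\<Oplus>\<^bsub>L\<^esub>r\<in>?S \<times> ?S. D_coproduct G H (D_basis p) r \<odot>\<^bsub>L\<^esub>
          (A (D_basis (fst r)) (field_gen_class G H x) \<otimes>\<^bsub>L\<^esub> A (D_basis (snd r)) (W w)))"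
        unfolding eq using Ad(6) D_basis_closed[OF p] xL by blast
      also have "\<dots> = (\<Oplus>\<^bsub>L\<^esub>r\<in>?S \<times> ?S. D_coproduct G H (D_basis p) r \<odot>\<^bsub>L\<^esub>
          (A' (D_basis (fst r)) (field_gen_class G H x) \<otimes>\<^bsub>L\<^esub> A' (D_basis (snd r)) (W w)))"
      proof (intro SL.finsum_cong' refl)
        fix r assume "r \<in> ?S \<times> ?S"
        then have r: "fst r \<in> ?S" "snd r \<in> ?S" by auto
        show "D_coproduct G H (D_basis p) r \<odot>\<^bsub>L\<^esub>
            (A (D_basis (fst r)) (field_gen_class G H x) \<otimes>\<^bsub>L\<^esub> A (D_basis (snd r)) (W w)) =
            D_coproduct G H (D_basis p) r \<odot>\<^bsub>L\<^esub>
            (A' (D_basis (fst r)) (field_gen_class G H x) \<otimes>\<^bsub>L\<^esub> A' (D_basis (snd r)) (W w))"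
          unfolding gen[OF r(1)] bspec[OF Cons.IH r(2)] ..
      next
        show "(\<lambda>r. D_coproduct G H (D_basis p) r \<odot>\<^bsub>L\<^esub>
            (A' (D_basis (fst r)) (field_gen_class G H x) \<otimes>\<^bsub>L\<^esub> A' (D_basis (snd r)) (W w))) \<in> ?S \<times> ?S \<rightarrow> carrier L"
        proof (rule funcsetI)
          fix r assume "r \<in> ?S \<times> ?S"
          then have r: "fst r \<in> ?S" "snd r \<in> ?S" by auto
          show "D_coproduct G H (D_basis p) r \<odot>\<^bsub>L\<^esub>
            (A' (D_basis (fst r)) (field_gen_class G H x) \<otimes>\<^bsub>L\<^esub> A' (D_basis (snd r)) (W w)) \<in> carrier L"
            by (intro SL.smult_closed SL.m_closed cl(2) r xL)
        qed
      qed
      also have "\<dots> = A' (D_basis p) (W (x # w))"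
        unfolding eq using Ad'(6) D_basis_closed[OF p] xL by simp
      finally show "A (D_basis p) (W (x # w)) = A' (D_basis p) (W (x # w))" .
    qed
  qed
  have basis: "A (D_basis p) (q f) = A' (D_basis p) (q f)" if p: "p \<in> ?S" and f: "f \<in> carrier F" for p f
    using f subset_UNIV
  proof (induction rule: F_induct)
    case zero
    show ?case
      using local_action_zero[OF A D_basis_closed[OF p]] local_action_zero[OF A' D_basis_closed[OF p]]
      unfolding zero_L F_simps(4) by simp
  next
    case (step f w k)
    have wF: "wmono w \<in> carrier F" using step by blast
    have "q (f \<oplus>\<^bsub>F\<^esub> k \<odot>\<^bsub>F\<^esub> wmono w) = q f \<oplus>\<^bsub>L\<^esub> (k \<odot>\<^bsub>L\<^esub> W w)"
      using step wF by (simp add: add_L smult_L)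
    moreover have "q f \<in> carrier L" "W w \<in> carrier L" "k \<odot>\<^bsub>L\<^esub> W w \<in> carrier L"
      using step wF by (auto intro: q_L)
    moreover have "A (D_basis p) (W w) = A' (D_basis p) (W w)" using word step p by blast
    ultimately show ?case
      using Ad(4,5) Ad'(4,5) D_basis_closed[OF p] step.IH by simp
  qed
  \<comment> \<open>Linearity in the element of D(H;G): its support is enlarged by one basis element
    at a time.\<close>
  have all: "\<forall>a. {p. a p \<noteq> 0} \<subseteq> T \<longrightarrow> (\<forall>Y\<in>carrier L. A a Y = A' a Y)" if "finite T" "T \<subseteq> ?S" for T
    using that
  proof (induction T)
    case empty
    show ?case
    proof (intro allI impI ballI)
      fix a :: "'a \<times> 'a \<Rightarrow> complex" and Y assume a: "{p. a p \<noteq> 0} \<subseteq> {}" and Y: "Y \<in> carrier L"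
      have aD: "a \<in> carrier D" using a by (auto simp: D_simps(1))
      have a0: "0 \<odot>\<^bsub>D\<^esub> a = a" using a by (auto simp: D_simps(3))
      have "A (0 \<odot>\<^bsub>D\<^esub> a) Y = 0 \<odot>\<^bsub>L\<^esub> A a Y" "A' (0 \<odot>\<^bsub>D\<^esub> a) Y = 0 \<odot>\<^bsub>L\<^esub> A' a Y"
        using Ad(3) Ad'(3) aD Y by blast+
      moreover have "A a Y \<in> carrier L" "A' a Y \<in> carrier L"
        using Ad(1) Ad'(1) aD Y by (auto simp: PiE_iff)
      ultimately show "A a Y = A' a Y" unfolding a0 by simp
    qed
  next
    case (insert p T)
    show ?case
    proof (intro allI impI ballI)
      fix a :: "'a \<times> 'a \<Rightarrow> complex" and Y assume a: "{p. a p \<noteq> 0} \<subseteq> insert p T" and Y: "Y \<in> carrier L"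
      define b where "b = a(p := 0)"
      have b: "{p. b p \<noteq> 0} \<subseteq> T" using a by (auto simp: b_def)
      have p: "p \<in> ?S" using insert.prems by blast
      have bD: "b \<in> carrier D" using b insert.prems by (auto simp: D_simps(1))
      have pD: "a p \<odot>\<^bsub>D\<^esub> D_basis p \<in> carrier D" using D_basis_closed[OF p] by (auto simp: D_simps)
      have aeq: "a = b \<oplus>\<^bsub>D\<^esub> (a p \<odot>\<^bsub>D\<^esub> D_basis p)"
        by (auto simp: b_def D_simps D_basis_def)
      obtain f where f: "f \<in> carrier F" "Y = q f" using Y by (rule carrier_LE)
      have "A b Y = A' b Y" using insert b Y by blast
      moreover have "A (a p \<odot>\<^bsub>D\<^esub> D_basis p) Y = A' (a p \<odot>\<^bsub>D\<^esub> D_basis p) Y"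
        using Ad(3) Ad'(3) D_basis_closed[OF p] Y basis[OF p f(1)] unfolding f(2) by simp
      moreover have "A (b \<oplus>\<^bsub>D\<^esub> (a p \<odot>\<^bsub>D\<^esub> D_basis p)) Y = A b Y \<oplus>\<^bsub>L\<^esub> A (a p \<odot>\<^bsub>D\<^esub> D_basis p) Y"
        "A' (b \<oplus>\<^bsub>D\<^esub> (a p \<odot>\<^bsub>D\<^esub> D_basis p)) Y = A' b Y \<oplus>\<^bsub>L\<^esub> A' (a p \<odot>\<^bsub>D\<^esub> D_basis p) Y"
        using Ad(2) Ad'(2) bD pD Y by blast+
      ultimately show "A a Y = A' a Y" using aeq by metis
    qed
  qed
  have fin: "finite ?S" using finite_G finite_H by simp
  have eqD: "A a Y = A' a Y" if a: "a \<in> carrier D" and Y: "Y \<in> carrier L" for a Y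
  proof -
    have "{p. a p \<noteq> 0} \<subseteq> ?S" using a unfolding D_simps(1) by blast
    then show ?thesis using all[OF fin order_refl] Y by blast
  qed
  show ?thesis
  proof (rule PiE_ext[OF Ad(1) Ad'(1)])
    fix a assume a: "a \<in> carrier D"
    have "A a \<in> carrier L \<rightarrow>\<^sub>E carrier L" "A' a \<in> carrier L \<rightarrow>\<^sub>E carrier L"
      using PiE_mem[OF Ad(1) a] PiE_mem[OF Ad'(1) a] by blast+
    then show "A a = A' a" by (rule PiE_ext) (rule eqD[OF a])
  qed
qed

lemma local_act_eq: "local_act G H = act0"
  unfolding local_act_def 
proof (rule the_equality)
  show "is_local_action G H act0" by (rule is_local_action_act0)
  show "A = act0" if "is_local_action G H A" for A by (rule local_action_unique[OF that is_local_action_act0])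
qed

lemma local_act_q: "a \<in> carrier D \<Longrightarrow> f \<in> carrier F \<Longrightarrow> local_act G H a (q f) = q (actF a f)"
  unfolding local_act_eq by (rule act0_q)

section \<open>Boundedness of the action\<close>

abbreviation N where "N \<equiv> local_norm G H"

lemma relF_mult:
  assumes "g \<in> carrier G" shows "relF g (f \<otimes>\<^bsub>F\<^esub> f') = relF g f \<otimes>\<^bsub>F\<^esub> relF g f'"
proof
  fix w show "relF g (f \<otimes>\<^bsub>F\<^esub> f') w = (relF g f \<otimes>\<^bsub>F\<^esub> relF g f') w"
  proof (cases "w \<in> lists X")
    case True
    have "take k w \<in> lists X" "drop k w \<in> lists X" for k
      using True by (auto simp: in_lists_conv_set dest: in_set_takeD in_set_dropD)
    then show ?thesis
      using True by (simp add: relF_def F_simps(2) conv_def take_map drop_map del: in_lists_conv_set)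
  next
    case False
    have "take k w \<notin> lists X \<or> drop k w \<notin> lists X" for k
      using False by (metis append_in_lists_conv append_take_drop_id)
    then have "(relF g f \<otimes>\<^bsub>F\<^esub> relF g f') w = 0"
      unfolding F_simps(2) conv_def by (intro sum.neutral) (auto simp: relF_def)
    then show ?thesis using False by (simp add: relF_def del: in_lists_conv_set)
  qed
qed

lemma relF_star:
  assumes "g \<in> carrier G" shows "relF g (star F f) = star F (relF g f)"
proof
  fix w show "relF g (star F f) w = star F (relF g f) w"
  proof (cases "w \<in> lists X")
    case True
    then show ?thesis
      unfolding relF_def F_simps(7) using rl_lists[OF True, of "inv g"] star_lists[OF True] rl_star[OF True, of "inv g"] assms
      by (simp del: in_lists_conv_set map_map)
  qed (simp add: relF_def F_simps(7))
qed

text \<open>The group-like element \<Sum>_h (h, g) of D(H;G), for g in G: it translates by g in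
  every degree.\<close>

definition rel_elem :: "'a \<Rightarrow> 'a \<times> 'a \<Rightarrow> complex" where
  "rel_elem g = (\<lambda>p. if fst p \<in> H \<and> snd p = g then 1 else 0)"

lemma actF_rel_elem: "g \<in> carrier G \<Longrightarrow> actF (rel_elem g) f = relF g f"
proof
  fix w assume g: "g \<in> carrier G"
  show "actF (rel_elem g) f w = relF g f w"
  proof (cases "w \<in> lists X")
    case True
    have "actF (rel_elem g) f w = (\<Sum>k\<in>carrier G. if k = g then f (rl (inv g) w) else 0)"
      unfolding actF_def using True tot_H[OF True] by (simp only: if_True) (intro sum.cong refl, simp add: rel_elem_def)
    then show ?thesis using True finite_G g by (simp add: relF_def del: in_lists_conv_set)
  qed (simp add: actF_def relF_def)
qed

lemma relF_relF: "f \<in> carrier F \<Longrightarrow> g \<in> carrier G \<Longrightarrow> relF (inv g) (relF g f) = f"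
proof
  fix w assume f: "f \<in> carrier F" and g: "g \<in> carrier G"
  show "relF (inv g) (relF g f) w = f w"
  proof (cases "w \<in> lists X")
    case True
    then show ?thesis
      using rl_inv'[OF True g] rl_lists[OF True g] g by (simp add: relF_def del: in_lists_conv_set map_map)
  next
    case False
    then have "f w = 0" using supp_lists[OF f] by blast
    then show ?thesis using False by (simp add: relF_def del: in_lists_conv_set)
  qed
qed

text \<open>Translation by g is a star homomorphism, and translation by g^{-1} makes it injective on
  the quotient; \<open>injective_hom_isometric\<close> applies.\<close>

lemma norm_relF:
  assumes g: "g \<in> carrier G" and f: "f \<in> carrier F" shows "N (q (relF g f)) = N (q f)"
proof -
  let ?\<phi> = "lact (rel_elem g)"
  have phi: "?\<phi> (q f) = q (relF g f)" if "f \<in> carrier F" for f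
    using lact_q[OF that, of "rel_elem g"] actF_rel_elem[OF g] by simp
  have cl: "relF g f \<in> carrier F" if "f \<in> carrier F" for f using relF_closed[OF that g] .
  have add: "relF g (f \<oplus>\<^bsub>F\<^esub> f') = relF g f \<oplus>\<^bsub>F\<^esub> relF g f'" for f f'
    by (auto simp: relF_def F_simps(5))
  have smult: "relF g (k \<odot>\<^bsub>F\<^esub> f) = k \<odot>\<^bsub>F\<^esub> relF g f" for k f
    by (auto simp: relF_def F_simps(6))
  have "N (?\<phi> (q f)) = N (q f)"
  proof (rule injective_hom_isometric)
    fix x assume "x \<in> carrier L"
    then obtain e where e: "e \<in> carrier F" "x = q e" by (rule carrier_LE)
    show "?\<phi> x \<in> carrier L" unfolding e(2) phi[OF e(1)] by (rule q_L[OF cl[OF e(1)]])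
    show "?\<phi> (star L x) = star L (?\<phi> x)"
      unfolding e(2) star_L[OF e(1)] phi[OF e(1)] phi[OF F.star_closed[OF e(1)]] star_L[OF cl[OF e(1)]]
        relF_star[OF g] ..
    show "?\<phi> (k \<odot>\<^bsub>L\<^esub> x) = k \<odot>\<^bsub>L\<^esub> ?\<phi> x" for k
      unfolding e(2) smult_L[OF e(1)] phi[OF e(1)] phi[OF F.smult_closed[OF e(1)]] smult_L[OF cl[OF e(1)]] smult ..
    have z: "relF h \<zero>\<^bsub>F\<^esub> = \<zero>\<^bsub>F\<^esub>" for h by (auto simp: relF_def F_simps(4))
    show "?\<phi> x = \<zero>\<^bsub>L\<^esub> \<longleftrightarrow> x = \<zero>\<^bsub>L\<^esub>"
    proof
      assume "?\<phi> x = \<zero>\<^bsub>L\<^esub>"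
      then have "q (relF g e) = q \<zero>\<^bsub>F\<^esub>" unfolding e(2) phi[OF e(1)] zero_L .
      then have "q (actF (rel_elem (inv g)) (relF g e)) = q (actF (rel_elem (inv g)) \<zero>\<^bsub>F\<^esub>)"
        by (rule q_actF_cong[OF cl[OF e(1)] F.zero_closed])
      then show "x = \<zero>\<^bsub>L\<^esub>"
        unfolding actF_rel_elem[OF inv_closed[OF g]] relF_relF[OF e(1) g] z e(2) zero_L .
    next
      assume "x = \<zero>\<^bsub>L\<^esub>"
      then show "?\<phi> x = \<zero>\<^bsub>L\<^esub>" using phi[OF F.zero_closed] by (simp add: zero_L z)
    qed
    fix y assume "y \<in> carrier L"
    then obtain e' where e': "e' \<in> carrier F" "y = q e'" by (rule carrier_LE)
    show "?\<phi> (x \<oplus>\<^bsub>L\<^esub> y) = ?\<phi> x \<oplus>\<^bsub>L\<^esub> ?\<phi> y"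
      unfolding e(2) e'(2) add_L[OF e(1) e'(1)] phi[OF e(1)] phi[OF e'(1)] phi[OF F.a_closed[OF e(1) e'(1)]]
        add_L[OF cl[OF e(1)] cl[OF e'(1)]] add ..
    show "?\<phi> (x \<otimes>\<^bsub>L\<^esub> y) = ?\<phi> x \<otimes>\<^bsub>L\<^esub> ?\<phi> y"
      unfolding e(2) e'(2) mult_L[OF e(1) e'(1)] phi[OF e(1)] phi[OF e'(1)] phi[OF F.m_closed[OF e(1) e'(1)]]
        mult_L[OF cl[OF e(1)] cl[OF e'(1)]] relF_mult[OF g] ..
  qed (rule q_L[OF f])
  then show ?thesis unfolding phi[OF f] .
qed

lemma lin_actF_basis:
  assumes g: "g \<in> carrier G" and f: "f \<in> carrier F"
  shows "lin (actF (D_basis (h, g)) f) \<phi> = lin (relF g f) (\<lambda>w. if tot w = h then \<phi> w else 0)"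
proof -
  have "lin (actF (D_basis (h, g)) f) \<phi> =
      (\<Sum>k\<in>carrier G. lin (relF k f) (\<lambda>w. D_basis (h, g) (tot w, k) * \<phi> w))"
    by (rule lin_actF[OF f])
  also have "\<dots> = (\<Sum>k\<in>carrier G. if k = g then lin (relF g f) (\<lambda>w. if tot w = h then \<phi> w else 0) else 0)"
  proof (intro sum.cong refl)
    fix k assume "k \<in> carrier G"
    show "lin (relF k f) (\<lambda>w. D_basis (h, g) (tot w, k) * \<phi> w) =
        (if k = g then lin (relF g f) (\<lambda>w. if tot w = h then \<phi> w else 0) else 0)"
    proof (cases "k = g")
      case True
      have "lin (relF g f) (\<lambda>w. D_basis (h, g) (tot w, g) * \<phi> w) = lin (relF g f) (\<lambda>w. if tot w = h then \<phi> w else 0)"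
        by (rule lin_cong) (simp add: D_basis_def)
      then show ?thesis using True by simp
    qed (simp add: D_basis_def)
  qed
  also have "\<dots> = lin (relF g f) (\<lambda>w. if tot w = h then \<phi> w else 0)" using finite_G g by simp
  finally show ?thesis .
qed

text \<open>The homogeneous component of degree \<open>h\<close> is cut out by the projections at a site beyond all
  bonds: there the word acts by its total shift.\<close>

lemma component_sandwich:
  assumes h: "h \<in> H" and g: "g \<in> carrier G" and f: "f \<in> carrier F" and x: "x \<in> \<int>"
    and below: "\<And>w. relF g f w \<noteq> 0 \<Longrightarrow> bonds_below w x"
  shows "q (actF (D_basis (h, g)) f) =
    (\<Oplus>\<^bsub>L\<^esub>k\<in>carrier G. W [Delta (h \<otimes> k) x] \<otimes>\<^bsub>L\<^esub> q (relF g f) \<otimes>\<^bsub>L\<^esub> W [Delta k x])"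
proof -
  let ?f = "relF g f"
  have fF: "?f \<in> carrier F" by (rule relF_closed[OF f g])
  let ?s = "\<lambda>k. wmono [Delta (h \<otimes> k) x] \<otimes>\<^bsub>F\<^esub> ?f \<otimes>\<^bsub>F\<^esub> wmono [Delta k x]"
  have dF: "wmono [Delta k x] \<in> carrier F" if "k \<in> carrier G" for k using that x by (intro wmono_closed) simp
  have sF: "?s k \<in> carrier F" if "k \<in> carrier G" for k
    using that h fF dF by (intro F.m_closed) auto
  have eq: "(\<Oplus>\<^bsub>L\<^esub>k\<in>carrier G. W [Delta (h \<otimes> k) x] \<otimes>\<^bsub>L\<^esub> q ?f \<otimes>\<^bsub>L\<^esub> W [Delta k x]) = q (\<Oplus>\<^bsub>F\<^esub>k\<in>carrier G. ?s k)"
  proof -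
    have t: "W [Delta (h \<otimes> k) x] \<otimes>\<^bsub>L\<^esub> q ?f \<otimes>\<^bsub>L\<^esub> W [Delta k x] = q (?s k)" if k: "k \<in> carrier G" for k
    proof -
      have hk: "h \<otimes> k \<in> carrier G" using h k by auto
      show ?thesis
        unfolding mult_L[OF dF[OF hk] fF] mult_L[OF F.m_closed[OF dF[OF hk] fF] dF[OF k]] ..
    qed
    have "(\<Oplus>\<^bsub>L\<^esub>k\<in>carrier G. W [Delta (h \<otimes> k) x] \<otimes>\<^bsub>L\<^esub> q ?f \<otimes>\<^bsub>L\<^esub> W [Delta k x]) = (\<Oplus>\<^bsub>L\<^esub>k\<in>carrier G. q (?s k))"
      using t sF by (intro SL.finsum_cong' refl) auto
    then show ?thesis using finsum_L[OF finite_G sF] by simp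
  qed
  have sumF: "(\<Oplus>\<^bsub>F\<^esub>k\<in>carrier G. ?s k) \<in> carrier F" using sF by (intro F.finsum_closed) auto
  have "q (actF (D_basis (h, g)) f) = q (\<Oplus>\<^bsub>F\<^esub>k\<in>carrier G. ?s k)"
    unfolding q_eq_iff_kern[OF actF_closed[OF f] sumF]
  proof (intro ballI allI)
    fix c b assume c: "c \<in> Conf"
    show "kern G (actF (D_basis (h, g)) f) c b = kern G (\<Oplus>\<^bsub>F\<^esub>k\<in>carrier G. ?s k) c b"
    proof (cases "b \<in> Conf")
      case False
      then show ?thesis using kern_outside[OF actF_closed[OF f] c] kern_outside[OF sumF c] by simp
    next
      case b: True
      have "kern G (\<Oplus>\<^bsub>F\<^esub>k\<in>carrier G. ?s k) c b = (\<Sum>k\<in>carrier G. kern G (?s k) c b)"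
      proof -
        have e: "(\<Oplus>\<^bsub>F\<^esub>k\<in>carrier G. ?s k) = (\<lambda>w. \<Sum>k\<in>carrier G. ?s k w)"
          by (rule finsum_F[OF finite_G]) (rule sF)
        show ?thesis unfolding e by (rule kern_sum[OF finite_G]) (rule sF)
      qed
      also have "\<dots> = (\<Sum>k\<in>carrier G. if k = b x then (if c x = h \<otimes> b x then kern G ?f c b else 0) else 0)"
      proof (intro sum.cong refl)
        fix k assume "k \<in> carrier G"
        have "kern G (?s k) c b = lin ?f (\<lambda>w. if pull G (([Delta (h \<otimes> k) x] @ w) @ [Delta k x]) c = Some b then 1 else 0)"
          unfolding F_simps(2) kern_def
          by (simp only: lin_conv finite_conv finite_supp[OF fF] finite_wmono lin_wmono)
        \<comment> \<open>The left projection reads the site x of the initial configuration c, the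
          right one the same site of the final configuration b.\<close>
        also have "\<dots> = lin ?f (\<lambda>w. (if c x = h \<otimes> k \<and> b x = k then 1 else 0) * (if pull G w c = Some b then 1 else 0))"
          by (intro lin_cong) (auto simp: pull_append bind_eq_Some_conv split: if_splits)
        also have "\<dots> = (if c x = h \<otimes> k \<and> b x = k then 1 else 0) * kern G ?f c b"
          unfolding lin_scale_right kern_def ..
        finally show "kern G (?s k) c b = (if k = b x then (if c x = h \<otimes> b x then kern G ?f c b else 0) else 0)"
          by auto
      qed
      also have "\<dots> = (if c x = h \<otimes> b x then kern G ?f c b else 0)"
        using finite_G Conf_mem[OF b] by simp
      also have "\<dots> = lin ?f (\<lambda>w. (if c x = h \<otimes> b x then 1 else 0) * (if pull G w c = Some b then 1 else 0))"
        unfolding lin_scale_right kern_def by simp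
      also have "\<dots> = lin ?f (\<lambda>w. if tot w = h then (if pull G w c = Some b then 1 else 0) else 0)"
      proof (rule lin_cong)
        fix w assume w: "?f w \<noteq> 0"
        have wX: "w \<in> lists X" by (rule supp_lists[OF fF w])
        have "c x = h \<otimes> b x \<longleftrightarrow> tot w = h" if "pull G w c = Some b"
          unfolding pull_tot[OF wX c that below[OF w]]
          using tot_H[OF wX] h Conf_mem[OF b] by (intro right_cancel) auto
        then show "(if c x = h \<otimes> b x then 1 else 0) * (if pull G w c = Some b then 1 else 0) =
            (if tot w = h then (if pull G w c = Some b then 1 else 0) else (0::complex))" by auto
      qed
      also have "\<dots> = kern G (actF (D_basis (h, g)) f) c b"
        unfolding kern_def lin_actF_basis[OF g f] ..
      finally show ?thesis ..
    qed
  qed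
  then show ?thesis unfolding eq .
qed

lemma norm_finsum_L:
  assumes "finite J" "\<And>j. j \<in> J \<Longrightarrow> y j \<in> carrier L" "\<And>j. j \<in> J \<Longrightarrow> N (y j) \<le> K"
  shows "N (\<Oplus>\<^bsub>L\<^esub>j\<in>J. y j) \<le> of_nat (card J) * K"
  using assms
proof (induction J)
  case (insert j J)
  have "(\<Oplus>\<^bsub>L\<^esub>j\<in>insert j J. y j) = y j \<oplus>\<^bsub>L\<^esub> (\<Oplus>\<^bsub>L\<^esub>j\<in>J. y j)"
    using insert by (intro SL.finsum_insert) auto
  moreover have "N (y j \<oplus>\<^bsub>L\<^esub> (\<Oplus>\<^bsub>L\<^esub>j\<in>J. y j)) \<le> N (y j) + N (\<Oplus>\<^bsub>L\<^esub>j\<in>J. y j)"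
    using insert by (intro CN.norm_add SL.finsum_closed) auto
  moreover have "N (y j) \<le> K" "N (\<Oplus>\<^bsub>L\<^esub>j\<in>J. y j) \<le> of_nat (card J) * K" using insert by auto
  ultimately show ?case using insert.hyps by (simp add: distrib_right)
qed simp

lemma star_wmono:
  assumes w: "w \<in> lists X" shows "star F (wmono w) = wmono (rev (map (field_gen_star G) w))"
proof
  fix v
  show "star F (wmono w) v = wmono (rev (map (field_gen_star G) w)) v"
  proof (cases "v \<in> lists X")
    case True
    have "rev (map (field_gen_star G) v) = w \<longleftrightarrow> v = rev (map (field_gen_star G) w)"
      using star_star_word[OF True] star_star_word[OF w] by metis
    then show ?thesis using True by (simp add: F_simps(7) wmono_def del: in_lists_conv_set)
  next
    case False
    then have "v \<noteq> rev (map (field_gen_star G) w)" using star_lists[OF w] by metis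
    then show ?thesis using False by (simp add: F_simps(7) wmono_def del: in_lists_conv_set)
  qed
qed

text \<open>A self-adjoint idempotent p satisfies N(p)^2 = N(p), so its norm is 0 or 1.\<close>

lemma norm_delta: assumes "k \<in> carrier G" "x \<in> \<int>" shows "N (W [Delta k x]) \<le> 1"
proof -
  have X: "[Delta k x] \<in> lists X" using assms by simp
  have cl: "W [Delta k x] \<in> carrier L" by (rule q_L[OF wmono_closed[OF X]])
  have "q (star F (wmono [Delta k x]) \<otimes>\<^bsub>F\<^esub> wmono [Delta k x]) = W [Delta k x]"
  proof -
    have "star F (wmono [Delta k x]) = wmono [Delta k x]" using star_wmono[OF X] by simp
    then show ?thesis using W_dd[of k k x] assms wmono_append[of "[Delta k x]" "[Delta k x]"] by simp
  qed
  then have "star L (W [Delta k x]) \<otimes>\<^bsub>L\<^esub> W [Delta k x] = W [Delta k x]"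
    unfolding star_L[OF wmono_closed[OF X]] mult_L[OF F.star_closed[OF wmono_closed[OF X]] wmono_closed[OF X]] .
  then have "(N (W [Delta k x]))\<^sup>2 = N (W [Delta k x])" using CN.norm_star_mult[OF cl] by simp
  then show ?thesis by (auto simp: power2_eq_square)
qed

text \<open>|G| is the number of summands in \<open>component_sandwich\<close>, each of norm at most
  that of f. The site x depends on f, the constant does not, and so the bound is uniform on the
  local algebra.\<close>

lemma norm_component:
  assumes h: "h \<in> H" and g: "g \<in> carrier G" and f: "f \<in> carrier F"
  shows "N (q (actF (D_basis (h, g)) f)) \<le> of_nat (order G) * N (q f)"
proof -
  let ?f = "relF g f"
  have fF: "?f \<in> carrier F" by (rule relF_closed[OF f g])
  obtain x where x: "x \<in> \<int>" "\<forall>w\<in>{w. ?f w \<noteq> 0}. bonds_below w x"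
    using bonds_below_ex[OF finite_supp[OF fF]] by blast
  have d: "W [Delta k x] \<in> carrier L" if "k \<in> carrier G" for k using that x(1) by (intro q_L wmono_closed) simp
  have "N (W [Delta (h \<otimes> k) x] \<otimes>\<^bsub>L\<^esub> q ?f \<otimes>\<^bsub>L\<^esub> W [Delta k x]) \<le> N (q f)" if k: "k \<in> carrier G" for k
  proof -
    have hk: "h \<otimes> k \<in> carrier G" using h k by auto
    note cl = d[OF hk] d[OF k] q_L[OF fF]
    have "N (W [Delta (h \<otimes> k) x] \<otimes>\<^bsub>L\<^esub> q ?f \<otimes>\<^bsub>L\<^esub> W [Delta k x]) \<le>
        N (W [Delta (h \<otimes> k) x] \<otimes>\<^bsub>L\<^esub> q ?f) * N (W [Delta k x])"
      by (rule CN.norm_mult[OF SL.m_closed[OF cl(1,3)] cl(2)])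
    also have "\<dots> \<le> N (W [Delta (h \<otimes> k) x] \<otimes>\<^bsub>L\<^esub> q ?f) * 1"
      by (rule mult_left_mono[OF norm_delta[OF k x(1)] CN.norm_nonneg[OF SL.m_closed[OF cl(1,3)]]])
    also have "\<dots> \<le> N (W [Delta (h \<otimes> k) x]) * N (q ?f)"
      using CN.norm_mult[OF cl(1,3)] by simp
    also have "\<dots> \<le> 1 * N (q ?f)"
      by (rule mult_right_mono[OF norm_delta[OF hk x(1)] CN.norm_nonneg[OF cl(3)]])
    finally show ?thesis by (simp add: norm_relF[OF g f])
  qed
  then have "N (\<Oplus>\<^bsub>L\<^esub>k\<in>carrier G. W [Delta (h \<otimes> k) x] \<otimes>\<^bsub>L\<^esub> q ?f \<otimes>\<^bsub>L\<^esub> W [Delta k x]) \<le> of_nat (card (carrier G)) * N (q f)"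
    using d h fF by (intro norm_finsum_L finite_G SL.m_closed) auto
  then show ?thesis
    using component_sandwich[OF h g f x(1)] x(2) by (simp add: order_def)
qed

section \<open>The field algebra as an instance of the abstract setting\<close>

lemma W_mult: "u \<in> lists X \<Longrightarrow> v \<in> lists X \<Longrightarrow> W u \<otimes>\<^bsub>L\<^esub> W v = W (u @ v)"
  by (simp only: mult_L[OF wmono_closed wmono_closed] wmono_append)

lemma W_Nil: "W [] = \<one>\<^bsub>L\<^esub>"
  by (simp only: one_L F_simps(3))

lemma z_elem_eval: "z_elem G p = (if fst p = \<one> \<and> snd p \<in> carrier G then 1 / of_nat (order G) else 0)"
proof -
  have "(\<Sum>g\<in>carrier G. D_basis (\<one>, g) p) = (\<Sum>g\<in>carrier G. if g = snd p then (if fst p = \<one> then 1 else 0) else (0::complex))"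
    by (intro sum.cong refl) (cases p, auto simp: D_basis_def)
  then show ?thesis using finite_G by (simp add: z_elem_def)
qed

lemma z_elem_closed: "z_elem G \<in> carrier D"
  by (auto simp: D_simps z_elem_eval)

lemma actF_z_elem:
  assumes f: "f \<in> carrier F"
  shows "actF (z_elem G) f = (1 / of_nat (order G)) \<odot>\<^bsub>F\<^esub> (\<Oplus>\<^bsub>F\<^esub>g\<in>carrier G. actF (D_basis (\<one>, g)) f)"
proof
  fix w
  have e: "(\<Oplus>\<^bsub>F\<^esub>g\<in>carrier G. actF (D_basis (\<one>, g)) f) = (\<lambda>w. \<Sum>g\<in>carrier G. actF (D_basis (\<one>, g)) f w)"
    by (rule finsum_F[OF finite_G]) (rule actF_closed[OF f])
  show "actF (z_elem G) f w =
      ((1 / of_nat (order G)) \<odot>\<^bsub>F\<^esub> (\<Oplus>\<^bsub>F\<^esub>g\<in>carrier G. actF (D_basis (\<one>, g)) f)) w"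
  proof (cases "w \<in> lists X \<and> tot w = \<one>")
    case True
    then have "actF (z_elem G) f w = (\<Sum>g\<in>carrier G. 1 / of_nat (order G) * f (rl (inv g) w))"
      by (simp add: actF_def z_elem_eval del: in_lists_conv_set)
    moreover have "(\<Sum>g\<in>carrier G. actF (D_basis (\<one>, g)) f w) = (\<Sum>g\<in>carrier G. f (rl (inv g) w))"
      using True by (intro sum.cong refl) (simp add: actF_basis del: in_lists_conv_set)
    ultimately show ?thesis unfolding e F_simps(6) by (simp add: sum_distrib_left)
  next
    case False
    then have "(\<Sum>g\<in>carrier G. actF (D_basis (\<one>, g)) f w) = 0"
      by (intro sum.neutral) (auto simp: actF_basis simp del: in_lists_conv_set)
    moreover have "actF (z_elem G) f w = 0"
      using False by (auto simp: actF_def z_elem_eval simp del: in_lists_conv_set)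
    ultimately show ?thesis unfolding e F_simps(6) by simp
  qed
qed

abbreviation \<beta> where "\<beta> h g \<equiv> local_act G H (D_basis (h, g))"

lemma \<beta>_q:
  assumes "h \<in> H" "g \<in> carrier G" "f \<in> carrier F" shows "\<beta> h g (q f) = q (actF (D_basis (h, g)) f)"
  using assms(1,2) by (intro local_act_q[OF D_basis_closed assms(3)]) simp

lemma \<beta>_add:
  assumes hg: "h \<in> H" "g \<in> carrier G" and x: "x \<in> carrier L" and y: "y \<in> carrier L"
  shows "\<beta> h g (x \<oplus>\<^bsub>L\<^esub> y) = \<beta> h g x \<oplus>\<^bsub>L\<^esub> \<beta> h g y"
proof -
  obtain f f' where f: "f \<in> carrier F" "x = q f" "f' \<in> carrier F" "y = q f'"
    using x y by (elim carrier_LE)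
  show ?thesis
    unfolding f(2,4) add_L[OF f(1,3)] \<beta>_q[OF hg f(1)] \<beta>_q[OF hg f(3)] \<beta>_q[OF hg F.a_closed[OF f(1,3)]]
      add_L[OF actF_closed[OF f(1)] actF_closed[OF f(3)]] actF_add[OF f(1,3)] ..
qed

lemma \<beta>_smult:
  assumes hg: "h \<in> H" "g \<in> carrier G" and x: "x \<in> carrier L"
  shows "\<beta> h g (c \<odot>\<^bsub>L\<^esub> x) = c \<odot>\<^bsub>L\<^esub> \<beta> h g x"
proof -
  obtain f where f: "f \<in> carrier F" "x = q f" using x by (rule carrier_LE)
  show ?thesis
    unfolding f(2) smult_L[OF f(1)] \<beta>_q[OF hg f(1)] \<beta>_q[OF hg F.smult_closed[OF f(1)]]
      smult_L[OF actF_closed[OF f(1)]] actF_smult ..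
qed

lemma \<beta>_bounded:
  assumes hg: "h \<in> H" "g \<in> carrier G" shows "CN.bounded_map (\<beta> h g)"
proof (rule CN.bounded_map_linear[OF _ \<beta>_add[OF hg] \<beta>_smult[OF hg]])
  fix x assume "x \<in> carrier L"
  then obtain f where f: "f \<in> carrier F" "x = q f" by (rule carrier_LE)
  show "\<beta> h g x \<in> carrier L" unfolding f(2) \<beta>_q[OF hg f(1)] by (rule q_L[OF actF_closed[OF f(1)]])
  show "N (\<beta> h g x) \<le> of_nat (order G) * N x"
    unfolding f(2) \<beta>_q[OF hg f(1)] by (rule norm_component[OF hg f(1)])
qed

lemma \<beta>_word:
  assumes hg: "h \<in> H" "g \<in> carrier G" and u: "u \<in> lists X"
  shows "\<beta> h g (W u) = (if h = g \<otimes> tot u \<otimes> inv g then W (rl g u) else \<zero>\<^bsub>L\<^esub>)"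
  unfolding \<beta>_q[OF hg wmono_closed[OF u]] actF_basis_wmono[OF hg(2) u] zero_L F_simps(4)
  by (rule if_distrib[of "\<lambda>f. q f"])

lemma crossed_action_field:
  "crossed_action L N G H \<beta> (\<lambda>k. W [Delta k 0]) (\<lambda>h. W [Rho h (1/2)]) (local_act G H (z_elem G))"
proof (rule crossed_action.intro[OF CN.cstar_normed_axioms], rule crossed_action_axioms.intro)
  have dX: "[Delta k 0] \<in> lists X" if "k \<in> carrier G" for k using that by simp
  have half: "(1/2 :: rat) \<in> half_odd" by (simp add: half_odd_def)
  have rX: "[Rho h (1/2)] \<in> lists X" if "h \<in> H" for h using that half by simp
  show "group G" by (rule is_group)
  show "finite (carrier G)" by (rule finite_G)
  show "H \<lhd> G" by (rule normal_H)
  show "CN.bounded_map (\<beta> h g)" if "h \<in> H" "g \<in> carrier G" for h g by (rule \<beta>_bounded[OF that])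
  show "\<beta> h g (x \<oplus>\<^bsub>L\<^esub> y) = \<beta> h g x \<oplus>\<^bsub>L\<^esub> \<beta> h g y"
    if "h \<in> H" "g \<in> carrier G" "x \<in> carrier L" "y \<in> carrier L" for h g x y by (rule \<beta>_add[OF that])
  show "\<beta> h g (c \<odot>\<^bsub>L\<^esub> x) = c \<odot>\<^bsub>L\<^esub> \<beta> h g x"
    if "h \<in> H" "g \<in> carrier G" "x \<in> carrier L" for h g x c by (rule \<beta>_smult[OF that])
  show "\<beta> h g \<one>\<^bsub>L\<^esub> = (if h = \<one> then \<one>\<^bsub>L\<^esub> else \<zero>\<^bsub>L\<^esub>)" if hg: "h \<in> H" "g \<in> carrier G" for h g
  proof -
    have "[] \<in> lists X" by simp
    from \<beta>_word[OF hg this] show ?thesis using hg(2) by (simp add: W_Nil)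
  qed
  show "\<beta> h g (x \<otimes>\<^bsub>L\<^esub> y) = (\<Oplus>\<^bsub>L\<^esub>t\<in>H. \<beta> t g x \<otimes>\<^bsub>L\<^esub> \<beta> (inv t \<otimes> h) g y)"
    if hg: "h \<in> H" "g \<in> carrier G" and x: "x \<in> carrier L" and y: "y \<in> carrier L" for h g x y
  proof -
    obtain f f' where f: "f \<in> carrier F" "x = q f" "f' \<in> carrier F" "y = q f'"
      using x y by (elim carrier_LE)
    let ?t = "\<lambda>t. actF (D_basis (t, g)) f \<otimes>\<^bsub>F\<^esub> actF (D_basis (inv t \<otimes> h, g)) f'"
    have tF: "?t t \<in> carrier F" for t by (rule F.m_closed[OF actF_closed[OF f(1)] actF_closed[OF f(3)]])
    have "\<beta> h g (x \<otimes>\<^bsub>L\<^esub> y) = q (\<Oplus>\<^bsub>F\<^esub>t\<in>H. ?t t)"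
      unfolding f(2,4) mult_L[OF f(1,3)] \<beta>_q[OF hg F.m_closed[OF f(1,3)]] actF_basis_mult[OF hg f(1,3)] ..
    also have "\<dots> = (\<Oplus>\<^bsub>L\<^esub>t\<in>H. q (?t t))" by (rule finsum_L[symmetric, OF finite_H]) (rule tF)
    also have "\<dots> = (\<Oplus>\<^bsub>L\<^esub>t\<in>H. \<beta> t g x \<otimes>\<^bsub>L\<^esub> \<beta> (inv t \<otimes> h) g y)"
    proof (rule SL.finsum_cong'[OF refl])
      have eq: "\<beta> t g x \<otimes>\<^bsub>L\<^esub> \<beta> (inv t \<otimes> h) g y = q (?t t)" if t: "t \<in> H" for t
      proof -
        have th: "inv t \<otimes> h \<in> H" using t hg by simp
        show ?thesis
          unfolding f(2,4) \<beta>_q[OF t hg(2) f(1)] \<beta>_q[OF th hg(2) f(3)] mult_L[OF actF_closed[OF f(1)] actF_closed[OF f(3)]] ..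
      qed
      show "q (?t t) = \<beta> t g x \<otimes>\<^bsub>L\<^esub> \<beta> (inv t \<otimes> h) g y" if "t \<in> H" for t by (rule eq[OF that, symmetric])
      show "(\<lambda>t. \<beta> t g x \<otimes>\<^bsub>L\<^esub> \<beta> (inv t \<otimes> h) g y) \<in> H \<rightarrow> carrier L"
      proof (rule funcsetI)
        fix t assume t: "t \<in> H"
        show "\<beta> t g x \<otimes>\<^bsub>L\<^esub> \<beta> (inv t \<otimes> h) g y \<in> carrier L" unfolding eq[OF t] by (rule q_L[OF tF])
      qed
    qed
    finally show ?thesis .
  qed
  show "\<beta> h g (star L x) = star L (\<beta> (inv h) g x)" if hg: "h \<in> H" "g \<in> carrier G" and x: "x \<in> carrier L" for h g x
  proof -
    obtain f where f: "f \<in> carrier F" "x = q f" using x by (rule carrier_LE)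
    have h': "inv h \<in> H" using hg by simp
    show ?thesis
      unfolding f(2) star_L[OF f(1)] \<beta>_q[OF hg F.star_closed[OF f(1)]] \<beta>_q[OF h' hg(2) f(1)]
        star_L[OF actF_closed[OF f(1)]] actF_basis_star[OF f(1) hg] ..
  qed
  show "\<beta> h g (\<beta> h' g' x) = (if h \<otimes> g = g \<otimes> h' then \<beta> h (g \<otimes> g') x else \<zero>\<^bsub>L\<^esub>)"
    if hg: "h \<in> H" "g \<in> carrier G" and hg': "h' \<in> H" "g' \<in> carrier G" and x: "x \<in> carrier L" for h g h' g' x
  proof -
    obtain f where f: "f \<in> carrier F" "x = q f" using x by (rule carrier_LE)
    show ?thesis
      unfolding f(2) \<beta>_q[OF hg' f(1)] \<beta>_q[OF hg actF_closed[OF f(1)]] actF_basis_comp[OF hg(2) hg'(2) hg(1) hg'(1)]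
        \<beta>_q[OF hg(1) m_closed[OF hg(2) hg'(2)] f(1)] zero_L F_simps(4)
      by (rule if_distrib[of "\<lambda>f. q f"])
  qed
  show "(\<Oplus>\<^bsub>L\<^esub>h\<in>H. \<beta> h \<one> x) = x" if x: "x \<in> carrier L" for x
  proof -
    obtain f where f: "f \<in> carrier F" "x = q f" using x by (rule carrier_LE)
    have "(\<Oplus>\<^bsub>L\<^esub>h\<in>H. \<beta> h \<one> x) = (\<Oplus>\<^bsub>L\<^esub>h\<in>H. q (actF (D_basis (h, \<one>)) f))"
    proof (rule SL.finsum_cong'[OF refl])
      show "(\<lambda>h. q (actF (D_basis (h, \<one>)) f)) \<in> H \<rightarrow> carrier L" using q_L[OF actF_closed[OF f(1)]] by blast
      show "\<beta> h \<one> x = q (actF (D_basis (h, \<one>)) f)" if "h \<in> H" for h unfolding f(2) by (rule \<beta>_q[OF that one_closed f(1)])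
    qed
    also have "\<dots> = q (\<Oplus>\<^bsub>F\<^esub>h\<in>H. actF (D_basis (h, \<one>)) f)" by (rule finsum_L[OF finite_H]) (rule actF_closed[OF f(1)])
    also have "\<dots> = x" unfolding actF_basis_sum[OF f(1)] f(2) ..
    finally show ?thesis .
  qed
  show "W [Delta g 0] \<in> carrier L" if "g \<in> carrier G" for g by (rule q_L[OF wmono_closed[OF dX[OF that]]])
  show "W [Rho h (1/2)] \<in> carrier L" if "h \<in> H" for h by (rule q_L[OF wmono_closed[OF rX[OF that]]])
  have act: "is_local_action G H (local_act G H)" unfolding local_act_eq by (rule is_local_action_act0)
  show "\<beta> h g (W [Delta k 0]) = (if h = \<one> then W [Delta (g \<otimes> k) 0] else \<zero>\<^bsub>L\<^esub>)"
    if "h \<in> H" "g \<in> carrier G" "k \<in> carrier G" for h g k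
    using local_actionD(8)[OF act, unfolded gen_class] that Ints_0 by blast
  show "\<beta> h g (W [Rho t (1/2)]) = (if h = g \<otimes> t \<otimes> inv g then W [Rho h (1/2)] else \<zero>\<^bsub>L\<^esub>)"
    if "h \<in> H" "g \<in> carrier G" "t \<in> H" for h g t
    using local_actionD(9)[OF act, unfolded gen_class] that half by blast
  show "W [Delta k 0] \<otimes>\<^bsub>L\<^esub> W [Delta k' 0] = (if k = k' then W [Delta k 0] else \<zero>\<^bsub>L\<^esub>)"
    if k: "k \<in> carrier G" "k' \<in> carrier G" for k k'
    unfolding W_mult[OF dX[OF k(1)] dX[OF k(2)]] append.simps zero_L by (rule W_dd[OF k Ints_0])
  show "(\<Oplus>\<^bsub>L\<^esub>k\<in>carrier G. W [Delta k 0]) = \<one>\<^bsub>L\<^esub>"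
  proof -
    have "(\<Oplus>\<^bsub>L\<^esub>k\<in>carrier G. W [Delta k 0]) = q (\<Oplus>\<^bsub>F\<^esub>k\<in>carrier G. wmono [Delta k 0])"
      by (rule finsum_L[OF finite_G]) (rule wmono_closed[OF dX])
    also have "\<dots> = \<one>\<^bsub>L\<^esub>"
      using rel_eq[OF field_rel.delta_sum[of 0 G H]] unfolding gen_elem_eq_wmono one_L by simp
    finally show ?thesis .
  qed
  show "W [Rho h (1/2)] \<otimes>\<^bsub>L\<^esub> W [Rho h' (1/2)] = W [Rho (h \<otimes> h') (1/2)]" if h: "h \<in> H" "h' \<in> H" for h h'
    unfolding W_mult[OF rX[OF h(1)] rX[OF h(2)]] append.simps by (rule W_rr[OF h half])
  show "W [Rho \<one> (1/2)] = \<one>\<^bsub>L\<^esub>" unfolding W_r_one[OF half] by (rule W_Nil)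
  \<comment> \<open>The bond 1/2 lies to the right of the site 0, which is why this site and this
    bond were paired.\<close>
  show "W [Rho h (1/2)] \<otimes>\<^bsub>L\<^esub> W [Delta k 0] = W [Delta k 0] \<otimes>\<^bsub>L\<^esub> W [Rho h (1/2)]"
    if h: "h \<in> H" and k: "k \<in> carrier G" for h k
    unfolding W_mult[OF rX[OF h] dX[OF k]] W_mult[OF dX[OF k] rX[OF h]] append.simps
    by (rule W_rd_greater[OF h k half Ints_0]) simp
  show "star L (W [Delta k 0]) = W [Delta k 0]" if k: "k \<in> carrier G" for k
    unfolding star_L[OF wmono_closed[OF dX[OF k]]] star_wmono[OF dX[OF k]] by simp
  show "star L (W [Rho h (1/2)]) = W [Rho (inv h) (1/2)]" if h: "h \<in> H" for h
    unfolding star_L[OF wmono_closed[OF rX[OF h]]] star_wmono[OF rX[OF h]] by simp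
  show "local_act G H (z_elem G) x = (1 / of_nat (order G)) \<odot>\<^bsub>L\<^esub> (\<Oplus>\<^bsub>L\<^esub>g\<in>carrier G. \<beta> \<one> g x)" if x: "x \<in> carrier L" for x
  proof -
    obtain f where f: "f \<in> carrier F" "x = q f" using x by (rule carrier_LE)
    let ?a = "\<lambda>g. actF (D_basis (\<one>, g)) f"
    have "(\<Oplus>\<^bsub>L\<^esub>g\<in>carrier G. \<beta> \<one> g x) = (\<Oplus>\<^bsub>L\<^esub>g\<in>carrier G. q (?a g))"
    proof (rule SL.finsum_cong'[OF refl])
      show "(\<lambda>g. q (?a g)) \<in> carrier G \<rightarrow> carrier L" using q_L[OF actF_closed[OF f(1)]] by blast
      show "\<beta> \<one> g x = q (?a g)" if "g \<in> carrier G" for g unfolding f(2) by (rule \<beta>_q[OF H_mem(2) that f(1)])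
    qed
    also have "\<dots> = q (\<Oplus>\<^bsub>F\<^esub>g\<in>carrier G. ?a g)" by (rule finsum_L[OF finite_G]) (rule actF_closed[OF f(1)])
    finally have e: "(\<Oplus>\<^bsub>L\<^esub>g\<in>carrier G. \<beta> \<one> g x) = q (\<Oplus>\<^bsub>F\<^esub>g\<in>carrier G. ?a g)" .
    have sF: "(\<Oplus>\<^bsub>F\<^esub>g\<in>carrier G. ?a g) \<in> carrier F" using actF_closed[OF f(1)] by (intro F.finsum_closed) blast
    show ?thesis
      unfolding e smult_L[OF sF] actF_z_elem[OF f(1), symmetric] unfolding f(2) by (rule local_act_q[OF z_elem_closed f(1)])
  qed
qed

end

theorem theorem3p2:
  fixes G :: "('a, 'm) monoid_scheme" and H :: "'a set"
  assumes "group G" and "finite (carrier G)" and "H \<lhd> G"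
  shows "index_finite_type (field_algebra G H) (observable_algebra G H) (field_act G H (z_elem G))
    \<and> cstar_index (field_algebra G H) (field_act G H (z_elem G)) =
        of_nat (order G * card H) \<odot>\<^bsub>field_algebra G H\<^esub> \<one>\<^bsub>field_algebra G H\<^esub>"
proof -
  interpret field_alg G H using assms by (simp add: field_alg_def field_alg_axioms_def)
  \<comment> \<open>After unfolding, the observable algebra is the set of fixed points of the lifted
    z_H, as in \<open>index_completion\<close>.\<close>
  show ?thesis
    unfolding observable_algebra_def field_act_def field_algebra_def
    by (rule crossed_action.index_completion[OF crossed_action_field])
qed

end
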